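(* Assume (A1)–(A4) (listed in the context) and that the coupling functions vanish to first order in all hyperbolic directions. Let $U_1,U_2\in\mathcal S(\mathbb R^2,\mathbb R^2)$, $\theta_0\in\mathcal S(\mathbb R^2)$, and let $(U,\theta)$ be the solution of the Cauchy problem $$U_{tt}+A(\mathrm D)U+\gamma\nabla\theta=0,\qquad \theta_t-\kappa\Delta\theta+\gamma\nabla^TU_t=0\qquad (t>0,\ x\in\mathbb R^2),$$ $$U(0,\cdot)=U_1,\quad U_t(0,\cdot)=U_2,\quad \theta(0,\cdot)=\theta_0 .$$ Then for all dual indices $p\in(1,2]$, $pq=p+q$, and every Sobolev regularity $r>2\left(\frac1p-\frac1q\right)$ there is a constant $c>0$, independent of $t\ge 0$ and of the data, such that for all $t\geq 0$ $$\|\mathrm D_tU(t,\cdot)\|_q+\|\sqrt{A(\mathrm D)}\,U(t,\cdot)\|_q+\|\theta(t,\cdot)\|_q\le c\,(1+t)^{-\frac12\left(\frac1p-\frac1q\right)}\bigl(\|U_1\|_{p,r+1}+\|U_2\|_{p,r}+\|\theta_0\|_{p,r}\bigr).$$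
   Context: Constants: $\kappa>0$, $\gamma\in\mathbb R\setminus\{0\}$. The map $A:\mathbb S^1\to\mathbb C^{2\times2}$ satisfies (A1) $A$ is real-analytic on $\mathbb S^1$; (A2) $A(\eta)$ is self-adjoint and positive for all $\eta\in\mathbb S^1$. It is extended by $A(\xi)=|\xi|^2A(\eta)$, $\eta=\xi/|\xi|$, and $A(\mathrm D)$, $\sqrt{A(\mathrm D)}$ are the Fourier multipliers on $\mathbb R^2$ with (matrix) symbols $A(\xi)$ and $\sqrt{A(\xi)}$; $\mathrm D_t=-\mathrm i\partial_t$. The eigenvalues $\varkappa_1,\varkappa_2$ of $A(\eta)$ and corresponding normalised eigenvectors $r_1,r_2:\mathbb S^1\to\mathbb S^1\subset\mathbb R^2$ (orthonormal) are assumed to be globally defined smooth, real-analytic functions of $\eta\in\mathbb S^1$. (A3) $A(\eta)$ has two distinct eigenvalues for every $\eta\in\mathbb S^1$. Put $\omega_j=\sqrt{\varkappa_j}$ and, for $\xi\ne0$, $\omega_j(\xi)=|\xi|\omega_j(\eta)$. The coupling functions are $a_j(\eta)=r_j(\eta)\cdot\eta$, $a_j(\xi)=r_j(\eta)\cdot\xi=|\xi|a_j(\eta)$, and $$B(\xi)=\begin{pmatrix}\omega_1(\xi)&0&0&0&\mathrm i\gamma a_1(\xi)\\0&\omega_2(\xi)&0&0&\mathrm i\gamma a_2(\xi)\\0&0&-\omega_1(\xi)&0&\mathrm i\gamma a_1(\xi)\\0&0&0&-\omega_2(\xi)&\mathrm i\gamma a_2(\xi)\\-\frac{\mathrm i\gamma}2a_1(\xi)&-\frac{\mathrm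 i\gamma}2a_2(\xi)&-\frac{\mathrm i\gamma}2a_1(\xi)&-\frac{\mathrm i\gamma}2a_2(\xi)&\mathrm i\kappa|\xi|^2\end{pmatrix}.$$ A direction $\eta\in\mathbb S^1$ is hyperbolic if $B(\xi)$, $\xi=|\xi|\eta\neq0$, has a real eigenvalue (this depends only on $\eta$), and parabolic otherwise; it is hyperbolic with respect to the index $j_0$ if $\pm\omega_{j_0}(\xi)\in\operatorname{spec}B(\xi)$. Under (A3), $\eta$ is hyperbolic with respect to $j_0$ iff $a_{j_0}(\eta)=0$; "the coupling functions vanish to first order in hyperbolic directions" means that in each hyperbolic direction $\bar\eta$ with respect to $j_0$ the zero of $a_{j_0}$ at $\bar\eta$ is simple. (A4) $\gamma^2\neq2\varkappa_{j_0}(\bar\eta)-\operatorname{tr}A(\bar\eta)$ for all hyperbolic directions $\bar\eta$ with respect to $j_0$. Norms: $\|\cdot\|_q$ is the $L^q(\mathbb R^2)$ norm and $\|f\|_{p,r}=\|\langle \mathrm D\rangle^rf\|_{L^p}$, where $\langle\mathrm D\rangle$ has symbol $(1+|\xi|^2)^{1/2}$. *)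

theory Defs
  imports "HOL-Analysis.Analysis"
begin

section \<open>Functions on the unit circle\<close>

definition circ :: "real \<Rightarrow> real^2" where
  "circ \<phi> = vector [cos \<phi>, sin \<phi>]"

text \<open>The circle is a real-analytic manifold with the angle as local coordinate.  Values off
  \<open>sphere 0 1\<close> are irrelevant.\<close>

definition real_analytic_on_circle :: "(real^2 \<Rightarrow> 'b::real_normed_vector) \<Rightarrow> bool" where
  "real_analytic_on_circle f \<longleftrightarrow>
     (\<forall>\<phi>\<^sub>0. \<exists>\<epsilon>>0. \<exists>a::nat \<Rightarrow> 'b. \<forall>\<phi>. \<bar>\<phi> - \<phi>\<^sub>0\<bar> < \<epsilon> \<longrightarrow>
        (\<lambda>n. (\<phi> - \<phi>\<^sub>0) ^ n *\<^sub>R a n) sums f (circ \<phi>))"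

definition simple_zero_on_circle :: "(real^2 \<Rightarrow> real) \<Rightarrow> real^2 \<Rightarrow> bool" where
  "simple_zero_on_circle a \<eta> \<longleftrightarrow> a \<eta> = 0 \<and>
     (\<forall>\<phi>. circ \<phi> = \<eta> \<longrightarrow> (\<exists>D. D \<noteq> 0 \<and> ((\<lambda>s. a (circ s)) has_real_derivative D) (at \<phi>)))"


section \<open>Complex matrices\<close>

definition complexify :: "real^'n \<Rightarrow> complex^'n" where
  "complexify v = (\<chi> i. complex_of_real (v $ i))"

definition self_adjoint :: "complex^'n^'n \<Rightarrow> bool" where
  "self_adjoint M \<longleftrightarrow> (\<forall>i j. M $ i $ j = cnj (M $ j $ i))"

definition quad_form :: "complex^'n^'n \<Rightarrow> complex^'n \<Rightarrow> complex" where
  "quad_form M v = (\<Sum>i\<in>UNIV. cnj (v $ i) * (M *v v) $ i)"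

text \<open>For self-adjoint matrices the quadratic form is real, so that taking real parts below loses
  nothing.\<close>

definition pos_definite :: "complex^'n^'n \<Rightarrow> bool" where
  "pos_definite M \<longleftrightarrow> (\<forall>v. v \<noteq> 0 \<longrightarrow> Re (quad_form M v) > 0)"

definition pos_semidefinite :: "complex^'n^'n \<Rightarrow> bool" where
  "pos_semidefinite M \<longleftrightarrow> (\<forall>v. Re (quad_form M v) \<ge> 0)"

definition spec :: "complex^'n^'n \<Rightarrow> complex set" where
  "spec M = {z. \<exists>v. v \<noteq> 0 \<and> M *v v = z *s v}"

text \<open>The unique self-adjoint positive semidefinite square root of a self-adjoint positive
  semidefinite matrix.\<close>

definition matrix_sqrt :: "complex^'n^'n \<Rightarrow> complex^'n^'n" where
  "matrix_sqrt M = (THE S. self_adjoint S \<and> pos_semidefinite S \<and> S ** S = M)"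


section \<open>The symbol and hyperbolic directions\<close>

text \<open>The extension \<open>A(\<xi>) = |\<xi>|\<^sup>2 A(\<xi>/|\<xi>|)\<close>.  Here and below \<open>sgn \<xi>\<close> is the normalised vector
  \<open>\<xi>/|\<xi>|\<close>, with \<open>sgn 0 = 0\<close>.\<close>

definition hom_symbol :: "(real^2 \<Rightarrow> complex^2^2) \<Rightarrow> real^2 \<Rightarrow> complex^2^2" where
  "hom_symbol A \<xi> = (norm \<xi>)\<^sup>2 *\<^sub>R A (sgn \<xi>)"

text \<open>Below, \<open>\<mu> j\<close> and \<open>rv j\<close> are the eigenvalues and the eigenvectors of \<open>A\<close>, \<open>j \<in> {1, 2}\<close>.\<close>

definition freq :: "(2 \<Rightarrow> real^2 \<Rightarrow> real) \<Rightarrow> 2 \<Rightarrow> real^2 \<Rightarrow> real" where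
  "freq \<mu> j \<xi> = norm \<xi> * sqrt (\<mu> j (sgn \<xi>))"

definition coupling :: "(2 \<Rightarrow> real^2 \<Rightarrow> real^2) \<Rightarrow> 2 \<Rightarrow> real^2 \<Rightarrow> real" where
  "coupling rv j \<xi> = rv j (sgn \<xi>) \<bullet> \<xi>"

definition B_matrix :: "real \<Rightarrow> real \<Rightarrow> (2 \<Rightarrow> real^2 \<Rightarrow> real) \<Rightarrow> (2 \<Rightarrow> real^2 \<Rightarrow> real^2) \<Rightarrow>
    real^2 \<Rightarrow> complex^5^5" where
  "B_matrix \<kappa> \<gamma> \<mu> rv \<xi> =
    (let w = (\<lambda>j. complex_of_real (freq \<mu> j \<xi>));
         b = (\<lambda>j. \<i> * complex_of_real (\<gamma> * coupling rv j \<xi>))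
     in vector
      [vector [w 1, 0, 0, 0, b 1],
       vector [0, w 2, 0, 0, b 2],
       vector [0, 0, - w 1, 0, b 1],
       vector [0, 0, 0, - w 2, b 2],
       vector [- b 1 / 2, - b 2 / 2, - b 1 / 2, - b 2 / 2,
               \<i> * complex_of_real (\<kappa> * (norm \<xi>)\<^sup>2)]])"

text \<open>Whether \<open>\<plusminus>\<omega>\<^sub>j(\<xi>)\<close> are eigenvalues of \<open>B(\<xi>)\<close> depends only on the direction of \<open>\<xi>\<close>, so it does
  not matter which \<open>\<xi>\<close> on the ray spanned by \<open>\<eta>\<close> is taken.\<close>

definition hyperbolic_wrt :: "real \<Rightarrow> real \<Rightarrow> (2 \<Rightarrow> real^2 \<Rightarrow> real) \<Rightarrow> (2 \<Rightarrow> real^2 \<Rightarrow> real^2) \<Rightarrow>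
    2 \<Rightarrow> real^2 \<Rightarrow> bool" where
  "hyperbolic_wrt \<kappa> \<gamma> \<mu> rv j \<eta> \<longleftrightarrow> norm \<eta> = 1 \<and>
     (\<exists>\<xi>. \<xi> \<noteq> 0 \<and> sgn \<xi> = \<eta> \<and>
        {complex_of_real (freq \<mu> j \<xi>), - complex_of_real (freq \<mu> j \<xi>)}
          \<subseteq> spec (B_matrix \<kappa> \<gamma> \<mu> rv \<xi>))"


section \<open>Schwartz functions, Fourier multipliers and norms\<close>

definition pd :: "2 \<Rightarrow> (real^2 \<Rightarrow> 'b::real_normed_vector) \<Rightarrow> real^2 \<Rightarrow> 'b" where
  "pd j f x = frechet_derivative f (at x) (axis j 1)"

text \<open>\<open>foldr pd js f\<close> is an arbitrary iterated partial derivative.\<close>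

definition schwartz :: "(real^2 \<Rightarrow> 'b::real_normed_vector) \<Rightarrow> bool" where
  "schwartz f \<longleftrightarrow> (\<forall>js. (\<forall>x. foldr pd js f differentiable (at x)) \<and>
     (\<forall>n::nat. bounded (range (\<lambda>x. (1 + norm x) ^ n *\<^sub>R foldr pd js f x))))"

definition fourier :: "(real^2 \<Rightarrow> complex) \<Rightarrow> real^2 \<Rightarrow> complex" where
  "fourier f \<xi> = (1 / (2 * pi)) *\<^sub>R (LINT x|lborel. cis (- (x \<bullet> \<xi>)) * f x)"

definition inv_fourier :: "(real^2 \<Rightarrow> complex) \<Rightarrow> real^2 \<Rightarrow> complex" where
  "inv_fourier g x = (1 / (2 * pi)) *\<^sub>R (LINT \<xi>|lborel. cis (x \<bullet> \<xi>) * g \<xi>)"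

definition fourier_vec :: "(real^2 \<Rightarrow> complex^2) \<Rightarrow> real^2 \<Rightarrow> complex^2" where
  "fourier_vec F \<xi> = (\<chi> k. fourier (\<lambda>x. F x $ k) \<xi>)"

definition inv_fourier_vec :: "(real^2 \<Rightarrow> complex^2) \<Rightarrow> real^2 \<Rightarrow> complex^2" where
  "inv_fourier_vec G x = (\<chi> k. inv_fourier (\<lambda>\<xi>. G \<xi> $ k) x)"

text \<open>Fourier multipliers with scalar and with matrix symbol.  They are meaningful for integrable
  functions whose transform, multiplied by the symbol, is integrable.\<close>

definition mult_op :: "(real^2 \<Rightarrow> complex) \<Rightarrow> (real^2 \<Rightarrow> complex) \<Rightarrow> real^2 \<Rightarrow> complex" where
  "mult_op m f = inv_fourier (\<lambda>\<xi>. m \<xi> * fourier f \<xi>)"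

definition mult_op_vec :: "(real^2 \<Rightarrow> complex^2^2) \<Rightarrow> (real^2 \<Rightarrow> complex^2) \<Rightarrow> real^2 \<Rightarrow> complex^2" where
  "mult_op_vec M F = inv_fourier_vec (\<lambda>\<xi>. M \<xi> *v fourier_vec F \<xi>)"

definition japanese :: "real \<Rightarrow> real^2 \<Rightarrow> complex" where
  "japanese s \<xi> = complex_of_real ((1 + (norm \<xi>)\<^sup>2) powr (s / 2))"

definition Lp_norm :: "real \<Rightarrow> (real^2 \<Rightarrow> 'b::euclidean_space) \<Rightarrow> ennreal" where
  "Lp_norm p f =
     (if f \<in> borel_measurable lborel \<and> integrable lborel (\<lambda>x. norm (f x) powr p)
      then ennreal ((LINT x|lborel. norm (f x) powr p) powr (1 / p)) else \<infinity>)"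

definition sobolev_norm :: "real \<Rightarrow> real \<Rightarrow> (real^2 \<Rightarrow> complex) \<Rightarrow> ennreal" where
  "sobolev_norm p s f = Lp_norm p (mult_op (japanese s) f)"

definition sobolev_norm_vec :: "real \<Rightarrow> real \<Rightarrow> (real^2 \<Rightarrow> complex^2) \<Rightarrow> ennreal" where
  "sobolev_norm_vec p s F = Lp_norm p (mult_op_vec (\<lambda>\<xi>. mat (japanese s \<xi>)) F)"


section \<open>The Cauchy problem\<close>

text \<open>Time derivative on \<open>[0, \<infinity>)\<close>, one-sided at \<open>t = 0\<close>.\<close>

definition dt :: "(real \<Rightarrow> real^2 \<Rightarrow> 'b::real_normed_vector) \<Rightarrow> real \<Rightarrow> real^2 \<Rightarrow> 'b" where
  "dt u t x = vector_derivative (\<lambda>s. u s x) (at t within {0..})"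

definition gradient :: "(real^2 \<Rightarrow> complex) \<Rightarrow> real^2 \<Rightarrow> complex^2" where
  "gradient f x = (\<chi> j. pd j f x)"

definition divergence :: "(real^2 \<Rightarrow> complex^2) \<Rightarrow> real^2 \<Rightarrow> complex" where
  "divergence F x = (\<Sum>j\<in>UNIV. pd j (\<lambda>y. F y $ j) x)"

definition laplacian :: "(real^2 \<Rightarrow> complex) \<Rightarrow> real^2 \<Rightarrow> complex" where
  "laplacian f x = (\<Sum>j\<in>UNIV. pd j (pd j f) x)"

text \<open>Continuously differentiable with integrable first derivatives.\<close>

definition C1_L1 :: "(real^2 \<Rightarrow> 'b::euclidean_space) \<Rightarrow> bool" where
  "C1_L1 f \<longleftrightarrow> integrable lborel f \<and> (\<forall>x. f differentiable (at x)) \<and>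
     (\<forall>j. continuous_on UNIV (pd j f) \<and> integrable lborel (pd j f))"

text \<open>Classical solutions.  As \<open>A(D)\<close> is nonlocal and the problem is posed on the whole plane, a
  regularity class has to be fixed: integrability in \<open>x\<close> with a majorant that is locally uniform in
  \<open>t\<close>, and integrability of \<open>|\<xi>|\<^sup>2\<close> times the transform of \<open>U(t)\<close>, so that \<open>A(D)U(t)\<close> is defined by
  its Fourier integral.  In this class the partial Fourier transform turns the problem into a linear
  ordinary differential equation for each \<open>\<xi>\<close>, hence solutions are unique.  For Schwartz data the
  solution belongs to the class: its transform decays rapidly together with its derivatives, and the
  only singularity of these, at \<open>\<xi> = 0\<close>, is that of the symbol \<open>|\<xi>|\<^sup>2 A(\<xi>/|\<xi>|)\<close>, which has
  locally integrable third derivatives.  The values are complex because \<open>A(\<eta>) = A(-\<eta>)\<close> is not required,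
  so that \<open>A(D)\<close> need not preserve real-valued functions.\<close>

definition solution_class ::
  "(real \<Rightarrow> real^2 \<Rightarrow> complex^2) \<Rightarrow> (real \<Rightarrow> real^2 \<Rightarrow> complex) \<Rightarrow> bool" where
  "solution_class U \<theta> \<longleftrightarrow>
     (\<forall>x. \<forall>t\<ge>0. (\<lambda>s. U s x) differentiable (at t within {0..})) \<and>
     (\<forall>x. continuous_on {0..} (\<lambda>t. dt U t x) \<and> continuous_on {0..} (\<lambda>t. \<theta> t x)) \<and>
     (\<forall>x. \<forall>t>0. (\<lambda>s. dt U s x) differentiable (at t) \<and> (\<lambda>s. \<theta> s x) differentiable (at t)) \<and>
     (\<forall>t>0. C1_L1 (U t) \<and> C1_L1 (dt U t) \<and> C1_L1 (\<theta> t) \<and> (\<forall>j. C1_L1 (pd j (\<theta> t)))) \<and>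
     (\<forall>t>0. integrable lborel (\<lambda>\<xi>. (norm \<xi>)\<^sup>2 *\<^sub>R fourier_vec (U t) \<xi>)) \<and>
     (\<forall>T>0. \<exists>g. integrable lborel g \<and> (\<forall>t x. 0 < t \<and> t \<le> T \<longrightarrow>
        norm (U t x) \<le> g x \<and> norm (dt U t x) \<le> g x \<and> norm (dt (dt U) t x) \<le> g x \<and>
        norm (\<theta> t x) \<le> g x \<and> norm (dt \<theta> t x) \<le> g x))"

definition thermoelastic_solution ::
  "(real^2 \<Rightarrow> complex^2^2) \<Rightarrow> real \<Rightarrow> real \<Rightarrow>
   (real^2 \<Rightarrow> complex^2) \<Rightarrow> (real^2 \<Rightarrow> complex^2) \<Rightarrow> (real^2 \<Rightarrow> complex) \<Rightarrow>
   (real \<Rightarrow> real^2 \<Rightarrow> complex^2) \<Rightarrow> (real \<Rightarrow> real^2 \<Rightarrow> complex) \<Rightarrow> bool" where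
  "thermoelastic_solution A \<kappa> \<gamma> U\<^sub>1 U\<^sub>2 \<theta>\<^sub>0 U \<theta> \<longleftrightarrow>
     solution_class U \<theta> \<and>
     (\<forall>t>0. \<forall>x.
        dt (dt U) t x + mult_op_vec (hom_symbol A) (U t) x + \<gamma> *\<^sub>R gradient (\<theta> t) x = 0 \<and>
        dt \<theta> t x - \<kappa> *\<^sub>R laplacian (\<theta> t) x + \<gamma> *\<^sub>R divergence (dt U t) x = 0) \<and>
     (\<forall>x. U 0 x = U\<^sub>1 x \<and> dt U 0 x = U\<^sub>2 x \<and> \<theta> 0 x = \<theta>\<^sub>0 x)"

end

theory Submission
  imports Defs "HOL-Probability.Probability"
begin

text \<open>The decay is visible pointwise in Fourier space.  For fixed \<open>\<xi>\<close> the system is a linear ordinary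
  differential equation, and its modal energy decays at least like
  \<open>exp (- c t |\<xi>|\<^sup>2 / (1 + |\<xi>|\<^sup>2) min (a\<^sub>1(\<eta>)\<^sup>2) (a\<^sub>2(\<eta>)\<^sup>2))\<close>; this follows from a Lyapunov functional,
  uniformly in \<open>\<xi>\<close> because the two frequencies stay apart.  As the coupling functions have only simple
  zeros, the minimum dominates a multiple of \<open>(\<eta> \<bullet> n)\<^sup>2\<close> for one of finitely many unit vectors \<open>n\<close>.
  Hence the decay factor, weighted with \<open>(1 + |\<xi>|\<^sup>2)\<close> to the power \<open>- r / 2\<close>, has an \<open>L\<^sup>s\<close> norm of order
  \<open>(1 + t)\<close> to the power \<open>- 1 / (2 s)\<close> with \<open>1 / s = 1 / p - 1 / q\<close>.  Hausdorff-Young from the data to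
  their transforms, Hoelder with this factor, and Hausdorff-Young back give the estimate, so that no
  stationary phase is involved.\<close>


section \<open>The Fourier transform on the plane\<close>

text \<open>Only the temperature is damped directly, and a mode whose coupling \<open>a_j\<close>
  vanishes is not damped at all, so no rate uniform in the direction exists. The loss is measured
  exactly: |\<xi>|^2 times the squared sine of the angle to a degenerate direction is (\<xi>
  \<bullet> n)^2, hence for bounded frequencies the decay factor is a Gaussian of width t^(-1/2) in
  a single linear coordinate. With \<delta> = 1/p - 1/q, its L^(1/\<delta>) norm turns this
  one-dimensional gain into t^(-\<delta>/2). For large |\<xi>| the factor depends on the direction
  only, so integrability has to come from the weight. Raised to the power 1/\<delta>, the weight has
  the exponent r / (2 \<delta>), which in the plane must exceed 1; this is the condition on r. A
  second obstacle is that the solution class does not make the transforms of U_t and \<theta>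
  integrable. The pointwise bound by the transforms of the data supplies this first, and only then
  may the solution be written as an inverse transform, to which the last Hausdorff-Young inequality
  applies.\<close>

lemma measurable_vector2 [measurable]:
  "(\<lambda>z. vector [fst z, snd z] :: real^2) \<in> borel_measurable (borel \<Otimes>\<^sub>M borel)"
proof -
  have "continuous_on UNIV (\<lambda>z::real\<times>real. \<chi> i::2. if i = 1 then fst z else snd z)"
  proof (intro continuous_on_vec_lambda)
    fix i :: 2
    show "continuous_on UNIV (\<lambda>z::real\<times>real. if i = 1 then fst z else snd z)"
      by (cases "i = 1") (auto intro!: continuous_intros)
  qed
  moreover have "(\<lambda>z::real\<times>real. \<chi> i::2. if i = 1 then fst z else snd z) = (\<lambda>z. vector [fst z, snd z])"
    by (auto simp: fun_eq_iff vec_eq_iff forall_2)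
  ultimately have "continuous_on UNIV (\<lambda>z. vector [fst z, snd z] :: real^2)"
    by (simp only:)
  hence "(\<lambda>z. vector [fst z, snd z] :: real^2) \<in> borel_measurable borel"
    by (rule borel_measurable_continuous_onI)
  thus ?thesis by (simp add: borel_prod)
qed

lemma Basis_plane: "(Basis :: (real^2) set) = {axis 1 1, axis 2 1}"
  by (auto simp: Basis_vec_def UNIV_2)

text \<open>Lebesgue measure is determined by its values on open boxes, and the coordinates pull a
  box back to a rectangle. All iterated integrals over the plane below go through this
  identification.\<close>

lemma lborel_plane:
  "(lborel :: (real^2) measure) = distr (lborel \<Otimes>\<^sub>M lborel) borel (\<lambda>z. vector [fst z, snd z])"
proof (rule lborel_eqI)
  fix l u :: "real^2"
  assume le: "\<And>b. b \<in> Basis \<Longrightarrow> l \<bullet> b \<le> u \<bullet> b"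
  have le1: "l $ 1 \<le> u $ 1" "l $ 2 \<le> u $ 2"
    using le[of "axis 1 1"] le[of "axis 2 1"] by (auto simp: inner_axis axis_in_Basis_iff)
  have vim: "(\<lambda>z. vector [fst z, snd z] :: real^2) -` box l u \<inter> space (lborel \<Otimes>\<^sub>M lborel)
      = {l$1<..<u$1} \<times> {l$2<..<u$2}"
    by (auto simp: box_def Basis_plane inner_axis space_pair_measure)
  have "emeasure (distr (lborel \<Otimes>\<^sub>M lborel) borel (\<lambda>z. vector [fst z, snd z] :: real^2)) (box l u)
     = emeasure (lborel \<Otimes>\<^sub>M lborel) ({l$1<..<u$1} \<times> {l$2<..<u$2})"
    by (subst emeasure_distr) (auto simp: vim)
  also have "\<dots> = ennreal (u$1 - l$1) * ennreal (u$2 - l$2)"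
    by (subst lborel.emeasure_pair_measure_Times) (auto simp: le1)
  also have "\<dots> = ennreal ((u$1 - l$1) * (u$2 - l$2))"
    using le1 by (simp add: ennreal_mult)
  also have "(u$1 - l$1) * (u$2 - l$2) = (\<Prod>b\<in>Basis. (u - l) \<bullet> b)"
  proof -
    have "axis 1 1 \<noteq> (axis 2 1 :: real^2)" by (simp add: axis_eq_axis)
    thus ?thesis by (simp add: Basis_plane inner_axis)
  qed
  finally show "emeasure (distr (lborel \<Otimes>\<^sub>M lborel) borel (\<lambda>z. vector [fst z, snd z] :: real^2)) (box l u)
     = ennreal (\<Prod>b\<in>Basis. (u - l) \<bullet> b)" .
qed simp

lemma nn_integral_plane:
  fixes f :: "real^2 \<Rightarrow> ennreal"
  assumes [measurable]: "f \<in> borel_measurable borel"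
  shows "(\<integral>\<^sup>+x. f x \<partial>lborel) = (\<integral>\<^sup>+x. \<integral>\<^sup>+y. f (vector [x, y]) \<partial>lborel \<partial>lborel)"
proof -
  have "(\<integral>\<^sup>+x. f x \<partial>lborel) = (\<integral>\<^sup>+z. f (vector [fst z, snd z]) \<partial>(lborel \<Otimes>\<^sub>M lborel))"
    by (subst lborel_plane, subst nn_integral_distr) auto
  also have "\<dots> = (\<integral>\<^sup>+x. \<integral>\<^sup>+y. f (vector [x, y]) \<partial>lborel \<partial>lborel)"
    by (subst lborel.nn_integral_fst[symmetric]) auto
  finally show ?thesis .
qed

lemma integrable_plane_mult:
  fixes f g :: "real \<Rightarrow> 'b::{real_normed_field, banach, second_countable_topology}"
  assumes [measurable]: "integrable lborel f" "integrable lborel g"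
  shows "integrable lborel (\<lambda>x::real^2. f (x$1) * g (x$2))"
    and "(LINT x|lborel. f ((x::real^2)$1) * g (x$2)) = (LINT x|lborel. f x) * (LINT x|lborel. g x)"
proof -
  have [measurable]: "f \<in> borel_measurable borel" "g \<in> borel_measurable borel"
    using assms by auto
  have [measurable]: "(\<lambda>x::real^2. f (x$1) * g (x$2)) \<in> borel_measurable borel"
  proof -
    have "(\<lambda>x::real^2. x $ i) \<in> borel_measurable borel" for i
      by (intro borel_measurable_continuous_onI continuous_intros)
    note [measurable] = this[of 1] this[of 2]
    show ?thesis by measurable
  qed
  have i: "integrable (lborel \<Otimes>\<^sub>M lborel) (\<lambda>(x, y). f x * g y)"
    by (intro lborel_pair.Fubini_integrable) (auto simp: norm_mult intro!: integrable_mult_right integrable_mult_left integrable_norm assms)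
  show "integrable lborel (\<lambda>x::real^2. f (x$1) * g (x$2))"
    by (subst lborel_plane, subst integrable_distr_eq) (use i in \<open>auto simp: case_prod_beta'\<close>)
  have "(LINT x|lborel. f ((x::real^2)$1) * g (x$2)) = (LINT z|(lborel \<Otimes>\<^sub>M lborel). f (fst z) * g (snd z))"
    by (subst lborel_plane, subst integral_distr) auto
  also have "\<dots> = (LINT x|lborel. LINT y|lborel. f x * g y)"
    using lborel_pair.integral_fst'[OF i] by (simp add: case_prod_beta')
  also have "\<dots> = (LINT x|lborel. f x) * (LINT x|lborel. g x)"
    by simp
  finally show "(LINT x|lborel. f ((x::real^2)$1) * g (x$2)) = (LINT x|lborel. f x) * (LINT x|lborel. g x)" .
qed

section \<open>Gaussians on the line and in the plane\<close>

lemma measurable_cis [measurable]: "cis \<in> borel_measurable borel"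
  by (intro borel_measurable_continuous_onI continuous_on_cis continuous_on_id)

text \<open>The characteristic function of the standard normal distribution supplies the integral;
  rescaling by sqrt N gives the variance \<open>N\<close>.\<close>

lemma gauss_fourier_1:
  assumes "N > 0"
  shows "integrable lborel (\<lambda>x::real. complex_of_real (exp (- x\<^sup>2 / (2 * N))) * cis (t * x))"
    and "(LINT x|lborel. complex_of_real (exp (- x\<^sup>2 / (2 * N))) * cis (t * x))
      = complex_of_real (sqrt (2 * pi * N) * exp (- N * t\<^sup>2 / 2))"
proof -
  have i0: "integrable lborel (\<lambda>x. complex_of_real (std_normal_density x) * cis (s * x))" for s
    by (rule Bochner_Integration.integrable_bound[OF integrable_normal_density[of 1 0]])
       (auto simp: norm_mult less_imp_le[OF normal_density_pos])
  have e0: "(LINT x|lborel. complex_of_real (std_normal_density x) * cis (s * x)) = complex_of_real (exp (- s\<^sup>2 / 2))" for s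
    using fun_cong[OF char_std_normal_distribution, of s]
    by (simp add: char_def integral_density less_imp_le[OF normal_density_pos] scaleR_conv_of_real cis_conv_exp mult_ac)
  have eq: "complex_of_real (exp (- x\<^sup>2 / (2 * N))) * cis (t * x) =
     complex_of_real (sqrt (2*pi)) * (complex_of_real (std_normal_density (0 + (1 / sqrt N) * x)) * cis ((t * sqrt N) * (0 + (1 / sqrt N) * x)))" for x
    using assms by (simp add: std_normal_density_def power_divide field_simps)
  show "integrable lborel (\<lambda>x::real. complex_of_real (exp (- x\<^sup>2 / (2 * N))) * cis (t * x))"
    unfolding eq
    by (intro integrable_mult_right) (subst lborel_integrable_real_affine_iff, use assms i0 in auto)
  have "(LINT x|lborel. complex_of_real (std_normal_density (0 + (1 / sqrt N) * x)) * cis ((t * sqrt N) * (0 + (1 / sqrt N) * x)))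
    = sqrt N *\<^sub>R complex_of_real (exp (- (t * sqrt N)\<^sup>2 / 2))"
    using e0[of "t * sqrt N"] assms lborel_integral_real_affine[of "1 / sqrt N" "\<lambda>x. complex_of_real (std_normal_density x) * cis ((t * sqrt N) * x)" 0]
    by (simp add: field_simps)
  thus "(LINT x|lborel. complex_of_real (exp (- x\<^sup>2 / (2 * N))) * cis (t * x))
      = complex_of_real (sqrt (2 * pi * N) * exp (- N * t\<^sup>2 / 2))"
    unfolding eq integral_mult_right_zero using assms
    by (simp add: scaleR_conv_of_real power_mult_distrib real_sqrt_mult mult_ac)
qed

text \<open>A convergence factor that tends to 1 pointwise as \<open>N\<close> grows. The shift to
  \<open>real N + 1\<close> keeps the variance positive at \<open>N = 0\<close>.\<close>

definition gauss :: "nat \<Rightarrow> real^2 \<Rightarrow> real" where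
  "gauss N x = exp (- (norm x)\<^sup>2 / (2 * (real N + 1)))"

lemma norm_plane: "(norm (x::real^2))\<^sup>2 = (x$1)\<^sup>2 + (x$2)\<^sup>2"
  unfolding power2_norm_eq_inner by (simp add: inner_vec_def sum_2 power2_eq_square)

lemma inner_plane: "(x::real^2) \<bullet> y = x$1 * y$1 + x$2 * y$2"
  by (simp add: inner_vec_def sum_2)

lemma gauss_fourier:
  shows "integrable lborel (\<lambda>x. complex_of_real (gauss N x) * cis (x \<bullet> \<xi>))"
    and "(LINT x|lborel. complex_of_real (gauss N x) * cis (x \<bullet> \<xi>))
      = complex_of_real (2 * pi * (real N + 1) * exp (- (real N + 1) * (norm \<xi>)\<^sup>2 / 2))"
proof -
  have eq: "complex_of_real (gauss N x) * cis (x \<bullet> \<xi>) =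
     (complex_of_real (exp (- (x$1)\<^sup>2 / (2 * (real N + 1)))) * cis (\<xi>$1 * x$1)) *
     (complex_of_real (exp (- (x$2)\<^sup>2 / (2 * (real N + 1)))) * cis (\<xi>$2 * x$2))" for x
  proof -
    have g: "gauss N x = exp (- (x$1)\<^sup>2 / (2 * (real N + 1))) * exp (- (x$2)\<^sup>2 / (2 * (real N + 1)))"
    proof -
      have "- (a + b) / m = - a / m + - b / m" for m a b :: real
        by (simp add: add_divide_distrib diff_divide_distrib)
      thus ?thesis unfolding gauss_def norm_plane mult_exp_exp by (rule arg_cong)
    qed
    have c: "cis (x \<bullet> \<xi>) = cis (\<xi>$1 * x$1) * cis (\<xi>$2 * x$2)"
      by (simp add: inner_plane cis_mult mult.commute)
    show ?thesis unfolding g c by simp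
  qed
  show "integrable lborel (\<lambda>x. complex_of_real (gauss N x) * cis (x \<bullet> \<xi>))"
    unfolding eq by (intro integrable_plane_mult gauss_fourier_1) auto
  show "(LINT x|lborel. complex_of_real (gauss N x) * cis (x \<bullet> \<xi>))
      = complex_of_real (2 * pi * (real N + 1) * exp (- (real N + 1) * (norm \<xi>)\<^sup>2 / 2))"
    unfolding eq
  proof (subst integrable_plane_mult(2))
    have M: "real N + 1 > 0" by simp
    have e: "exp (- (real N + 1) * (\<xi>$1)\<^sup>2 / 2) * exp (- (real N + 1) * (\<xi>$2)\<^sup>2 / 2)
        = exp (- (real N + 1) * (norm \<xi>)\<^sup>2 / 2)"
    proof -
      have "- m * a / 2 + - m * b / 2 = - m * (a + b) / 2" for m a b :: real
        by (simp add: field_simps)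
      thus ?thesis unfolding norm_plane mult_exp_exp by (rule arg_cong)
    qed
    have "(LINT x|lborel. complex_of_real (exp (- x\<^sup>2 / (2 * (real N + 1)))) * cis (\<xi>$1 * x)) *
       (LINT x|lborel. complex_of_real (exp (- x\<^sup>2 / (2 * (real N + 1)))) * cis (\<xi>$2 * x)) =
       complex_of_real ((sqrt (2 * pi * (real N + 1)) * sqrt (2 * pi * (real N + 1))) * (exp (- (real N + 1) * (\<xi>$1)\<^sup>2 / 2) * exp (- (real N + 1) * (\<xi>$2)\<^sup>2 / 2)))"
      unfolding gauss_fourier_1(2)[OF M] by (simp only: of_real_mult mult.assoc mult.left_commute)
    also have "\<dots> = complex_of_real (2 * pi * (real N + 1) * exp (- (real N + 1) * (norm \<xi>)\<^sup>2 / 2))"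
      unfolding e by simp
    finally show "(LINT x|lborel. complex_of_real (exp (- x\<^sup>2 / (2 * (real N + 1)))) * cis (\<xi>$1 * x)) *
       (LINT x|lborel. complex_of_real (exp (- x\<^sup>2 / (2 * (real N + 1)))) * cis (\<xi>$2 * x)) =
       complex_of_real (2 * pi * (real N + 1) * exp (- (real N + 1) * (norm \<xi>)\<^sup>2 / 2))" .
  qed (intro gauss_fourier_1; simp)+
qed

text \<open>There is no normalising constant, and the sign of the phase is a parameter:
  \<open>s = -1\<close> is the forward and \<open>s = 1\<close> the inverse transform, so that each
  fact is proved once for both. The hypothesis \<open>s\<^sup>2 = 1\<close> below stands for this
  choice of sign.\<close>

definition FT :: "real \<Rightarrow> (real^2 \<Rightarrow> complex) \<Rightarrow> real^2 \<Rightarrow> complex" where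
  "FT s f \<xi> = (LINT x|lborel. cis (s * (x \<bullet> \<xi>)) * f x)"

lemma fourier_FT: "fourier f = (\<lambda>\<xi>. complex_of_real (1 / (2 * pi)) * FT (-1) f \<xi>)"
  by (simp add: fun_eq_iff fourier_def FT_def scaleR_conv_of_real)

lemma inv_fourier_FT: "inv_fourier f = (\<lambda>\<xi>. complex_of_real (1 / (2 * pi)) * FT 1 f \<xi>)"
  by (simp add: fun_eq_iff inv_fourier_def FT_def scaleR_conv_of_real inner_commute)

section \<open>Bounds, continuity and duality of the transform\<close>

lemma measurable_cis_inner [measurable]:
  "(\<lambda>x::real^2. cis (s * (x \<bullet> \<xi>))) \<in> borel_measurable borel"
  by (intro borel_measurable_continuous_onI continuous_intros continuous_on_cis)

lemma integrable_cis_mult: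
  assumes [measurable]: "integrable lborel f"
  shows "integrable lborel (\<lambda>x::real^2. cis (s * (x \<bullet> \<xi>)) * f x)"
  by (rule Bochner_Integration.integrable_bound[OF assms]) (auto simp: norm_mult)

text \<open>Integrability can be left out: a function that is not integrable has integral 0 by
  convention, and the bound is then trivial.\<close>

lemma norm_LINT_le_nn:
  fixes f :: "'a \<Rightarrow> 'b::{banach, second_countable_topology}"
  shows "ennreal (norm (LINT x|M. f x)) \<le> (\<integral>\<^sup>+x. ennreal (norm (f x)) \<partial>M)"
  by (cases "integrable M f") (auto simp: integral_norm_bound_ennreal not_integrable_integral_eq)

lemma norm_FT_le: "ennreal (norm (FT s f \<xi>)) \<le> (\<integral>\<^sup>+x. ennreal (norm (f x)) \<partial>lborel)"
  unfolding FT_def by (rule order_trans[OF norm_LINT_le_nn]) (simp add: norm_mult)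

lemma norm_FT_le_LINT:
  assumes "integrable lborel f"
  shows "norm (FT s f \<xi>) \<le> (LINT x|lborel. norm (f x))"
proof -
  have "ennreal (norm (FT s f \<xi>)) \<le> ennreal (LINT x|lborel. norm (f x))"
    using norm_FT_le[of s f \<xi>] assms by (simp add: nn_integral_eq_integral)
  thus ?thesis by (simp add: integral_nonneg)
qed

lemma continuous_FT:
  assumes f: "integrable lborel f"
  shows "continuous_on UNIV (FT s f)"
proof (clarsimp simp: continuous_on_sequentially o_def)
  fix \<xi> :: "real^2" and u assume u: "u \<longlonglongrightarrow> \<xi>"
  have [measurable]: "f \<in> borel_measurable borel" using f by auto
  have "(\<lambda>n. LINT x|lborel. cis (s * (x \<bullet> u n)) * f x) \<longlonglongrightarrow> (LINT x|lborel. cis (s * (x \<bullet> \<xi>)) * f x)"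
  proof (rule integral_dominated_convergence[where w = "\<lambda>x. norm (f x)"])
    show "AE x in lborel. (\<lambda>n. cis (s * (x \<bullet> u n)) * f x) \<longlonglongrightarrow> cis (s * (x \<bullet> \<xi>)) * f x"
      by (intro AE_I2 tendsto_intros u)
  qed (use f in \<open>auto simp: norm_mult\<close>)
  thus "(\<lambda>n. FT s f (u n)) \<longlonglongrightarrow> FT s f \<xi>" by (simp add: FT_def)
qed

lemma measurable_FT [measurable]:
  assumes "integrable lborel f" shows "FT s f \<in> borel_measurable borel"
  by (intro borel_measurable_continuous_onI continuous_FT assms)

lemma FT_cmult: "FT s (\<lambda>x. c * f x) \<xi> = c * FT s f \<xi>"
proof -
  have "(\<lambda>x. cis (s * (x \<bullet> \<xi>)) * (c * f x)) = (\<lambda>x. c * (cis (s * (x \<bullet> \<xi>)) * f x))"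
    by (auto simp: mult_ac)
  thus ?thesis by (simp add: FT_def)
qed

lemma FT_add:
  assumes "integrable lborel f" "integrable lborel g"
  shows "FT s (\<lambda>x. f x + g x) \<xi> = FT s f \<xi> + FT s g \<xi>"
  unfolding FT_def
  by (simp add: distrib_left Bochner_Integration.integral_add integrable_cis_mult assms)

lemma cnj_FT: "cnj (FT s f \<xi>) = FT (-s) (\<lambda>x. cnj (f x)) \<xi>"
proof -
  have "cnj (LINT x|lborel. cis (s * (x \<bullet> \<xi>)) * f x) = (LINT x|lborel. cnj (cis (s * (x \<bullet> \<xi>)) * f x))"
    by (rule Bochner_Integration.integral_cnj[symmetric])
  thus ?thesis by (simp add: FT_def cis_cnj)
qed

text \<open>The kernel is symmetric in its two points, so Fubini moves the transform to the other
  factor. Inversion and the L^2 bound both rest on this, with a second factor that contains a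
  Gaussian.\<close>

lemma FT_multiplication_formula:
  assumes [measurable]: "integrable lborel f" and "integrable lborel g"
  shows "(LINT \<xi>|lborel. FT s f \<xi> * g \<xi>) = (LINT x|lborel. f x * FT s g x)"
proof -
  have [measurable]: "f \<in> borel_measurable borel" "g \<in> borel_measurable borel" using assms by auto
  have [measurable]: "(\<lambda>z::(real^2)\<times>(real^2). cis (s * (fst z \<bullet> snd z))) \<in> borel_measurable (borel \<Otimes>\<^sub>M borel)"
    by measurable
  have i: "integrable (lborel \<Otimes>\<^sub>M lborel) (\<lambda>(x, \<xi>). cis (s * (x \<bullet> \<xi>)) * f x * g \<xi>)"
  proof (rule lborel_pair.Fubini_integrable)
    show "(\<lambda>(x, \<xi>). cis (s * (x \<bullet> \<xi>)) * f x * g \<xi>) \<in> borel_measurable (lborel \<Otimes>\<^sub>M lborel)"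
      by (simp add: case_prod_beta')
    show "integrable lborel (\<lambda>x. LINT y|lborel. norm (case (x, y) of (x, \<xi>) \<Rightarrow> cis (s * (x \<bullet> \<xi>)) * f x * g \<xi>))"
      using assms by (simp add: norm_mult)
    show "AE x in lborel. integrable lborel (\<lambda>y. case (x, y) of (x, \<xi>) \<Rightarrow> cis (s * (x \<bullet> \<xi>)) * f x * g \<xi>)"
    proof (rule AE_I2)
      fix x :: "real^2"
      have "integrable lborel (\<lambda>y. cis (s * (y \<bullet> x)) * (f x * g y))"
        by (intro integrable_cis_mult integrable_mult_right assms)
      thus "integrable lborel (\<lambda>y. case (x, y) of (x, \<xi>) \<Rightarrow> cis (s * (x \<bullet> \<xi>)) * f x * g \<xi>)"
        by (simp add: inner_commute mult_ac)
    qed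
  qed
  have "(LINT \<xi>|lborel. FT s f \<xi> * g \<xi>) = (LINT \<xi>|lborel. LINT x|lborel. cis (s * (x \<bullet> \<xi>)) * f x * g \<xi>)"
    by (simp add: FT_def)
  also have "\<dots> = (LINT x|lborel. LINT \<xi>|lborel. cis (s * (x \<bullet> \<xi>)) * f x * g \<xi>)"
    by (rule lborel_pair.Fubini_integral[OF i])
  also have "\<dots> = (LINT x|lborel. LINT \<xi>|lborel. f x * (cis (s * (\<xi> \<bullet> x)) * g \<xi>))"
    by (intro Bochner_Integration.integral_cong) (auto simp: inner_commute mult_ac)
  also have "\<dots> = (LINT x|lborel. f x * FT s g x)"
    by (simp add: FT_def)
  finally show ?thesis .
qed

text \<open>The transform of \<open>gauss N\<close>: a bump of width of order 1 / sqrt (N + 1) whose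
  mass is (2 pi)^2 for every \<open>N\<close>. This mass is the constant in the inversion
  formula.\<close>

definition gaussT :: "nat \<Rightarrow> real^2 \<Rightarrow> real" where
  "gaussT N z = 2 * pi * (real N + 1) * exp (- (real N + 1) * (norm z)\<^sup>2 / 2)"

lemma continuous_gauss: "continuous_on S (gauss N)" and continuous_gaussT: "continuous_on S (gaussT N)"
  unfolding gauss_def[abs_def] gaussT_def[abs_def] by (intro continuous_intros; simp)+

lemma measurable_gauss [measurable]: "gauss N \<in> borel_measurable borel"
  and measurable_gaussT [measurable]: "gaussT N \<in> borel_measurable borel"
  by (auto intro!: borel_measurable_continuous_onI continuous_gauss continuous_gaussT)

lemma gauss_pos: "gauss N x > 0" and gauss_le_1: "gauss N x \<le> 1"
  by (auto simp: gauss_def intro!: divide_nonneg_nonneg)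

lemma gauss_tendsto_1: "(\<lambda>N. gauss N x) \<longlonglongrightarrow> 1"
proof -
  have "(\<lambda>N. (- (norm x)\<^sup>2 / 2) * inverse (real (Suc N))) \<longlonglongrightarrow> (- (norm x)\<^sup>2 / 2) * 0"
    by (intro tendsto_intros LIMSEQ_inverse_real_of_nat)
  hence L: "(\<lambda>N. exp ((- (norm x)\<^sup>2 / 2) * inverse (real (Suc N)))) \<longlonglongrightarrow> exp ((- (norm x)\<^sup>2 / 2) * 0)"
    by (rule tendsto_exp)
  have e: "exp ((- (norm x)\<^sup>2 / 2) * inverse (real (Suc N))) = gauss N x" for N
    unfolding gauss_def by (rule arg_cong[where f = exp]) (simp add: field_simps)
  show ?thesis using L unfolding e by simp
qed

lemma integrable_gauss: "integrable lborel (gauss N)"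
  using integrable_norm[OF gauss_fourier(1)[of N 0]] gauss_pos[of N] by (simp add: less_imp_le)

lemma integrable_gauss_cis: "integrable lborel (\<lambda>x. complex_of_real (gauss N x) * cis (s * (x \<bullet> \<xi>)))"
  using gauss_fourier(1)[of N "s *\<^sub>R \<xi>"] by simp

lemma gaussT_nonneg: "gaussT N z \<ge> 0" by (simp add: gaussT_def)

text \<open>An invertible affine map preserves and reflects measurability, so for a non-measurable
  function both sides are non-integrable and both integrals are 0 by convention. The factor
  \<open>c\<^sup>2\<close> is the Jacobian in dimension two.\<close>

lemma plane_affine:
  fixes f :: "real^2 \<Rightarrow> 'b::{banach, second_countable_topology}"
  assumes "c \<noteq> 0"
  shows "integrable lborel (\<lambda>x. f (t + c *\<^sub>R x)) \<longleftrightarrow> integrable lborel f"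
    and "(LINT x|lborel. f x) = c\<^sup>2 *\<^sub>R (LINT x|lborel. f (t + c *\<^sub>R x))"
proof -
  have L: "(lborel::(real^2) measure) = density (distr lborel borel (\<lambda>x. t + c *\<^sub>R x)) (\<lambda>x. ennreal (c\<^sup>2))"
    using lborel_affine[OF assms, of t] by simp
  have m: "f \<in> borel_measurable borel \<longleftrightarrow> (\<lambda>x. f (t + c *\<^sub>R x)) \<in> borel_measurable borel"
  proof (intro iffI)
    assume [measurable]: "f \<in> borel_measurable borel"
    show "(\<lambda>x. f (t + c *\<^sub>R x)) \<in> borel_measurable borel" by measurable
  next
    assume [measurable]: "(\<lambda>x. f (t + c *\<^sub>R x)) \<in> borel_measurable borel"
    have "(\<lambda>y. (\<lambda>x. f (t + c *\<^sub>R x)) ((1/c) *\<^sub>R (y - t))) \<in> borel_measurable borel"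
      by measurable
    thus "f \<in> borel_measurable borel" using assms by simp
  qed
  show I: "integrable lborel (\<lambda>x. f (t + c *\<^sub>R x)) \<longleftrightarrow> integrable lborel f"
  proof (cases "f \<in> borel_measurable borel")
    case [measurable]: True
    have "integrable lborel f \<longleftrightarrow> integrable (density (distr lborel borel (\<lambda>x. t + c *\<^sub>R x)) (\<lambda>x. ennreal (c\<^sup>2))) f"
      using L by simp
    also have "\<dots> \<longleftrightarrow> integrable lborel (\<lambda>x. f (t + c *\<^sub>R x))"
    proof -
      have "integrable lborel (\<lambda>x. c\<^sup>2 *\<^sub>R f (t + c *\<^sub>R x)) \<longleftrightarrow> integrable lborel (\<lambda>x. f (t + c *\<^sub>R x))"
      proof
        assume "integrable lborel (\<lambda>x. c\<^sup>2 *\<^sub>R f (t + c *\<^sub>R x))"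
        hence "integrable lborel (\<lambda>x. (1 / c\<^sup>2) *\<^sub>R (c\<^sup>2 *\<^sub>R f (t + c *\<^sub>R x)))"
          by (rule integrable_scaleR_right)
        thus "integrable lborel (\<lambda>x. f (t + c *\<^sub>R x))" using assms by simp
      qed simp
      thus ?thesis by (subst integrable_density; simp add: integrable_distr_eq)
    qed
    finally show ?thesis by simp
  next
    case False
    thus ?thesis using m by (auto dest: borel_measurable_integrable)
  qed
  show "(LINT x|lborel. f x) = c\<^sup>2 *\<^sub>R (LINT x|lborel. f (t + c *\<^sub>R x))"
  proof (cases "f \<in> borel_measurable borel")
    case [measurable]: True
    have "(LINT x|lborel. f x) = integral\<^sup>L (density (distr lborel borel (\<lambda>x. t + c *\<^sub>R x)) (\<lambda>x. ennreal (c\<^sup>2))) f"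
      using L by simp
    also have "\<dots> = c\<^sup>2 *\<^sub>R (LINT x|lborel. f (t + c *\<^sub>R x))"
      by (subst integral_density; simp add: integral_distr)
    finally show ?thesis .
  next
    case False
    hence "\<not> integrable lborel f" by auto
    thus ?thesis using I by (simp add: not_integrable_integral_eq)
  qed
qed

section \<open>Concentration of the transformed Gaussians\<close>

lemma gaussT_scale: "gaussT N ((1 / sqrt (real N + 1)) *\<^sub>R z) = (real N + 1) * gaussT 0 z"
proof -
  have n: "(norm ((1 / sqrt M) *\<^sub>R z))\<^sup>2 = (norm z)\<^sup>2 / M" if "M > 0" for M
    using that by (simp add: power_divide)
  have "- M * ((norm z)\<^sup>2 / M) / 2 = - 1 * (norm z)\<^sup>2 / 2" if "M > 0" for M
    using that by (simp add: field_simps)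
  from this[of "real N + 1"] n[of "real N + 1"] show ?thesis by (simp add: gaussT_def)
qed

lemma gaussT_0: "gaussT 0 z = 2 * pi * gauss 0 z"
  by (simp add: gaussT_def gauss_def)

lemma integrable_gaussT_0: "integrable lborel (gaussT 0)" and LINT_gaussT_0: "(LINT z|lborel. gaussT 0 z) = (2 * pi)\<^sup>2"
proof -
  show "integrable lborel (gaussT 0)" unfolding gaussT_0[abs_def] by (intro integrable_mult_right integrable_gauss)
  have "complex_of_real (LINT z|lborel. gauss 0 z) = complex_of_real (2 * pi)"
    using gauss_fourier(2)[of 0 0] by simp
  hence "(LINT z|lborel. gauss 0 z) = 2 * pi" by (simp only: of_real_eq_iff)
  thus "(LINT z|lborel. gaussT 0 z) = (2 * pi)\<^sup>2"
    by (simp add: gaussT_0[abs_def] power2_eq_square)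
qed

lemma integrable_gaussT: "integrable lborel (\<lambda>x. gaussT N (x - t))"
  and LINT_gaussT: "(LINT x|lborel. gaussT N (x - t)) = (2 * pi)\<^sup>2"
proof -
  define c where "c = 1 / sqrt (real N + 1)"
  have c: "c \<noteq> 0" by (simp add: c_def)
  have e: "gaussT N (t + c *\<^sub>R x - t) = (real N + 1) * gaussT 0 x" for x
    using gaussT_scale[of N x] by (simp add: c_def)
  show "integrable lborel (\<lambda>x. gaussT N (x - t))"
    using plane_affine(1)[OF c, of "\<lambda>x. gaussT N (x - t)" t] unfolding e
    using integrable_gaussT_0 by simp
  show "(LINT x|lborel. gaussT N (x - t)) = (2 * pi)\<^sup>2"
    using plane_affine(2)[OF c, of "\<lambda>x. gaussT N (x - t)" t] unfolding e
    using LINT_gaussT_0 by (simp add: c_def power_divide)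
qed

text \<open>Damping by \<open>gauss N\<close> before transforming back amounts to a convolution with
  \<open>gaussT N\<close>: the transform of a modulated Gaussian is a translated
  \<open>gaussT N\<close>, and the multiplication formula does the rest. The transform of
  \<open>k\<close> itself need not be integrable.\<close>

lemma FT_gauss_FT:
  assumes k: "integrable lborel k" and s: "s\<^sup>2 = 1"
  shows "FT (-s) (\<lambda>x. complex_of_real (gauss N x) * FT s k x) \<xi> = (LINT \<zeta>|lborel. k \<zeta> * complex_of_real (gaussT N (\<zeta> - \<xi>)))"
proof -
  have ga: "FT s (\<lambda>x. complex_of_real (gauss N x) * cis ((-s) * (x \<bullet> \<xi>))) \<zeta> = complex_of_real (gaussT N (\<zeta> - \<xi>))" for \<zeta>
  proof -
    have "FT s (\<lambda>x. complex_of_real (gauss N x) * cis ((-s) * (x \<bullet> \<xi>))) \<zeta>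
       = (LINT x|lborel. complex_of_real (gauss N x) * cis (x \<bullet> (s *\<^sub>R (\<zeta> - \<xi>))))"
      unfolding FT_def
      by (intro Bochner_Integration.integral_cong) (auto simp: cis_mult inner_diff_right algebra_simps)
    also have "\<dots> = complex_of_real (gaussT N (\<zeta> - \<xi>))"
      unfolding gauss_fourier(2) using s by (simp add: gaussT_def power_mult_distrib)
    finally show ?thesis .
  qed
  have "FT (-s) (\<lambda>x. complex_of_real (gauss N x) * FT s k x) \<xi> =
     (LINT x|lborel. FT s k x * (complex_of_real (gauss N x) * cis ((-s) * (x \<bullet> \<xi>))))"
    unfolding FT_def[of "-s"] by (intro Bochner_Integration.integral_cong) (auto simp: mult_ac)
  also have "\<dots> = (LINT x|lborel. k x * FT s (\<lambda>x. complex_of_real (gauss N x) * cis ((-s) * (x \<bullet> \<xi>))) x)"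
    by (rule FT_multiplication_formula[OF k integrable_gauss_cis])
  finally show ?thesis unfolding ga .
qed

text \<open>The inequality exp (-y) \<le> 2 / y^2 beats the prefactor N + 1 by one power, which
  leaves a bound of order 1 / (N + 1) away from the origin.\<close>

lemma gaussT_tail:
  assumes "\<delta> > 0" "norm z \<ge> \<delta>"
  shows "gaussT N z \<le> (16 * pi / \<delta> ^ 4) * inverse (real (Suc N))"
proof -
  define y where "y = (real N + 1) * (norm z)\<^sup>2 / 2"
  have "norm z > 0" using assms by linarith
  hence y0: "y > 0" by (simp add: y_def)
  have "y\<^sup>2 / 2 \<le> exp y" using exp_lower_Taylor_quadratic[of y] y0 by simp
  hence "exp (- y) \<le> 2 / y\<^sup>2" using y0 by (simp add: exp_minus field_simps)
  hence "gaussT N z \<le> 2 * pi * (real N + 1) * (2 / y\<^sup>2)"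
    unfolding gaussT_def by (intro mult_left_mono) (auto simp: y_def algebra_simps add_divide_distrib diff_divide_distrib)
  also have "\<dots> = (16 * pi / norm z ^ 4) * inverse (real (Suc N))"
    by (simp add: y_def power2_eq_square power4_eq_xxxx divide_simps)
  also have "\<dots> \<le> (16 * pi / \<delta> ^ 4) * inverse (real (Suc N))"
    using assms by (intro mult_right_mono divide_left_mono power_mono mult_pos_pos zero_less_power) auto
  finally show ?thesis .
qed

text \<open>As \<open>k\<close> is merely integrable, it may be unbounded away from \<xi>. Hence the
  splitting: near \<xi> continuity bounds \<open>k\<close>, and dominated convergence applies after
  rescaling; away from \<xi> the kernel is uniformly small and \<open>k\<close> serves as
  majorant.\<close>

lemma gaussT_approximate_identity:
  fixes k :: "real^2 \<Rightarrow> complex"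
  assumes k: "integrable lborel k" and c: "isCont k \<xi>"
  shows "(\<lambda>N. LINT \<zeta>|lborel. k \<zeta> * complex_of_real (gaussT N (\<zeta> - \<xi>))) \<longlonglongrightarrow> (2 * pi)\<^sup>2 * k \<xi>"
proof -
  have [measurable]: "k \<in> borel_measurable borel" using k by auto
  obtain \<delta> where \<delta>: "\<delta> > 0" "\<And>\<zeta>. dist \<zeta> \<xi> < \<delta> \<Longrightarrow> dist (k \<zeta>) (k \<xi>) < 1"
    using c[unfolded continuous_at_eps_delta, rule_format, OF zero_less_one] by auto
  define k1 where "k1 = (\<lambda>\<zeta>. indicator (ball \<xi> \<delta>) \<zeta> * k \<zeta>)"
  define k2 where "k2 = (\<lambda>\<zeta>. indicator (- ball \<xi> \<delta>) \<zeta> * k \<zeta>)"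
  have [measurable]: "ball \<xi> \<delta> \<in> sets borel" "- ball \<xi> \<delta> \<in> sets borel" by auto
  have [measurable]: "k1 \<in> borel_measurable borel" "k2 \<in> borel_measurable borel"
    unfolding k1_def k2_def by measurable
  have k1b: "norm (k1 \<zeta>) \<le> norm (k \<xi>) + 1" for \<zeta>
  proof (cases "\<zeta> \<in> ball \<xi> \<delta>")
    case True
    hence "dist (k \<zeta>) (k \<xi>) < 1" by (intro \<delta>) (simp add: dist_commute)
    hence "norm (k \<zeta>) \<le> norm (k \<xi>) + 1" by norm
    thus ?thesis using True by (simp add: k1_def)
  qed (simp add: k1_def)
  have b2: "norm (k2 \<zeta> * complex_of_real (gaussT N (\<zeta> - \<xi>))) \<le> (norm (k \<zeta>) * (16 * pi / \<delta> ^ 4)) * inverse (real (Suc N))" for \<zeta> N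
  proof (cases "\<zeta> \<in> ball \<xi> \<delta>")
    case False
    hence "gaussT N (\<zeta> - \<xi>) \<le> (16 * pi / \<delta> ^ 4) * inverse (real (Suc N))"
      by (intro gaussT_tail \<delta>) (auto simp: dist_norm norm_minus_commute)
    hence "norm (k \<zeta>) * gaussT N (\<zeta> - \<xi>) \<le> norm (k \<zeta>) * ((16 * pi / \<delta> ^ 4) * inverse (real (Suc N)))"
      by (intro mult_left_mono) auto
    thus ?thesis using False gaussT_nonneg[of N "\<zeta> - \<xi>"] by (simp add: k2_def norm_mult mult_ac)
  next
    case True thus ?thesis using \<delta>(1) by (simp add: k2_def)
  qed
  have b2': "norm (k2 \<zeta> * complex_of_real (gaussT N (\<zeta> - \<xi>))) \<le> norm (k \<zeta>) * (16 * pi / \<delta> ^ 4)" for \<zeta> N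
  proof -
    have "(norm (k \<zeta>) * (16 * pi / \<delta> ^ 4)) * inverse (real (Suc N)) \<le> (norm (k \<zeta>) * (16 * pi / \<delta> ^ 4)) * 1"
      using \<delta>(1) by (intro mult_left_mono) (auto simp: inverse_eq_divide)
    thus ?thesis using b2[of \<zeta> N] by simp
  qed
  have lim2: "(\<lambda>N. LINT \<zeta>|lborel. k2 \<zeta> * complex_of_real (gaussT N (\<zeta> - \<xi>))) \<longlonglongrightarrow> (LINT \<zeta>::real^2|lborel. (0::complex))"
  proof (rule integral_dominated_convergence[where w = "\<lambda>\<zeta>. norm (k \<zeta>) * (16 * pi / \<delta> ^ 4)"])
    show "integrable lborel (\<lambda>\<zeta>. norm (k \<zeta>) * (16 * pi / \<delta> ^ 4))" using k by simp
    show "AE \<zeta> in lborel. (\<lambda>N. k2 \<zeta> * complex_of_real (gaussT N (\<zeta> - \<xi>))) \<longlonglongrightarrow> 0"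
    proof (rule AE_I2)
      fix \<zeta>
      have "(\<lambda>N. (norm (k \<zeta>) * (16 * pi / \<delta> ^ 4)) * inverse (real (Suc N))) \<longlonglongrightarrow> (norm (k \<zeta>) * (16 * pi / \<delta> ^ 4)) * 0"
        by (intro tendsto_intros LIMSEQ_inverse_real_of_nat)
      thus "(\<lambda>N. k2 \<zeta> * complex_of_real (gaussT N (\<zeta> - \<xi>))) \<longlonglongrightarrow> 0"
        by (intro Lim_null_comparison[OF always_eventually[OF allI[OF b2]]]) simp
    qed
  qed (use b2' in auto)
  \<comment> \<open>The substitution by \<xi> + c N z replaces the concentrating kernel by the fixed
    \<open>gaussT 0\<close> and moves the limit into the argument of \<open>k1\<close>.\<close>
  define c where "c N = 1 / sqrt (real N + 1)" for N
  have c0: "c N \<noteq> 0" for N by (simp add: c_def)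
  have cl: "c \<longlonglongrightarrow> 0"
  proof -
    have "(\<lambda>N. sqrt (inverse (real (Suc N)))) \<longlonglongrightarrow> sqrt 0"
      by (intro tendsto_intros LIMSEQ_inverse_real_of_nat)
    moreover have "sqrt (inverse (real (Suc N))) = c N" for N
      by (simp add: c_def real_sqrt_inverse inverse_eq_divide add.commute real_sqrt_divide)
    ultimately show ?thesis by simp
  qed
  have i1: "(LINT \<zeta>|lborel. k1 \<zeta> * complex_of_real (gaussT N (\<zeta> - \<xi>))) = (LINT z|lborel. k1 (\<xi> + c N *\<^sub>R z) * complex_of_real (gaussT 0 z))" for N
  proof -
    have e: "gaussT N (\<xi> + c N *\<^sub>R z - \<xi>) = (real N + 1) * gaussT 0 z" for z
      using gaussT_scale[of N z] by (simp add: c_def)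
    have "(LINT \<zeta>|lborel. k1 \<zeta> * complex_of_real (gaussT N (\<zeta> - \<xi>))) = (c N)\<^sup>2 *\<^sub>R (LINT z|lborel. k1 (\<xi> + c N *\<^sub>R z) * complex_of_real (gaussT N (\<xi> + c N *\<^sub>R z - \<xi>)))"
      by (rule plane_affine(2)[OF c0])
    also have "\<dots> = (LINT z|lborel. (c N)\<^sup>2 *\<^sub>R (k1 (\<xi> + c N *\<^sub>R z) * complex_of_real (gaussT N (\<xi> + c N *\<^sub>R z - \<xi>))))"
      by simp
    also have "\<dots> = (LINT z|lborel. k1 (\<xi> + c N *\<^sub>R z) * complex_of_real (gaussT 0 z))"
      unfolding e
    proof (intro Bochner_Integration.integral_cong refl)
      fix z
      have "(c N)\<^sup>2 * (real N + 1) = 1" by (simp add: c_def power_divide)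
      hence "complex_of_real ((c N)\<^sup>2 * (real N + 1)) = 1" by simp
      hence "complex_of_real ((c N)\<^sup>2) * complex_of_real (real N + 1) = 1" by (simp only: of_real_mult)
      moreover have "(c N)\<^sup>2 *\<^sub>R (k1 (\<xi> + c N *\<^sub>R z) * complex_of_real ((real N + 1) * gaussT 0 z))
        = (complex_of_real ((c N)\<^sup>2) * complex_of_real (real N + 1)) * (k1 (\<xi> + c N *\<^sub>R z) * complex_of_real (gaussT 0 z))"
        unfolding scaleR_conv_of_real of_real_mult by (simp only: mult_ac)
      ultimately show "(c N)\<^sup>2 *\<^sub>R (k1 (\<xi> + c N *\<^sub>R z) * complex_of_real ((real N + 1) * gaussT 0 z))
        = k1 (\<xi> + c N *\<^sub>R z) * complex_of_real (gaussT 0 z)" by simp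
    qed
    finally show ?thesis .
  qed
  have lim1: "(\<lambda>N. LINT z|lborel. k1 (\<xi> + c N *\<^sub>R z) * complex_of_real (gaussT 0 z)) \<longlonglongrightarrow> (LINT z|lborel. k \<xi> * complex_of_real (gaussT 0 z))"
  proof (rule integral_dominated_convergence[where w = "\<lambda>z. (norm (k \<xi>) + 1) * gaussT 0 z"])
    show "integrable lborel (\<lambda>z. (norm (k \<xi>) + 1) * gaussT 0 z)" using integrable_gaussT_0 by simp
    show "AE z in lborel. norm (k1 (\<xi> + c N *\<^sub>R z) * complex_of_real (gaussT 0 z)) \<le> (norm (k \<xi>) + 1) * gaussT 0 z" for N
      using k1b gaussT_nonneg[of 0] by (intro AE_I2) (auto simp: norm_mult intro!: mult_right_mono)
    show "AE z in lborel. (\<lambda>N. k1 (\<xi> + c N *\<^sub>R z) * complex_of_real (gaussT 0 z)) \<longlonglongrightarrow> k \<xi> * complex_of_real (gaussT 0 z)"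
    proof (intro AE_I2 tendsto_mult tendsto_const)
      fix z
      have l: "(\<lambda>N. \<xi> + c N *\<^sub>R z) \<longlonglongrightarrow> \<xi>"
        using tendsto_add[OF tendsto_const[of \<xi>] tendsto_scaleR[OF cl tendsto_const[of z]]] by simp
      hence "(\<lambda>N. k (\<xi> + c N *\<^sub>R z)) \<longlonglongrightarrow> k \<xi>" by (rule isCont_tendsto_compose[OF assms(2)])
      moreover have "eventually (\<lambda>N. \<xi> + c N *\<^sub>R z \<in> ball \<xi> \<delta>) sequentially"
        using topological_tendstoD[OF l open_ball, of \<xi> \<delta>] \<delta>(1) by simp
      hence "eventually (\<lambda>N. k (\<xi> + c N *\<^sub>R z) = k1 (\<xi> + c N *\<^sub>R z)) sequentially"
        by eventually_elim (simp add: k1_def)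
      ultimately show "(\<lambda>N. k1 (\<xi> + c N *\<^sub>R z)) \<longlonglongrightarrow> k \<xi>" by (rule Lim_transform_eventually)
    qed
  qed auto
  have I1: "integrable lborel (\<lambda>\<zeta>. k1 \<zeta> * complex_of_real (gaussT N (\<zeta> - \<xi>)))" for N
    by (rule Bochner_Integration.integrable_bound[of lborel "\<lambda>\<zeta>. (norm (k \<xi>) + 1) * gaussT N (\<zeta> - \<xi>)"])
       (use integrable_gaussT[of N \<xi>] k1b gaussT_nonneg[of N] in \<open>auto simp: norm_mult intro!: mult_mono\<close>)
  have I2: "integrable lborel (\<lambda>\<zeta>. k2 \<zeta> * complex_of_real (gaussT N (\<zeta> - \<xi>)))" for N
    by (rule Bochner_Integration.integrable_bound[of lborel "\<lambda>\<zeta>. norm (k \<zeta>) * (16 * pi / \<delta> ^ 4)"])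
       (use k b2' \<delta>(1) in \<open>auto intro!: AE_I2 order_trans[OF b2']\<close>)
  have "k \<zeta> = k1 \<zeta> + k2 \<zeta>" for \<zeta> by (auto simp: k1_def k2_def indicator_def)
  hence "(LINT \<zeta>|lborel. k \<zeta> * complex_of_real (gaussT N (\<zeta> - \<xi>))) =
     (LINT \<zeta>|lborel. k1 \<zeta> * complex_of_real (gaussT N (\<zeta> - \<xi>))) + (LINT \<zeta>|lborel. k2 \<zeta> * complex_of_real (gaussT N (\<zeta> - \<xi>)))" for N
    by (simp add: distrib_right Bochner_Integration.integral_add I1 I2)
  hence "(\<lambda>N. LINT \<zeta>|lborel. k \<zeta> * complex_of_real (gaussT N (\<zeta> - \<xi>))) \<longlonglongrightarrow>
     (LINT z|lborel. k \<xi> * complex_of_real (gaussT 0 z)) + (LINT \<zeta>::real^2|lborel. (0::complex))"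
    using tendsto_add[OF lim1[folded i1] lim2] by simp
  moreover have "(LINT z|lborel. k \<xi> * complex_of_real (gaussT 0 z)) + (LINT \<zeta>::real^2|lborel. (0::complex)) = (2 * pi)\<^sup>2 * k \<xi>"
    using LINT_gaussT_0 by simp
  ultimately show ?thesis by (simp only:)
qed

text \<open>The damped integrals have two limits: the undamped inverse transform, by dominated
  convergence with the integrable transform as majorant, and a multiple of the value of
  \<open>k\<close>, by the approximate identity.\<close>

lemma FT_inversion:
  fixes k :: "real^2 \<Rightarrow> complex" and s :: real
  assumes k: "integrable lborel k" and w: "integrable lborel (FT s k)" and c: "isCont k \<xi>" and s: "s\<^sup>2 = 1"
  shows "FT (-s) (FT s k) \<xi> = (2 * pi)\<^sup>2 * k \<xi>"
proof (rule LIMSEQ_unique)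
  have [measurable]: "FT s k \<in> borel_measurable borel" using w by auto
  show "(\<lambda>N. FT (-s) (\<lambda>x. complex_of_real (gauss N x) * FT s k x) \<xi>) \<longlonglongrightarrow> (2 * pi)\<^sup>2 * k \<xi>"
    unfolding FT_gauss_FT[OF k s] by (rule gaussT_approximate_identity[OF k c])
  show "(\<lambda>N. FT (-s) (\<lambda>x. complex_of_real (gauss N x) * FT s k x) \<xi>) \<longlonglongrightarrow> FT (-s) (FT s k) \<xi>"
    unfolding FT_def[of "-s"]
  proof (rule integral_dominated_convergence[where w = "\<lambda>x. norm (FT s k x)"])
    show "AE x in lborel. (\<lambda>N. cis (- s * (x \<bullet> \<xi>)) * (complex_of_real (gauss N x) * FT s k x)) \<longlonglongrightarrow> cis (- s * (x \<bullet> \<xi>)) * FT s k x"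
    proof (rule AE_I2)
      fix x
      have "(\<lambda>N. cis (- s * (x \<bullet> \<xi>)) * (complex_of_real (gauss N x) * FT s k x)) \<longlonglongrightarrow> cis (- s * (x \<bullet> \<xi>)) * (complex_of_real 1 * FT s k x)"
        by (intro tendsto_intros gauss_tendsto_1)
      thus "(\<lambda>N. cis (- s * (x \<bullet> \<xi>)) * (complex_of_real (gauss N x) * FT s k x)) \<longlonglongrightarrow> cis (- s * (x \<bullet> \<xi>)) * FT s k x" by simp
    qed
    show "AE x in lborel. norm (cis (- s * (x \<bullet> \<xi>)) * (complex_of_real (gauss N x) * FT s k x)) \<le> norm (FT s k x)" for N
      using gauss_le_1[of N] less_imp_le[OF gauss_pos[of N]] by (intro AE_I2) (auto simp: norm_mult intro!: mult_left_le_one_le)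
  qed (use w in auto)
qed

text \<open>The half of Plancherel's theorem that the interpolation uses. The L^2 norm of
  \<open>f\<close> may be infinite, so the integrals take values in [0, \<infinity>]; a Gaussian
  weight makes the left-hand side finite before the limit.\<close>

lemma FT_L2:
  assumes f: "integrable lborel f" and s: "s\<^sup>2 = 1"
  shows "(\<integral>\<^sup>+\<xi>. ennreal ((norm (FT s f \<xi>))\<^sup>2) \<partial>lborel) \<le> ennreal ((2 * pi)\<^sup>2) * (\<integral>\<^sup>+x. ennreal ((norm (f x))\<^sup>2) \<partial>lborel)"
proof -
  have [measurable]: "f \<in> borel_measurable borel" using f by auto
  note [measurable] = measurable_FT[OF f]
  define B where "B = (LINT x|lborel. norm (f x))"
  have B: "norm (FT s f \<xi>) \<le> B" for \<xi> unfolding B_def by (rule norm_FT_le_LINT[OF f])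
  have cf: "integrable lborel (\<lambda>x. cnj (f x))" using f by simp
  let ?R = "ennreal ((2 * pi)\<^sup>2) * (\<integral>\<^sup>+x. ennreal ((norm (f x))\<^sup>2) \<partial>lborel)"
  have step: "(\<integral>\<^sup>+\<xi>. ennreal (gauss N \<xi> * (norm (FT s f \<xi>))\<^sup>2) \<partial>lborel) \<le> ?R" for N
  proof -
    let ?g = "\<lambda>\<xi>. complex_of_real (gauss N \<xi>) * FT (-s) (\<lambda>x. cnj (f x)) \<xi>"
    have gi: "integrable lborel ?g"
    proof (rule Bochner_Integration.integrable_bound[of lborel "\<lambda>\<xi>. B * gauss N \<xi>"])
      show "integrable lborel (\<lambda>\<xi>. B * gauss N \<xi>)" using integrable_gauss by simp
      show "?g \<in> borel_measurable lborel" using measurable_FT[OF cf, of "-s"] by simp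
      show "AE \<xi> in lborel. norm (?g \<xi>) \<le> norm (B * gauss N \<xi>)"
      proof (rule AE_I2)
        fix \<xi>
        have "norm (FT (-s) (\<lambda>x. cnj (f x)) \<xi>) \<le> B" using B[of \<xi>] by (simp flip: cnj_FT)
        hence "gauss N \<xi> * norm (FT (-s) (\<lambda>x. cnj (f x)) \<xi>) \<le> gauss N \<xi> * B"
          using gauss_pos[of N \<xi>] by (intro mult_left_mono) auto
        thus "norm (?g \<xi>) \<le> norm (B * gauss N \<xi>)" using gauss_pos[of N \<xi>]
          by (simp add: norm_mult abs_mult mult.commute)
      qed
    qed
    have ii: "integrable lborel (\<lambda>\<xi>. gauss N \<xi> * (norm (FT s f \<xi>))\<^sup>2)"
    proof (rule Bochner_Integration.integrable_bound[of lborel "\<lambda>\<xi>. B\<^sup>2 * gauss N \<xi>"])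
      show "integrable lborel (\<lambda>\<xi>. B\<^sup>2 * gauss N \<xi>)" using integrable_gauss by simp
      show "AE \<xi> in lborel. norm (gauss N \<xi> * (norm (FT s f \<xi>))\<^sup>2) \<le> norm (B\<^sup>2 * gauss N \<xi>)"
        using B gauss_pos[of N] by (intro AE_I2) (auto simp: abs_mult mult.commute intro!: mult_left_mono power_mono)
    qed measurable
    have inner: "norm (LINT \<zeta>|lborel. cnj (f \<zeta>) * complex_of_real (gaussT N (\<zeta> - x)))
       \<le> (\<integral>\<^sup>+\<zeta>. ennreal (norm (f \<zeta>) * gaussT N (\<zeta> - x)) \<partial>lborel)" for x
      by (rule order_trans[OF norm_LINT_le_nn]) (simp add: norm_mult gaussT_nonneg)
    have nnT: "(\<integral>\<^sup>+\<zeta>. ennreal (gaussT N (\<zeta> - x)) \<partial>lborel) = ennreal ((2 * pi)\<^sup>2)" for x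
      using integrable_gaussT[of N x] LINT_gaussT[of N x] by (simp add: nn_integral_eq_integral gaussT_nonneg)
    have sym: "gaussT N (\<zeta> - x) = gaussT N (x - \<zeta>)" for \<zeta> x by (simp add: gaussT_def norm_minus_commute)
    have "complex_of_real (LINT \<xi>|lborel. gauss N \<xi> * (norm (FT s f \<xi>))\<^sup>2) = (LINT \<xi>|lborel. FT s f \<xi> * ?g \<xi>)"
      unfolding integral_complex_of_real[symmetric] cnj_FT[symmetric]
      by (intro Bochner_Integration.integral_cong) (auto simp: mult_ac complex_norm_square simp del: of_real_power)
    also have "\<dots> = (LINT x|lborel. f x * FT s ?g x)"
      by (rule FT_multiplication_formula[OF f gi])
    also have "\<dots> = (LINT x|lborel. f x * (LINT \<zeta>|lborel. cnj (f \<zeta>) * complex_of_real (gaussT N (\<zeta> - x))))"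
      using FT_gauss_FT[OF cf, of "-s" N] s by simp
    finally have eqn: "complex_of_real (LINT \<xi>|lborel. gauss N \<xi> * (norm (FT s f \<xi>))\<^sup>2)
      = (LINT x|lborel. f x * (LINT \<zeta>|lborel. cnj (f \<zeta>) * complex_of_real (gaussT N (\<zeta> - x))))" .
    have "ennreal (norm (complex_of_real (LINT \<xi>|lborel. gauss N \<xi> * (norm (FT s f \<xi>))\<^sup>2)))
       \<le> (\<integral>\<^sup>+x. ennreal (norm (f x * (LINT \<zeta>|lborel. cnj (f \<zeta>) * complex_of_real (gaussT N (\<zeta> - x))))) \<partial>lborel)"
      unfolding eqn by (rule norm_LINT_le_nn)
    also have "\<dots> \<le> (\<integral>\<^sup>+x. ennreal (norm (f x)) * (\<integral>\<^sup>+\<zeta>. ennreal (norm (f \<zeta>) * gaussT N (\<zeta> - x)) \<partial>lborel) \<partial>lborel)"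
      by (intro nn_integral_mono) (auto simp: norm_mult ennreal_mult intro!: mult_left_mono inner)
    also have "\<dots> = (\<integral>\<^sup>+x. \<integral>\<^sup>+\<zeta>. ennreal (norm (f x)) * ennreal (norm (f \<zeta>) * gaussT N (\<zeta> - x)) \<partial>lborel \<partial>lborel)"
      by (subst nn_integral_cmult) auto
    \<comment> \<open>Schur's test: the product is split by the inequality of the arithmetic and
      geometric means, and in each of the two terms the kernel can be integrated in the variable
      that \<open>f\<close> does not contain, with mass (2 pi)^2.\<close>
    also have "\<dots> \<le> (\<integral>\<^sup>+x. \<integral>\<^sup>+\<zeta>. ennreal ((norm (f x))\<^sup>2 / 2) * ennreal (gaussT N (\<zeta> - x)) + ennreal ((norm (f \<zeta>))\<^sup>2 / 2) * ennreal (gaussT N (\<zeta> - x)) \<partial>lborel \<partial>lborel)"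
    proof (intro nn_integral_mono)
      fix x \<zeta> :: "real^2"
      have "norm (f x) * norm (f \<zeta>) \<le> (norm (f x))\<^sup>2 / 2 + (norm (f \<zeta>))\<^sup>2 / 2"
        using sum_squares_bound[of "norm (f x)" "norm (f \<zeta>)"] by simp
      hence "norm (f x) * norm (f \<zeta>) * gaussT N (\<zeta> - x) \<le> ((norm (f x))\<^sup>2 / 2 + (norm (f \<zeta>))\<^sup>2 / 2) * gaussT N (\<zeta> - x)"
        using gaussT_nonneg by (rule mult_right_mono)
      thus "ennreal (norm (f x)) * ennreal (norm (f \<zeta>) * gaussT N (\<zeta> - x)) \<le> ennreal ((norm (f x))\<^sup>2 / 2) * ennreal (gaussT N (\<zeta> - x)) + ennreal ((norm (f \<zeta>))\<^sup>2 / 2) * ennreal (gaussT N (\<zeta> - x))"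
      proof -
        have "ennreal ((a + b) * g) = ennreal a * ennreal g + ennreal b * ennreal g" if "a \<ge> 0" "b \<ge> 0" "g \<ge> 0" for a b g
          using that by (simp add: ennreal_mult distrib_right)
        moreover have "ennreal a * ennreal (b * g) = ennreal (a * b * g)" if "a \<ge> 0" "b \<ge> 0" "g \<ge> 0" for a b g
          using that by (simp add: ennreal_mult mult.assoc)
        ultimately show ?thesis
          using ennreal_leI[OF \<open>norm (f x) * norm (f \<zeta>) * gaussT N (\<zeta> - x) \<le> _\<close>] gaussT_nonneg[of N "\<zeta> - x"] by simp
      qed
    qed
    also have "\<dots> = (\<integral>\<^sup>+x. \<integral>\<^sup>+\<zeta>. ennreal ((norm (f x))\<^sup>2 / 2) * ennreal (gaussT N (\<zeta> - x)) \<partial>lborel \<partial>lborel) + (\<integral>\<^sup>+x. \<integral>\<^sup>+\<zeta>. ennreal ((norm (f \<zeta>))\<^sup>2 / 2) * ennreal (gaussT N (\<zeta> - x)) \<partial>lborel \<partial>lborel)"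
      (is "_ = ?X + ?Y")
    proof -
      have "(\<integral>\<^sup>+x. \<integral>\<^sup>+\<zeta>. ennreal ((norm (f x))\<^sup>2 / 2) * ennreal (gaussT N (\<zeta> - x)) + ennreal ((norm (f \<zeta>))\<^sup>2 / 2) * ennreal (gaussT N (\<zeta> - x)) \<partial>lborel \<partial>lborel)
        = (\<integral>\<^sup>+x. (\<integral>\<^sup>+\<zeta>. ennreal ((norm (f x))\<^sup>2 / 2) * ennreal (gaussT N (\<zeta> - x)) \<partial>lborel) + (\<integral>\<^sup>+\<zeta>. ennreal ((norm (f \<zeta>))\<^sup>2 / 2) * ennreal (gaussT N (\<zeta> - x)) \<partial>lborel) \<partial>lborel)"
        by (intro nn_integral_cong nn_integral_add) measurable
      also have "\<dots> = ?X + ?Y" by (rule nn_integral_add) measurable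
      finally show ?thesis .
    qed
    also have "(\<integral>\<^sup>+x. \<integral>\<^sup>+\<zeta>. ennreal ((norm (f x))\<^sup>2 / 2) * ennreal (gaussT N (\<zeta> - x)) \<partial>lborel \<partial>lborel) = (\<integral>\<^sup>+x. ennreal ((norm (f x))\<^sup>2 / 2) * ennreal ((2 * pi)\<^sup>2) \<partial>lborel)"
    proof (rule nn_integral_cong)
      fix x
      have "(\<integral>\<^sup>+\<zeta>. ennreal ((norm (f x))\<^sup>2 / 2) * ennreal (gaussT N (\<zeta> - x)) \<partial>lborel) = ennreal ((norm (f x))\<^sup>2 / 2) * (\<integral>\<^sup>+\<zeta>. ennreal (gaussT N (\<zeta> - x)) \<partial>lborel)"
        by (rule nn_integral_cmult) measurable
      thus "(\<integral>\<^sup>+\<zeta>. ennreal ((norm (f x))\<^sup>2 / 2) * ennreal (gaussT N (\<zeta> - x)) \<partial>lborel) = ennreal ((norm (f x))\<^sup>2 / 2) * ennreal ((2 * pi)\<^sup>2)"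
        unfolding nnT .
    qed
    also have "(\<integral>\<^sup>+x. \<integral>\<^sup>+\<zeta>. ennreal ((norm (f \<zeta>))\<^sup>2 / 2) * ennreal (gaussT N (\<zeta> - x)) \<partial>lborel \<partial>lborel) = (\<integral>\<^sup>+\<zeta>. \<integral>\<^sup>+x. ennreal ((norm (f \<zeta>))\<^sup>2 / 2) * ennreal (gaussT N (\<zeta> - x)) \<partial>lborel \<partial>lborel)"
      by (rule lborel_pair.Fubini') measurable
    also have "\<dots> = (\<integral>\<^sup>+x. ennreal ((norm (f x))\<^sup>2 / 2) * ennreal ((2 * pi)\<^sup>2) \<partial>lborel)"
    proof (rule nn_integral_cong)
      fix \<zeta>
      have "(\<integral>\<^sup>+x. ennreal ((norm (f \<zeta>))\<^sup>2 / 2) * ennreal (gaussT N (\<zeta> - x)) \<partial>lborel) = ennreal ((norm (f \<zeta>))\<^sup>2 / 2) * (\<integral>\<^sup>+x. ennreal (gaussT N (\<zeta> - x)) \<partial>lborel)"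
        by (rule nn_integral_cmult) measurable
      also have "(\<integral>\<^sup>+x. ennreal (gaussT N (\<zeta> - x)) \<partial>lborel) = ennreal ((2 * pi)\<^sup>2)"
        using nnT[of \<zeta>] by (simp add: sym[of \<zeta>])
      finally show "(\<integral>\<^sup>+x. ennreal ((norm (f \<zeta>))\<^sup>2 / 2) * ennreal (gaussT N (\<zeta> - x)) \<partial>lborel) = ennreal ((norm (f \<zeta>))\<^sup>2 / 2) * ennreal ((2 * pi)\<^sup>2)" .
    qed
    also have "(\<integral>\<^sup>+x. ennreal ((norm (f x))\<^sup>2 / 2) * ennreal ((2 * pi)\<^sup>2) \<partial>lborel) + (\<integral>\<^sup>+x. ennreal ((norm (f x))\<^sup>2 / 2) * ennreal ((2 * pi)\<^sup>2) \<partial>lborel)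
       = (\<integral>\<^sup>+x. ennreal ((norm (f x))\<^sup>2) * ennreal ((2 * pi)\<^sup>2) \<partial>lborel)"
    proof -
      have "ennreal (y / 2) + ennreal (y / 2) = ennreal y" if "y \<ge> 0" for y
        using that by (simp flip: ennreal_plus)
      hence h: "ennreal ((norm (f x))\<^sup>2 / 2) * ennreal ((2 * pi)\<^sup>2) + ennreal ((norm (f x))\<^sup>2 / 2) * ennreal ((2 * pi)\<^sup>2) = ennreal ((norm (f x))\<^sup>2) * ennreal ((2 * pi)\<^sup>2)" for x
        by (simp only: distrib_right[symmetric] zero_le_power2)
      show ?thesis unfolding h[symmetric] by (rule nn_integral_add[symmetric]) measurable
    qed
    also have "\<dots> = ?R" by (subst nn_integral_multc) (auto simp: mult.commute)
    finally have "ennreal (norm (complex_of_real (LINT \<xi>|lborel. gauss N \<xi> * (norm (FT s f \<xi>))\<^sup>2))) \<le> ?R" .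
    moreover have "(\<integral>\<^sup>+\<xi>. ennreal (gauss N \<xi> * (norm (FT s f \<xi>))\<^sup>2) \<partial>lborel) = ennreal (LINT \<xi>|lborel. gauss N \<xi> * (norm (FT s f \<xi>))\<^sup>2)"
      by (intro nn_integral_eq_integral ii) (auto intro!: AE_I2 mult_nonneg_nonneg less_imp_le[OF gauss_pos])
    moreover have "ennreal (LINT \<xi>|lborel. gauss N \<xi> * (norm (FT s f \<xi>))\<^sup>2) \<le> ennreal (norm (complex_of_real (LINT \<xi>|lborel. gauss N \<xi> * (norm (FT s f \<xi>))\<^sup>2)))"
      by (intro ennreal_leI) simp
    ultimately show ?thesis by (simp only:)
  qed
  \<comment> \<open>Removal of the weight: it tends to 1, and the bound \<open>step\<close> does not
    depend on \<open>N\<close>, so Fatou's lemma is enough.\<close>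
  have "(\<lambda>N. ennreal (gauss N \<xi> * (norm (FT s f \<xi>))\<^sup>2)) \<longlonglongrightarrow> ennreal (1 * (norm (FT s f \<xi>))\<^sup>2)" for \<xi>
    by (intro tendsto_ennrealI tendsto_intros gauss_tendsto_1)
  hence "liminf (\<lambda>N. ennreal (gauss N \<xi> * (norm (FT s f \<xi>))\<^sup>2)) = ennreal ((norm (FT s f \<xi>))\<^sup>2)" for \<xi>
    by (simp add: lim_imp_Liminf)
  hence "(\<integral>\<^sup>+\<xi>. ennreal ((norm (FT s f \<xi>))\<^sup>2) \<partial>lborel) = (\<integral>\<^sup>+\<xi>. liminf (\<lambda>N. ennreal (gauss N \<xi> * (norm (FT s f \<xi>))\<^sup>2)) \<partial>lborel)"
    by simp
  also have "\<dots> \<le> liminf (\<lambda>N. \<integral>\<^sup>+\<xi>. ennreal (gauss N \<xi> * (norm (FT s f \<xi>))\<^sup>2) \<partial>lborel)"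
    by (rule nn_integral_liminf) measurable
  also have "\<dots> \<le> liminf (\<lambda>N. ?R)"
    by (intro Liminf_mono always_eventually allI step)
  also have "\<dots> = ?R" by (simp add: Liminf_const)
  finally show ?thesis .
qed

section \<open>The Hausdorff-Young inequality\<close>

text \<open>The layer-cake formula. It is applied with \<open>a = q\<close> to the size of the
  transform, and with \<open>a = q - 2\<close> to the levels at which a given value of
  \<open>f\<close> counts as small.\<close>

lemma nn_integral_powr_Icc:
  fixes a y :: real
  assumes "a > 0" "y \<ge> 0"
  shows "(\<integral>\<^sup>+l. indicator {0..y} l * ennreal (l powr (a - 1)) \<partial>lborel) = ennreal (y powr a / a)"
proof -
  have "((\<lambda>x. x powr (a - 1)) has_integral (y powr (a - 1 + 1) / (a - 1 + 1))) {0..y}"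
    by (rule has_integral_powr_from_0) (use assms in auto)
  hence "(\<integral>\<^sup>+l. ennreal (indicator {0..y} l * l powr (a - 1)) \<partial>lborel) = ennreal (y powr (a - 1 + 1) / (a - 1 + 1))"
    by (intro nn_integral_has_integral_lebesgue) auto
  thus ?thesis by (simp add: ennreal_mult' ennreal_indicator)
qed

text \<open>Marcinkiewicz interpolation: at level \<open>l\<close> the transform of the large part of \<open>f\<close> is at most
  \<open>l / 2\<close> by the \<open>L\<^sup>1\<close> bound, so that only the \<open>L\<^sup>2\<close> norm of the small part matters.\<close>

lemma hausdorff_young_normalized:
  fixes p q :: real
  assumes p: "1 < p" "p < 2" and q: "q = p / (p - 1)" and f: "integrable lborel f" and s: "s\<^sup>2 = 1"
    and le1: "(\<integral>\<^sup>+x. ennreal (norm (f x) powr p) \<partial>lborel) \<le> 1"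
  shows "(\<integral>\<^sup>+\<xi>. ennreal (norm (FT s f \<xi>) powr q) \<partial>lborel) \<le> ennreal (q * (16 * pi\<^sup>2) * 2 powr (q - 2) / (q - 2))"
proof -
  have [measurable]: "f \<in> borel_measurable borel" using f by auto
  note [measurable] = measurable_FT[OF f]
  have q2: "q > 2" using p by (simp add: q field_simps)
  \<comment> \<open>The truncation height at level \<open>l\<close>, chosen such that its power with
    exponent 1 - p is l / 2. As the integral of |f|^p is at most 1, the part of \<open>f\<close>
    above this height has L^1 norm at most l / 2.\<close>
  define \<sigma> where "\<sigma> l = (l / 2) powr (- 1 / (p - 1))" for l :: real
  have [measurable]: "\<sigma> \<in> borel_measurable borel" unfolding \<sigma>_def by measurable
  let ?K = "ennreal (16 * pi\<^sup>2)"
  have level: "(\<integral>\<^sup>+\<xi>. indicator {0..norm (FT s f \<xi>)} l * ennreal (l powr (q - 1)) \<partial>lborel)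
      \<le> (\<integral>\<^sup>+x. (if 0 < l \<and> norm (f x) \<le> \<sigma> l then ?K * ennreal ((norm (f x))\<^sup>2) * ennreal (l powr (q - 3)) else 0) \<partial>lborel)" for l
  proof (cases "l > 0")
    case False
    hence z: "indicator {0..norm (FT s f \<xi>)} l * ennreal (l powr (q - 1)) = 0" for \<xi>
      by (cases "l = 0") (auto simp: indicator_def)
    show ?thesis unfolding z by simp
  next
    case l: True
    define f1 where "f1 x = (if norm (f x) > \<sigma> l then f x else 0)" for x
    define f2 where "f2 x = (if norm (f x) > \<sigma> l then 0 else f x)" for x
    have [measurable]: "f1 \<in> borel_measurable borel" "f2 \<in> borel_measurable borel"
      unfolding f1_def f2_def by measurable
    have i1: "integrable lborel f1" and i2: "integrable lborel f2"
      by (rule Bochner_Integration.integrable_bound[OF f]; auto simp: f1_def f2_def)+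
    have \<sigma>0: "\<sigma> l > 0" using l by (simp add: \<sigma>_def)
    have \<sigma>p: "\<sigma> l powr (1 - p) = l / 2"
    proof -
      have "- 1 / (p - 1) * (1 - p) = 1" using p by (simp add: field_simps)
      thus ?thesis using l by (simp add: \<sigma>_def powr_powr)
    qed
    have "ennreal (norm (f1 x)) \<le> ennreal (l / 2) * ennreal (norm (f x) powr p)" for x
    proof (cases "norm (f x) > \<sigma> l")
      case True
      hence "norm (f x) powr (1 - p) \<le> \<sigma> l powr (1 - p)"
        using \<sigma>0 p by (intro powr_mono2') auto
      hence "norm (f x) powr (1 - p) * norm (f x) powr p \<le> (l / 2) * norm (f x) powr p"
        unfolding \<sigma>p by (rule mult_right_mono) simp
      moreover have "norm (f x) powr (1 - p) * norm (f x) powr p = norm (f x)"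
        using True \<sigma>0 by (simp flip: powr_add)
      ultimately show ?thesis using True l by (simp add: f1_def flip: ennreal_mult')
    qed (simp add: f1_def)
    hence "(\<integral>\<^sup>+x. ennreal (norm (f1 x)) \<partial>lborel) \<le> (\<integral>\<^sup>+x. ennreal (l / 2) * ennreal (norm (f x) powr p) \<partial>lborel)"
      by (rule nn_integral_mono)
    also have "\<dots> = ennreal (l / 2) * (\<integral>\<^sup>+x. ennreal (norm (f x) powr p) \<partial>lborel)"
      by (rule nn_integral_cmult) measurable
    also have "\<dots> \<le> ennreal (l / 2) * 1" by (intro mult_left_mono le1) simp
    finally have "(\<integral>\<^sup>+x. ennreal (norm (f1 x)) \<partial>lborel) \<le> ennreal (l / 2)" by simp
    hence "ennreal (norm (FT s f1 \<xi>)) \<le> ennreal (l / 2)" for \<xi>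
      using norm_FT_le[of s f1 \<xi>] by (rule order_trans[rotated])
    hence F1: "norm (FT s f1 \<xi>) \<le> l / 2" for \<xi> using l by simp
    note [measurable] = measurable_FT[OF i2]
    have "(\<lambda>x. f1 x + f2 x) = f" by (auto simp: f1_def f2_def)
    hence Fs: "FT s f \<xi> = FT s f1 \<xi> + FT s f2 \<xi>" for \<xi> using FT_add[OF i1 i2, of s \<xi>] by simp
    \<comment> \<open>Where the transform of \<open>f\<close> is at least \<open>l\<close>, that of
      the small part is at least l / 2. Chebyshev's inequality with squares gives the factor 4 and
      lowers the exponent from q - 1 to q - 3.\<close>
    have pt: "indicator {0..norm (FT s f \<xi>)} l * ennreal (l powr (q - 1)) \<le> ennreal (4 * l powr (q - 3)) * ennreal ((norm (FT s f2 \<xi>))\<^sup>2)" for \<xi>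
    proof (cases "l \<le> norm (FT s f \<xi>)")
      case True
      hence "l / 2 \<le> norm (FT s f2 \<xi>)" using F1[of \<xi>] norm_triangle_ineq[of "FT s f1 \<xi>" "FT s f2 \<xi>"] Fs[of \<xi>] by simp
      hence "(l / 2)\<^sup>2 \<le> (norm (FT s f2 \<xi>))\<^sup>2" using l by (intro power_mono) auto
      hence "4 * l powr (q - 3) * (l / 2)\<^sup>2 \<le> 4 * l powr (q - 3) * (norm (FT s f2 \<xi>))\<^sup>2"
        by (intro mult_left_mono) auto
      moreover have "4 * l powr (q - 3) * (l / 2)\<^sup>2 = l powr (q - 1)"
      proof -
        have "4 * l powr (q - 3) * (l / 2)\<^sup>2 = l powr (q - 3) * l powr 2"
          using l by (simp add: power_divide)
        also have "\<dots> = l powr (q - 1)" by (simp flip: powr_add)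
        finally show ?thesis .
      qed
      ultimately show ?thesis using True l by (simp add: ennreal_leI flip: ennreal_mult')
    qed simp
    have "(\<integral>\<^sup>+\<xi>. indicator {0..norm (FT s f \<xi>)} l * ennreal (l powr (q - 1)) \<partial>lborel)
      \<le> (\<integral>\<^sup>+\<xi>. ennreal (4 * l powr (q - 3)) * ennreal ((norm (FT s f2 \<xi>))\<^sup>2) \<partial>lborel)"
      by (intro nn_integral_mono pt)
    also have "\<dots> = ennreal (4 * l powr (q - 3)) * (\<integral>\<^sup>+\<xi>. ennreal ((norm (FT s f2 \<xi>))\<^sup>2) \<partial>lborel)"
      by (rule nn_integral_cmult) measurable
    also have "\<dots> \<le> ennreal (4 * l powr (q - 3)) * (ennreal ((2 * pi)\<^sup>2) * (\<integral>\<^sup>+x. ennreal ((norm (f2 x))\<^sup>2) \<partial>lborel))"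
      by (intro mult_left_mono FT_L2 i2 s) simp
    also have "\<dots> = (?K * ennreal (l powr (q - 3))) * (\<integral>\<^sup>+x. ennreal ((norm (f2 x))\<^sup>2) \<partial>lborel)"
    proof -
      have "ennreal (4 * l powr (q - 3)) * ennreal ((2 * pi)\<^sup>2) = ?K * ennreal (l powr (q - 3))"
        by (simp add: power_mult_distrib mult_ac flip: ennreal_mult')
      thus ?thesis by (simp only: mult.assoc[symmetric])
    qed
    also have "\<dots> = (\<integral>\<^sup>+x. (?K * ennreal (l powr (q - 3))) * ennreal ((norm (f2 x))\<^sup>2) \<partial>lborel)"
      by (rule nn_integral_cmult[symmetric]) measurable
    also have "\<dots> = (\<integral>\<^sup>+x. (if 0 < l \<and> norm (f x) \<le> \<sigma> l then ?K * ennreal ((norm (f x))\<^sup>2) * ennreal (l powr (q - 3)) else 0) \<partial>lborel)"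
      using l by (intro nn_integral_cong) (auto simp: f2_def mult_ac)
    finally show ?thesis .
  qed
  \<comment> \<open>For fixed \<open>x\<close>, the value \<open>f x\<close> belongs to the small
    part only for levels l \<le> 2 |f x|^(1-p). Integrating l^(q-3), which is possible at 0 because
    q > 2, yields the exponent (1 - p)(q - 2) = p - 2; with the square this makes |f x|^p.\<close>
  have column: "(\<integral>\<^sup>+l. (if 0 < l \<and> norm (f x) \<le> \<sigma> l then ?K * ennreal ((norm (f x))\<^sup>2) * ennreal (l powr (q - 3)) else 0) \<partial>lborel)
     \<le> ennreal ((16 * pi\<^sup>2) * 2 powr (q - 2) / (q - 2)) * ennreal (norm (f x) powr p)" for x
  proof (cases "f x = 0")
    case False
    define y where "y = norm (f x)"
    have y: "y > 0" using False by (simp add: y_def)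
    define L where "L = 2 * y powr (1 - p)"
    have L: "L \<ge> 0" by (simp add: L_def)
    have imp: "l \<le> L" if "0 < l" "y \<le> \<sigma> l" for l
    proof -
      have "\<sigma> l powr (1 - p) \<le> y powr (1 - p)" using y p that by (intro powr_mono2') auto
      moreover have "\<sigma> l powr (1 - p) = l / 2"
      proof -
        have "- 1 / (p - 1) * (1 - p) = 1" using p by (simp add: field_simps)
        thus ?thesis using that by (simp add: \<sigma>_def powr_powr)
      qed
      ultimately show ?thesis by (simp add: L_def)
    qed
    have "(\<integral>\<^sup>+l. (if 0 < l \<and> y \<le> \<sigma> l then ?K * ennreal (y\<^sup>2) * ennreal (l powr (q - 3)) else 0) \<partial>lborel)
      \<le> (\<integral>\<^sup>+l. (?K * ennreal (y\<^sup>2)) * (indicator {0..L} l * ennreal (l powr (q - 2 - 1))) \<partial>lborel)"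
      using imp by (intro nn_integral_mono) (auto simp: indicator_def)
    also have "\<dots> = (?K * ennreal (y\<^sup>2)) * ennreal (L powr (q - 2) / (q - 2))"
      using q2 L by (subst nn_integral_cmult, measurable) (subst nn_integral_powr_Icc; simp)
    also have "\<dots> = ennreal ((16 * pi\<^sup>2) * y\<^sup>2 * (L powr (q - 2) / (q - 2)))"
    proof -
      have "ennreal a * ennreal b * ennreal c = ennreal (a * b * c)" if "a \<ge> 0" "b \<ge> 0" "c \<ge> 0" for a b c
        using that by (simp add: ennreal_mult)
      thus ?thesis using q2 by simp
    qed
    also have "(16 * pi\<^sup>2) * y\<^sup>2 * (L powr (q - 2) / (q - 2)) = ((16 * pi\<^sup>2) * 2 powr (q - 2) / (q - 2)) * y powr p"
    proof -
      have e: "(1 - p) * (q - 2) = p - 2"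
      proof -
        have "q * (p - 1) = p" using p by (simp add: q)
        moreover have "(1 - p) * (q - 2) = - (q * (p - 1)) + 2 * p - 2" by (simp add: algebra_simps)
        ultimately show ?thesis by simp
      qed
      have "L powr (q - 2) = 2 powr (q - 2) * y powr (p - 2)"
        using y by (simp add: L_def powr_mult powr_powr e)
      moreover have "y\<^sup>2 * y powr (p - 2) = y powr p"
      proof -
        have "y\<^sup>2 * y powr (p - 2) = y powr 2 * y powr (p - 2)" using y by simp
        also have "\<dots> = y powr p" by (simp flip: powr_add)
        finally show ?thesis .
      qed
      moreover have "c * y2 * (b * z / d) = (c * b / d) * (y2 * z)" for c y2 b z d :: real
        by simp
      ultimately show ?thesis by (simp only:)
    qed
    finally show ?thesis
      unfolding y_def[symmetric] using q2 by (subst ennreal_mult[symmetric]) auto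
  next
    case True
    hence z: "(if 0 < l \<and> norm (f x) \<le> \<sigma> l then ?K * ennreal ((norm (f x))\<^sup>2) * ennreal (l powr (q - 3)) else 0) = 0" for l
      by simp
    show ?thesis unfolding z by simp
  qed
  have "(\<integral>\<^sup>+\<xi>. ennreal (norm (FT s f \<xi>) powr q) \<partial>lborel)
     = (\<integral>\<^sup>+\<xi>. ennreal q * (\<integral>\<^sup>+l. indicator {0..norm (FT s f \<xi>)} l * ennreal (l powr (q - 1)) \<partial>lborel) \<partial>lborel)"
  proof (rule nn_integral_cong)
    fix \<xi>
    have "(\<integral>\<^sup>+l. indicator {0..norm (FT s f \<xi>)} l * ennreal (l powr (q - 1)) \<partial>lborel) = ennreal (norm (FT s f \<xi>) powr q / q)"
      using q2 by (intro nn_integral_powr_Icc) auto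
    thus "ennreal (norm (FT s f \<xi>) powr q) = ennreal q * (\<integral>\<^sup>+l. indicator {0..norm (FT s f \<xi>)} l * ennreal (l powr (q - 1)) \<partial>lborel)"
      using q2 by (simp flip: ennreal_mult)
  qed
  also have "\<dots> = ennreal q * (\<integral>\<^sup>+\<xi>. (\<integral>\<^sup>+l. indicator {0..norm (FT s f \<xi>)} l * ennreal (l powr (q - 1)) \<partial>lborel) \<partial>lborel)"
    by (rule nn_integral_cmult) (simp add: indicator_def[abs_def])
  also have "(\<integral>\<^sup>+\<xi>. (\<integral>\<^sup>+l. indicator {0..norm (FT s f \<xi>)} l * ennreal (l powr (q - 1)) \<partial>lborel) \<partial>lborel)
     = (\<integral>\<^sup>+l. (\<integral>\<^sup>+\<xi>. indicator {0..norm (FT s f \<xi>)} l * ennreal (l powr (q - 1)) \<partial>lborel) \<partial>lborel)"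
    by (rule lborel_pair.Fubini') (simp add: indicator_def[abs_def])
  also have "\<dots> \<le> (\<integral>\<^sup>+l. \<integral>\<^sup>+x. (if 0 < l \<and> norm (f x) \<le> \<sigma> l then ?K * ennreal ((norm (f x))\<^sup>2) * ennreal (l powr (q - 3)) else 0) \<partial>lborel \<partial>lborel)"
    by (intro nn_integral_mono level)
  also have "\<dots> = (\<integral>\<^sup>+x. \<integral>\<^sup>+l. (if 0 < l \<and> norm (f x) \<le> \<sigma> l then ?K * ennreal ((norm (f x))\<^sup>2) * ennreal (l powr (q - 3)) else 0) \<partial>lborel \<partial>lborel)"
    by (rule lborel_pair.Fubini') measurable
  also have "\<dots> \<le> (\<integral>\<^sup>+x. ennreal ((16 * pi\<^sup>2) * 2 powr (q - 2) / (q - 2)) * ennreal (norm (f x) powr p) \<partial>lborel)"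
    by (intro nn_integral_mono column)
  also have "\<dots> = ennreal ((16 * pi\<^sup>2) * 2 powr (q - 2) / (q - 2)) * (\<integral>\<^sup>+x. ennreal (norm (f x) powr p) \<partial>lborel)"
    by (rule nn_integral_cmult) measurable
  also have "\<dots> \<le> ennreal ((16 * pi\<^sup>2) * 2 powr (q - 2) / (q - 2)) * 1"
    by (intro mult_left_mono le1) simp
  finally show ?thesis
    using q2 by (simp add: mult_left_mono mult.assoc flip: ennreal_mult')
qed

text \<open>The norm in the form of an upper bound: no root is taken, no infinite norm occurs, and
  measurability is included, so that estimates combine by comparing integrals of powers.\<close>

definition Lp_le :: "real \<Rightarrow> (real^2 \<Rightarrow> 'b::real_normed_vector) \<Rightarrow> real \<Rightarrow> bool" where
  "Lp_le p f a \<longleftrightarrow> f \<in> borel_measurable borel \<and> (\<integral>\<^sup>+x. ennreal (norm (f x) powr p) \<partial>lborel) \<le> ennreal (a powr p)"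

text \<open>The exponent 2 is treated apart because the interpolation constant has
  \<open>q - 2\<close> in its denominator. For the other exponents, division by \<open>a\<close>
  reduces to a norm of at most 1.\<close>

theorem hausdorff_young:
  fixes p q :: real
  assumes p: "1 < p" "p \<le> 2" and q: "q = p / (p - 1)"
  shows "\<exists>C>0. \<forall>s f a. s\<^sup>2 = 1 \<longrightarrow> integrable lborel f \<longrightarrow> a > 0 \<longrightarrow> Lp_le p f a \<longrightarrow> Lp_le q (FT s f) (C * a)"
proof (cases "p = 2")
  case True
  hence q2: "q = 2" using q by simp
  have "Lp_le q (FT s f) (2 * pi * a)" if "s\<^sup>2 = 1" "integrable lborel f" "a > 0" "Lp_le p f a" for s f a
  proof -
    have "ennreal ((2 * pi)\<^sup>2) * (\<integral>\<^sup>+x. ennreal ((norm (f x))\<^sup>2) \<partial>lborel) \<le> ennreal ((2 * pi)\<^sup>2) * ennreal (a\<^sup>2)"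
      using that(3,4) True by (intro mult_left_mono) (auto simp: Lp_le_def)
    also have "\<dots> = ennreal ((2 * pi * a)\<^sup>2)" by (simp add: power_mult_distrib flip: ennreal_mult')
    finally show ?thesis
      using FT_L2[OF that(2,1)] measurable_FT[OF that(2)] that(3) unfolding Lp_le_def q2 by auto
  qed
  thus ?thesis by (intro exI[of _ "2 * pi"]) auto
next
  case False
  hence p2: "p < 2" using p by simp
  have q2: "q > 2" using p p2 by (simp add: q field_simps)
  define C0 where "C0 = q * (16 * pi\<^sup>2) * 2 powr (q - 2) / (q - 2)"
  have C0: "C0 > 0" unfolding C0_def using q2 by auto
  define C where "C = C0 powr (1 / q)"
  have Cq: "C powr q = C0" using C0 q2 by (simp add: C_def powr_powr)
  have "Lp_le q (FT s f) (C * a)" if s: "s\<^sup>2 = 1" and f: "integrable lborel f" and a: "a > 0" and L: "Lp_le p f a" for s f a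
  proof -
    have [measurable]: "f \<in> borel_measurable borel" using f by auto
    note [measurable] = measurable_FT[OF f]
    define g where "g x = complex_of_real (1 / a) * f x" for x
    have g: "integrable lborel g" unfolding g_def using f by simp
    note [measurable] = measurable_FT[OF g]
    have ng: "norm (g x) = norm (f x) / a" for x using a by (simp add: g_def norm_mult norm_divide)
    have "(\<integral>\<^sup>+x. ennreal (norm (g x) powr p) \<partial>lborel) = (\<integral>\<^sup>+x. ennreal (1 / a powr p) * ennreal (norm (f x) powr p) \<partial>lborel)"
      using a by (intro nn_integral_cong) (simp add: ng powr_divide flip: ennreal_mult')
    also have "\<dots> = ennreal (1 / a powr p) * (\<integral>\<^sup>+x. ennreal (norm (f x) powr p) \<partial>lborel)"
      by (rule nn_integral_cmult) measurable
    also have "\<dots> \<le> ennreal (1 / a powr p) * ennreal (a powr p)"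
      using L by (intro mult_left_mono) (auto simp: Lp_le_def)
    also have "\<dots> = 1" using a by (simp flip: ennreal_mult')
    finally have gle: "(\<integral>\<^sup>+\<xi>. ennreal (norm (FT s g \<xi>) powr q) \<partial>lborel) \<le> ennreal C0"
      unfolding C0_def by (intro hausdorff_young_normalized[OF p(1) p2 q g s])
    have "norm (FT s f \<xi>) powr q = a powr q * norm (FT s g \<xi>) powr q" for \<xi>
    proof -
      have "FT s g \<xi> = complex_of_real (1 / a) * FT s f \<xi>" unfolding g_def by (rule FT_cmult)
      hence "norm (FT s f \<xi>) = a * norm (FT s g \<xi>)" using a by (simp add: norm_mult norm_divide)
      thus ?thesis using a by (simp add: powr_mult)
    qed
    hence "(\<integral>\<^sup>+\<xi>. ennreal (norm (FT s f \<xi>) powr q) \<partial>lborel) = (\<integral>\<^sup>+\<xi>. ennreal (a powr q) * ennreal (norm (FT s g \<xi>) powr q) \<partial>lborel)"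
      by (simp add: ennreal_mult')
    also have "\<dots> = ennreal (a powr q) * (\<integral>\<^sup>+\<xi>. ennreal (norm (FT s g \<xi>) powr q) \<partial>lborel)"
      by (rule nn_integral_cmult) measurable
    also have "\<dots> \<le> ennreal (a powr q) * ennreal C0"
      by (intro mult_left_mono gle) simp
    also have "\<dots> = ennreal ((C * a) powr q)"
    proof -
      have "(C * a) powr q = a powr q * C0"
      proof -
        have "C \<ge> 0" by (simp add: C_def)
        thus ?thesis using a by (simp add: powr_mult Cq mult.commute)
      qed
      thus ?thesis using C0 by (simp flip: ennreal_mult')
    qed
    finally show ?thesis by (simp add: Lp_le_def)
  qed
  moreover have "C > 0" using C0 by (simp add: C_def)
  ultimately show ?thesis by blast
qed

section \<open>Energy decay for the real system of modes\<close>

text \<open>Completing the square: the hypothesis states that the quadratic form in \<open>x\<close>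
  and \<open>y\<close> has nonpositive discriminant.\<close>

lemma young_mult:
  fixes A B k x y :: real
  assumes "A > 0" "k\<^sup>2 \<le> 4 * A * B"
  shows "k * x * y \<le> A * x\<^sup>2 + B * y\<^sup>2"
proof -
  have "4 * A * (A * x\<^sup>2 + B * y\<^sup>2 - k * x * y) = (2 * A * x - k * y)\<^sup>2 + (4 * A * B - k\<^sup>2) * y\<^sup>2"
    by (simp add: power2_eq_square algebra_simps)
  also have "\<dots> \<ge> 0" using assms by (intro add_nonneg_nonneg mult_nonneg_nonneg) auto
  finally have "0 \<le> (4 * A) * (A * x\<^sup>2 + B * y\<^sup>2 - k * x * y)" .
  thus ?thesis using assms(1) by (simp add: zero_le_mult_iff)
qed

lemma young_mult_bound:
  fixes A k K x y :: real
  assumes "A > 0" "\<bar>k\<bar> \<le> K"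
  shows "k * x * y \<le> A * x\<^sup>2 + (K\<^sup>2 / (4 * A)) * y\<^sup>2"
proof (rule young_mult[OF assms(1)])
  have "k\<^sup>2 \<le> K\<^sup>2" using assms(2) by (simp add: abs_le_square_iff[symmetric])
  thus "k\<^sup>2 \<le> 4 * A * (K\<^sup>2 / (4 * A))" using assms(1) by simp
qed

text \<open>Up to terms in \<open>f\<close>, the quantities \<open>n1\<close>, \<open>m3\<close>, \<open>n3\<close> arise from the coupling quantity \<open>m1\<close> by
  successive differentiation in time.  The powers of \<open>\<delta>\<close> grow such that every indefinite product is
  absorbed by its two neighbouring squares.\<close>

lemma corrector_dissipation:
  fixes \<gamma> S :: real
  assumes g: "\<gamma> \<noteq> 0" and S: "S \<ge> 1"
  shows "\<exists>\<delta> c C. 0 < \<delta> \<and> \<delta> \<le> 1 \<and> 0 < c \<and> 0 < C \<and>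
    (\<forall>s d b h m1 n1 m3 n3 f :: real. \<bar>s\<bar> \<le> S \<longrightarrow> \<bar>d\<bar> \<le> S \<longrightarrow> \<bar>b\<bar> \<le> S \<longrightarrow>
      - \<gamma> * (\<gamma> * m1\<^sup>2 - \<gamma> * f\<^sup>2 - f * n1 - h * f * m1)
      + \<delta>^3 * (- n1\<^sup>2 - \<gamma> * f * n1 + m1 * m3)
      - \<delta>^5 * (m3\<^sup>2 - n1 * n3 - \<gamma> * b * f * n1)
      + \<delta>^6 * (- n3\<^sup>2 - \<gamma> * b * f * n3 + s * m3\<^sup>2 - d * m1 * m3)
      \<le> - c * (m1\<^sup>2 + n1\<^sup>2 + m3\<^sup>2 + n3\<^sup>2) + C * (1 + h\<^sup>2) * f\<^sup>2)"
proof -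
  \<comment> \<open>The bounds 1 / 16 and \<gamma>^2 / 16 make the mixed products small against
    their neighbouring squares; 1 / (8 S) absorbs the coefficients \<open>s\<close> and
    \<open>d\<close>, which are built from the squared frequencies.\<close>
  define \<delta> where "\<delta> = Min {1 / 16, \<gamma>\<^sup>2 / 16, 1 / (8 * S)}"
  have \<delta>0: "\<delta> > 0" using g S by (simp add: \<delta>_def)
  have \<delta>1: "\<delta> \<le> 1 / 16" and \<delta>2: "\<delta> \<le> \<gamma>\<^sup>2 / 16" and \<delta>3: "\<delta> \<le> 1 / (8 * S)"
    by (simp_all add: \<delta>_def)
  have \<delta>S: "\<delta> * S \<le> 1 / 8" using \<delta>3 S by (simp add: field_simps)
  define c where "c = min (\<gamma>\<^sup>2 / 2) (\<delta>^6 / 2)"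
  have c0: "c > 0" using g \<delta>0 by (simp add: c_def)
  define G where "G = \<bar>\<gamma>\<bar> * S"
  have G: "G \<ge> 0" "\<bar>\<gamma>\<bar> \<le> G" using S mult_left_mono[OF S, of "\<bar>\<gamma>\<bar>"] by (auto simp: G_def)
  have dk: "\<delta>^k \<le> 1" for k using \<delta>0 \<delta>1 by (intro power_le_one) auto
  \<comment> \<open>The summands pay for the term \<gamma>^2 f^2, for the product of h m1 with f,
    for three products of n1 with f, and for one product of n3 with f.\<close>
  define C where "C = \<gamma>\<^sup>2 + 2 + 3 * (G\<^sup>2 / (4 * (\<delta>^3 / 8))) + G\<^sup>2 / (4 * (\<delta>^6 / 8))"
  have "G\<^sup>2 / (4 * (\<delta>^3 / 8)) \<ge> 0" "G\<^sup>2 / (4 * (\<delta>^6 / 8)) \<ge> 0" using \<delta>0 by auto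
  hence C0: "C > 0" unfolding C_def by (smt (verit) zero_le_power2)
  have "- \<gamma> * (\<gamma> * m1\<^sup>2 - \<gamma> * f\<^sup>2 - f * n1 - h * f * m1)
      + \<delta>^3 * (- n1\<^sup>2 - \<gamma> * f * n1 + m1 * m3)
      - \<delta>^5 * (m3\<^sup>2 - n1 * n3 - \<gamma> * b * f * n1)
      + \<delta>^6 * (- n3\<^sup>2 - \<gamma> * b * f * n3 + s * m3\<^sup>2 - d * m1 * m3)
      \<le> - c * (m1\<^sup>2 + n1\<^sup>2 + m3\<^sup>2 + n3\<^sup>2) + C * (1 + h\<^sup>2) * f\<^sup>2"
    if s: "\<bar>s\<bar> \<le> S" and d: "\<bar>d\<bar> \<le> S" and b: "\<bar>b\<bar> \<le> S" for s d b h m1 n1 m3 n3 f :: real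
  proof -
    \<comment> \<open>The squares of m1, n1, m3, n3 carry the powers 0, 3, 5, 6 of \<delta>. Here 2
      * 3 exceeds 0 + 5, and in the next product 2 * 5 exceeds 3 + 6: one power of \<delta> is left
      over in each case.\<close>
    have y1: "\<delta>^3 * m1 * m3 \<le> \<gamma>\<^sup>2 / 8 * m1\<^sup>2 + \<delta>^5 / 8 * m3\<^sup>2"
    proof (rule young_mult)
      have "(\<delta>^3)\<^sup>2 = \<delta>^5 * \<delta>" by (simp add: eval_nat_numeral)
      also have "\<dots> \<le> \<delta>^5 * (\<gamma>\<^sup>2 / 16)" using \<delta>2 \<delta>0 by (intro mult_left_mono) auto
      finally show "(\<delta>^3)\<^sup>2 \<le> 4 * (\<gamma>\<^sup>2 / 8) * (\<delta>^5 / 8)" by (simp add: mult.commute)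
    qed (use g in simp)
    have y2: "\<delta>^5 * n1 * n3 \<le> \<delta>^3 / 8 * n1\<^sup>2 + \<delta>^6 / 8 * n3\<^sup>2"
    proof (rule young_mult)
      have "(\<delta>^5)\<^sup>2 = \<delta>^9 * \<delta>" by (simp add: eval_nat_numeral)
      also have "\<dots> \<le> \<delta>^9 * (1 / 16)" using \<delta>1 \<delta>0 by (intro mult_left_mono) auto
      also have "\<dots> = 4 * (\<delta>^3 / 8) * (\<delta>^6 / 8)" by (simp add: eval_nat_numeral)
      finally show "(\<delta>^5)\<^sup>2 \<le> 4 * (\<delta>^3 / 8) * (\<delta>^6 / 8)" .
    qed (use \<delta>0 in simp)
    have y3: "\<delta>^6 * s * m3\<^sup>2 \<le> \<delta>^5 / 8 * m3\<^sup>2"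
    proof (intro mult_right_mono)
      have "\<delta>^6 * s \<le> \<delta>^6 * S" using s \<delta>0 by (intro mult_left_mono) auto
      also have "\<dots> = \<delta>^5 * (\<delta> * S)" by (simp add: eval_nat_numeral)
      also have "\<dots> \<le> \<delta>^5 * (1 / 8)" using \<delta>S \<delta>0 by (intro mult_left_mono) auto
      finally show "\<delta>^6 * s \<le> \<delta>^5 / 8" by simp
    qed simp
    have y4: "(- (\<delta>^6 * d)) * m1 * m3 \<le> \<gamma>\<^sup>2 / 8 * m1\<^sup>2 + \<delta>^5 / 8 * m3\<^sup>2"
    proof (rule young_mult)
      have "\<bar>\<delta> * d\<bar> \<le> \<delta> * S" using d \<delta>0 by (simp add: abs_mult)
      hence "\<bar>\<delta> * d\<bar> \<le> 1" using \<delta>S by linarith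
      hence sq: "(\<delta> * d)\<^sup>2 \<le> 1" using abs_square_le_1 by blast
      have "(- (\<delta>^6 * d))\<^sup>2 = \<delta>^10 * (\<delta> * d)\<^sup>2" by (simp add: eval_nat_numeral)
      also have "\<dots> \<le> \<delta>^10 * 1" using sq \<delta>0 by (intro mult_left_mono) auto
      also have "\<dots> = \<delta>^5 * (\<delta>^4 * \<delta>)" by (simp add: eval_nat_numeral)
      also have "\<dots> \<le> \<delta>^5 * (1 * (\<gamma>\<^sup>2 / 16))" using \<delta>2 \<delta>0 dk by (intro mult_left_mono mult_mono) auto
      finally show "(- (\<delta>^6 * d))\<^sup>2 \<le> 4 * (\<gamma>\<^sup>2 / 8) * (\<delta>^5 / 8)" by (simp add: mult.commute)
    qed (use g in simp)
    have y5: "(\<gamma> * h) * m1 * f \<le> \<gamma>\<^sup>2 / 8 * m1\<^sup>2 + 2 * h\<^sup>2 * f\<^sup>2"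
      by (rule young_mult) (use g in \<open>auto simp: power_mult_distrib\<close>)
    have B3: "\<delta>^3 / 8 > 0" and B6: "\<delta>^6 / 8 > 0" using \<delta>0 by auto
    have gb: "\<bar>\<gamma> * b\<bar> \<le> G" using b by (simp add: G_def abs_mult mult_left_mono)
    have sm: "\<bar>\<delta>^k * x\<bar> \<le> \<bar>x\<bar>" for k x using dk[of k] \<delta>0 by (simp add: abs_mult mult_left_le_one_le)
    have y6: "\<gamma> * n1 * f \<le> \<delta>^3 / 8 * n1\<^sup>2 + (G\<^sup>2 / (4 * (\<delta>^3 / 8))) * f\<^sup>2"
      by (rule young_mult_bound[OF B3 G(2)])
    have y7: "(\<delta>^3 * (- \<gamma>)) * n1 * f \<le> \<delta>^3 / 8 * n1\<^sup>2 + (G\<^sup>2 / (4 * (\<delta>^3 / 8))) * f\<^sup>2"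
      by (rule young_mult_bound[OF B3]) (use sm[of 3 "- \<gamma>"] G in linarith)
    have y8: "(\<delta>^5 * (\<gamma> * b)) * n1 * f \<le> \<delta>^3 / 8 * n1\<^sup>2 + (G\<^sup>2 / (4 * (\<delta>^3 / 8))) * f\<^sup>2"
      by (rule young_mult_bound[OF B3]) (use sm[of 5 "\<gamma> * b"] gb in linarith)
    have y9: "(\<delta>^6 * (- (\<gamma> * b))) * n3 * f \<le> \<delta>^6 / 8 * n3\<^sup>2 + (G\<^sup>2 / (4 * (\<delta>^6 / 8))) * f\<^sup>2"
      by (rule young_mult_bound[OF B6]) (use sm[of 6 "- (\<gamma> * b)"] gb in linarith)
    have c1: "c * m1\<^sup>2 \<le> \<gamma>\<^sup>2 / 2 * m1\<^sup>2" by (intro mult_right_mono) (auto simp: c_def)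
    have "\<delta>^6 \<le> \<delta>^3" "\<delta>^6 \<le> \<delta>^5" using \<delta>0 \<delta>1 by (auto intro!: power_decreasing)
    hence cc: "c \<le> \<delta>^3 / 2" "c \<le> \<delta>^5 / 2" "c \<le> \<delta>^6 / 2"
      by (auto simp: c_def min_le_iff_disj)
    have c2: "c * n1\<^sup>2 \<le> \<delta>^3 / 2 * n1\<^sup>2" and c3: "c * m3\<^sup>2 \<le> \<delta>^5 / 2 * m3\<^sup>2" and c4: "c * n3\<^sup>2 \<le> \<delta>^6 / 2 * n3\<^sup>2"
      by (intro mult_right_mono cc zero_le_power2)+
    have "C * f\<^sup>2 * h\<^sup>2 \<ge> 2 * f\<^sup>2 * h\<^sup>2"
      unfolding C_def using \<delta>0 by (intro mult_right_mono) auto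
    hence Ch: "C * (1 + h\<^sup>2) * f\<^sup>2 \<ge> C * f\<^sup>2 + 2 * h\<^sup>2 * f\<^sup>2" by (simp add: algebra_simps)
    have Cf: "C * f\<^sup>2 \<ge> \<gamma>\<^sup>2 * f\<^sup>2 + 3 * ((G\<^sup>2 / (4 * (\<delta>^3 / 8))) * f\<^sup>2) + (G\<^sup>2 / (4 * (\<delta>^6 / 8))) * f\<^sup>2"
    proof -
      have "C * f\<^sup>2 = \<gamma>\<^sup>2 * f\<^sup>2 + 2 * f\<^sup>2 + 3 * ((G\<^sup>2 / (4 * (\<delta>^3 / 8))) * f\<^sup>2) + (G\<^sup>2 / (4 * (\<delta>^6 / 8))) * f\<^sup>2"
        unfolding C_def by (simp only: distrib_right mult.assoc)
      thus ?thesis by simp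
    qed
    have eq: "- \<gamma> * (\<gamma> * m1\<^sup>2 - \<gamma> * f\<^sup>2 - f * n1 - h * f * m1)
      + \<delta>^3 * (- n1\<^sup>2 - \<gamma> * f * n1 + m1 * m3)
      - \<delta>^5 * (m3\<^sup>2 - n1 * n3 - \<gamma> * b * f * n1)
      + \<delta>^6 * (- n3\<^sup>2 - \<gamma> * b * f * n3 + s * m3\<^sup>2 - d * m1 * m3)
      = - (\<gamma>\<^sup>2 * m1\<^sup>2) - \<delta>^3 * n1\<^sup>2 - \<delta>^5 * m3\<^sup>2 - \<delta>^6 * n3\<^sup>2 + \<gamma>\<^sup>2 * f\<^sup>2
       + \<gamma> * n1 * f + (\<gamma> * h) * m1 * f + (\<delta>^3 * (- \<gamma>)) * n1 * f + \<delta>^3 * m1 * m3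
       + \<delta>^5 * n1 * n3 + (\<delta>^5 * (\<gamma> * b)) * n1 * f + (\<delta>^6 * (- (\<gamma> * b))) * n3 * f + \<delta>^6 * s * m3\<^sup>2
       + (- (\<delta>^6 * d)) * m1 * m3"
      by (simp add: algebra_simps power2_eq_square)
    have "0 \<le> \<gamma>\<^sup>2 * m1\<^sup>2" "0 \<le> \<delta>^5 * m3\<^sup>2" "0 \<le> \<delta>^6 * n3\<^sup>2" using \<delta>0 by auto
    thus ?thesis unfolding eq using y1 y2 y3 y4 y5 y6 y7 y8 y9 c1 c2 c3 c4 Ch Cf by (simp only: distrib_left)
  qed
  thus ?thesis using \<delta>0 \<delta>1 c0 C0 by (intro exI[of _ \<delta>] exI[of _ c] exI[of _ C]) auto
qed

text \<open>The product with exp (l t) is nonincreasing. The derivative is asked for at positive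
  times only and the initial value enters by continuity, as in the Cauchy problem, where the
  equations hold for t > 0.\<close>

lemma exponential_decay:
  fixes f f' :: "real \<Rightarrow> real"
  assumes cont: "continuous_on {0..} f"
    and der: "\<And>t. t > 0 \<Longrightarrow> (f has_real_derivative f' t) (at t)"
    and le: "\<And>t. t > 0 \<Longrightarrow> f' t \<le> - l * f t" and t: "t \<ge> 0"
  shows "f t \<le> exp (- l * t) * f 0"
proof -
  have "f t * exp (l * t) \<le> f 0 * exp (l * 0)"
  proof (rule DERIV_nonpos_imp_decreasing_open[of 0 t "\<lambda>t. f t * exp (l * t)", OF t])
    fix x :: real assume x: "0 < x" "x < t"
    have "((\<lambda>t. f t * exp (l * t)) has_real_derivative f' x * exp (l * x) + f x * (exp (l * x) * l)) (at x)"
      by (auto intro!: derivative_eq_intros der x)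
    moreover have "f' x * exp (l * x) + f x * (exp (l * x) * l) = (f' x + l * f x) * exp (l * x)"
      by (simp add: algebra_simps)
    moreover have "\<dots> \<le> 0" using le[OF x(1)] by (intro mult_nonpos_nonneg) auto
    ultimately show "\<exists>y. ((\<lambda>t. f t * exp (l * t)) has_real_derivative y) (at x) \<and> y \<le> 0" by auto
  next
    show "continuous_on {0..t} (\<lambda>t. f t * exp (l * t))"
      by (intro continuous_intros continuous_on_subset[OF cont]) auto
  qed
  thus ?thesis by (simp add: exp_minus field_simps)
qed

text \<open>The \<open>v\<close> stand for modal velocities, the \<open>w\<close> for modal
  displacements times \<rho> and frequency, \<open>f\<close> for a real component of \<i> times the
  temperature, and \<rho> for |\<xi>|, which is factored out of the system. The energy itself
  dissipates only through \<open>f\<close>, so a corrector has to transfer the damping to the other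
  components. The constants depend on the direction only through the bounds \<open>m\<close> and
  \<open>M\<close>.\<close>

lemma energy_decay_real:
  fixes \<kappa> \<gamma> m M :: real
  assumes \<kappa>: "\<kappa> > 0" and g: "\<gamma> \<noteq> 0" and m: "m > 0" and M: "M \<ge> 1"
  shows "\<exists>C>0. \<exists>c>0. \<forall>o1 o2 a1 a2 \<rho> :: real. m \<le> o1 \<longrightarrow> o1 \<le> M \<longrightarrow> m \<le> o2 \<longrightarrow> o2 \<le> M \<longrightarrow> m \<le> \<bar>o1\<^sup>2 - o2\<^sup>2\<bar> \<longrightarrow>
    a1\<^sup>2 + a2\<^sup>2 = 1 \<longrightarrow> \<rho> > 0 \<longrightarrow> (\<forall>v1 v2 w1 w2 f :: real \<Rightarrow> real.
      continuous_on {0..} v1 \<longrightarrow> continuous_on {0..} v2 \<longrightarrow> continuous_on {0..} w1 \<longrightarrow> continuous_on {0..} w2 \<longrightarrow> continuous_on {0..} f \<longrightarrow>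
      (\<forall>t>0. (v1 has_real_derivative \<rho> * (- o1 * w1 t - \<gamma> * a1 * f t)) (at t) \<and>
             (v2 has_real_derivative \<rho> * (- o2 * w2 t - \<gamma> * a2 * f t)) (at t) \<and>
             (w1 has_real_derivative \<rho> * (o1 * v1 t)) (at t) \<and>
             (w2 has_real_derivative \<rho> * (o2 * v2 t)) (at t) \<and>
             (f has_real_derivative \<rho> * (- (\<kappa> * \<rho>) * f t + \<gamma> * (a1 * v1 t + a2 * v2 t))) (at t)) \<longrightarrow>
      (\<forall>t\<ge>0. (v1 t)\<^sup>2 + (v2 t)\<^sup>2 + (w1 t)\<^sup>2 + (w2 t)\<^sup>2 + (f t)\<^sup>2
        \<le> C * exp (- c * t * (\<rho>\<^sup>2 / (1 + \<rho>\<^sup>2)) * min (a1\<^sup>2) (a2\<^sup>2)) *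
            ((v1 0)\<^sup>2 + (v2 0)\<^sup>2 + (w1 0)\<^sup>2 + (w2 0)\<^sup>2 + (f 0)\<^sup>2)))"
proof -
  define S where "S = 2 * M^4"
  have Mp: "M^k \<ge> 1" for k using M by (rule one_le_power)
  have S1: "S \<ge> 1" using Mp[of 4] by (simp add: S_def)
  obtain \<delta> c1 C1 where \<delta>: "0 < \<delta>" "\<delta> \<le> 1" and c1: "0 < c1" and C1: "0 < C1"
    and diss: "\<And>s d b h m1 n1 m3 n3 f :: real. \<bar>s\<bar> \<le> S \<Longrightarrow> \<bar>d\<bar> \<le> S \<Longrightarrow> \<bar>b\<bar> \<le> S \<Longrightarrow>
      - \<gamma> * (\<gamma> * m1\<^sup>2 - \<gamma> * f\<^sup>2 - f * n1 - h * f * m1)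
      + \<delta>^3 * (- n1\<^sup>2 - \<gamma> * f * n1 + m1 * m3)
      - \<delta>^5 * (m3\<^sup>2 - n1 * n3 - \<gamma> * b * f * n1)
      + \<delta>^6 * (- n3\<^sup>2 - \<gamma> * b * f * n3 + s * m3\<^sup>2 - d * m1 * m3)
      \<le> - c1 * (m1\<^sup>2 + n1\<^sup>2 + m3\<^sup>2 + n3\<^sup>2) + C1 * (1 + h\<^sup>2) * f\<^sup>2"
    using corrector_dissipation[OF g S1] by blast
  define C2 where "C2 = (\<bar>\<gamma>\<bar> + 3) * M^6"
  have C2: "C2 > 0" unfolding C2_def using Mp[of 6] by (intro mult_pos_pos) auto
  \<comment> \<open>The summand 16 C2 keeps the corrector below a quarter of K times the energy, so
    that both functionals are comparable; C1 pays for the error in f^2 and c1 leaves some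
    dissipation of f.\<close>
  define K where "K = 16 * C2 + C1 + c1 + 1"
  have K: "K > 0" unfolding K_def using C2 C1 c1 by linarith
  \<comment> \<open>Bounds the inverse of the Vandermonde matrix with nodes o1^2 and o2^2 by means
    of the gap: the first summand for the velocities, the second, with one more division by m^2, for
    the displacements, the last for f.\<close>
  define C3 where "C3 = (4 + 4 * M^4) / m\<^sup>2 + (4 + 4 * M^4) / (m\<^sup>2 * m\<^sup>2) + 1"
  have C3: "C3 > 0" unfolding C3_def using m M by (intro add_nonneg_pos add_nonneg_nonneg divide_nonneg_nonneg) auto
  define c4 where "c4 = c1 / (C3 * K)"
  have c4: "c4 > 0" unfolding c4_def using c1 C3 K by auto
  \<comment> \<open>The factor \<kappa> / (1 + \<kappa>^2) arises from the comparison of \<rho>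
    \<eta> = \<kappa> \<rho>^2 / (1 + \<kappa>^2 \<rho>^2) with \<rho>^2 / (1 + \<rho>^2) at the end
    of the proof.\<close>
  define c where "c = c4 * (\<kappa> / (1 + \<kappa>\<^sup>2))"
  have "1 + \<kappa>\<^sup>2 > 0" by (simp add: add_pos_nonneg)
  hence c: "c > 0" unfolding c_def using c4 \<kappa> by auto
  show ?thesis
  proof (rule exI[of _ 4], rule conjI, simp, rule exI[of _ c], rule conjI[OF c], intro allI impI)
    fix o1 o2 a1 a2 \<rho> :: real and v1 v2 w1 w2 f :: "real \<Rightarrow> real" and t :: real
    assume o1: "m \<le> o1" "o1 \<le> M" and o2: "m \<le> o2" "o2 \<le> M" and gap: "m \<le> \<bar>o1\<^sup>2 - o2\<^sup>2\<bar>"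
      and a: "a1\<^sup>2 + a2\<^sup>2 = 1" and \<rho>: "\<rho> > 0"
      and cont: "continuous_on {0..} v1" "continuous_on {0..} v2" "continuous_on {0..} w1" "continuous_on {0..} w2" "continuous_on {0..} f"
      and der: "\<forall>t>0. (v1 has_real_derivative \<rho> * (- o1 * w1 t - \<gamma> * a1 * f t)) (at t) \<and>
             (v2 has_real_derivative \<rho> * (- o2 * w2 t - \<gamma> * a2 * f t)) (at t) \<and>
             (w1 has_real_derivative \<rho> * (o1 * v1 t)) (at t) \<and>
             (w2 has_real_derivative \<rho> * (o2 * v2 t)) (at t) \<and>
             (f has_real_derivative \<rho> * (- (\<kappa> * \<rho>) * f t + \<gamma> * (a1 * v1 t + a2 * v2 t))) (at t)"
      and t: "0 \<le> t"
    define h where "h = \<kappa> * \<rho>"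
    have h: "h > 0" using \<kappa> \<rho> by (simp add: h_def)
    \<comment> \<open>The weight of the corrector. As \<eta> (1 + h^2) = h, its error (1 + h^2) f^2
      becomes h f^2, which is the order of the true dissipation at low and at high frequencies
      alike.\<close>
    define \<eta> where "\<eta> = h / (1 + h\<^sup>2)"
    have h2: "1 + h\<^sup>2 > 0" by (simp add: add_pos_nonneg)
    have \<eta>0: "\<eta> > 0" using h h2 by (simp add: \<eta>_def)
    have \<eta>h: "\<eta> * (1 + h\<^sup>2) = h" using h2 by (simp add: \<eta>_def)
    have \<eta>1: "\<eta> \<le> 1"
    proof -
      have "h \<le> 1 + h\<^sup>2" using sum_squares_bound[of 1 h] h by (simp)
      thus ?thesis using h2 by (simp add: \<eta>_def)
    qed
    have \<eta>h': "\<eta> \<le> h"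
    proof -
      have "\<eta> * 1 \<le> \<eta> * (1 + h\<^sup>2)" using \<eta>0 by (intro mult_left_mono) auto
      thus ?thesis using \<eta>h by simp
    qed
    define \<sigma> where "\<sigma> = min (a1\<^sup>2) (a2\<^sup>2)"
    have \<sigma>0: "\<sigma> \<ge> 0" by (simp add: \<sigma>_def)
    have a1le: "a1\<^sup>2 \<le> 1" "a2\<^sup>2 \<le> 1" using a by (smt (verit) zero_le_power2)+
    have \<sigma>1: "\<sigma> \<le> a1\<^sup>2" "\<sigma> \<le> a2\<^sup>2" "\<sigma> \<le> 1" using a1le by (auto simp: \<sigma>_def)
    define s where "s = o1\<^sup>2 + o2\<^sup>2"
    define d where "d = o1\<^sup>2 * o2\<^sup>2"
    define b where "b = a1\<^sup>2 * o1\<^sup>2 + a2\<^sup>2 * o2\<^sup>2"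
    have op: "o1 > 0" "o2 > 0" using m o1 o2 by auto
    have ok: "o1^k \<le> M^k" "o2^k \<le> M^k" for k using op o1 o2 by (auto intro!: power_mono)
    have M24: "M\<^sup>2 \<le> M^4" using M by (intro power_increasing) auto
    have M2: "0 \<le> M\<^sup>2" by simp
    have sS: "\<bar>s\<bar> \<le> S" using ok[of 2] M24 by (simp add: s_def S_def)
    have dS: "\<bar>d\<bar> \<le> S"
    proof -
      have "o1\<^sup>2 * o2\<^sup>2 \<le> M\<^sup>2 * M\<^sup>2" using ok[of 2] by (intro mult_mono) auto
      also have "\<dots> = M^4" by (simp add: power2_eq_square power4_eq_xxxx)
      finally show ?thesis using Mp[of 4] by (simp add: d_def S_def)
    qed
    have bS: "\<bar>b\<bar> \<le> S"
    proof -
      have "b \<le> 1 * M\<^sup>2 + 1 * M\<^sup>2" unfolding b_def using ok[of 2] a1le by (intro add_mono mult_mono) auto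
      thus ?thesis using M24 by (simp add: b_def S_def)
    qed
    \<comment> \<open>Moments of the modes with weights a_j o_j^k, even k for velocities and odd k
      for displacements. Each mode enters multiplied by its coupling, which is why the resulting
      control degenerates with a_j.\<close>
    define m1 where "m1 t = a1 * v1 t + a2 * v2 t" for t
    define n1 where "n1 t = a1 * o1 * w1 t + a2 * o2 * w2 t" for t
    define m3 where "m3 t = a1 * o1\<^sup>2 * v1 t + a2 * o2\<^sup>2 * v2 t" for t
    define n3 where "n3 t = a1 * o1^3 * w1 t + a2 * o2^3 * w2 t" for t
    define E where "E t = (v1 t)\<^sup>2 + (v2 t)\<^sup>2 + (w1 t)\<^sup>2 + (w2 t)\<^sup>2 + (f t)\<^sup>2" for t
    define Q where "Q t = (m1 t)\<^sup>2 + (n1 t)\<^sup>2 + (m3 t)\<^sup>2 + (n3 t)\<^sup>2" for t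
    \<comment> \<open>The sign of each product is such that its derivative contributes the negative
      of a square: of m1, n1, m3 and n3 in turn.\<close>
    define Z where "Z t = - \<gamma> * (f t * m1 t) + \<delta>^3 * (m1 t * n1 t) - \<delta>^5 * (n1 t * m3 t) + \<delta>^6 * (m3 t * n3 t)" for t
    define dZ where "dZ t = - \<gamma> * (\<gamma> * (m1 t)\<^sup>2 - \<gamma> * (f t)\<^sup>2 - f t * n1 t - h * f t * m1 t)
      + \<delta>^3 * (- (n1 t)\<^sup>2 - \<gamma> * f t * n1 t + m1 t * m3 t)
      - \<delta>^5 * ((m3 t)\<^sup>2 - n1 t * n3 t - \<gamma> * b * f t * n1 t)
      + \<delta>^6 * (- (n3 t)\<^sup>2 - \<gamma> * b * f t * n3 t + s * (m3 t)\<^sup>2 - d * m1 t * m3 t)" for t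
    define L where "L t = K * (E t / 2) + \<eta> * Z t" for t
    have dz: "dZ t \<le> - c1 * Q t + C1 * (1 + h\<^sup>2) * (f t)\<^sup>2" for t
      unfolding dZ_def Q_def by (rule diss[OF sS dS bS])
    have DL: "(L has_real_derivative \<rho> * (K * (- h * (f t)\<^sup>2) + \<eta> * dZ t)) (at t)" if "t > 0" for t
    proof -
      have D: "(v1 has_real_derivative \<rho> * (- o1 * w1 t - \<gamma> * a1 * f t)) (at t)"
             "(v2 has_real_derivative \<rho> * (- o2 * w2 t - \<gamma> * a2 * f t)) (at t)"
             "(w1 has_real_derivative \<rho> * (o1 * v1 t)) (at t)"
             "(w2 has_real_derivative \<rho> * (o2 * v2 t)) (at t)"
             "(f has_real_derivative \<rho> * (- h * f t + \<gamma> * m1 t)) (at t)"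
        using der that by (auto simp: h_def m1_def)
      have Dm1: "(m1 has_real_derivative \<rho> * (- n1 t - \<gamma> * f t)) (at t)"
      proof -
        have "(m1 has_real_derivative a1 * (\<rho> * (- o1 * w1 t - \<gamma> * a1 * f t)) + a2 * (\<rho> * (- o2 * w2 t - \<gamma> * a2 * f t))) (at t)"
          unfolding m1_def[abs_def] by (auto intro!: derivative_eq_intros D)
        also have "a1 * (\<rho> * (- o1 * w1 t - \<gamma> * a1 * f t)) + a2 * (\<rho> * (- o2 * w2 t - \<gamma> * a2 * f t)) = \<rho> * (- n1 t - \<gamma> * f t * (a1\<^sup>2 + a2\<^sup>2))"
          by (simp add: n1_def power2_eq_square algebra_simps)
        finally show ?thesis by (simp add: a)
      qed
      have Dn1: "(n1 has_real_derivative \<rho> * m3 t) (at t)"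
      proof -
        have "(n1 has_real_derivative a1 * o1 * (\<rho> * (o1 * v1 t)) + a2 * o2 * (\<rho> * (o2 * v2 t))) (at t)"
          unfolding n1_def[abs_def] by (auto intro!: derivative_eq_intros D)
        thus ?thesis by (simp add: m3_def power2_eq_square algebra_simps)
      qed
      have Dm3: "(m3 has_real_derivative \<rho> * (- n3 t - \<gamma> * b * f t)) (at t)"
      proof -
        have "(m3 has_real_derivative a1 * o1\<^sup>2 * (\<rho> * (- o1 * w1 t - \<gamma> * a1 * f t)) + a2 * o2\<^sup>2 * (\<rho> * (- o2 * w2 t - \<gamma> * a2 * f t))) (at t)"
          unfolding m3_def[abs_def] by (auto intro!: derivative_eq_intros D)
        also have "a1 * o1\<^sup>2 * (\<rho> * (- o1 * w1 t - \<gamma> * a1 * f t)) + a2 * o2\<^sup>2 * (\<rho> * (- o2 * w2 t - \<gamma> * a2 * f t)) = \<rho> * (- n3 t - \<gamma> * b * f t)"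
          by (simp add: n3_def b_def power2_eq_square power3_eq_cube algebra_simps)
        finally show ?thesis .
      qed
      \<comment> \<open>The chain closes here: o1^2 and o2^2 are the roots of X^2 - s X + d, so the
        moment of order four is a combination of m3 and m1.\<close>
      have Dn3: "(n3 has_real_derivative \<rho> * (s * m3 t - d * m1 t)) (at t)"
      proof -
        have "(n3 has_real_derivative a1 * o1^3 * (\<rho> * (o1 * v1 t)) + a2 * o2^3 * (\<rho> * (o2 * v2 t))) (at t)"
          unfolding n3_def[abs_def] by (auto intro!: derivative_eq_intros D)
        also have "a1 * o1^3 * (\<rho> * (o1 * v1 t)) + a2 * o2^3 * (\<rho> * (o2 * v2 t)) = \<rho> * (s * m3 t - d * m1 t)"
          by (simp add: m1_def m3_def s_def d_def power2_eq_square power3_eq_cube algebra_simps)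
        finally show ?thesis .
      qed
      have DE: "((\<lambda>t. E t / 2) has_real_derivative \<rho> * (- h * (f t)\<^sup>2)) (at t)"
      proof -
        have "((\<lambda>t. E t / 2) has_real_derivative v1 t * (\<rho> * (- o1 * w1 t - \<gamma> * a1 * f t)) + v2 t * (\<rho> * (- o2 * w2 t - \<gamma> * a2 * f t))
            + w1 t * (\<rho> * (o1 * v1 t)) + w2 t * (\<rho> * (o2 * v2 t)) + f t * (\<rho> * (- h * f t + \<gamma> * m1 t))) (at t)"
          unfolding E_def[abs_def] by (auto intro!: derivative_eq_intros D)
        also have "v1 t * (\<rho> * (- o1 * w1 t - \<gamma> * a1 * f t)) + v2 t * (\<rho> * (- o2 * w2 t - \<gamma> * a2 * f t))
            + w1 t * (\<rho> * (o1 * v1 t)) + w2 t * (\<rho> * (o2 * v2 t)) + f t * (\<rho> * (- h * f t + \<gamma> * m1 t)) = \<rho> * (- h * (f t)\<^sup>2)"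
          by (simp add: m1_def power2_eq_square algebra_simps)
        finally show ?thesis .
      qed
      have DZ: "(Z has_real_derivative \<rho> * dZ t) (at t)"
      proof -
        have X0: "((\<lambda>t. f t * m1 t) has_real_derivative \<rho> * (\<gamma> * (m1 t)\<^sup>2 - \<gamma> * (f t)\<^sup>2 - f t * n1 t - h * f t * m1 t)) (at t)"
          by (rule DERIV_cong[OF DERIV_mult[OF D(5) Dm1]]) (simp add: power2_eq_square algebra_simps)
        have X1: "((\<lambda>t. m1 t * n1 t) has_real_derivative \<rho> * (- (n1 t)\<^sup>2 - \<gamma> * f t * n1 t + m1 t * m3 t)) (at t)"
          by (rule DERIV_cong[OF DERIV_mult[OF Dm1 Dn1]]) (simp add: power2_eq_square algebra_simps)
        have X2: "((\<lambda>t. n1 t * m3 t) has_real_derivative \<rho> * ((m3 t)\<^sup>2 - n1 t * n3 t - \<gamma> * b * f t * n1 t)) (at t)"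
          by (rule DERIV_cong[OF DERIV_mult[OF Dn1 Dm3]]) (simp add: power2_eq_square algebra_simps)
        have X3: "((\<lambda>t. m3 t * n3 t) has_real_derivative \<rho> * (- (n3 t)\<^sup>2 - \<gamma> * b * f t * n3 t + s * (m3 t)\<^sup>2 - d * m1 t * m3 t)) (at t)"
          by (rule DERIV_cong[OF DERIV_mult[OF Dm3 Dn3]]) (simp add: power2_eq_square algebra_simps)
        have e: "g * (\<rho> * x0) + p * (\<rho> * x1) - q * (\<rho> * x2) + r * (\<rho> * x3) = \<rho> * (g * x0 + p * x1 - q * x2 + r * x3)" for g p q r x0 x1 x2 x3
          by (simp add: algebra_simps)
        show ?thesis unfolding Z_def[abs_def] dZ_def e[symmetric]
          by (intro DERIV_add DERIV_diff DERIV_cmult X0 X1 X2 X3)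
      qed
      show ?thesis unfolding L_def[abs_def]
        by (rule DERIV_cong[OF DERIV_add[OF DERIV_cmult[OF DE] DERIV_cmult[OF DZ]]]) (simp add: algebra_simps)
    qed
    have E0: "E t \<ge> 0" for t by (simp add: E_def)
    have QE: "(f t)\<^sup>2 + Q t \<le> 4 * M^6 * E t" for t
    proof -
      \<comment> \<open>The Cauchy-Schwarz inequality for the unit vector (a1, a2), by Lagrange's
        identity.\<close>
      have cs: "(a1 * x * u + a2 * y * w)\<^sup>2 \<le> B\<^sup>2 * (u\<^sup>2 + w\<^sup>2)" if "0 \<le> x" "x \<le> B" "0 \<le> y" "y \<le> B" for x y u w B
      proof -
        have "(a1\<^sup>2 + a2\<^sup>2) * ((x * u)\<^sup>2 + (y * w)\<^sup>2) - (a1 * x * u + a2 * y * w)\<^sup>2 = (a1 * (y * w) - a2 * (x * u))\<^sup>2"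
          by (simp add: power2_eq_square algebra_simps)
        hence "(a1 * x * u + a2 * y * w)\<^sup>2 \<le> (x * u)\<^sup>2 + (y * w)\<^sup>2"
          unfolding a by (smt (verit) zero_le_power2)
        also have "\<dots> = x\<^sup>2 * u\<^sup>2 + y\<^sup>2 * w\<^sup>2" by (simp add: power_mult_distrib)
        also have "\<dots> \<le> B\<^sup>2 * u\<^sup>2 + B\<^sup>2 * w\<^sup>2" using that by (intro add_mono mult_right_mono power_mono) auto
        finally show ?thesis by (simp add: distrib_left)
      qed
      have M6: "(M^k)\<^sup>2 \<le> M^6" if "k \<le> 3" for k
        unfolding power_mult[symmetric] using M that by (intro power_increasing) auto
      have le: "B\<^sup>2 * z \<le> M^6 * z" if "B = M^k" "k \<le> 3" "z \<ge> 0" for B k z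
        using M6[OF that(2)] that by (intro mult_right_mono) auto
      have A: "(m1 t)\<^sup>2 \<le> M^6 * ((v1 t)\<^sup>2 + (v2 t)\<^sup>2)"
        using cs[of 1 "M^0" 1 "v1 t" "v2 t"] le[of "M^0" 0 "(v1 t)\<^sup>2 + (v2 t)\<^sup>2"] by (simp add: m1_def)
      have B: "(n1 t)\<^sup>2 \<le> M^6 * ((w1 t)\<^sup>2 + (w2 t)\<^sup>2)"
        using cs[of o1 "M^1" o2 "w1 t" "w2 t"] le[of "M^1" 1 "(w1 t)\<^sup>2 + (w2 t)\<^sup>2"] op o1 o2 by (simp add: n1_def)
      have C: "(m3 t)\<^sup>2 \<le> M^6 * ((v1 t)\<^sup>2 + (v2 t)\<^sup>2)"
        using cs[of "o1^2" "M^2" "o2^2" "v1 t" "v2 t"] le[of "M^2" 2 "(v1 t)\<^sup>2 + (v2 t)\<^sup>2"] ok[of 2] by (simp add: m3_def)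
      have D: "(n3 t)\<^sup>2 \<le> M^6 * ((w1 t)\<^sup>2 + (w2 t)\<^sup>2)"
        using cs[of "o1^3" "M^3" "o2^3" "w1 t" "w2 t"] le[of "M^3" 3 "(w1 t)\<^sup>2 + (w2 t)\<^sup>2"] ok[of 3] op by (simp add: n3_def)
      have F: "(f t)\<^sup>2 \<le> M^6 * (f t)\<^sup>2" using mult_right_mono[OF Mp[of 6], of "(f t)\<^sup>2"] by simp
      have "4 * M^6 * E t = 4 * (M^6 * ((v1 t)\<^sup>2 + (v2 t)\<^sup>2)) + 4 * (M^6 * ((w1 t)\<^sup>2 + (w2 t)\<^sup>2)) + 4 * (M^6 * (f t)\<^sup>2)"
        by (simp add: E_def algebra_simps)
      moreover have "0 \<le> (f t)\<^sup>2" "0 \<le> M^6 * ((v1 t)\<^sup>2 + (v2 t)\<^sup>2)" "0 \<le> M^6 * ((w1 t)\<^sup>2 + (w2 t)\<^sup>2)" using Mp[of 6] by auto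
      ultimately show ?thesis using A B C D F unfolding Q_def by linarith
    qed
    have ZE: "\<bar>Z t\<bar> \<le> 4 * C2 * E t" for t
    proof -
      have xy: "\<bar>k * (x * y)\<bar> \<le> B * ((f t)\<^sup>2 + Q t)" if "\<bar>k\<bar> \<le> B" "x\<^sup>2 + y\<^sup>2 \<le> (f t)\<^sup>2 + Q t" for k x y B
      proof -
        have "2 * \<bar>x * y\<bar> \<le> x\<^sup>2 + y\<^sup>2" using sum_squares_bound[of "\<bar>x\<bar>" "\<bar>y\<bar>"]
          by (simp add: abs_mult)
        hence "\<bar>x * y\<bar> \<le> x\<^sup>2 + y\<^sup>2" using abs_ge_zero[of "x * y"] by linarith
        hence "\<bar>k\<bar> * \<bar>x * y\<bar> \<le> B * ((f t)\<^sup>2 + Q t)" using that by (intro mult_mono) auto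
        thus ?thesis by (simp add: abs_mult)
      qed
      have dk: "\<bar>\<delta>^k\<bar> \<le> 1" for k using \<delta> by (simp add: power_le_one)
      have "\<bar>(- \<gamma>) * (f t * m1 t)\<bar> \<le> \<bar>\<gamma>\<bar> * ((f t)\<^sup>2 + Q t)" by (rule xy) (auto simp: Q_def)
      moreover have "\<bar>\<delta>^3 * (m1 t * n1 t)\<bar> \<le> 1 * ((f t)\<^sup>2 + Q t)" by (rule xy[OF dk]) (auto simp: Q_def)
      moreover have "\<bar>\<delta>^5 * (n1 t * m3 t)\<bar> \<le> 1 * ((f t)\<^sup>2 + Q t)" by (rule xy[OF dk]) (auto simp: Q_def)
      moreover have "\<bar>\<delta>^6 * (m3 t * n3 t)\<bar> \<le> 1 * ((f t)\<^sup>2 + Q t)" by (rule xy[OF dk]) (auto simp: Q_def)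
      ultimately have "\<bar>Z t\<bar> \<le> \<bar>\<gamma>\<bar> * ((f t)\<^sup>2 + Q t) + 3 * ((f t)\<^sup>2 + Q t)" unfolding Z_def by linarith
      also have "\<dots> = (\<bar>\<gamma>\<bar> + 3) * ((f t)\<^sup>2 + Q t)" by (simp add: distrib_right)
      also have "\<dots> \<le> (\<bar>\<gamma>\<bar> + 3) * (4 * M^6 * E t)" using QE by (intro mult_left_mono) auto
      finally show ?thesis by (simp add: C2_def mult_ac)
    qed
    show "(v1 t)\<^sup>2 + (v2 t)\<^sup>2 + (w1 t)\<^sup>2 + (w2 t)\<^sup>2 + (f t)\<^sup>2
        \<le> 4 * exp (- c * t * (\<rho>\<^sup>2 / (1 + \<rho>\<^sup>2)) * min (a1\<^sup>2) (a2\<^sup>2)) *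
            ((v1 0)\<^sup>2 + (v2 0)\<^sup>2 + (w1 0)\<^sup>2 + (w2 0)\<^sup>2 + (f 0)\<^sup>2)"
    proof -
      \<comment> \<open>The moments determine a_j v_j and a_j o_j w_j, not the modes themselves.
        Instead of dividing by a_j^2, which may vanish, the factor \<sigma> \<le> a_j^2 is kept on
        the left.\<close>
      have coer: "\<sigma> * E t \<le> C3 * ((f t)\<^sup>2 + Q t)" for t
      proof -
        have gap2: "m\<^sup>2 \<le> (o1\<^sup>2 - o2\<^sup>2)\<^sup>2"
          using gap m by (simp add: abs_le_square_iff[symmetric])
        \<comment> \<open>Cramer's rule for two nodes: for instance (o1^2 - o2^2) a1 v1 = m3 - o2^2
          m1. The sign \<open>e = -1\<close> serves the case with exchanged indices.\<close>
        have sq: "x\<^sup>2 * m\<^sup>2 \<le> 2 * y3\<^sup>2 + 2 * M^4 * y1\<^sup>2"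
          if "x * (o1\<^sup>2 - o2\<^sup>2) = e * (y3 - z * y1)" "e\<^sup>2 = 1" "\<bar>z\<bar> \<le> M\<^sup>2" for x e z y1 y3
        proof -
          have "x\<^sup>2 * m\<^sup>2 \<le> x\<^sup>2 * (o1\<^sup>2 - o2\<^sup>2)\<^sup>2" by (intro mult_left_mono gap2) simp
          also have "\<dots> = (e * (y3 - z * y1))\<^sup>2" by (simp add: that(1)[symmetric] power_mult_distrib)
          also have "\<dots> = (y3 - z * y1)\<^sup>2" by (simp add: power_mult_distrib that(2))
          also have "\<dots> \<le> 2 * y3\<^sup>2 + 2 * (z * y1)\<^sup>2"
          proof -
            have "2 * y3\<^sup>2 + 2 * (z * y1)\<^sup>2 - (y3 - z * y1)\<^sup>2 = (y3 + z * y1)\<^sup>2"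
              by (simp add: power2_eq_square algebra_simps)
            thus ?thesis by (smt (verit) zero_le_power2)
          qed
          also have "2 * (z * y1)\<^sup>2 \<le> 2 * M^4 * y1\<^sup>2"
          proof -
            have "\<bar>z\<bar>\<^sup>2 \<le> (M\<^sup>2)\<^sup>2" using that(3) by (intro power_mono) auto
            hence "z\<^sup>2 \<le> M^4" by simp
            hence "z\<^sup>2 * y1\<^sup>2 \<le> M^4 * y1\<^sup>2" by (intro mult_right_mono) auto
            thus ?thesis by (simp add: power_mult_distrib)
          qed
          finally show ?thesis by simp
        qed
        have oz: "\<bar>o1\<^sup>2\<bar> \<le> M\<^sup>2" "\<bar>o2\<^sup>2\<bar> \<le> M\<^sup>2" using ok[of 2] by auto
        have V1: "(a1 * v1 t)\<^sup>2 * m\<^sup>2 \<le> 2 * (m3 t)\<^sup>2 + 2 * M^4 * (m1 t)\<^sup>2"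
          by (rule sq[of _ 1 _ "o2\<^sup>2"]) (use oz in \<open>auto simp: m3_def m1_def algebra_simps\<close>)
        have V2: "(a2 * v2 t)\<^sup>2 * m\<^sup>2 \<le> 2 * (m3 t)\<^sup>2 + 2 * M^4 * (m1 t)\<^sup>2"
          by (rule sq[of _ "-1" _ "o1\<^sup>2"]) (use oz in \<open>auto simp: m3_def m1_def algebra_simps\<close>)
        have W1: "(a1 * o1 * w1 t)\<^sup>2 * m\<^sup>2 \<le> 2 * (n3 t)\<^sup>2 + 2 * M^4 * (n1 t)\<^sup>2"
          by (rule sq[of _ 1 _ "o2\<^sup>2"]) (use oz in \<open>auto simp: n3_def n1_def power2_eq_square power3_eq_cube algebra_simps\<close>)
        have W2: "(a2 * o2 * w2 t)\<^sup>2 * m\<^sup>2 \<le> 2 * (n3 t)\<^sup>2 + 2 * M^4 * (n1 t)\<^sup>2"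
          by (rule sq[of _ "-1" _ "o1\<^sup>2"]) (use oz in \<open>auto simp: n3_def n1_def power2_eq_square power3_eq_cube algebra_simps\<close>)
        have mp: "m\<^sup>2 > 0" using m by simp
        have om: "m\<^sup>2 \<le> o1\<^sup>2" "m\<^sup>2 \<le> o2\<^sup>2" using m o1 o2 by (auto intro!: power_mono)
        have up: "\<sigma> * v\<^sup>2 \<le> (2 + 2 * M^4) / m\<^sup>2 * (y3 + y1)"
          if "\<sigma> \<le> a\<^sup>2" "(a * v)\<^sup>2 * m\<^sup>2 \<le> 2 * y3 + 2 * M^4 * y1" "y3 \<ge> 0" "y1 \<ge> 0" for a v y1 y3
        proof -
          have "\<sigma> * v\<^sup>2 * m\<^sup>2 \<le> a\<^sup>2 * v\<^sup>2 * m\<^sup>2" using that(1) by (intro mult_right_mono) auto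
          also have "\<dots> \<le> 2 * y3 + 2 * M^4 * y1" using that(2) by (simp add: power_mult_distrib)
          also have "\<dots> \<le> (2 + 2 * M^4) * (y3 + y1)"
            using that(3,4) Mp[of 4] by (simp add: algebra_simps)
          finally show ?thesis using mp by (simp add: field_simps)
        qed
        have upw: "\<sigma> * w\<^sup>2 \<le> (2 + 2 * M^4) / (m\<^sup>2 * m\<^sup>2) * (y3 + y1)"
          if "\<sigma> \<le> a\<^sup>2" "(a * o' * w)\<^sup>2 * m\<^sup>2 \<le> 2 * y3 + 2 * M^4 * y1" "y3 \<ge> 0" "y1 \<ge> 0" "m\<^sup>2 \<le> o'\<^sup>2" for a o' w y1 y3
        proof -
          have "\<sigma> * (m * w)\<^sup>2 \<le> (2 + 2 * M^4) / m\<^sup>2 * (y3 + y1)"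
          proof (rule up[OF that(1) _ that(3,4)])
            have "(a * (m * w))\<^sup>2 * m\<^sup>2 = a\<^sup>2 * w\<^sup>2 * m\<^sup>2 * m\<^sup>2" by (simp add: power_mult_distrib)
            also have "\<dots> \<le> a\<^sup>2 * w\<^sup>2 * m\<^sup>2 * o'\<^sup>2" using that(5) by (intro mult_left_mono) auto
            also have "\<dots> = (a * o' * w)\<^sup>2 * m\<^sup>2" by (simp add: power_mult_distrib)
            finally show "(a * (m * w))\<^sup>2 * m\<^sup>2 \<le> 2 * y3 + 2 * M^4 * y1" using that(2) by linarith
          qed
          thus ?thesis using mp by (simp add: field_simps power_mult_distrib)
        qed
        define A where "A = (4 + 4 * M^4) / m\<^sup>2"
        define B where "B = (4 + 4 * M^4) / (m\<^sup>2 * m\<^sup>2)"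
        have AB: "A \<ge> 0" "B \<ge> 0" using Mp[of 4] by (auto simp: A_def B_def)
        have A2: "(2 + 2 * M^4) / m\<^sup>2 = A / 2" using m by (simp add: A_def field_simps)
        have B2: "(2 + 2 * M^4) / (m\<^sup>2 * m\<^sup>2) = B / 2" using m by (simp add: B_def field_simps)
        have "\<sigma> * (v1 t)\<^sup>2 + \<sigma> * (v2 t)\<^sup>2 \<le> A * ((m3 t)\<^sup>2 + (m1 t)\<^sup>2)"
          using up[OF \<sigma>1(1) V1] up[OF \<sigma>1(2) V2] unfolding A2 by simp
        moreover have "\<sigma> * (w1 t)\<^sup>2 + \<sigma> * (w2 t)\<^sup>2 \<le> B * ((n3 t)\<^sup>2 + (n1 t)\<^sup>2)"
          using upw[OF \<sigma>1(1) W1 _ _ om(1)] upw[OF \<sigma>1(2) W2 _ _ om(2)] unfolding B2 by simp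
        moreover have "\<sigma> * (f t)\<^sup>2 \<le> (f t)\<^sup>2" using mult_right_mono[OF \<sigma>1(3), of "(f t)\<^sup>2"] by simp
        moreover have "\<sigma> * E t = (\<sigma> * (v1 t)\<^sup>2 + \<sigma> * (v2 t)\<^sup>2) + (\<sigma> * (w1 t)\<^sup>2 + \<sigma> * (w2 t)\<^sup>2) + \<sigma> * (f t)\<^sup>2"
          by (simp add: E_def algebra_simps)
        moreover have "C3 * ((f t)\<^sup>2 + Q t) = A * ((m3 t)\<^sup>2 + (m1 t)\<^sup>2) + B * ((n3 t)\<^sup>2 + (n1 t)\<^sup>2) + (f t)\<^sup>2
            + (A * ((n3 t)\<^sup>2 + (n1 t)\<^sup>2) + B * ((m3 t)\<^sup>2 + (m1 t)\<^sup>2) + (A + B) * (f t)\<^sup>2 + Q t)"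
          unfolding C3_def A_def[symmetric] B_def[symmetric] Q_def by (simp add: algebra_simps)
        moreover have "A * ((n3 t)\<^sup>2 + (n1 t)\<^sup>2) + B * ((m3 t)\<^sup>2 + (m1 t)\<^sup>2) + (A + B) * (f t)\<^sup>2 + Q t \<ge> 0"
          using AB unfolding Q_def by (intro add_nonneg_nonneg mult_nonneg_nonneg) auto
        ultimately show ?thesis by linarith
      qed
      have \<eta>Z: "\<bar>\<eta> * Z t\<bar> \<le> 4 * C2 * E t" for t
      proof -
        have "\<bar>\<eta> * Z t\<bar> \<le> 1 * \<bar>Z t\<bar>" unfolding abs_mult using \<eta>0 \<eta>1 by (intro mult_right_mono) auto
        thus ?thesis using ZE[of t] by simp
      qed
      have CK: "16 * C2 \<le> K" using C1 c1 by (simp add: K_def)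
      have CE: "16 * (C2 * E t) \<le> K * E t" for t using mult_right_mono[OF CK E0[of t]] by simp
      have Llow: "K * E t \<le> 4 * L t" for t using \<eta>Z[of t] CE[of t] unfolding L_def by (simp add: abs_le_iff)
      have Lup: "L t \<le> K * E t" for t
      proof -
        have "0 \<le> K * E t" using K E0[of t] by simp
        thus ?thesis using \<eta>Z[of t] CE[of t] unfolding L_def by (simp add: abs_le_iff)
      qed
      define l where "l = c4 * (\<rho> * \<eta>) * \<sigma>"
      have le: "\<rho> * (K * (- h * (f t)\<^sup>2) + \<eta> * dZ t) \<le> - l * L t" for t
      proof -
        have "\<eta> * dZ t \<le> \<eta> * (- c1 * Q t + C1 * (1 + h\<^sup>2) * (f t)\<^sup>2)"
          using \<eta>0 dz by (intro mult_left_mono) auto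
        also have "\<dots> = - c1 * (\<eta> * Q t) + C1 * (f t)\<^sup>2 * (\<eta> * (1 + h\<^sup>2))" by (simp add: algebra_simps)
        also have "\<dots> = - c1 * (\<eta> * Q t) + C1 * (h * (f t)\<^sup>2)" unfolding \<eta>h by simp
        finally have "K * (- h * (f t)\<^sup>2) + \<eta> * dZ t \<le> - c1 * (\<eta> * Q t) - (K - C1) * (h * (f t)\<^sup>2)"
          by (simp add: algebra_simps)
        also have "\<dots> \<le> - c1 * (\<eta> * Q t) - c1 * (\<eta> * (f t)\<^sup>2)"
        proof -
          have "c1 * (\<eta> * (f t)\<^sup>2) \<le> (K - C1) * (h * (f t)\<^sup>2)"
            using c1 C2 \<eta>0 \<eta>h' h by (intro mult_mono mult_right_mono) (auto simp: K_def)
          thus ?thesis by simp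
        qed
        also have "\<dots> = - (c1 * \<eta> * ((f t)\<^sup>2 + Q t))" by (simp add: algebra_simps)
        also have "\<dots> \<le> - (c1 * \<eta> * (\<sigma> * E t / C3))"
        proof -
          have "\<sigma> * E t / C3 \<le> (f t)\<^sup>2 + Q t" using coer[of t] C3 by (simp add: pos_divide_le_eq mult.commute)
          hence "c1 * \<eta> * (\<sigma> * E t / C3) \<le> c1 * \<eta> * ((f t)\<^sup>2 + Q t)"
            using c1 \<eta>0 by (intro mult_left_mono) auto
          thus ?thesis by (simp only: neg_le_iff_le)
        qed
        also have "\<dots> \<le> - (c1 * \<eta> * (\<sigma> * (L t / K) / C3))"
        proof -
          have "L t / K \<le> E t" using Lup[of t] K by (simp add: pos_divide_le_eq mult.commute)
          hence "\<sigma> * (L t / K) / C3 \<le> \<sigma> * E t / C3" using \<sigma>0 C3 by (intro divide_right_mono mult_left_mono) auto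
          hence "c1 * \<eta> * (\<sigma> * (L t / K) / C3) \<le> c1 * \<eta> * (\<sigma> * E t / C3)"
            using c1 \<eta>0 by (intro mult_left_mono) auto
          thus ?thesis by (simp only: neg_le_iff_le)
        qed
        also have "\<dots> = - (c4 * \<eta> * \<sigma> * L t)" by (simp add: c4_def mult_ac)
        finally have "\<rho> * (K * (- h * (f t)\<^sup>2) + \<eta> * dZ t) \<le> \<rho> * (- (c4 * \<eta> * \<sigma> * L t))"
          using \<rho> by (intro mult_left_mono) auto
        thus ?thesis by (simp add: l_def mult_ac)
      qed
      have Lc: "continuous_on {0..} L"
        unfolding L_def[abs_def] E_def[abs_def] Z_def[abs_def] m1_def[abs_def] n1_def[abs_def] m3_def[abs_def] n3_def[abs_def]
        by (intro continuous_intros cont) auto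
      have "L t \<le> exp (- l * t) * L 0"
        by (rule exponential_decay[OF Lc DL le t])
      also have "\<dots> \<le> exp (- l * t) * (K * E 0)" by (intro mult_left_mono Lup) simp
      finally have "K * E t \<le> 4 * (exp (- l * t) * (K * E 0))" using Llow[of t] by linarith
      also have "\<dots> = K * (4 * exp (- l * t) * E 0)" by simp
      finally have "K * E t \<le> K * (4 * exp (- l * t) * E 0)" .
      hence Et: "E t \<le> 4 * exp (- l * t) * E 0" using K by simp
      have "(\<kappa> / (1 + \<kappa>\<^sup>2)) * (\<rho>\<^sup>2 / (1 + \<rho>\<^sup>2)) \<le> \<rho> * \<eta>"
      proof -
        have "1 + h\<^sup>2 \<le> (1 + \<kappa>\<^sup>2) * (1 + \<rho>\<^sup>2)" by (simp add: h_def power_mult_distrib algebra_simps)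
        hence "(\<kappa> * \<rho>\<^sup>2) / ((1 + \<kappa>\<^sup>2) * (1 + \<rho>\<^sup>2)) \<le> (\<kappa> * \<rho>\<^sup>2) / (1 + h\<^sup>2)"
          using \<kappa> h2 by (intro divide_left_mono mult_pos_pos) (auto simp: add_pos_nonneg)
        thus ?thesis by (simp add: \<eta>_def h_def power2_eq_square mult_ac)
      qed
      hence "c4 * \<sigma> * t * ((\<kappa> / (1 + \<kappa>\<^sup>2)) * (\<rho>\<^sup>2 / (1 + \<rho>\<^sup>2))) \<le> c4 * \<sigma> * t * (\<rho> * \<eta>)"
        using c4 \<sigma>0 t by (intro mult_left_mono) auto
      hence "- l * t \<le> - c * t * (\<rho>\<^sup>2 / (1 + \<rho>\<^sup>2)) * \<sigma>" by (simp add: l_def c_def mult_ac)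
      hence "4 * exp (- l * t) * E 0 \<le> 4 * exp (- c * t * (\<rho>\<^sup>2 / (1 + \<rho>\<^sup>2)) * \<sigma>) * E 0"
        using E0[of 0] by (intro mult_right_mono mult_left_mono) auto
      with Et have "E t \<le> 4 * exp (- c * t * (\<rho>\<^sup>2 / (1 + \<rho>\<^sup>2)) * \<sigma>) * E 0" by linarith
      thus ?thesis unfolding E_def \<sigma>_def .
    qed
  qed
qed

section \<open>Gaussian weights degenerate along a line\<close>

lemma powr_minus_half:
  fixes x :: real
  assumes "0 < x"
  shows "x powr (- 1 / 2) = 1 / sqrt x"
proof -
  have "x powr (- 1 / 2) * x powr (1 / 2) = x powr 0" unfolding powr_add[symmetric] by simp
  hence "x powr (- 1 / 2) * sqrt x = 1" using assms by (simp add: powr_half_sqrt)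
  thus ?thesis using assms by (simp add: eq_divide_eq)
qed

text \<open>Outside [-1, 1] the integrand is at most |y|^(-2a), and 2a > 1.\<close>

lemma nn_integral_japanese_line:
  fixes a :: real
  assumes a: "a > 1 / 2"
  shows "(\<integral>\<^sup>+y. ennreal ((1 + y\<^sup>2) powr (- a)) \<partial>lborel) < \<infinity>"
proof -
  have one: "1 + (y::real)\<^sup>2 \<ge> 1" for y by simp
  have tail: "(\<integral>\<^sup>+y. ennreal (indicator {1..} y * y powr (- 2 * a)) \<partial>lborel) = ennreal (- (1 powr (- 2 * a + 1)) / (- 2 * a + 1))"
    by (intro nn_integral_has_integral_lebesgue has_integral_powr_to_inf) (use a in auto)
  have refl: "(\<integral>\<^sup>+y. ennreal (indicator {1..} (- y) * (- y) powr (- 2 * a)) \<partial>lborel) = (\<integral>\<^sup>+y. ennreal (indicator {1..} y * y powr (- 2 * a)) \<partial>lborel)"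
    by (subst nn_integral_real_affine[where c = "-1" and t = 0]) auto
  have pt: "ennreal ((1 + y\<^sup>2) powr (- a)) \<le> indicator {-1..1} y + (ennreal (indicator {1..} y * y powr (- 2 * a)) + ennreal (indicator {1..} (- y) * (- y) powr (- 2 * a)))" for y :: real
  proof -
    have big: "(1 + y\<^sup>2) powr (- a) \<le> \<bar>y\<bar> powr (- 2 * a)" if "\<bar>y\<bar> \<ge> 1"
    proof -
      have "(1 + y\<^sup>2) powr (- a) \<le> (\<bar>y\<bar>\<^sup>2) powr (- a)"
        using that a by (intro powr_mono2') auto
      also have "\<dots> = \<bar>y\<bar> powr (- 2 * a)"
      proof -
        have "\<bar>y\<bar> > 0" using that by linarith
        hence e: "\<bar>y\<bar> powr 2 = \<bar>y\<bar>\<^sup>2" by (subst powr_numeral) auto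
        have "2 * - a = - 2 * a" by simp
        thus ?thesis unfolding e[symmetric] powr_powr by (simp only:)
      qed
      finally show ?thesis .
    qed
    consider "y > 1" | "y < -1" | "\<bar>y\<bar> \<le> 1" by linarith
    thus ?thesis
    proof cases
      case 1 thus ?thesis using big by (simp add: ennreal_leI)
    next
      case 2 thus ?thesis using big by (simp add: ennreal_leI)
    next
      case 3
      have "(1 + y\<^sup>2) powr (- a) \<le> (1 + y\<^sup>2) powr 0" using a by (intro powr_mono) auto
      moreover have "1 + y\<^sup>2 \<noteq> 0" using one[of y] by linarith
      ultimately have "(1 + y\<^sup>2) powr (- a) \<le> 1" by simp
      hence "ennreal ((1 + y\<^sup>2) powr (- a)) \<le> indicator {-1..1} y" using 3 by (simp add: abs_le_iff indicator_def)
      thus ?thesis by (rule order_trans) simp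
    qed
  qed
  have "(\<integral>\<^sup>+y. ennreal ((1 + y\<^sup>2) powr (- a)) \<partial>lborel) \<le> (\<integral>\<^sup>+y. indicator {-1..1} y + (ennreal (indicator {1..} y * y powr (- 2 * a)) + ennreal (indicator {1..} (- y) * (- y) powr (- 2 * a))) \<partial>lborel)"
    by (intro nn_integral_mono pt)
  also have "\<dots> = (\<integral>\<^sup>+y. indicator {-1..1} y \<partial>(lborel::real measure)) + ((\<integral>\<^sup>+y. ennreal (indicator {1..} y * y powr (- 2 * a)) \<partial>lborel) + (\<integral>\<^sup>+y. ennreal (indicator {1..} (- y) * (- y) powr (- 2 * a)) \<partial>lborel))"
  proof -
    have [measurable]: "(\<lambda>y. ennreal (indicator {1..} (- y) * (- y) powr (- 2 * a))) \<in> borel_measurable borel"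
      using measurable_compose[of "\<lambda>y::real. - y" borel borel "\<lambda>y. ennreal (indicator {1..} y * y powr (- 2 * a))"] by simp
    show ?thesis by (subst nn_integral_add; (subst nn_integral_add)?; simp)
  qed
  also have "\<dots> < \<infinity>" unfolding refl tail by (simp add: ennreal_add_eq_top less_top)
  finally show ?thesis .
qed

text \<open>Substitution by s Y / k. The factor 1 / k will carry the decay in time, as k^2 is going
  to be proportional to 1 + t.\<close>

lemma nn_integral_lorentz:
  fixes k Y :: real
  assumes k: "k > 0" and Y: "Y > 0"
  shows "(\<integral>\<^sup>+s. ennreal (1 / (Y\<^sup>2 + k\<^sup>2 * s\<^sup>2)) \<partial>lborel) = ennreal (1 / (Y * k)) * (\<integral>\<^sup>+s. ennreal ((1 + s\<^sup>2) powr (- 1)) \<partial>lborel)"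
proof -
  have "(\<integral>\<^sup>+s. ennreal (1 / (Y\<^sup>2 + k\<^sup>2 * s\<^sup>2)) \<partial>lborel) = ennreal \<bar>Y / k\<bar> * (\<integral>\<^sup>+s. ennreal (1 / (Y\<^sup>2 + k\<^sup>2 * (0 + (Y / k) * s)\<^sup>2)) \<partial>lborel)"
    using k Y by (intro nn_integral_real_affine) auto
  also have "(\<lambda>s. ennreal (1 / (Y\<^sup>2 + k\<^sup>2 * (0 + (Y / k) * s)\<^sup>2))) = (\<lambda>s. ennreal (1 / Y\<^sup>2) * ennreal ((1 + s\<^sup>2) powr (- 1)))"
  proof
    fix s :: real
    have "1 + s\<^sup>2 > 0" by (simp add: add_pos_nonneg)
    hence "(1 + s\<^sup>2) powr (- 1) = 1 / (1 + s\<^sup>2)" by (simp add: powr_minus_divide)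
    moreover have "Y\<^sup>2 + k\<^sup>2 * (0 + (Y / k) * s)\<^sup>2 = Y\<^sup>2 * (1 + s\<^sup>2)" using k by (simp add: power_mult_distrib power_divide distrib_left)
    ultimately show "ennreal (1 / (Y\<^sup>2 + k\<^sup>2 * (0 + (Y / k) * s)\<^sup>2)) = ennreal (1 / Y\<^sup>2) * ennreal ((1 + s\<^sup>2) powr (- 1))"
      by (simp flip: ennreal_mult')
  qed
  also have "(\<integral>\<^sup>+s. ennreal (1 / Y\<^sup>2) * ennreal ((1 + s\<^sup>2) powr (- 1)) \<partial>lborel) = ennreal (1 / Y\<^sup>2) * (\<integral>\<^sup>+s. ennreal ((1 + s\<^sup>2) powr (- 1)) \<partial>lborel)"
    by (rule nn_integral_cmult) measurable
  also have "ennreal \<bar>Y / k\<bar> * (ennreal (1 / Y\<^sup>2) * (\<integral>\<^sup>+s. ennreal ((1 + s\<^sup>2) powr (- 1)) \<partial>lborel)) = ennreal (1 / (Y * k)) * (\<integral>\<^sup>+s. ennreal ((1 + s\<^sup>2) powr (- 1)) \<partial>lborel)"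
  proof -
    have "ennreal \<bar>Y / k\<bar> * ennreal (1 / Y\<^sup>2) = ennreal (1 / (Y * k))"
      using k Y by (simp add: power2_eq_square flip: ennreal_mult')
    thus ?thesis by (simp flip: mult.assoc)
  qed
  finally show ?thesis .
qed

text \<open>The bound behind the rate \<open>t\<close> to the power \<open>- 1 / 2\<close>: for fixed \<open>y\<close> the weight
  concentrates on \<open>s\<close> of size \<open>t\<close> to the power \<open>- 1 / 2\<close> around the degenerate direction.\<close>

lemma degenerate_gauss_iterated:
  fixes c \<beta> :: real
  assumes c: "c > 0" and \<beta>: "\<beta> > 1"
  shows "\<exists>C>0. \<forall>t\<ge>0. (\<integral>\<^sup>+y. \<integral>\<^sup>+s. ennreal (exp (- c * t * s\<^sup>2 / (1 + s\<^sup>2 + y\<^sup>2)) * (1 + s\<^sup>2 + y\<^sup>2) powr (- \<beta>)) \<partial>lborel \<partial>lborel)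
     \<le> ennreal (C * (1 + t) powr (- 1 / 2))"
proof -
  define I where "I = (\<integral>\<^sup>+s. ennreal ((1 + (s::real)\<^sup>2) powr (- 1)) \<partial>lborel)"
  define J where "J = (\<integral>\<^sup>+s. ennreal ((1 + (s::real)\<^sup>2) powr (- (\<beta> - 1 / 2))) \<partial>lborel)"
  have I: "I < \<infinity>" unfolding I_def by (intro nn_integral_japanese_line) simp
  have J: "J < \<infinity>" unfolding J_def using \<beta> by (intro nn_integral_japanese_line) simp
  \<comment> \<open>Being below both 1 and c, it satisfies c' (1 + t) s^2 \<le> s^2 + c t s^2. This
    is how 1 + t takes the place of t, so that small times need no separate argument.\<close>
  define c' where "c' = min 1 c"
  have c': "c' > 0" "c' \<le> 1" "c' \<le> c" using c by (auto simp: c'_def)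
  define C where "C = enn2real (I * J) / sqrt c' + 1"
  have C: "C > 0" unfolding C_def using c' by (intro add_nonneg_pos) auto
  have IJ: "I * J = ennreal (enn2real (I * J))"
    using I J by (simp add: ennreal_mult_less_top)
  have "(\<integral>\<^sup>+y. \<integral>\<^sup>+s. ennreal (exp (- c * t * s\<^sup>2 / (1 + s\<^sup>2 + y\<^sup>2)) * (1 + s\<^sup>2 + y\<^sup>2) powr (- \<beta>)) \<partial>lborel \<partial>lborel)
     \<le> ennreal (C * (1 + t) powr (- 1 / 2))" if t: "t \<ge> 0" for t
  proof -
    define k where "k = sqrt (c' * (1 + t))"
    have k: "k > 0" and k2: "k\<^sup>2 = c' * (1 + t)" using c' t by (auto simp: k_def)
    \<comment> \<open>The inequality exp (-x) \<le> 1 / (1 + x) trades the Gaussian for a Lorentz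
      function of \<open>s\<close> at the cost of one power of 1 + s^2 + y^2. The remaining power
      has a negative exponent and is largest at s = 0.\<close>
    have pt: "exp (- c * t * s\<^sup>2 / (1 + s\<^sup>2 + y\<^sup>2)) * (1 + s\<^sup>2 + y\<^sup>2) powr (- \<beta>)
        \<le> (1 + y\<^sup>2) powr (1 - \<beta>) * (1 / ((sqrt (1 + y\<^sup>2))\<^sup>2 + k\<^sup>2 * s\<^sup>2))" for s y :: real
    proof -
      define R where "R = 1 + s\<^sup>2 + y\<^sup>2"
      have R: "R > 0" "1 + y\<^sup>2 \<le> R" "1 + y\<^sup>2 > 0" by (auto simp: R_def add_pos_nonneg)
      have "c * t * s\<^sup>2 / R \<ge> 0" using c t R by auto
      hence "exp (- (c * t * s\<^sup>2 / R)) \<le> inverse (1 + c * t * s\<^sup>2 / R)"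
        unfolding exp_minus by (intro le_imp_inverse_le exp_ge_add_one_self add_pos_nonneg) auto
      also have "\<dots> = R / (R + c * t * s\<^sup>2)"
      proof -
        have "1 + c * t * s\<^sup>2 / R = (R + c * t * s\<^sup>2) / R" using R by (simp add: add_divide_distrib)
        thus ?thesis by simp
      qed
      also have "\<dots> \<le> R / ((1 + y\<^sup>2) + k\<^sup>2 * s\<^sup>2)"
      proof (rule divide_left_mono)
        have "c' * s\<^sup>2 \<le> 1 * s\<^sup>2" using c' by (intro mult_right_mono) auto
        moreover have "c' * (t * s\<^sup>2) \<le> c * (t * s\<^sup>2)" using c' t by (intro mult_right_mono) auto
        ultimately show "(1 + y\<^sup>2) + k\<^sup>2 * s\<^sup>2 \<le> R + c * t * s\<^sup>2" unfolding k2 by (simp add: R_def algebra_simps)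
        have "k\<^sup>2 * s\<^sup>2 \<ge> 0" "c * t * s\<^sup>2 \<ge> 0" using c t by auto
        thus "0 < (R + c * t * s\<^sup>2) * ((1 + y\<^sup>2) + k\<^sup>2 * s\<^sup>2)"
          using R by (intro mult_pos_pos add_pos_nonneg) auto
      qed (use R in simp)
      finally have e: "exp (- (c * t * s\<^sup>2 / R)) \<le> R / ((1 + y\<^sup>2) + k\<^sup>2 * s\<^sup>2)" .
      have "exp (- (c * t * s\<^sup>2 / R)) * R powr (- \<beta>) \<le> R / ((1 + y\<^sup>2) + k\<^sup>2 * s\<^sup>2) * R powr (- \<beta>)"
        using e by (rule mult_right_mono) simp
      also have "\<dots> = R powr (1 - \<beta>) / ((1 + y\<^sup>2) + k\<^sup>2 * s\<^sup>2)"
      proof -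
        have "R * R powr (- \<beta>) = R powr 1 * R powr (- \<beta>)" using R by simp
        also have "\<dots> = R powr (1 - \<beta>)" unfolding powr_add[symmetric] by simp
        finally show ?thesis by simp
      qed
      also have "\<dots> \<le> (1 + y\<^sup>2) powr (1 - \<beta>) / ((1 + y\<^sup>2) + k\<^sup>2 * s\<^sup>2)"
        using R \<beta> by (intro divide_right_mono powr_mono2') auto
      finally have "exp (- (c * t * s\<^sup>2 / R)) * R powr (- \<beta>) \<le> (1 + y\<^sup>2) powr (1 - \<beta>) / ((1 + y\<^sup>2) + k\<^sup>2 * s\<^sup>2)" .
      moreover have "(sqrt (1 + y\<^sup>2))\<^sup>2 = 1 + y\<^sup>2" using R(3) by (intro real_sqrt_pow2) auto
      moreover have "- c * t * s\<^sup>2 / R = - (c * t * s\<^sup>2 / R)" by simp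
      ultimately show ?thesis unfolding R_def[symmetric] by (simp only: times_divide_eq_right mult_1_right)
    qed
    \<comment> \<open>The integration in \<open>s\<close> contributes 1 / (k sqrt (1 + y^2)), which
      raises the exponent \<beta> - 1 to \<beta> - 1/2 > 1/2, just what the integral in
      \<open>y\<close> requires.\<close>
    have inner: "(\<integral>\<^sup>+s. ennreal (exp (- c * t * s\<^sup>2 / (1 + s\<^sup>2 + y\<^sup>2)) * (1 + s\<^sup>2 + y\<^sup>2) powr (- \<beta>)) \<partial>lborel)
        \<le> (ennreal (1 / k) * I) * ennreal ((1 + y\<^sup>2) powr (- (\<beta> - 1 / 2)))" for y :: real
    proof -
      have Yp: "1 + y\<^sup>2 > 0" by (simp add: add_pos_nonneg)
      have "(\<integral>\<^sup>+s. ennreal (exp (- c * t * s\<^sup>2 / (1 + s\<^sup>2 + y\<^sup>2)) * (1 + s\<^sup>2 + y\<^sup>2) powr (- \<beta>)) \<partial>lborel)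
        \<le> (\<integral>\<^sup>+s. ennreal ((1 + y\<^sup>2) powr (1 - \<beta>)) * ennreal (1 / ((sqrt (1 + y\<^sup>2))\<^sup>2 + k\<^sup>2 * s\<^sup>2)) \<partial>lborel)"
        by (intro nn_integral_mono, subst ennreal_mult'[symmetric], simp, intro ennreal_leI pt)
      also have "\<dots> = ennreal ((1 + y\<^sup>2) powr (1 - \<beta>)) * (\<integral>\<^sup>+s. ennreal (1 / ((sqrt (1 + y\<^sup>2))\<^sup>2 + k\<^sup>2 * s\<^sup>2)) \<partial>lborel)"
        by (rule nn_integral_cmult) measurable
      also have "(\<integral>\<^sup>+s. ennreal (1 / ((sqrt (1 + y\<^sup>2))\<^sup>2 + k\<^sup>2 * s\<^sup>2)) \<partial>lborel) = ennreal (1 / (sqrt (1 + y\<^sup>2) * k)) * I"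
        unfolding I_def using Yp k by (intro nn_integral_lorentz) auto
      also have "ennreal ((1 + y\<^sup>2) powr (1 - \<beta>)) * (ennreal (1 / (sqrt (1 + y\<^sup>2) * k)) * I) = (ennreal (1 / k) * I) * ennreal ((1 + y\<^sup>2) powr (- (\<beta> - 1 / 2)))"
      proof -
        have "(1 + y\<^sup>2) powr (- (\<beta> - 1 / 2)) = (1 + y\<^sup>2) powr ((1 - \<beta>) - 1 / 2)"
          by (rule arg_cong[where f = "(powr) (1 + y\<^sup>2)"]) linarith
        also have "\<dots> = (1 + y\<^sup>2) powr (1 - \<beta>) / (1 + y\<^sup>2) powr (1 / 2)" by (rule powr_diff)
        also have "(1 + y\<^sup>2) powr (1 / 2) = sqrt (1 + y\<^sup>2)" using Yp by (simp add: powr_half_sqrt)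
        finally have "(1 / k) * (1 + y\<^sup>2) powr (- (\<beta> - 1 / 2)) = (1 + y\<^sup>2) powr (1 - \<beta>) * (1 / (sqrt (1 + y\<^sup>2) * k))" by simp
        note that = this
        have "ennreal (1 / k) * ennreal ((1 + y\<^sup>2) powr (- (\<beta> - 1 / 2))) = ennreal ((1 + y\<^sup>2) powr (1 - \<beta>)) * ennreal (1 / (sqrt (1 + y\<^sup>2) * k))"
        proof -
          have "ennreal (1 / k) * ennreal z = ennreal (1 / k * z)" for z
            using k by (intro ennreal_mult'[symmetric]) simp
          moreover have "ennreal ((1 + y\<^sup>2) powr (1 - \<beta>)) * ennreal z = ennreal ((1 + y\<^sup>2) powr (1 - \<beta>) * z)" for z
            by (intro ennreal_mult'[symmetric]) simp
          ultimately show ?thesis using that by (simp only:)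
        qed
        hence "ennreal ((1 + y\<^sup>2) powr (1 - \<beta>)) * ennreal (1 / (sqrt (1 + y\<^sup>2) * k)) * I = ennreal (1 / k) * ennreal ((1 + y\<^sup>2) powr (- (\<beta> - 1 / 2))) * I"
          by (simp only:)
        thus ?thesis by (simp only: mult.assoc mult.commute mult.left_commute)
      qed
      finally show ?thesis .
    qed
    have "(\<integral>\<^sup>+y. \<integral>\<^sup>+s. ennreal (exp (- c * t * s\<^sup>2 / (1 + s\<^sup>2 + y\<^sup>2)) * (1 + s\<^sup>2 + y\<^sup>2) powr (- \<beta>)) \<partial>lborel \<partial>lborel)
      \<le> (\<integral>\<^sup>+y. (ennreal (1 / k) * I) * ennreal ((1 + y\<^sup>2) powr (- (\<beta> - 1 / 2))) \<partial>lborel)"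
      by (intro nn_integral_mono inner)
    also have "\<dots> = (ennreal (1 / k) * I) * J"
      unfolding J_def by (rule nn_integral_cmult) measurable
    also have "\<dots> = ennreal (1 / k) * ennreal (enn2real (I * J))" by (simp only: mult.assoc IJ[symmetric])
    also have "\<dots> = ennreal (1 / k * enn2real (I * J))" using k by (intro ennreal_mult'[symmetric]) simp
    also have "1 / k * enn2real (I * J) = enn2real (I * J) / sqrt c' * (1 + t) powr (- 1 / 2)"
    proof -
      have "(1 + t) powr (- 1 / 2) = 1 / sqrt (1 + t)" by (rule powr_minus_half) (use t in simp)
      thus ?thesis unfolding k_def real_sqrt_mult by simp
    qed
    also have "ennreal (enn2real (I * J) / sqrt c' * (1 + t) powr (- 1 / 2)) \<le> ennreal (C * (1 + t) powr (- 1 / 2))"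
      by (intro ennreal_leI mult_right_mono) (auto simp: C_def)
    finally show ?thesis .
  qed
  thus ?thesis using C by blast
qed

lemma nn_integral_plane_swap:
  fixes f :: "real^2 \<Rightarrow> ennreal"
  assumes [measurable]: "f \<in> borel_measurable borel"
  shows "(\<integral>\<^sup>+x. f x \<partial>lborel) = (\<integral>\<^sup>+y. \<integral>\<^sup>+x. f (vector [x, y]) \<partial>lborel \<partial>lborel)"
proof -
  have [measurable]: "(\<lambda>z. f (vector [fst z, snd z])) \<in> borel_measurable (borel \<Otimes>\<^sub>M borel)"
    by measurable
  have "(\<lambda>z. (snd z, fst z)) \<in> (borel \<Otimes>\<^sub>M borel :: (real \<times> real) measure) \<rightarrow>\<^sub>M (borel \<Otimes>\<^sub>M borel)"
    by measurable
  from measurable_compose[OF this measurable_vector2]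
  have "(\<lambda>z. vector [snd z, fst z] :: real^2) \<in> borel_measurable (borel \<Otimes>\<^sub>M borel)"
    by simp
  hence [measurable]: "(\<lambda>z. f (vector [snd z, fst z])) \<in> borel_measurable (borel \<Otimes>\<^sub>M borel)"
    by (rule measurable_compose) (rule assms)
  have "(\<integral>\<^sup>+x. f x \<partial>lborel) = (\<integral>\<^sup>+x. \<integral>\<^sup>+y. f (vector [x, y]) \<partial>lborel \<partial>lborel)"
    by (rule nn_integral_plane) measurable
  also have "\<dots> = (\<integral>\<^sup>+y. \<integral>\<^sup>+x. f (vector [x, y]) \<partial>lborel \<partial>lborel)"
    by (rule lborel_pair.Fubini') (simp add: case_prod_beta')
  finally show ?thesis .
qed

text \<open>For fixed \<open>y\<close>, the variable s = a x + b y replaces \<open>x\<close>. As a^2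
  \<ge> 1/2, the Jacobian is at most 2, and 1 + x^2 + y^2 is comparable with 1 + s^2 + y^2: one is
  at most 5 times, the other at most twice its counterpart.\<close>

lemma degenerate_gauss_line:
  fixes a b \<beta> c t y :: real
  assumes \<beta>: "\<beta> > 0" and c: "c > 0" and ab: "a\<^sup>2 + b\<^sup>2 = 1" "a\<^sup>2 \<ge> 1 / 2" and t: "t \<ge> 0"
  shows "(\<integral>\<^sup>+x. ennreal (exp (- c * t * (a * x + b * y)\<^sup>2 / (1 + x\<^sup>2 + y\<^sup>2)) * (1 + x\<^sup>2 + y\<^sup>2) powr (- \<beta>)) \<partial>lborel)
    \<le> ennreal (2 * 2 powr \<beta>) * (\<integral>\<^sup>+s. ennreal (exp (- (c / 5) * t * s\<^sup>2 / (1 + s\<^sup>2 + y\<^sup>2)) * (1 + s\<^sup>2 + y\<^sup>2) powr (- \<beta>)) \<partial>lborel)"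
proof -
  have a0: "a \<noteq> 0" using ab by auto
  have b1: "b\<^sup>2 \<le> 1" using ab(1) zero_le_power2[of a] by linarith
  let ?G = "\<lambda>s. ennreal (2 powr \<beta> * (exp (- (c / 5) * t * s\<^sup>2 / (1 + s\<^sup>2 + y\<^sup>2)) * (1 + s\<^sup>2 + y\<^sup>2) powr (- \<beta>)))"
  have pt: "ennreal (exp (- c * t * (a * x + b * y)\<^sup>2 / (1 + x\<^sup>2 + y\<^sup>2)) * (1 + x\<^sup>2 + y\<^sup>2) powr (- \<beta>)) \<le> ?G (b * y + a * x)" for x
  proof (rule ennreal_leI)
    define s where "s = a * x + b * y"
    have cm: "b * y + a * x = s" by (simp add: s_def)
    have s2: "s\<^sup>2 \<le> x\<^sup>2 + y\<^sup>2"
    proof -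
      have "(a\<^sup>2 + b\<^sup>2) * (x\<^sup>2 + y\<^sup>2) - s\<^sup>2 = (a * y - b * x)\<^sup>2"
        by (simp add: s_def power2_eq_square algebra_simps)
      moreover have "(a\<^sup>2 + b\<^sup>2) * (x\<^sup>2 + y\<^sup>2) = x\<^sup>2 + y\<^sup>2" by (simp only: ab mult_1)
      moreover have "(a * y - b * x)\<^sup>2 \<ge> 0" by simp
      ultimately show ?thesis by linarith
    qed
    have x2: "x\<^sup>2 \<le> 4 * s\<^sup>2 + 4 * y\<^sup>2"
    proof -
      have "(a * x)\<^sup>2 \<le> 2 * s\<^sup>2 + 2 * (b * y)\<^sup>2"
      proof -
        have "2 * s\<^sup>2 + 2 * (b * y)\<^sup>2 - (a * x)\<^sup>2 = (s + b * y)\<^sup>2"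
          by (simp add: s_def power2_eq_square algebra_simps)
        moreover have "(s + b * y)\<^sup>2 \<ge> 0" by simp
        ultimately show ?thesis by linarith
      qed
      moreover have "(b * y)\<^sup>2 \<le> y\<^sup>2" using mult_right_mono[OF b1, of "y\<^sup>2"] by (simp add: power_mult_distrib)
      moreover have "(1 / 2) * x\<^sup>2 \<le> (a * x)\<^sup>2" using mult_right_mono[OF ab(2), of "x\<^sup>2"] by (simp add: power_mult_distrib)
      ultimately show ?thesis by linarith
    qed
    define P where "P = 1 + x\<^sup>2 + y\<^sup>2"
    define R where "R = 1 + s\<^sup>2 + y\<^sup>2"
    have P: "P > 0" and R: "R > 0" by (auto simp: P_def R_def add_pos_nonneg)
    have "P \<le> 5 * R" using x2 zero_le_power2[of s] zero_le_power2[of y]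
      unfolding P_def R_def distrib_left by linarith
    moreover have "R \<le> 2 * P" using s2 zero_le_power2[of x] zero_le_power2[of y]
      unfolding P_def R_def distrib_left by linarith
    ultimately have PR: "P \<le> 5 * R" "R \<le> 2 * P" by auto
    have "(c / 5) * t * s\<^sup>2 / R \<le> c * t * s\<^sup>2 / P"
    proof -
      have "c * t * s\<^sup>2 / (5 * R) \<le> c * t * s\<^sup>2 / P"
        using PR P R c t by (intro divide_left_mono mult_pos_pos) auto
      thus ?thesis by simp
    qed
    hence e: "exp (- c * t * s\<^sup>2 / P) \<le> exp (- (c / 5) * t * s\<^sup>2 / R)" by simp
    have "P powr (- \<beta>) \<le> (R / 2) powr (- \<beta>)" using PR R \<beta> by (intro powr_mono2') auto
    also have "\<dots> = 2 powr \<beta> * R powr (- \<beta>)" using R by (simp add: powr_divide powr_minus field_simps)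
    finally have "exp (- c * t * s\<^sup>2 / P) * P powr (- \<beta>) \<le> exp (- (c / 5) * t * s\<^sup>2 / R) * (2 powr \<beta> * R powr (- \<beta>))"
      using e by (intro mult_mono) auto
    thus "exp (- c * t * (a * x + b * y)\<^sup>2 / (1 + x\<^sup>2 + y\<^sup>2)) * (1 + x\<^sup>2 + y\<^sup>2) powr (- \<beta>) \<le>
      2 powr \<beta> * (exp (- (c / 5) * t * (b * y + a * x)\<^sup>2 / (1 + (b * y + a * x)\<^sup>2 + y\<^sup>2)) * (1 + (b * y + a * x)\<^sup>2 + y\<^sup>2) powr (- \<beta>))"
      unfolding s_def[symmetric] P_def[symmetric] cm R_def[symmetric] by (simp only: mult.left_commute)
  qed
  have "(\<integral>\<^sup>+x. ennreal (exp (- c * t * (a * x + b * y)\<^sup>2 / (1 + x\<^sup>2 + y\<^sup>2)) * (1 + x\<^sup>2 + y\<^sup>2) powr (- \<beta>)) \<partial>lborel)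
    \<le> (\<integral>\<^sup>+x. ?G (b * y + a * x) \<partial>lborel)"
    by (intro nn_integral_mono pt)
  also have "\<dots> \<le> ennreal 2 * (ennreal \<bar>a\<bar> * (\<integral>\<^sup>+x. ?G (b * y + a * x) \<partial>lborel))"
  proof -
    have "\<bar>a\<bar> \<ge> 1 / 2"
    proof (rule ccontr)
      assume "\<not> ?thesis"
      hence "\<bar>a\<bar>\<^sup>2 < (1 / 2)\<^sup>2" by (intro power_strict_mono) auto
      thus False using ab(2) by (simp add: power2_eq_square)
    qed
    hence "1 \<le> ennreal 2 * ennreal \<bar>a\<bar>" by (subst ennreal_mult'[symmetric]) auto
    hence "1 * (\<integral>\<^sup>+x. ?G (b * y + a * x) \<partial>lborel) \<le> (ennreal 2 * ennreal \<bar>a\<bar>) * (\<integral>\<^sup>+x. ?G (b * y + a * x) \<partial>lborel)"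
      by (rule mult_right_mono) simp
    thus ?thesis by (simp only: mult.assoc mult_1)
  qed
  also have "ennreal \<bar>a\<bar> * (\<integral>\<^sup>+x. ?G (b * y + a * x) \<partial>lborel) = (\<integral>\<^sup>+s. ?G s \<partial>lborel)"
    by (rule nn_integral_real_affine[symmetric, OF _ a0]) measurable
  also have "(\<integral>\<^sup>+s. ?G s \<partial>lborel) = ennreal (2 powr \<beta>) * (\<integral>\<^sup>+s. ennreal (exp (- (c / 5) * t * s\<^sup>2 / (1 + s\<^sup>2 + y\<^sup>2)) * (1 + s\<^sup>2 + y\<^sup>2) powr (- \<beta>)) \<partial>lborel)"
  proof -
    have "(\<integral>\<^sup>+s. ?G s \<partial>lborel) = (\<integral>\<^sup>+s. ennreal (2 powr \<beta>) * ennreal (exp (- (c / 5) * t * s\<^sup>2 / (1 + s\<^sup>2 + y\<^sup>2)) * (1 + s\<^sup>2 + y\<^sup>2) powr (- \<beta>)) \<partial>lborel)"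
      by (simp add: ennreal_mult')
    also have "\<dots> = ennreal (2 powr \<beta>) * (\<integral>\<^sup>+s. ennreal (exp (- (c / 5) * t * s\<^sup>2 / (1 + s\<^sup>2 + y\<^sup>2)) * (1 + s\<^sup>2 + y\<^sup>2) powr (- \<beta>)) \<partial>lborel)"
      by (rule nn_integral_cmult) measurable
    finally show ?thesis .
  qed
  also have "ennreal 2 * (ennreal (2 powr \<beta>) * X) = ennreal (2 * 2 powr \<beta>) * X" for X
    by (simp add: ennreal_mult' mult.assoc)
  finally show ?thesis .
qed

text \<open>Some coordinate of the unit vector \<open>n\<close> has square at least 1/2. The same
  coordinate of \<xi> is integrated first, which requires both orders of integration.\<close>

lemma degenerate_gauss_bound:
  fixes c \<beta> :: real and n :: "real^2"
  assumes c: "c > 0" and \<beta>: "\<beta> > 1" and n: "norm n = 1"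
  shows "\<exists>C>0. \<forall>t\<ge>0. (\<integral>\<^sup>+\<xi>. ennreal (exp (- c * t * (\<xi> \<bullet> n)\<^sup>2 / (1 + (norm \<xi>)\<^sup>2)) * (1 + (norm \<xi>)\<^sup>2) powr (- \<beta>)) \<partial>lborel)
     \<le> ennreal (C * (1 + t) powr (- 1 / 2))"
proof -
  obtain C0 where C0: "C0 > 0" and bd: "\<And>t. t \<ge> 0 \<Longrightarrow> (\<integral>\<^sup>+y. \<integral>\<^sup>+s. ennreal (exp (- (c / 5) * t * s\<^sup>2 / (1 + s\<^sup>2 + y\<^sup>2)) * (1 + s\<^sup>2 + y\<^sup>2) powr (- \<beta>)) \<partial>lborel \<partial>lborel)
     \<le> ennreal (C0 * (1 + t) powr (- 1 / 2))"
    using degenerate_gauss_iterated[of "c / 5" \<beta>] c \<beta> by auto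
  have n2: "(n$1)\<^sup>2 + (n$2)\<^sup>2 = 1" using norm_plane[of n] n by simp
  let ?f = "\<lambda>t \<xi>::real^2. ennreal (exp (- c * t * (\<xi> \<bullet> n)\<^sup>2 / (1 + (norm \<xi>)\<^sup>2)) * (1 + (norm \<xi>)\<^sup>2) powr (- \<beta>))"
  let ?K = "ennreal (2 * 2 powr \<beta>)"
  have fin: "(\<integral>\<^sup>+y. ?K * (\<integral>\<^sup>+s. ennreal (exp (- (c / 5) * t * s\<^sup>2 / (1 + s\<^sup>2 + y\<^sup>2)) * (1 + s\<^sup>2 + y\<^sup>2) powr (- \<beta>)) \<partial>lborel) \<partial>lborel)
    \<le> ennreal ((2 * 2 powr \<beta>) * C0 * (1 + t) powr (- 1 / 2))" if t: "t \<ge> 0" for t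
  proof -
    have "(\<integral>\<^sup>+y. ?K * (\<integral>\<^sup>+s. ennreal (exp (- (c / 5) * t * s\<^sup>2 / (1 + s\<^sup>2 + y\<^sup>2)) * (1 + s\<^sup>2 + y\<^sup>2) powr (- \<beta>)) \<partial>lborel) \<partial>lborel)
       = ?K * (\<integral>\<^sup>+y. (\<integral>\<^sup>+s. ennreal (exp (- (c / 5) * t * s\<^sup>2 / (1 + s\<^sup>2 + y\<^sup>2)) * (1 + s\<^sup>2 + y\<^sup>2) powr (- \<beta>)) \<partial>lborel) \<partial>lborel)"
      by (rule nn_integral_cmult) measurable
    also have "\<dots> \<le> ?K * ennreal (C0 * (1 + t) powr (- 1 / 2))"
      by (intro mult_left_mono bd t) simp
    also have "\<dots> = ennreal ((2 * 2 powr \<beta>) * C0 * (1 + t) powr (- 1 / 2))"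
      by (subst ennreal_mult'[symmetric]) (auto simp: mult.assoc)
    finally show ?thesis .
  qed
  have m [measurable]: "?f t \<in> borel_measurable borel" for t by measurable
  have e1: "?f t (vector [x, y]) = ennreal (exp (- c * t * (n$1 * x + n$2 * y)\<^sup>2 / (1 + x\<^sup>2 + y\<^sup>2)) * (1 + x\<^sup>2 + y\<^sup>2) powr (- \<beta>))" for t x y
  proof -
    have "1 + (norm (vector [x, y] :: real^2))\<^sup>2 = 1 + x\<^sup>2 + y\<^sup>2" by (simp add: norm_plane)
    moreover have "(vector [x, y] :: real^2) \<bullet> n = n$1 * x + n$2 * y" by (simp add: inner_plane)
    ultimately show ?thesis by (simp only:)
  qed
  have "(\<integral>\<^sup>+\<xi>. ?f t \<xi> \<partial>lborel) \<le> ennreal ((2 * 2 powr \<beta>) * C0 * (1 + t) powr (- 1 / 2))" if t: "t \<ge> 0" for t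
  proof (cases "(n$1)\<^sup>2 \<ge> 1 / 2")
    case True
    have "(\<integral>\<^sup>+\<xi>. ?f t \<xi> \<partial>lborel) = (\<integral>\<^sup>+y. \<integral>\<^sup>+x. ?f t (vector [x, y]) \<partial>lborel \<partial>lborel)"
      by (rule nn_integral_plane_swap[OF m])
    also have "\<dots> \<le> (\<integral>\<^sup>+y. ?K * (\<integral>\<^sup>+s. ennreal (exp (- (c / 5) * t * s\<^sup>2 / (1 + s\<^sup>2 + y\<^sup>2)) * (1 + s\<^sup>2 + y\<^sup>2) powr (- \<beta>)) \<partial>lborel) \<partial>lborel)"
    proof (intro nn_integral_mono)
      fix y :: real
      show "(\<integral>\<^sup>+x. ?f t (vector [x, y]) \<partial>lborel) \<le> ?K * (\<integral>\<^sup>+s. ennreal (exp (- (c / 5) * t * s\<^sup>2 / (1 + s\<^sup>2 + y\<^sup>2)) * (1 + s\<^sup>2 + y\<^sup>2) powr (- \<beta>)) \<partial>lborel)"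
        unfolding e1 using \<beta> by (intro degenerate_gauss_line c n2 True t) auto
    qed
    also note fin[OF t]
    finally show ?thesis .
  next
    case False
    hence n2': "(n$2)\<^sup>2 \<ge> 1 / 2" "(n$2)\<^sup>2 + (n$1)\<^sup>2 = 1" using n2 by auto
    have "(\<integral>\<^sup>+\<xi>. ?f t \<xi> \<partial>lborel) = (\<integral>\<^sup>+x. \<integral>\<^sup>+y. ?f t (vector [x, y]) \<partial>lborel \<partial>lborel)"
      by (rule nn_integral_plane[OF m])
    also have "\<dots> \<le> (\<integral>\<^sup>+y. ?K * (\<integral>\<^sup>+s. ennreal (exp (- (c / 5) * t * s\<^sup>2 / (1 + s\<^sup>2 + y\<^sup>2)) * (1 + s\<^sup>2 + y\<^sup>2) powr (- \<beta>)) \<partial>lborel) \<partial>lborel)"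
    proof (intro nn_integral_mono)
      fix x :: real
      have e: "?f t (vector [x, y]) = ennreal (exp (- c * t * (n$2 * y + n$1 * x)\<^sup>2 / (1 + y\<^sup>2 + x\<^sup>2)) * (1 + y\<^sup>2 + x\<^sup>2) powr (- \<beta>))" for y
      proof -
        have "n$1 * x + n$2 * y = n$2 * y + n$1 * x" "1 + x\<^sup>2 + y\<^sup>2 = 1 + y\<^sup>2 + x\<^sup>2" by simp_all
        thus ?thesis unfolding e1 by (simp only:)
      qed
      show "(\<integral>\<^sup>+y. ?f t (vector [x, y]) \<partial>lborel) \<le> ?K * (\<integral>\<^sup>+s. ennreal (exp (- (c / 5) * t * s\<^sup>2 / (1 + s\<^sup>2 + x\<^sup>2)) * (1 + s\<^sup>2 + x\<^sup>2) powr (- \<beta>)) \<partial>lborel)"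
        unfolding e using \<beta> by (intro degenerate_gauss_line c n2' t) auto
    qed
    also note fin[OF t]
    finally show ?thesis .
  qed
  moreover have "(2 * 2 powr \<beta>) * C0 > 0" using C0 by simp
  ultimately show ?thesis by blast
qed

section \<open>Bounds in Lebesgue spaces\<close>

lemma Lp_le_mono:
  assumes "Lp_le p f a" "g \<in> borel_measurable borel" "AE x in lborel. norm (g x) \<le> norm (f x)" "p \<ge> 0"
  shows "Lp_le p g a"
proof -
  have "(\<integral>\<^sup>+x. ennreal (norm (g x) powr p) \<partial>lborel) \<le> (\<integral>\<^sup>+x. ennreal (norm (f x) powr p) \<partial>lborel)"
    using assms(3)
  proof (intro nn_integral_mono_AE, elim eventually_mono)
    fix x assume "norm (g x) \<le> norm (f x)"
    thus "ennreal (norm (g x) powr p) \<le> ennreal (norm (f x) powr p)"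
      using assms(4) by (intro ennreal_leI powr_mono2) auto
  qed
  also have "\<dots> \<le> ennreal (a powr p)" using assms(1) by (simp add: Lp_le_def)
  finally show ?thesis using assms(2) by (simp add: Lp_le_def)
qed

lemma Lp_le_cmult:
  assumes f: "Lp_le p f a" and h: "h \<in> borel_measurable borel" "AE x in lborel. norm (h x) \<le> c * norm (f x)"
    and "p \<ge> 0" "c \<ge> 0" "a \<ge> 0"
  shows "Lp_le p h (c * a)"
proof -
  have [measurable]: "f \<in> borel_measurable borel" using f by (simp add: Lp_le_def)
  have "(\<integral>\<^sup>+x. ennreal (norm (h x) powr p) \<partial>lborel) \<le> (\<integral>\<^sup>+x. ennreal (c powr p) * ennreal (norm (f x) powr p) \<partial>lborel)"
    using h(2)
  proof (intro nn_integral_mono_AE, elim eventually_mono)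
    fix x assume "norm (h x) \<le> c * norm (f x)"
    hence "norm (h x) powr p \<le> (c * norm (f x)) powr p" using assms by (intro powr_mono2) auto
    also have "\<dots> = c powr p * norm (f x) powr p" using assms by (simp add: powr_mult)
    finally have "ennreal (norm (h x) powr p) \<le> ennreal (c powr p * norm (f x) powr p)" by (rule ennreal_leI)
    also have "\<dots> = ennreal (c powr p) * ennreal (norm (f x) powr p)" by (rule ennreal_mult') simp
    finally show "ennreal (norm (h x) powr p) \<le> ennreal (c powr p) * ennreal (norm (f x) powr p)" .
  qed
  also have "\<dots> = ennreal (c powr p) * (\<integral>\<^sup>+x. ennreal (norm (f x) powr p) \<partial>lborel)"
    by (rule nn_integral_cmult) measurable
  also have "\<dots> \<le> ennreal (c powr p) * ennreal (a powr p)"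
    using f by (intro mult_left_mono) (auto simp: Lp_le_def)
  also have "\<dots> = ennreal ((c * a) powr p)"
  proof -
    have "(c * a) powr p = c powr p * a powr p" using \<open>c \<ge> 0\<close> \<open>a \<ge> 0\<close> by (simp add: powr_mult)
    thus ?thesis using ennreal_mult'[of "c powr p" "a powr p"] by simp
  qed
  finally show ?thesis using h by (simp add: Lp_le_def)
qed

text \<open>A crude substitute for Minkowski's inequality: (x + y)^p \<le> 2^p (x^p + y^p) gives one
  factor 2, and a^p + b^p \<le> 2 (a + b)^p \<le> 2^p (a + b)^p the other.\<close>

lemma Lp_le_add:
  assumes f: "Lp_le p f a" and g: "Lp_le p g b" and h: "h \<in> borel_measurable borel" "AE x in lborel. norm (h x) \<le> norm (f x) + norm (g x)"
    and p: "p \<ge> 1" and ab: "a \<ge> 0" "b \<ge> 0"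
  shows "Lp_le p h (4 * (a + b))"
proof -
  have [measurable]: "f \<in> borel_measurable borel" "g \<in> borel_measurable borel" using f g by (auto simp: Lp_le_def)
  have lin0: "ennreal (A * (x + y)) = ennreal A * (ennreal x + ennreal y)" if "A \<ge> 0" "x \<ge> 0" "y \<ge> 0" for A x y
    using that by (simp add: ennreal_mult)
  have "(\<integral>\<^sup>+x. ennreal (norm (h x) powr p) \<partial>lborel) \<le> (\<integral>\<^sup>+x. ennreal (2 powr p) * (ennreal (norm (f x) powr p) + ennreal (norm (g x) powr p)) \<partial>lborel)"
    using h(2)
  proof (intro nn_integral_mono_AE, elim eventually_mono)
    fix x assume le: "norm (h x) \<le> norm (f x) + norm (g x)"
    define m where "m = max (norm (f x)) (norm (g x))"
    have "norm (h x) \<le> 2 * m" using le unfolding m_def by linarith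
    hence "norm (h x) powr p \<le> (2 * m) powr p" using p by (intro powr_mono2) auto
    also have "\<dots> = 2 powr p * m powr p" by (simp add: powr_mult m_def)
    also have "m powr p \<le> norm (f x) powr p + norm (g x) powr p" by (simp add: m_def max_def)
    finally have "norm (h x) powr p \<le> 2 powr p * (norm (f x) powr p + norm (g x) powr p)" by simp
    hence "ennreal (norm (h x) powr p) \<le> ennreal (2 powr p * (norm (f x) powr p + norm (g x) powr p))"
      by (rule ennreal_leI)
    also have "\<dots> = ennreal (2 powr p) * (ennreal (norm (f x) powr p) + ennreal (norm (g x) powr p))"
      by (rule lin0) simp_all
    finally show "ennreal (norm (h x) powr p) \<le> ennreal (2 powr p) * (ennreal (norm (f x) powr p) + ennreal (norm (g x) powr p))" .
  qed
  also have "\<dots> = ennreal (2 powr p) * ((\<integral>\<^sup>+x. ennreal (norm (f x) powr p) \<partial>lborel) + (\<integral>\<^sup>+x. ennreal (norm (g x) powr p) \<partial>lborel))"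
  proof -
    have "(\<integral>\<^sup>+x. ennreal (2 powr p) * (ennreal (norm (f x) powr p) + ennreal (norm (g x) powr p)) \<partial>lborel) = ennreal (2 powr p) * (\<integral>\<^sup>+x. ennreal (norm (f x) powr p) + ennreal (norm (g x) powr p) \<partial>lborel)"
      by (rule nn_integral_cmult) measurable
    also have "(\<integral>\<^sup>+x. ennreal (norm (f x) powr p) + ennreal (norm (g x) powr p) \<partial>lborel) = (\<integral>\<^sup>+x. ennreal (norm (f x) powr p) \<partial>lborel) + (\<integral>\<^sup>+x. ennreal (norm (g x) powr p) \<partial>lborel)"
      by (rule nn_integral_add) measurable
    finally show ?thesis .
  qed
  also have "\<dots> \<le> ennreal (2 powr p) * (ennreal (a powr p) + ennreal (b powr p))"
    using f g by (intro mult_left_mono add_mono) (auto simp: Lp_le_def)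
  also have "\<dots> = ennreal (2 powr p * (a powr p + b powr p))"
    by (rule lin0[symmetric]) simp_all
  also have "\<dots> \<le> ennreal ((4 * (a + b)) powr p)"
  proof (rule ennreal_leI)
    have "a powr p + b powr p \<le> (a + b) powr p + (a + b) powr p"
      using ab p by (intro add_mono powr_mono2) auto
    also have "\<dots> = 2 powr 1 * (a + b) powr p" by simp
    also have "\<dots> \<le> 2 powr p * (a + b) powr p" using p by (intro mult_right_mono powr_mono) auto
    finally have "2 powr p * (a powr p + b powr p) \<le> 2 powr p * (2 powr p * (a + b) powr p)" by (intro mult_left_mono) auto
    also have "\<dots> = (2 * (2 * (a + b))) powr p" using ab by (simp only: powr_mult)
    finally show "2 powr p * (a powr p + b powr p) \<le> (4 * (a + b)) powr p" by simp
  qed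
  finally show ?thesis using h by (simp add: Lp_le_def)
qed

text \<open>Hoelder's inequality with a constant: Young's inequality is applied to |f| / a and |g| /
  b, with the weights p / r and p / q estimated by 1. The two integrals contribute 2 in total, and 2
  \<le> 2^p.\<close>

lemma Lp_le_mult:
  fixes p q r :: real
  assumes p: "p \<ge> 1" and r: "r > 0" and q: "q > 0" and e: "1 / p = 1 / r + 1 / q"
    and f: "Lp_le r f a" and g: "Lp_le q g b" and a: "a > 0" and b: "b > 0"
    and h: "h \<in> borel_measurable borel" "AE x in lborel. norm (h x) \<le> norm (f x) * norm (g x)"
  shows "Lp_le p h (2 * a * b)"
proof -
  have [measurable]: "f \<in> borel_measurable borel" "g \<in> borel_measurable borel" using f g by (auto simp: Lp_le_def)
  have "1 / r > 0" "1 / q > 0" using r q by auto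
  hence "1 / r < 1 / p" "1 / q < 1 / p" unfolding e by linarith+
  hence "p < r" "p < q" using inverse_less_imp_less[of r p] inverse_less_imp_less[of q p] r q by (simp_all add: inverse_eq_divide)
  hence pr: "r / p > 1" and pq: "q / p > 1" using p by (simp_all add: less_divide_eq)
  have pe: "1 / (r / p) + 1 / (q / p) = 1"
  proof -
    have "1 / (r / p) + 1 / (q / p) = p * (1 / r + 1 / q)" by (simp add: distrib_left)
    also have "\<dots> = p * (1 / p)" by (simp only: e)
    also have "\<dots> = 1" using p by simp
    finally show ?thesis .
  qed
  have lin: "(\<integral>\<^sup>+x. K * (A * F x + B * G x) \<partial>lborel) = K * (A * (\<integral>\<^sup>+x. F x \<partial>lborel) + B * (\<integral>\<^sup>+x. G x \<partial>lborel))"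
    if [measurable]: "F \<in> borel_measurable borel" "G \<in> borel_measurable borel" for K A B and F G :: "real^2 \<Rightarrow> ennreal"
  proof -
    have "(\<integral>\<^sup>+x. K * (A * F x + B * G x) \<partial>lborel) = K * (\<integral>\<^sup>+x. A * F x + B * G x \<partial>lborel)"
      by (rule nn_integral_cmult) measurable
    also have "(\<integral>\<^sup>+x. A * F x + B * G x \<partial>lborel) = (\<integral>\<^sup>+x. A * F x \<partial>lborel) + (\<integral>\<^sup>+x. B * G x \<partial>lborel)"
      by (rule nn_integral_add) measurable
    also have "(\<integral>\<^sup>+x. A * F x \<partial>lborel) = A * (\<integral>\<^sup>+x. F x \<partial>lborel)"
      by (rule nn_integral_cmult) measurable
    also have "(\<integral>\<^sup>+x. B * G x \<partial>lborel) = B * (\<integral>\<^sup>+x. G x \<partial>lborel)"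
      by (rule nn_integral_cmult) measurable
    finally show ?thesis .
  qed
  have "(\<integral>\<^sup>+x. ennreal (norm (h x) powr p) \<partial>lborel) \<le> (\<integral>\<^sup>+x. ennreal ((a * b) powr p) * (ennreal (1 / a powr r) * ennreal (norm (f x) powr r) + ennreal (1 / b powr q) * ennreal (norm (g x) powr q)) \<partial>lborel)"
    using h(2)
  proof (intro nn_integral_mono_AE, elim eventually_mono)
    fix x assume le: "norm (h x) \<le> norm (f x) * norm (g x)"
    define X where "X = norm (f x) / a"
    define Y where "Y = norm (g x) / b"
    have XY: "X \<ge> 0" "Y \<ge> 0" using a b by (auto simp: X_def Y_def)
    have "norm (h x) powr p \<le> ((a * b) * (X * Y)) powr p"
      using le p a b by (intro powr_mono2) (auto simp: X_def Y_def)
    also have "\<dots> = (a * b) powr p * (X powr p * Y powr p)" using XY a b by (simp add: powr_mult)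
    also have "X powr p * Y powr p \<le> (X powr p) powr (r / p) / (r / p) + (Y powr p) powr (q / p) / (q / p)"
      using pr pq pe by (intro Youngs_inequality) auto
    also have "\<dots> \<le> X powr r + Y powr q"
    proof -
      have d: "z / u \<le> z" if "u > 1" "z \<ge> 0" for z u :: real
        using that by (simp add: pos_divide_le_eq mult_le_cancel_left1)
      have e: "(X powr p) powr (r / p) = X powr r" "(Y powr p) powr (q / p) = Y powr q" using p by (simp_all add: powr_powr)
      show ?thesis unfolding e by (intro add_mono d pr pq) auto
    qed
    finally have "norm (h x) powr p \<le> (a * b) powr p * (X powr r + Y powr q)" by (simp add: mult_left_mono)
    also have "X powr r = 1 / a powr r * norm (f x) powr r" using a by (simp add: X_def powr_divide)
    also have "Y powr q = 1 / b powr q * norm (g x) powr q" using b by (simp add: Y_def powr_divide)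
    finally have "ennreal (norm (h x) powr p) \<le> ennreal ((a * b) powr p * (1 / a powr r * norm (f x) powr r + 1 / b powr q * norm (g x) powr q))"
      by (rule ennreal_leI)
    also have "\<dots> = ennreal ((a * b) powr p) * (ennreal (1 / a powr r) * ennreal (norm (f x) powr r) + ennreal (1 / b powr q) * ennreal (norm (g x) powr q))"
    proof -
      have lin0: "ennreal (A * (B * x + C * y)) = ennreal A * (ennreal B * ennreal x + ennreal C * ennreal y)"
        if "A \<ge> 0" "B \<ge> 0" "C \<ge> 0" "x \<ge> 0" "y \<ge> 0" for A B C x y
        using that by (simp add: ennreal_mult)
      show ?thesis by (rule lin0) simp_all
    qed
    finally show "ennreal (norm (h x) powr p) \<le> ennreal ((a * b) powr p) * (ennreal (1 / a powr r) * ennreal (norm (f x) powr r) + ennreal (1 / b powr q) * ennreal (norm (g x) powr q))" .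
  qed
  also have "\<dots> = ennreal ((a * b) powr p) * (ennreal (1 / a powr r) * (\<integral>\<^sup>+x. ennreal (norm (f x) powr r) \<partial>lborel) + ennreal (1 / b powr q) * (\<integral>\<^sup>+x. ennreal (norm (g x) powr q) \<partial>lborel))"
    by (rule lin) measurable
  also have "\<dots> \<le> ennreal ((a * b) powr p) * (ennreal (1 / a powr r) * ennreal (a powr r) + ennreal (1 / b powr q) * ennreal (b powr q))"
    using f g by (intro mult_left_mono add_mono) (auto simp: Lp_le_def)
  also have "\<dots> = ennreal ((a * b) powr p) * ennreal 2"
  proof -
    have one: "ennreal (1 / z) * ennreal z = 1" if "z > 0" for z
      using that ennreal_mult'[of "1 / z" z] by simp
    have "ennreal (1 / a powr r) * ennreal (a powr r) = 1" "ennreal (1 / b powr q) * ennreal (b powr q) = 1"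
      using a b by (intro one; simp)+
    thus ?thesis by (simp only: one_add_one ennreal_numeral)
  qed
  also have "\<dots> = ennreal (2 * (a * b) powr p)" by (subst mult.commute) (rule ennreal_mult'[symmetric], simp)
  also have "\<dots> \<le> ennreal ((2 * a * b) powr p)"
  proof (rule ennreal_leI)
    have "2 * (a * b) powr p = 2 powr 1 * (a * b) powr p" by simp
    also have "\<dots> \<le> 2 powr p * (a * b) powr p" using p by (intro mult_right_mono powr_mono) auto
    also have "\<dots> = (2 * (a * b)) powr p" using a b by (simp only: powr_mult)
    finally show "2 * (a * b) powr p \<le> (2 * a * b) powr p" by (simp only: mult.assoc)
  qed
  finally show ?thesis using h by (simp add: Lp_le_def)
qed

lemma Lp_norm_le:
  assumes "Lp_le p f a" "p > 0" "a \<ge> 0"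
  shows "Lp_norm p f \<le> ennreal a"
proof -
  have m [measurable]: "f \<in> borel_measurable borel" and le: "(\<integral>\<^sup>+x. ennreal (norm (f x) powr p) \<partial>lborel) \<le> ennreal (a powr p)"
    using assms by (auto simp: Lp_le_def)
  have i: "integrable lborel (\<lambda>x. norm (f x) powr p)"
    using le by (intro integrableI_bounded) (auto simp: le_less_trans)
  have "(LINT x|lborel. norm (f x) powr p) \<le> a powr p"
    using le i by (simp add: nn_integral_eq_integral)
  hence "(LINT x|lborel. norm (f x) powr p) powr (1 / p) \<le> (a powr p) powr (1 / p)"
    using assms by (intro powr_mono2) (auto intro!: integral_nonneg)
  also have "\<dots> = a" using assms by (simp add: powr_powr)
  finally show ?thesis using m i by (simp add: Lp_norm_def ennreal_leI)
qed

lemma Lp_norm_finite: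
  assumes "Lp_norm p f \<noteq> \<infinity>" "p > 0"
  obtains a where "a \<ge> 0" "Lp_norm p f = ennreal a" "Lp_le p f a"
proof -
  have m: "f \<in> borel_measurable borel" and i: "integrable lborel (\<lambda>x. norm (f x) powr p)"
    using assms by (auto simp: Lp_norm_def split: if_splits)
  define a where "a = (LINT x|lborel. norm (f x) powr p) powr (1 / p)"
  have "(\<integral>\<^sup>+x. ennreal (norm (f x) powr p) \<partial>lborel) = ennreal (LINT x|lborel. norm (f x) powr p)"
    using i by (simp add: nn_integral_eq_integral)
  also have "(LINT x|lborel. norm (f x) powr p) = a powr p"
    using assms by (simp add: a_def powr_powr integral_nonneg)
  finally have "Lp_le p f a" using m by (simp add: Lp_le_def)
  moreover have "Lp_norm p f = ennreal a" using m i by (simp add: Lp_norm_def a_def)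
  ultimately show ?thesis using that[of a] by (simp add: a_def)
qed

text \<open>Hausdorff-Young in the direction \<open>||h||_q \<le> C ||FT h||_p\<close>; as \<open>FT h\<close> need not be
  integrable, it is damped by Gaussians.\<close>

lemma hausdorff_young_inverse:
  fixes h :: "real^2 \<Rightarrow> complex" and s :: real
  assumes HY: "\<And>f a. integrable lborel f \<Longrightarrow> a > 0 \<Longrightarrow> Lp_le p f a \<Longrightarrow> Lp_le q (FT (-s) f) (C * a)"
    and s: "s\<^sup>2 = 1" and h: "integrable lborel h" "continuous_on UNIV h" and a: "a > 0"
    and L: "Lp_le p (FT s h) a" and pq: "p > 0" "q > 0"
  shows "Lp_le q h (C * a)"
proof -
  have hm [measurable]: "h \<in> borel_measurable borel" by (rule borel_measurable_continuous_onI[OF h(2)])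
  have [measurable]: "FT s h \<in> borel_measurable borel" by (rule measurable_FT[OF h(1)])
  define g where "g N x = complex_of_real (gauss N x) * FT s h x" for N x
  have [measurable]: "g N \<in> borel_measurable borel" for N
  proof -
    have "(\<lambda>x. complex_of_real (gauss N x) * FT s h x) \<in> borel_measurable borel" by measurable
    thus ?thesis unfolding g_def[abs_def] .
  qed
  define B where "B = (LINT x|lborel. norm (h x))"
  have B: "norm (FT s h \<xi>) \<le> B" for \<xi> unfolding B_def by (rule norm_FT_le_LINT[OF h(1)])
  have gi: "integrable lborel (g N)" for N
  proof (rule Bochner_Integration.integrable_bound[of lborel "\<lambda>x. gauss N x * B"])
    show "integrable lborel (\<lambda>x. gauss N x * B)" using integrable_gauss by simp
    show "AE x in lborel. norm (g N x) \<le> norm (gauss N x * B)"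
    proof (rule AE_I2)
      fix x
      have "gauss N x * norm (FT s h x) \<le> gauss N x * B" using gauss_pos[of N x] B[of x] by (intro mult_left_mono) auto
      also have "\<dots> \<le> norm (gauss N x * B)" by simp
      finally show "norm (g N x) \<le> norm (gauss N x * B)" using gauss_pos[of N x] by (simp add: g_def norm_mult)
    qed
  qed simp
  have gL: "Lp_le p (g N) a" for N
  proof (rule Lp_le_mono[OF L])
    show "AE x in lborel. norm (g N x) \<le> norm (FT s h x)"
    proof (rule AE_I2)
      fix x
      have "\<bar>gauss N x\<bar> \<le> 1" using gauss_pos[of N x] gauss_le_1[of N x] by simp
      thus "norm (g N x) \<le> norm (FT s h x)" by (simp add: g_def norm_mult mult_left_le_one_le)
    qed
  qed (use pq in auto)
  have gq: "Lp_le q (FT (-s) (g N)) (C * a)" for N by (rule HY[OF gi a gL])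
  \<comment> \<open>Transforming the damped functions back recovers (2 pi)^2 h pointwise, so Fatou's
    lemma passes their common bound on to the limit. The factor (2 pi)^2 \<ge> 1 is simply
    discarded.\<close>
  have lim: "(\<lambda>N. FT (-s) (g N) \<xi>) \<longlonglongrightarrow> (2 * pi)\<^sup>2 * h \<xi>" for \<xi>
  proof -
    have e: "FT (-s) (g N) \<xi> = (LINT \<zeta>|lborel. h \<zeta> * complex_of_real (gaussT N (\<zeta> - \<xi>)))" for N
      unfolding g_def by (rule FT_gauss_FT[OF h(1) s])
    have c: "isCont h \<xi>" using h(2) by (simp add: continuous_on_eq_continuous_at)
    show ?thesis unfolding e by (rule gaussT_approximate_identity[OF h(1) c])
  qed
  have "(\<lambda>N. ennreal (norm (FT (-s) (g N) \<xi>) powr q)) \<longlonglongrightarrow> ennreal (norm ((2 * pi)\<^sup>2 * h \<xi>) powr q)" for \<xi>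
    using pq by (intro tendsto_ennrealI tendsto_powr' tendsto_norm lim tendsto_const) auto
  hence li: "liminf (\<lambda>N. ennreal (norm (FT (-s) (g N) \<xi>) powr q)) = ennreal (norm ((2 * pi)\<^sup>2 * h \<xi>) powr q)" for \<xi>
    by (rule lim_imp_Liminf[OF trivial_limit_sequentially])
  have [measurable]: "FT (-s) (g N) \<in> borel_measurable borel" for N by (rule measurable_FT[OF gi])
  have "(\<integral>\<^sup>+\<xi>. ennreal (norm (h \<xi>) powr q) \<partial>lborel) \<le> (\<integral>\<^sup>+\<xi>. ennreal (norm ((2 * pi)\<^sup>2 * h \<xi>) powr q) \<partial>lborel)"
  proof (intro nn_integral_mono ennreal_leI powr_mono2)
    fix \<xi>
    have "1 \<le> (2 * pi)\<^sup>2" using pi_gt3 by (intro one_le_power) linarith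
    hence "1 * norm (h \<xi>) \<le> (2 * pi)\<^sup>2 * norm (h \<xi>)" by (intro mult_right_mono) auto
    thus "norm (h \<xi>) \<le> norm ((2 * pi)\<^sup>2 * h \<xi>)"
      by (simp add: norm_mult norm_power)
  qed (use pq in auto)
  also have "\<dots> = (\<integral>\<^sup>+\<xi>. liminf (\<lambda>N. ennreal (norm (FT (-s) (g N) \<xi>) powr q)) \<partial>lborel)" by (simp only: li)
  also have "\<dots> \<le> liminf (\<lambda>N. \<integral>\<^sup>+\<xi>. ennreal (norm (FT (-s) (g N) \<xi>) powr q) \<partial>lborel)"
    by (rule nn_integral_liminf) measurable
  also have "\<dots> \<le> liminf (\<lambda>N. ennreal ((C * a) powr q))"
    by (intro Liminf_mono always_eventually allI) (use gq in \<open>simp only: Lp_le_def\<close>)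
  also have "\<dots> = ennreal ((C * a) powr q)" by (simp add: Liminf_const)
  finally show ?thesis by (simp add: Lp_le_def)
qed

section \<open>Simple zeros on the circle\<close>

lemma norm_circ [simp]: "norm (circ \<phi>) = 1"
  by (simp add: circ_def norm_vec_def L2_set_def sum_2)

lemma continuous_circ: "continuous_on S circ"
proof -
  have "circ = (\<lambda>\<phi>. \<chi> i. if i = 1 then cos \<phi> else sin \<phi>)"
    by (auto simp: circ_def fun_eq_iff vec_eq_iff forall_2)
  moreover have "continuous_on S (\<lambda>\<phi>. \<chi> i::2. if i = 1 then cos \<phi> else sin \<phi>)"
  proof (intro continuous_on_vec_lambda)
    fix i :: 2 show "continuous_on S (\<lambda>\<phi>. if i = 1 then cos \<phi> else sin \<phi>)"
      by (cases "i = 1") (auto intro!: continuous_intros)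
  qed
  ultimately show ?thesis by (simp only:)
qed

lemma sphere_circ: "circ ` {0..2 * pi} = sphere 0 1"
proof (intro equalityI subsetI)
  fix \<eta> :: "real^2" assume "\<eta> \<in> sphere 0 1"
  hence "(\<eta>$1)\<^sup>2 + (\<eta>$2)\<^sup>2 = 1" by (simp add: norm_vec_def L2_set_def sum_2)
  then obtain t where t: "0 \<le> t" "t < 2 * pi" "\<eta>$1 = cos t" "\<eta>$2 = sin t"
    by (rule sincos_total_2pi)
  hence "\<eta> = circ t" by (simp add: circ_def vec_eq_iff forall_2)
  thus "\<eta> \<in> circ ` {0..2 * pi}" using t by auto
qed auto

lemma inner_circ: "circ s \<bullet> circ t = cos (s - t)"
  by (simp add: circ_def inner_vec_def sum_2 cos_diff)

text \<open>Convergence at one radius bounds the terms there, so closer to the centre the series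
  without its constant term is dominated by a geometric series of ratio at most 1/2. The estimate is
  made for partial sums, because the space need not be complete.\<close>

lemma power_series_continuous_at_center:
  fixes g :: "real \<Rightarrow> 'b::real_normed_vector"
  assumes e: "\<epsilon> > 0" and s: "\<And>\<phi>. \<bar>\<phi> - \<phi>0\<bar> < \<epsilon> \<Longrightarrow> (\<lambda>n. (\<phi> - \<phi>0) ^ n *\<^sub>R a n) sums g \<phi>"
  shows "isCont g \<phi>0"
proof -
  define R where "R = \<epsilon> / 2"
  have R: "R > 0" using e by (simp add: R_def)
  have "(\<lambda>n. R ^ n *\<^sub>R a n) sums g (\<phi>0 + R)" using s[of "\<phi>0 + R"] e by (simp add: R_def)
  hence "(\<lambda>n. R ^ n *\<^sub>R a n) \<longlonglongrightarrow> 0" using summable_LIMSEQ_zero sums_summable by blast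
  hence "Bseq (\<lambda>n. R ^ n *\<^sub>R a n)" by (intro convergent_imp_Bseq) (auto simp: convergent_def)
  then obtain K where K: "K > 0" "\<And>n. norm (R ^ n *\<^sub>R a n) \<le> K" by (auto elim: BseqE)
  have g0: "g \<phi>0 = a 0"
  proof -
    have "(\<lambda>n. 0 ^ n *\<^sub>R a n) sums g \<phi>0" using s[of \<phi>0] e by simp
    moreover have "(\<lambda>n. 0 ^ n *\<^sub>R a n) sums a 0"
    proof -
      have "(\<lambda>n. 0 ^ n *\<^sub>R a n) = (\<lambda>n. if n = 0 then a n else 0)" by (auto simp: power_0_left)
      thus ?thesis using sums_single[of 0 a] by simp
    qed
    ultimately show ?thesis by (rule sums_unique2)
  qed
  have bound: "norm (g \<phi> - g \<phi>0) \<le> (2 * K / R) * \<bar>\<phi> - \<phi>0\<bar>" if "\<bar>\<phi> - \<phi>0\<bar> < R / 2" for \<phi>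
  proof -
    define y where "y = \<bar>\<phi> - \<phi>0\<bar> / R"
    have y: "0 \<le> y" "y \<le> 1 / 2" using that R by (auto simp: y_def field_simps)
    have "(\<lambda>n. (\<phi> - \<phi>0) ^ n *\<^sub>R a n) sums g \<phi>" using that R by (intro s) (auto simp: R_def)
    hence "(\<lambda>n. (\<phi> - \<phi>0) ^ Suc n *\<^sub>R a (Suc n)) sums (g \<phi> - g \<phi>0)"
      by (subst sums_Suc_iff) (simp add: g0)
    hence l: "(\<lambda>N. \<Sum>n<N. (\<phi> - \<phi>0) ^ Suc n *\<^sub>R a (Suc n)) \<longlonglongrightarrow> g \<phi> - g \<phi>0" by (simp add: sums_def)
    have "norm (\<Sum>n<N. (\<phi> - \<phi>0) ^ Suc n *\<^sub>R a (Suc n)) \<le> 2 * K * y" for N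
    proof -
      have "norm ((\<phi> - \<phi>0) ^ Suc n *\<^sub>R a (Suc n)) \<le> K * y * (1 / 2) ^ n" for n
      proof -
        have "norm ((\<phi> - \<phi>0) ^ Suc n *\<^sub>R a (Suc n)) = y ^ Suc n * norm (R ^ Suc n *\<^sub>R a (Suc n))"
          using R by (simp add: y_def power_divide abs_mult power_abs)
        also have "\<dots> \<le> y ^ Suc n * K" by (intro mult_left_mono K(2) zero_le_power y(1))
        also have "\<dots> = (K * y) * y ^ n" by simp
        also have "\<dots> \<le> (K * y) * (1 / 2) ^ n" using K y by (intro mult_left_mono power_mono) auto
        finally show ?thesis .
      qed
      hence "norm (\<Sum>n<N. (\<phi> - \<phi>0) ^ Suc n *\<^sub>R a (Suc n)) \<le> (\<Sum>n<N. K * y * (1 / 2) ^ n)"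
        by (intro sum_norm_le) auto
      also have "\<dots> = K * y * (\<Sum>n<N. (1 / 2) ^ n)" by (rule sum_distrib_left[symmetric])
      also have "(\<Sum>n<N. (1 / 2 :: real) ^ n) \<le> 2"
        by (subst sum_gp_strict) (auto simp: field_simps)
      finally have "norm (\<Sum>n<N. (\<phi> - \<phi>0) ^ Suc n *\<^sub>R a (Suc n)) \<le> K * y * 2"
        using K y by (simp add: mult_left_mono)
      thus ?thesis by (simp only: mult.commute mult.left_commute)
    qed
    hence "norm (g \<phi> - g \<phi>0) \<le> 2 * K * y"
      by (intro tendsto_upperbound[OF tendsto_norm[OF l]]) auto
    thus ?thesis by (simp add: y_def)
  qed
  have "((\<lambda>\<phi>. g \<phi> - g \<phi>0) \<longlongrightarrow> 0) (at \<phi>0)"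
  proof (rule Lim_null_comparison)
    show "\<forall>\<^sub>F \<phi> in at \<phi>0. norm (g \<phi> - g \<phi>0) \<le> (2 * K / R) * \<bar>\<phi> - \<phi>0\<bar>"
      unfolding eventually_at using R bound by (intro exI[of _ "R / 2"]) (auto simp: dist_real_def)
    have "((\<lambda>\<phi>. (2 * K / R) * \<bar>\<phi> - \<phi>0\<bar>) \<longlongrightarrow> (2 * K / R) * \<bar>\<phi>0 - \<phi>0\<bar>) (at \<phi>0)"
      by (intro tendsto_intros)
    thus "((\<lambda>\<phi>. (2 * K / R) * \<bar>\<phi> - \<phi>0\<bar>) \<longlongrightarrow> 0) (at \<phi>0)" by simp
  qed
  thus ?thesis by (simp add: isCont_def LIM_zero_iff)
qed

text \<open>Continuity in the angle descends to the circle by compactness: a closed set has a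
  compact preimage in one period of angles, and the image of that preimage under \<open>circ\<close>
  is again compact.\<close>

lemma real_analytic_on_circle_continuous:
  fixes f :: "real^2 \<Rightarrow> 'b::real_normed_vector"
  assumes "real_analytic_on_circle f"
  shows "continuous_on (sphere 0 1) f"
proof -
  have c: "continuous_on UNIV (\<lambda>\<phi>. f (circ \<phi>))"
  proof (rule continuous_at_imp_continuous_on, rule ballI)
    fix \<phi>0
    obtain \<epsilon> a where "\<epsilon> > 0" "\<forall>\<phi>. \<bar>\<phi> - \<phi>0\<bar> < \<epsilon> \<longrightarrow> (\<lambda>n. (\<phi> - \<phi>0) ^ n *\<^sub>R a n) sums f (circ \<phi>)"
      using assms unfolding real_analytic_on_circle_def by blast
    thus "isCont (\<lambda>\<phi>. f (circ \<phi>)) \<phi>0" by (intro power_series_continuous_at_center) auto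
  qed
  show ?thesis unfolding continuous_on_closed_vimage[OF closed_sphere]
  proof (intro allI impI)
    fix B :: "'b set" assume B: "closed B"
    have "closed ((\<lambda>\<phi>. f (circ \<phi>)) -` B)" using continuous_closed_vimage[OF B, of "\<lambda>\<phi>. f (circ \<phi>)"] c
      by (simp add: continuous_on_eq_continuous_at)
    hence "compact ({0..2 * pi} \<inter> (\<lambda>\<phi>. f (circ \<phi>)) -` B)" by (intro compact_Int_closed) auto
    hence "compact (circ ` ({0..2 * pi} \<inter> (\<lambda>\<phi>. f (circ \<phi>)) -` B))"
      by (intro compact_continuous_image continuous_circ)
    moreover have "circ ` ({0..2 * pi} \<inter> (\<lambda>\<phi>. f (circ \<phi>)) -` B) = f -` B \<inter> sphere 0 1"
      unfolding sphere_circ[symmetric] by auto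
    ultimately show "closed (f -` B \<inter> sphere 0 1)" using compact_imp_closed by metis
  qed
qed

text \<open>Near the zero, \<open>a\<close> grows at least like half of its derivative times the
  angle, while the square of \<open>b\<close> is close to 1. So the minimum of the squares dominates
  a multiple of the squared sine of the angle, with D^2 / 4 for \<open>a\<close> and 1/2 for
  \<open>b\<close>.\<close>

lemma quadratic_lower_bound_at_simple_zero:
  assumes ca: "continuous_on (sphere 0 1) a" and cb: "continuous_on (sphere 0 1) b"
    and ab: "\<And>\<eta>. norm \<eta> = 1 \<Longrightarrow> (a \<eta>)\<^sup>2 + (b \<eta>)\<^sup>2 = 1" and z: "simple_zero_on_circle a (circ \<phi>)"
  shows "\<exists>\<epsilon>>0. \<exists>c>0. \<exists>n. norm n = 1 \<and> (\<forall>s\<in>ball \<phi> \<epsilon>. c * (circ s \<bullet> n)\<^sup>2 \<le> min ((a (circ s))\<^sup>2) ((b (circ s))\<^sup>2))"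
proof -
  from z obtain D where a0: "a (circ \<phi>) = 0" and D: "D \<noteq> 0" "((\<lambda>s. a (circ s)) has_real_derivative D) (at \<phi>)"
    unfolding simple_zero_on_circle_def by blast
  have "((\<lambda>s. (a (circ s) - a (circ \<phi>)) / (s - \<phi>)) \<longlongrightarrow> D) (at \<phi>)"
    using D(2) by (simp add: has_field_derivative_iff)
  hence "((\<lambda>s. \<bar>(a (circ s) - a (circ \<phi>)) / (s - \<phi>)\<bar>) \<longlongrightarrow> \<bar>D\<bar>) (at \<phi>)" by (rule tendsto_rabs)
  hence "\<forall>\<^sub>F s in at \<phi>. \<bar>(a (circ s) - a (circ \<phi>)) / (s - \<phi>)\<bar> > \<bar>D\<bar> / 2"
    using D(1) by (intro order_tendstoD(1)) auto
  then obtain e1 where e1: "e1 > 0" "\<And>s. s \<noteq> \<phi> \<Longrightarrow> dist s \<phi> < e1 \<Longrightarrow> \<bar>(a (circ s) - a (circ \<phi>)) / (s - \<phi>)\<bar> > \<bar>D\<bar> / 2"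
    unfolding eventually_at by auto
  have "continuous_on UNIV (\<lambda>s. (b (circ s))\<^sup>2)"
    by (intro continuous_intros continuous_on_compose2[OF cb continuous_circ]) auto
  hence "isCont (\<lambda>s. (b (circ s))\<^sup>2) \<phi>" by (simp add: continuous_on_eq_continuous_at)
  moreover have b1: "(b (circ \<phi>))\<^sup>2 = 1" using ab[of "circ \<phi>"] a0 by simp
  ultimately have "((\<lambda>s. (b (circ s))\<^sup>2) \<longlongrightarrow> 1) (at \<phi>)" by (simp add: isCont_def)
  hence "\<forall>\<^sub>F s in at \<phi>. (b (circ s))\<^sup>2 > 1 / 2" by (rule order_tendstoD(1)) simp
  then obtain e2 where e2: "e2 > 0" "\<And>s. s \<noteq> \<phi> \<Longrightarrow> dist s \<phi> < e2 \<Longrightarrow> (b (circ s))\<^sup>2 > 1 / 2"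
    unfolding eventually_at by auto
  define c where "c = min (D\<^sup>2 / 4) (1 / 2)"
  \<comment> \<open>The normal to the degenerate direction: its inner product with
    \<open>circ s\<close> is the sine of the angle between \<open>circ s\<close> and that
    direction.\<close>
  define n where "n = circ (\<phi> + pi / 2)"
  have n: "circ s \<bullet> n = sin (s - \<phi>)" for s
  proof -
    have "circ s \<bullet> n = cos (pi / 2 - (s - \<phi>))" unfolding n_def inner_circ by (subst cos_minus[symmetric]) (simp add: algebra_simps)
    thus ?thesis by (simp add: cos_sin_eq[symmetric] sin_cos_eq)
  qed
  have "c * (circ s \<bullet> n)\<^sup>2 \<le> min ((a (circ s))\<^sup>2) ((b (circ s))\<^sup>2)" if s: "s \<in> ball \<phi> (min e1 e2)" for s
  proof (cases "s = \<phi>")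
    case True thus ?thesis by (simp add: n)
  next
    case False
    have d: "dist s \<phi> < e1" "dist s \<phi> < e2" using s by (auto simp: dist_commute)
    have sn: "(circ s \<bullet> n)\<^sup>2 \<le> (s - \<phi>)\<^sup>2" unfolding n
      using abs_sin_x_le_abs_x[of "s - \<phi>"] by (simp add: abs_le_square_iff)
    have "\<bar>D\<bar> / 2 * \<bar>s - \<phi>\<bar> \<le> \<bar>a (circ s)\<bar>"
      using e1(2)[OF False d(1)] False a0 by (simp add: abs_divide less_divide_eq)
    hence "(\<bar>D\<bar> / 2 * \<bar>s - \<phi>\<bar>)\<^sup>2 \<le> \<bar>a (circ s)\<bar>\<^sup>2" by (intro power_mono) auto
    hence A: "D\<^sup>2 / 4 * (s - \<phi>)\<^sup>2 \<le> (a (circ s))\<^sup>2" by (simp add: power_mult_distrib power_divide)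
    have "c * (circ s \<bullet> n)\<^sup>2 \<le> D\<^sup>2 / 4 * (s - \<phi>)\<^sup>2" using sn by (intro mult_mono) (auto simp: c_def)
    hence 1: "c * (circ s \<bullet> n)\<^sup>2 \<le> (a (circ s))\<^sup>2" using A by linarith
    have "c * (circ s \<bullet> n)\<^sup>2 \<le> 1 / 2 * 1" unfolding n by (intro mult_mono) (auto simp: c_def abs_square_le_1)
    hence "c * (circ s \<bullet> n)\<^sup>2 \<le> (b (circ s))\<^sup>2" using e2(2)[OF False d(2)] by linarith
    with 1 show ?thesis by simp
  qed
  moreover have "c > 0" using D by (simp add: c_def)
  moreover have "norm n = 1" by (simp add: n_def)
  moreover have "min e1 e2 > 0" using e1 e2 by simp
  ultimately show ?thesis by blast
qed

text \<open>A local bound holds at every angle, by the simple zeros or by continuity, and one period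
  is compact. Finitely many normals therefore suffice, although the bound cannot be made with a
  single one.\<close>

lemma quadratic_lower_bound_finite:
  assumes ca: "continuous_on (sphere 0 1) a" and cb: "continuous_on (sphere 0 1) b"
    and ab: "\<And>\<eta>. norm \<eta> = 1 \<Longrightarrow> (a \<eta>)\<^sup>2 + (b \<eta>)\<^sup>2 = 1"
    and za: "\<And>\<eta>. norm \<eta> = 1 \<Longrightarrow> a \<eta> = 0 \<Longrightarrow> simple_zero_on_circle a \<eta>"
    and zb: "\<And>\<eta>. norm \<eta> = 1 \<Longrightarrow> b \<eta> = 0 \<Longrightarrow> simple_zero_on_circle b \<eta>"
  shows "\<exists>F :: (real \<times> (real^2)) set. finite F \<and> (\<forall>(c, n)\<in>F. c > 0 \<and> norm n = 1) \<and>
    (\<forall>\<eta>. norm \<eta> = 1 \<longrightarrow> (\<exists>(c, n)\<in>F. c * (\<eta> \<bullet> n)\<^sup>2 \<le> min ((a \<eta>)\<^sup>2) ((b \<eta>)\<^sup>2)))"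
proof -
  let ?m = "\<lambda>s. min ((a (circ s))\<^sup>2) ((b (circ s))\<^sup>2)"
  have loc: "\<exists>\<epsilon>>0. \<exists>c>0. \<exists>n. norm n = 1 \<and> (\<forall>s\<in>ball \<phi> \<epsilon>. c * (circ s \<bullet> n)\<^sup>2 \<le> ?m s)" for \<phi>
  proof -
    consider "a (circ \<phi>) = 0" | "b (circ \<phi>) = 0" | "a (circ \<phi>) \<noteq> 0" "b (circ \<phi>) \<noteq> 0" by blast
    thus ?thesis
    proof cases
      case 1 thus ?thesis using quadratic_lower_bound_at_simple_zero[OF ca cb ab za[OF norm_circ]] by simp
    next
      case 2
      have "(b \<eta>)\<^sup>2 + (a \<eta>)\<^sup>2 = 1" if "norm \<eta> = 1" for \<eta> using ab[OF that] by simp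
      thus ?thesis using quadratic_lower_bound_at_simple_zero[OF cb ca _ zb[OF norm_circ]] 2 by (simp add: min.commute)
    next
      case 3
      have "continuous_on UNIV ?m"
        by (intro continuous_intros continuous_on_compose2[OF ca continuous_circ] continuous_on_compose2[OF cb continuous_circ]) auto
      hence "isCont ?m \<phi>" by (simp add: continuous_on_eq_continuous_at)
      hence l: "(?m \<longlongrightarrow> ?m \<phi>) (at \<phi>)" by (simp only: isCont_def)
      have m0: "?m \<phi> > 0" using 3 by simp
      hence "?m \<phi> / 2 < ?m \<phi>" by (simp only: field_sum_of_halves half_gt_zero_iff less_add_same_cancel1)
      from order_tendstoD(1)[OF l this] have "\<forall>\<^sub>F s in at \<phi>. ?m s > ?m \<phi> / 2" .
      then obtain e where e: "e > 0" "\<And>s. s \<noteq> \<phi> \<Longrightarrow> dist s \<phi> < e \<Longrightarrow> ?m s > ?m \<phi> / 2"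
        unfolding eventually_at by auto
      \<comment> \<open>Away from the zeros any unit vector will do, since a squared inner product
        of unit vectors is at most 1; \<open>circ 0\<close> is an arbitrary choice.\<close>
      have "?m \<phi> / 2 * (circ s \<bullet> circ 0)\<^sup>2 \<le> ?m s" if "s \<in> ball \<phi> e" for s
      proof -
        have "?m \<phi> / 2 * (circ s \<bullet> circ 0)\<^sup>2 \<le> ?m \<phi> / 2 * 1"
          using m0 unfolding inner_circ by (intro mult_left_mono) (auto simp: abs_square_le_1)
        also have "\<dots> \<le> ?m s"
        proof (cases "s = \<phi>")
          case True
          have "x / 2 * 1 \<le> x" if "x > 0" for x :: real using that by simp
          from this[OF m0] show ?thesis unfolding True .
        next
          case False
          have "dist s \<phi> < e" using that by (simp add: dist_commute)
          from e(2)[OF False this] show ?thesis by linarith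
        qed
        finally show ?thesis .
      qed
      thus ?thesis using e(1) m0 by (intro exI[of _ e] conjI exI[of _ "?m \<phi> / 2"] exI[of _ "circ 0"]) auto
    qed
  qed
  then obtain \<epsilon> where "\<forall>\<phi>. \<epsilon> \<phi> > 0 \<and> (\<exists>c>0. \<exists>n. norm n = 1 \<and> (\<forall>s\<in>ball \<phi> (\<epsilon> \<phi>). c * (circ s \<bullet> n)\<^sup>2 \<le> ?m s))"
    by metis
  then obtain c where "\<forall>\<phi>. \<epsilon> \<phi> > 0 \<and> c \<phi> > 0 \<and> (\<exists>n. norm n = 1 \<and> (\<forall>s\<in>ball \<phi> (\<epsilon> \<phi>). c \<phi> * (circ s \<bullet> n)\<^sup>2 \<le> ?m s))"
    by metis
  then obtain n where N: "\<And>\<phi>. \<epsilon> \<phi> > 0" "\<And>\<phi>. c \<phi> > 0" "\<And>\<phi>. norm (n \<phi>) = 1" "\<And>\<phi> s. s \<in> ball \<phi> (\<epsilon> \<phi>) \<Longrightarrow> c \<phi> * (circ s \<bullet> n \<phi>)\<^sup>2 \<le> ?m s"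
    by metis
  obtain T where T: "T \<subseteq> {0..2 * pi}" "finite T" "{0..2 * pi} \<subseteq> (\<Union>\<phi>\<in>T. ball \<phi> (\<epsilon> \<phi>))"
  proof (rule compactE_image[of "{0..2 * pi}" "{0..2 * pi}" "\<lambda>\<phi>. ball \<phi> (\<epsilon> \<phi>)"])
    show "{0..2 * pi} \<subseteq> (\<Union>\<phi>\<in>{0..2 * pi}. ball \<phi> (\<epsilon> \<phi>))" using N(1) by force
  qed auto
  show ?thesis
  proof (intro exI[of _ "(\<lambda>\<phi>. (c \<phi>, n \<phi>)) ` T"] conjI allI impI)
    fix \<eta> :: "real^2" assume "norm \<eta> = 1"
    hence "\<eta> \<in> circ ` {0..2 * pi}" unfolding sphere_circ by simp
    then obtain s where s: "s \<in> {0..2 * pi}" "\<eta> = circ s" by blast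
    then obtain \<phi> where "\<phi> \<in> T" "s \<in> ball \<phi> (\<epsilon> \<phi>)" using T(3) by blast
    thus "\<exists>(c, n)\<in>(\<lambda>\<phi>. (c \<phi>, n \<phi>)) ` T. c * (\<eta> \<bullet> n)\<^sup>2 \<le> min ((a \<eta>)\<^sup>2) ((b \<eta>)\<^sup>2)"
      using N(4)[of s \<phi>] s(2) by auto
  qed (use T N in auto)
qed

section \<open>Zeros of the coupling functions as hyperbolic directions\<close>

lemma exhaust_5: "x = 1 \<or> x = 2 \<or> x = 3 \<or> x = 4 \<or> x = (5::5)"
proof (induct x)
  case (of_int z)
  hence "0 \<le> z" "z < 5" by simp_all
  hence "z = 0 \<or> z = 1 \<or> z = 2 \<or> z = 3 \<or> z = 4" by arith
  thus ?case by auto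
qed

lemma forall_5: "(\<forall>i::5. P i) \<longleftrightarrow> P 1 \<and> P 2 \<and> P 3 \<and> P 4 \<and> P 5"
  by (metis exhaust_5)

lemma vector_5:
  "(vector [a, b, c, d, e] :: 'a::zero^5) $ 1 = a"
  "(vector [a, b, c, d, e] :: 'a^5) $ 2 = b"
  "(vector [a, b, c, d, e] :: 'a^5) $ 3 = c"
  "(vector [a, b, c, d, e] :: 'a^5) $ 4 = d"
  "(vector [a, b, c, d, e] :: 'a^5) $ 5 = e"
  by (simp_all add: vector_def)

text \<open>If a_j vanishes, then so does the last entry of the two columns of B with diagonal
  entries \<omega>_j and -\<omega>_j, so that unit vectors are eigenvectors. This makes the
  hypothesis on hyperbolic directions available at every zero of a coupling function.\<close>

lemma hyperbolic_wrt_of_coupling_eq_0: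
  assumes "norm \<eta> = 1" "coupling rv j \<eta> = 0"
  shows "hyperbolic_wrt \<kappa> \<gamma> \<mu> rv j \<eta>"
proof -
  have eig: "z \<in> spec M" if "column k M = z *s axis k 1" for k :: 5 and M z
  proof -
    have "M *v axis k 1 = column k M"
      by (simp add: vec_eq_iff matrix_vector_mult_def column_def axis_def if_distrib[of "\<lambda>x. _ * x"] cong: if_cong)
    hence "M *v axis k 1 = z *s axis k 1" using that by (simp only:)
    moreover have "axis k (1::complex) \<noteq> 0" by (simp add: axis_eq_0_iff)
    ultimately show ?thesis unfolding spec_def by blast
  qed
  have j: "j = 1 \<or> j = 2" by (rule exhaust_2)
  have "complex_of_real (freq \<mu> j \<eta>) \<in> spec (B_matrix \<kappa> \<gamma> \<mu> rv \<eta>) \<and> - complex_of_real (freq \<mu> j \<eta>) \<in> spec (B_matrix \<kappa> \<gamma> \<mu> rv \<eta>)"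
    using j
  proof
    assume j: "j = 1"
    have "column 1 (B_matrix \<kappa> \<gamma> \<mu> rv \<eta>) = complex_of_real (freq \<mu> j \<eta>) *s axis 1 1"
      "column 3 (B_matrix \<kappa> \<gamma> \<mu> rv \<eta>) = (- complex_of_real (freq \<mu> j \<eta>)) *s axis 3 1"
      using assms(2) by (simp_all add: j column_def B_matrix_def Let_def vec_eq_iff forall_5 vector_5 axis_def)
    thus ?thesis by (blast intro: eig)
  next
    assume j: "j = 2"
    have "column 2 (B_matrix \<kappa> \<gamma> \<mu> rv \<eta>) = complex_of_real (freq \<mu> j \<eta>) *s axis 2 1"
      "column 4 (B_matrix \<kappa> \<gamma> \<mu> rv \<eta>) = (- complex_of_real (freq \<mu> j \<eta>)) *s axis 4 1"
      using assms(2) by (simp_all add: j column_def B_matrix_def Let_def vec_eq_iff forall_5 vector_5 axis_def)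
    thus ?thesis by (blast intro: eig)
  qed
  thus ?thesis unfolding hyperbolic_wrt_def using assms(1)
    by (intro conjI exI[of _ \<eta>]) (auto simp: sgn_div_norm)
qed

section \<open>Differentiation and the Fourier transform\<close>

text \<open>In the form of difference quotients, derivatives of integrals can be computed along
  sequences by dominated convergence.\<close>

lemma has_vector_derivative_iff_quotient:
  fixes f :: "real \<Rightarrow> 'b::real_normed_vector"
  shows "(f has_vector_derivative D) (at t within S) \<longleftrightarrow> ((\<lambda>s. (f s - f t) /\<^sub>R (s - t)) \<longlongrightarrow> D) (at t within S)"
proof -
  have e: "norm (f s - f t - (s - t) *\<^sub>R D) / norm (s - t) = norm ((f s - f t) /\<^sub>R (s - t) - D)" if "s \<noteq> t" for s
  proof -
    have "(f s - f t) /\<^sub>R (s - t) - D = (f s - f t - (s - t) *\<^sub>R D) /\<^sub>R (s - t)"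
      using that by (simp add: scaleR_diff_right)
    thus ?thesis by (simp add: divide_inverse mult.commute)
  qed
  have ev: "\<forall>\<^sub>F s in at t within S. norm (f s - f t - (s - t) *\<^sub>R D) / norm (s - t) = norm ((f s - f t) /\<^sub>R (s - t) - D)"
    unfolding eventually_at_filter by (intro always_eventually) (blast intro: e)
  have "(f has_vector_derivative D) (at t within S) \<longleftrightarrow> ((\<lambda>s. norm (f s - f t - (s - t) *\<^sub>R D) / norm (s - t)) \<longlongrightarrow> 0) (at t within S)"
    unfolding has_vector_derivative_def has_derivative_iff_norm by (simp add: bounded_linear_scaleR_left)
  also have "\<dots> \<longleftrightarrow> ((\<lambda>s. norm ((f s - f t) /\<^sub>R (s - t) - D)) \<longlongrightarrow> 0) (at t within S)"
    by (rule tendsto_cong[OF ev])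
  also have "\<dots> \<longleftrightarrow> ((\<lambda>s. (f s - f t) /\<^sub>R (s - t)) \<longlongrightarrow> D) (at t within S)"
    by (simp add: tendsto_norm_zero_iff LIM_zero_iff)
  finally show ?thesis .
qed

lemma vector_derivative_mean_value_bound:
  fixes f :: "real \<Rightarrow> 'b::real_normed_vector"
  assumes "convex S" and d: "\<And>x. x \<in> S \<Longrightarrow> (f has_vector_derivative f' x) (at x)" and B: "\<And>x. x \<in> S \<Longrightarrow> norm (f' x) \<le> B"
    and "s \<in> S" "t \<in> S"
  shows "norm ((f s - f t) /\<^sub>R (s - t)) \<le> B"
proof (cases "s = t")
  case True thus ?thesis using order_trans[OF norm_ge_zero B[OF assms(4)]] by simp
next
  case False
  have "norm (f s - f t) \<le> B * norm (s - t)"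
  proof (rule differentiable_bound[OF assms(1)])
    fix x assume x: "x \<in> S"
    show "(f has_derivative (\<lambda>h. h *\<^sub>R f' x)) (at x within S)"
      using d[OF x] by (simp add: has_vector_derivative_def has_derivative_at_withinI)
    show "onorm (\<lambda>h. h *\<^sub>R f' x) \<le> B"
    proof (rule onorm_le)
      fix h :: real
      show "norm (h *\<^sub>R f' x) \<le> B * norm h" using mult_right_mono[OF B[OF x], of "\<bar>h\<bar>"] by (simp add: mult.commute)
    qed
  qed (use assms in auto)
  moreover have "norm ((f s - f t) /\<^sub>R (s - t)) = norm (f s - f t) / \<bar>s - t\<bar>" by (simp add: divide_inverse mult.commute)
  ultimately show ?thesis using False by (simp add: pos_divide_le_eq)
qed

text \<open>No decay of \<open>F\<close> at infinity is assumed. By translation invariance the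
  integral of F(x + e) - F(x) is 0; by the fundamental theorem and Fubini it is the average over
  \<open>s\<close> in [0, 1] of the integrals of the translates of \<open>G\<close>, which are all
  equal.\<close>

lemma integral_directional_derivative_eq_0:
  fixes F G :: "real^2 \<Rightarrow> complex"
  assumes der: "\<And>x s. ((\<lambda>s. F (x + s *\<^sub>R e)) has_vector_derivative G (x + s *\<^sub>R e)) (at s)"
    and G: "continuous_on UNIV G" "integrable lborel G" and F: "integrable lborel F"
  shows "(LINT x|lborel. G x) = 0"
proof -
  have [measurable]: "G \<in> borel_measurable borel" using G(2) by auto
  have tr: "integrable lborel (\<lambda>x. f (x + t)) \<longleftrightarrow> integrable lborel f" "(LINT x|lborel. f (x + t)) = (LINT x|lborel. f x)"
    for f :: "real^2 \<Rightarrow> 'b::{banach, second_countable_topology}" and t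
    using plane_affine[of 1 f t] by (simp_all add: add.commute)
  let ?h = "\<lambda>s x. indicator {0..1} s *\<^sub>R G (x + s *\<^sub>R e)"
  have Gc: "continuous_on S (\<lambda>s. G (x + s *\<^sub>R e))" for S x
    by (rule continuous_on_compose2[OF G(1)]) (auto intro!: continuous_intros)
  have ftc: "F (x + e) - F x = (LINT s|lborel. ?h s x)" for x
  proof -
    have "has_bochner_integral lborel (\<lambda>s. indicator {0..1} s *\<^sub>R G (x + s *\<^sub>R e)) (F (x + 1 *\<^sub>R e) - F (x + 0 *\<^sub>R e))"
      by (rule has_bochner_integral_FTC_Icc[where F = "\<lambda>s. F (x + s *\<^sub>R e)"])
         (auto intro!: has_vector_derivative_at_within der Gc)
    thus ?thesis by (simp add: has_bochner_integral_integral_eq)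
  qed
  have int: "integrable (lborel \<Otimes>\<^sub>M lborel) (\<lambda>(s, x). ?h s x)"
  proof (rule lborel_pair.Fubini_integrable)
    show "(\<lambda>(s, x). ?h s x) \<in> borel_measurable (lborel \<Otimes>\<^sub>M lborel)"
      by (simp add: case_prod_beta') 
    have "(\<lambda>s. LINT x|lborel. norm (?h s x)) = (\<lambda>s. indicator {0..1} s *\<^sub>R (LINT x|lborel. norm (G x)))"
      using tr(2)[of "\<lambda>x. norm (G x)"] by (auto simp: indicator_def)
    thus "integrable lborel (\<lambda>s. LINT x|lborel. norm (case (s, x) of (s, x) \<Rightarrow> ?h s x))"
      by simp
    show "AE s in lborel. integrable lborel (\<lambda>x. case (s, x) of (s, x) \<Rightarrow> ?h s x)"
      using tr(1)[of G] G(2) by simp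
  qed
  have "0 = (LINT x|lborel. F (x + e)) - (LINT x|lborel. F x)" using tr(2)[of F e] by simp
  also have "\<dots> = (LINT x|lborel. F (x + e) - F x)"
    using F tr(1)[of F e] by (intro Bochner_Integration.integral_diff[symmetric]) auto
  also have "\<dots> = (LINT x|lborel. LINT s|lborel. ?h s x)" by (simp only: ftc)
  also have "\<dots> = (LINT s|lborel. LINT x|lborel. ?h s x)" by (rule lborel_pair.Fubini_integral[OF int])
  also have "\<dots> = (LINT s|(lborel :: real measure). indicator {0..1} s *\<^sub>R (LINT x|lborel. G x))"
  proof -
    have "(LINT x|lborel. ?h s x) = indicator {0..1} s *\<^sub>R (LINT x|lborel. G x)" for s
      using tr(2)[of G] by simp
    thus ?thesis by (simp only:)
  qed
  also have "\<dots> = (LINT s|(lborel :: real measure). indicator {0..1} s) *\<^sub>R (LINT x|lborel. G x)"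
    by (rule integral_scaleR_left) simp
  also have "\<dots> = (LINT x|lborel. G x)" by simp
  finally show ?thesis by simp
qed

lemma pd_has_vector_derivative:
  fixes f :: "real^2 \<Rightarrow> 'b::real_normed_vector"
  assumes "f differentiable (at (x + s *\<^sub>R axis j 1))"
  shows "((\<lambda>s. f (x + s *\<^sub>R axis j 1)) has_vector_derivative pd j f (x + s *\<^sub>R axis j 1)) (at s)"
proof -
  let ?y = "x + s *\<^sub>R axis j 1"
  have D: "(f has_derivative frechet_derivative f (at ?y)) (at ?y)"
    using assms by (simp add: frechet_derivative_works)
  have "((\<lambda>s. x + s *\<^sub>R axis j 1) has_derivative (\<lambda>h. h *\<^sub>R axis j 1)) (at s)"
    by (auto intro!: derivative_eq_intros)
  from has_derivative_compose[OF this D]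
  have "((\<lambda>s. f (x + s *\<^sub>R axis j 1)) has_derivative (\<lambda>h. frechet_derivative f (at ?y) (h *\<^sub>R axis j 1))) (at s)" .
  moreover have "frechet_derivative f (at ?y) (h *\<^sub>R axis j 1) = h *\<^sub>R pd j f ?y" for h
    using D by (simp add: pd_def has_derivative_def bounded_linear.linear linear_cmul)
  ultimately show ?thesis by (simp add: has_vector_derivative_def)
qed

section \<open>Transforms of derivatives in space and time\<close>

lemma cis_affine_has_vector_derivative:
  "((\<lambda>s. cis (a + b * s)) has_vector_derivative (\<i> * complex_of_real b * cis (a + b * s))) (at s)"
  unfolding has_vector_derivative_complex_iff
  by (auto intro!: derivative_eq_intros)

text \<open>Integration by parts without boundary terms: the product of \<open>f\<close> with the
  exponential has an integrable directional derivative, whose integral vanishes.\<close>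

lemma FT_pd:
  fixes f :: "real^2 \<Rightarrow> complex"
  assumes "C1_L1 f"
  shows "FT (-1) (pd j f) \<xi> = \<i> * complex_of_real (\<xi> $ j) * FT (-1) f \<xi>"
proof -
  have f: "integrable lborel f" "\<And>x. f differentiable (at x)" "continuous_on UNIV (pd j f)" "integrable lborel (pd j f)"
    using assms by (auto simp: C1_L1_def)
  have fc: "continuous_on UNIV f"
    using f(2) by (simp add: continuous_on_eq_continuous_at differentiable_imp_continuous_within)
  let ?e = "\<lambda>x. cis (- 1 * (x \<bullet> \<xi>))"
  let ?G = "\<lambda>x. ?e x * pd j f x + (- \<i> * complex_of_real (\<xi> $ j)) * (?e x * f x)"
  have i1: "integrable lborel (\<lambda>x. ?e x * pd j f x)" and i2: "integrable lborel (\<lambda>x. ?e x * f x)"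
    by (intro integrable_cis_mult f)+
  have "(LINT x|lborel. ?G x) = 0"
  proof (rule integral_directional_derivative_eq_0[where F = "\<lambda>x. ?e x * f x" and e = "axis j 1"])
    fix x s
    have ax: "axis j 1 \<bullet> \<xi> = \<xi> $ j" by (simp add: inner_axis')
    have "((\<lambda>s. cis (- (x \<bullet> \<xi>) + (- (\<xi> $ j)) * s) * f (x + s *\<^sub>R axis j 1)) has_vector_derivative
       (cis (- (x \<bullet> \<xi>) + (- (\<xi> $ j)) * s) * pd j f (x + s *\<^sub>R axis j 1) + (\<i> * complex_of_real (- (\<xi> $ j)) * cis (- (x \<bullet> \<xi>) + (- (\<xi> $ j)) * s)) * f (x + s *\<^sub>R axis j 1))) (at s)"
      by (intro has_vector_derivative_mult cis_affine_has_vector_derivative pd_has_vector_derivative f)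
    moreover have "cis (- 1 * ((x + s *\<^sub>R axis j 1) \<bullet> \<xi>)) = cis (- (x \<bullet> \<xi>) + (- (\<xi> $ j)) * s)" for s
      by (simp add: inner_add_left ax algebra_simps)
    ultimately show "((\<lambda>s. ?e (x + s *\<^sub>R axis j 1) * f (x + s *\<^sub>R axis j 1)) has_vector_derivative ?G (x + s *\<^sub>R axis j 1)) (at s)"
      by (simp add: mult_ac)
  next
    show "continuous_on UNIV ?G"
      by (intro continuous_intros f fc)
    show "integrable lborel ?G" by (intro Bochner_Integration.integrable_add i1 integrable_mult_right i2)
  qed (rule i2)
  moreover have "(LINT x|lborel. ?G x) = FT (-1) (pd j f) \<xi> + (- \<i> * complex_of_real (\<xi> $ j)) * FT (-1) f \<xi>"
    unfolding FT_def by (subst Bochner_Integration.integral_add[OF i1 integrable_mult_right[OF i2]]) simp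
  ultimately show ?thesis by (simp add: add_eq_0_iff)
qed

text \<open>The majorant of the derivative also bounds the difference quotients, by the mean value
  inequality on the convex set of times between 0 and \<open>T\<close>. That \<open>t\<close> lies
  inside this interval makes the limit two-sided.\<close>

lemma FT_has_vector_derivative:
  fixes u u' :: "real \<Rightarrow> real^2 \<Rightarrow> complex"
  assumes t: "t > 0" and T: "t < T"
    and g: "integrable lborel g"
    and u: "\<And>s. 0 < s \<Longrightarrow> integrable lborel (u s)"
    and d: "\<And>s x. 0 < s \<Longrightarrow> ((\<lambda>s. u s x) has_vector_derivative u' s x) (at s)"
    and b: "\<And>s x. 0 < s \<Longrightarrow> s \<le> T \<Longrightarrow> norm (u' s x) \<le> g x"
  shows "((\<lambda>s. FT \<sigma> (u s) \<xi>) has_vector_derivative FT \<sigma> (u' t) \<xi>) (at t)" and "integrable lborel (u' t)"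
proof -
  have [measurable]: "u s \<in> borel_measurable borel" if "0 < s" for s using u[OF that] by auto
  have op: "at t within {0<..<T} = at t" using t T by (intro at_within_open) auto
  have q: "((\<lambda>s. (u s x - u t x) /\<^sub>R (s - t)) \<longlongrightarrow> u' t x) (at t within {0<..<T})" for x
    using d[OF t, of x] unfolding op has_vector_derivative_iff_quotient .
  have qb: "norm ((u s x - u t x) /\<^sub>R (s - t)) \<le> g x" if "s \<in> {0<..<T}" for s x
    by (rule vector_derivative_mean_value_bound[of "{0<..<T}" _ "\<lambda>s. u' s x"]) (use that t T d b in auto)
  \<comment> \<open>Measurability of the derivative is not among the hypotheses. It is obtained from
    a limit of difference quotients along times in (t, T) that tend to \<open>t\<close>.\<close>
  have meas: "u' t \<in> borel_measurable borel"
  proof -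
    define X where "X n = t + (T - t) / real (n + 2)" for n
    have X: "X n \<in> {0<..<T} - {t}" for n
    proof -
      have "(T - t) / real (n + 2) > 0" using T by simp
      moreover have "(T - t) / real (n + 2) < T - t" using T by (simp add: divide_less_eq)
      ultimately show ?thesis using t by (auto simp: X_def)
    qed
    have "(\<lambda>n. t + (T - t) * inverse (real (Suc (Suc n)))) \<longlonglongrightarrow> t + (T - t) * 0"
      by (intro tendsto_intros LIMSEQ_Suc[OF LIMSEQ_inverse_real_of_nat])
    hence Xl: "X \<longlonglongrightarrow> t" unfolding X_def[abs_def] by (simp add: divide_inverse)
    have "(\<lambda>n. (u (X n) x - u t x) /\<^sub>R (X n - t)) \<longlonglongrightarrow> u' t x" for x
      using q[of x, unfolded tendsto_at_iff_sequentially, rule_format, of X] X Xl by (auto simp: o_def)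
    thus ?thesis
    proof (rule borel_measurable_LIMSEQ_metric[rotated])
      fix n
      have "0 < X n" using X[of n] by auto
      thus "(\<lambda>x. (u (X n) x - u t x) /\<^sub>R (X n - t)) \<in> borel_measurable borel" using t by measurable
    qed
  qed
  show i: "integrable lborel (u' t)"
  proof (rule Bochner_Integration.integrable_bound[OF g])
    show "AE x in lborel. norm (u' t x) \<le> norm (g x)"
    proof (rule AE_I2)
      fix x
      have "norm (u' t x) \<le> g x" by (rule b) (use t T in auto)
      thus "norm (u' t x) \<le> norm (g x)" by simp
    qed
  qed (use meas in simp)
  have "((\<lambda>s. (FT \<sigma> (u s) \<xi> - FT \<sigma> (u t) \<xi>) /\<^sub>R (s - t)) \<longlongrightarrow> FT \<sigma> (u' t) \<xi>) (at t within {0<..<T})"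
    unfolding tendsto_at_iff_sequentially
  proof (intro allI impI)
    fix X assume X: "\<forall>n. X n \<in> {0<..<T} - {t}" "X \<longlonglongrightarrow> t"
    have Xp: "0 < X n" for n using X by auto
    have e: "(FT \<sigma> (u (X n)) \<xi> - FT \<sigma> (u t) \<xi>) /\<^sub>R (X n - t) = (LINT x|lborel. cis (\<sigma> * (x \<bullet> \<xi>)) * ((u (X n) x - u t x) /\<^sub>R (X n - t)))" for n
    proof -
      have "FT \<sigma> (u (X n)) \<xi> - FT \<sigma> (u t) \<xi> = (LINT x|lborel. cis (\<sigma> * (x \<bullet> \<xi>)) * u (X n) x - cis (\<sigma> * (x \<bullet> \<xi>)) * u t x)"
        unfolding FT_def by (intro Bochner_Integration.integral_diff[symmetric] integrable_cis_mult u Xp t)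
      hence "(FT \<sigma> (u (X n)) \<xi> - FT \<sigma> (u t) \<xi>) /\<^sub>R (X n - t) = (LINT x|lborel. (cis (\<sigma> * (x \<bullet> \<xi>)) * u (X n) x - cis (\<sigma> * (x \<bullet> \<xi>)) * u t x) /\<^sub>R (X n - t))"
        by simp
      thus ?thesis by (simp add: right_diff_distrib)
    qed
    have "(\<lambda>n. LINT x|lborel. cis (\<sigma> * (x \<bullet> \<xi>)) * ((u (X n) x - u t x) /\<^sub>R (X n - t))) \<longlonglongrightarrow> (LINT x|lborel. cis (\<sigma> * (x \<bullet> \<xi>)) * u' t x)"
    proof (rule integral_dominated_convergence[where w = g])
      show "AE x in lborel. (\<lambda>n. cis (\<sigma> * (x \<bullet> \<xi>)) * ((u (X n) x - u t x) /\<^sub>R (X n - t))) \<longlonglongrightarrow> cis (\<sigma> * (x \<bullet> \<xi>)) * u' t x"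
      proof (rule AE_I2)
        fix x
        have "(\<lambda>n. (u (X n) x - u t x) /\<^sub>R (X n - t)) \<longlonglongrightarrow> u' t x"
          using q[of x, unfolded tendsto_at_iff_sequentially, rule_format, of X] X by (auto simp: o_def)
        thus "(\<lambda>n. cis (\<sigma> * (x \<bullet> \<xi>)) * ((u (X n) x - u t x) /\<^sub>R (X n - t))) \<longlonglongrightarrow> cis (\<sigma> * (x \<bullet> \<xi>)) * u' t x"
          by (intro tendsto_mult tendsto_const)
      qed
      show "AE x in lborel. norm (cis (\<sigma> * (x \<bullet> \<xi>)) * ((u (X n) x - u t x) /\<^sub>R (X n - t))) \<le> g x" for n
      proof (rule AE_I2)
        fix x
        have "norm ((u (X n) x - u t x) /\<^sub>R (X n - t)) \<le> g x" using X(1) by (intro qb) auto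
        thus "norm (cis (\<sigma> * (x \<bullet> \<xi>)) * ((u (X n) x - u t x) /\<^sub>R (X n - t))) \<le> g x"
          unfolding norm_mult norm_cis mult_1 .
      qed
      show "(\<lambda>x. cis (\<sigma> * (x \<bullet> \<xi>)) * u' t x) \<in> borel_measurable lborel" using meas by simp
      show "(\<lambda>x. cis (\<sigma> * (x \<bullet> \<xi>)) * ((u (X n) x - u t x) /\<^sub>R (X n - t))) \<in> borel_measurable lborel" for n
        using Xp[of n] t by simp
    qed (rule g)
    thus "((\<lambda>s. (FT \<sigma> (u s) \<xi> - FT \<sigma> (u t) \<xi>) /\<^sub>R (s - t)) \<circ> X) \<longlonglongrightarrow> FT \<sigma> (u' t) \<xi>"
      unfolding o_def e FT_def[symmetric] .
  qed
  thus "((\<lambda>s. FT \<sigma> (u s) \<xi>) has_vector_derivative FT \<sigma> (u' t) \<xi>) (at t)"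
    unfolding op has_vector_derivative_iff_quotient .
qed

lemma FT_time_continuous:
  fixes u :: "real \<Rightarrow> real^2 \<Rightarrow> complex"
  assumes m: "\<And>s. 0 \<le> s \<Longrightarrow> u s \<in> borel_measurable borel"
    and c: "\<And>x. continuous_on {0..} (\<lambda>s. u s x)"
    and b: "\<And>T. T > 0 \<Longrightarrow> \<exists>g. integrable lborel g \<and> (\<forall>s x. 0 < s \<longrightarrow> s \<le> T \<longrightarrow> norm (u s x) \<le> g x)"
  shows "continuous_on {0..} (\<lambda>s. FT \<sigma> (u s) \<xi>)" and "integrable lborel (u 0)"
proof -
  \<comment> \<open>The majorant is given for positive times only; by continuity in time it extends
    to 0 along the sequence T / (n + 1).\<close>
  have b0: "norm (u s x) \<le> g x" if g: "\<And>s x. 0 < s \<Longrightarrow> s \<le> T \<Longrightarrow> norm (u s x) \<le> g x" and T: "T > 0" and s: "0 \<le> s" "s \<le> T" for s x g T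
  proof (cases "s = 0")
    case False thus ?thesis using s by (intro g) auto
  next
    case True
    define X where "X n = T * inverse (real (Suc n))" for n
    have X: "0 < X n" "X n \<le> T" for n using T by (auto simp: X_def field_simps)
    have "(\<lambda>n. T * inverse (real (Suc n))) \<longlonglongrightarrow> T * 0"
      by (intro tendsto_intros LIMSEQ_inverse_real_of_nat)
    hence "X \<longlonglongrightarrow> 0" by (simp add: X_def[abs_def])
    hence "(\<lambda>n. u (X n) x) \<longlonglongrightarrow> u 0 x"
      using c[of x] X(1) by (auto simp: continuous_on_sequentially o_def less_imp_le dest!: spec[of _ X])
    hence "(\<lambda>n. norm (u (X n) x)) \<longlonglongrightarrow> norm (u 0 x)" by (rule tendsto_norm)
    thus ?thesis unfolding True
      by (rule LIMSEQ_le_const2) (use g X in blast)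
  qed
  have cT: "continuous_on {0..T} (\<lambda>s. FT \<sigma> (u s) \<xi>)" if T: "T > 0" for T
  proof -
    obtain g where gi: "integrable lborel g" and g: "\<And>s x. 0 < s \<Longrightarrow> s \<le> T \<Longrightarrow> norm (u s x) \<le> g x"
      using b[OF T] by blast
    show ?thesis unfolding continuous_on_sequentially
    proof (intro ballI allI impI, elim conjE)
      fix t X assume t: "t \<in> {0..T}" and X: "\<forall>n. X n \<in> {0..T}" "X \<longlonglongrightarrow> t"
      have "(\<lambda>n. LINT x|lborel. cis (\<sigma> * (x \<bullet> \<xi>)) * u (X n) x) \<longlonglongrightarrow> (LINT x|lborel. cis (\<sigma> * (x \<bullet> \<xi>)) * u t x)"
      proof (rule integral_dominated_convergence[where w = g])
        show "AE x in lborel. (\<lambda>n. cis (\<sigma> * (x \<bullet> \<xi>)) * u (X n) x) \<longlonglongrightarrow> cis (\<sigma> * (x \<bullet> \<xi>)) * u t x"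
        proof (intro AE_I2 tendsto_mult tendsto_const)
          fix x
          have "continuous_on {0..T} (\<lambda>s. u s x)" by (rule continuous_on_subset[OF c]) auto
          thus "(\<lambda>n. u (X n) x) \<longlonglongrightarrow> u t x" using t X unfolding continuous_on_sequentially o_def by blast
        qed
        show "AE x in lborel. norm (cis (\<sigma> * (x \<bullet> \<xi>)) * u (X n) x) \<le> g x" for n
        proof (rule AE_I2)
          fix x
          have "norm (u (X n) x) \<le> g x" using X(1) by (intro b0[OF g T]) auto
          thus "norm (cis (\<sigma> * (x \<bullet> \<xi>)) * u (X n) x) \<le> g x" unfolding norm_mult norm_cis mult_1 .
        qed
        show "(\<lambda>x. cis (\<sigma> * (x \<bullet> \<xi>)) * u t x) \<in> borel_measurable lborel" using m[of t] t by simp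
        show "(\<lambda>x. cis (\<sigma> * (x \<bullet> \<xi>)) * u (X n) x) \<in> borel_measurable lborel" for n using m[of "X n"] X(1) by simp
      qed (rule gi)
      thus "((\<lambda>s. FT \<sigma> (u s) \<xi>) \<circ> X) \<longlonglongrightarrow> FT \<sigma> (u t) \<xi>" unfolding o_def FT_def .
    qed
  qed
  show "continuous_on {0..} (\<lambda>s. FT \<sigma> (u s) \<xi>)" unfolding continuous_on_eq_continuous_within
  proof
    fix t :: real assume t: "t \<in> {0..}"
    have "at t within {0..} = at t within {0..t + 1}"
      by (rule at_within_nhd[of t "{..<t+1}"]) auto
    moreover have "continuous (at t within {0..t + 1}) (\<lambda>s. FT \<sigma> (u s) \<xi>)"
      using cT[of "t + 1"] t by (simp add: continuous_on_eq_continuous_within)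
    ultimately show "continuous (at t within {0..}) (\<lambda>s. FT \<sigma> (u s) \<xi>)" by simp
  qed
  obtain g where gi: "integrable lborel g" and g: "\<And>s x. 0 < s \<Longrightarrow> s \<le> 1 \<Longrightarrow> norm (u s x) \<le> g x"
    using b[of 1] by auto
  have le: "norm (u 0 x) \<le> norm (g x)" for x
  proof -
    have "norm (u 0 x) \<le> g x" by (rule b0[OF g]) auto
    thus ?thesis by simp
  qed
  show "integrable lborel (u 0)"
    by (rule Bochner_Integration.integrable_bound[OF gi]) (use m[of 0] le in auto)
qed

text \<open>The bound for degenerate Gaussians at time 0, where the exponential is 1.\<close>

lemma integrable_japanese_powr:
  fixes \<beta> :: real
  assumes "\<beta> > 1"
  shows "integrable lborel (\<lambda>x::real^2. (1 + (norm x)\<^sup>2) powr (- \<beta>))"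
proof -
  obtain C where C: "0 < C \<and> (\<forall>t\<ge>0. (\<integral>\<^sup>+\<xi>. ennreal (exp (- 1 * t * (\<xi> \<bullet> circ 0)\<^sup>2 / (1 + (norm \<xi>)\<^sup>2)) * (1 + (norm \<xi>)\<^sup>2) powr (- \<beta>)) \<partial>lborel)
     \<le> ennreal (C * (1 + t) powr (- 1 / 2)))"
    using degenerate_gauss_bound[OF zero_less_one assms norm_circ[of 0]] by (elim exE) (rule that)
  have "(\<integral>\<^sup>+\<xi>. ennreal (exp (- 1 * 0 * (\<xi> \<bullet> circ 0)\<^sup>2 / (1 + (norm \<xi>)\<^sup>2)) * (1 + (norm \<xi>)\<^sup>2) powr (- \<beta>)) \<partial>lborel)
     \<le> ennreal (C * (1 + 0) powr (- 1 / 2))"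
    by (rule C[THEN conjunct2, rule_format]) (rule order_refl)
  hence "(\<integral>\<^sup>+\<xi>. ennreal ((1 + (norm (\<xi> :: real^2))\<^sup>2) powr (- \<beta>)) \<partial>lborel) \<le> ennreal C"
    by (simp only: mult_zero_right mult_zero_left div_0 exp_zero mult_1 add_0_right powr_one_eq_one mult_1_right)
  hence "(\<integral>\<^sup>+\<xi>. ennreal ((1 + (norm (\<xi> :: real^2))\<^sup>2) powr (- \<beta>)) \<partial>lborel) < \<infinity>"
    by (rule le_less_trans) simp
  thus ?thesis by (intro integrableI_bounded) auto
qed

section \<open>Schwartz functions and their transforms\<close>

lemma pd_bounded_linear:
  assumes L: "bounded_linear L" and f: "f differentiable (at x)"
  shows "pd j (\<lambda>x. L (f x)) x = L (pd j f x)" and "(\<lambda>x. L (f x)) differentiable (at x)"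
proof -
  have D: "(f has_derivative frechet_derivative f (at x)) (at x)" using f by (simp add: frechet_derivative_works)
  hence D': "((\<lambda>x. L (f x)) has_derivative (\<lambda>h. L (frechet_derivative f (at x) h))) (at x)"
    by (rule bounded_linear.has_derivative[OF L])
  show "pd j (\<lambda>x. L (f x)) x = L (pd j f x)"
    using frechet_derivative_at[OF D'] by (simp add: pd_def fun_eq_iff)
  show "(\<lambda>x. L (f x)) differentiable (at x)" using D' by (auto simp: differentiable_def)
qed

lemma schwartz_bounded_linear:
  assumes L: "bounded_linear L" and f: "schwartz f"
  shows "schwartz (\<lambda>x. L (f x))"
proof -
  have fd: "foldr pd js f differentiable (at x)" for js x using f by (simp add: schwartz_def)
  have eq: "foldr pd js (\<lambda>x. L (f x)) = (\<lambda>x. L (foldr pd js f x))" for js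
  proof (induction js)
    case (Cons j js)
    have "foldr pd (j # js) (\<lambda>x. L (f x)) = pd j (\<lambda>x. L (foldr pd js f x))" using Cons by simp
    also have "\<dots> = (\<lambda>x. L (pd j (foldr pd js f) x))" by (rule ext) (rule pd_bounded_linear(1)[OF L fd])
    finally show ?case by simp
  qed simp
  obtain K where K: "K > 0" "\<And>x. norm (L x) \<le> norm x * K" using bounded_linear.pos_bounded[OF L] by blast
  show ?thesis unfolding schwartz_def eq
  proof (intro allI conjI)
    fix js n
    obtain B where B: "\<And>x. norm ((1 + norm x) ^ n *\<^sub>R foldr pd js f x) \<le> B"
      using f unfolding schwartz_def bounded_iff by blast
    have "norm ((1 + norm x) ^ n *\<^sub>R L (foldr pd js f x)) \<le> B * K" for x
    proof -
      have "(1 + norm x) ^ n *\<^sub>R L (foldr pd js f x) = L ((1 + norm x) ^ n *\<^sub>R foldr pd js f x)"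
        by (simp add: linear_cmul[OF bounded_linear.linear[OF L]])
      also have "norm \<dots> \<le> norm ((1 + norm x) ^ n *\<^sub>R foldr pd js f x) * K" by (rule K(2))
      also have "\<dots> \<le> B * K" using B K(1) by (intro mult_right_mono) auto
      finally show ?thesis .
    qed
    thus "bounded (range (\<lambda>x. (1 + norm x) ^ n *\<^sub>R L (foldr pd js f x)))" unfolding bounded_iff by blast
  qed (rule pd_bounded_linear(2)[OF L fd])
qed

text \<open>Three powers of 1 + |x| give the exponent 3/2 of 1 + |x|^2, which exceeds the critical
  value 1 of the plane.\<close>

lemma schwartz_C1_L1:
  fixes f :: "real^2 \<Rightarrow> 'b::euclidean_space"
  assumes "schwartz f"
  shows "C1_L1 (foldr pd js f)"
proof -
  have d: "foldr pd js f differentiable (at x)" for js x using assms by (simp add: schwartz_def)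
  have c: "continuous_on UNIV (foldr pd js f)" for js
    using d by (simp add: continuous_on_eq_continuous_at differentiable_imp_continuous_within)
  have i: "integrable lborel (foldr pd js f)" for js
  proof -
    obtain B where B: "\<And>x. norm ((1 + norm x) ^ 3 *\<^sub>R foldr pd js f x) \<le> B"
      using assms unfolding schwartz_def bounded_iff by blast
    show ?thesis
    proof (rule Bochner_Integration.integrable_bound)
      show "integrable lborel (\<lambda>x::real^2. B * (1 + (norm x)\<^sup>2) powr (- (3 / 2)))"
        by (intro integrable_mult_right integrable_japanese_powr) simp
      show "AE x in lborel. norm (foldr pd js f x) \<le> norm (B * (1 + (norm x)\<^sup>2) powr (- (3 / 2)))"
      proof (rule AE_I2)
        fix x :: "real^2"
        have B0: "B \<ge> 0" using B[of 0] norm_ge_zero order_trans by blast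
        have p: "1 + (norm x)\<^sup>2 > 0" by (simp add: add_pos_nonneg)
        have "(1 + (norm x)\<^sup>2) powr (3 / 2) \<le> ((1 + norm x) powr 2) powr (3 / 2)"
        proof (rule powr_mono2)
          have "(1 + norm x) powr 2 = (1 + norm x)\<^sup>2" by (subst powr_numeral) (auto simp: add_nonneg_nonneg)
          also have "\<dots> \<ge> 1 + (norm x)\<^sup>2" by (simp add: power2_sum)
          finally show "1 + (norm x)\<^sup>2 \<le> (1 + norm x) powr 2" .
        qed (use p in auto)
        also have "\<dots> = (1 + norm x) powr 3" unfolding powr_powr by simp
        also have "\<dots> = (1 + norm x) ^ 3" by (subst powr_numeral) (auto simp: add_nonneg_nonneg)
        finally have "(1 + (norm x)\<^sup>2) powr (3 / 2) * norm (foldr pd js f x) \<le> (1 + norm x) ^ 3 * norm (foldr pd js f x)"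
          by (rule mult_right_mono) simp
        also have "\<dots> \<le> B" using B[of x] by simp
        finally have "norm (foldr pd js f x) \<le> B * (1 + (norm x)\<^sup>2) powr (- (3 / 2))"
          using p by (simp add: powr_minus_divide pos_le_divide_eq mult.commute)
        thus "norm (foldr pd js f x) \<le> norm (B * (1 + (norm x)\<^sup>2) powr (- (3 / 2)))" using B0 by simp
      qed
    qed (use c in \<open>simp add: borel_measurable_continuous_onI\<close>)
  qed
  show ?thesis unfolding C1_L1_def
    using i d c i[of "_ # js"] c[of "_ # js"] by simp
qed

lemma schwartz_integrable:
  fixes f :: "real^2 \<Rightarrow> 'b::euclidean_space"
  assumes "schwartz f" shows "integrable lborel f" "continuous_on UNIV f"
  using schwartz_C1_L1[OF assms, of "[]"]
  by (auto simp: C1_L1_def continuous_on_eq_continuous_at differentiable_imp_continuous_within)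

lemma FT_pd_replicate:
  fixes f :: "real^2 \<Rightarrow> complex"
  assumes "schwartz f"
  shows "FT (-1) (foldr pd (replicate n j) f) \<xi> = (\<i> * complex_of_real (\<xi> $ j)) ^ n * FT (-1) f \<xi>"
proof (induction n)
  case (Suc n)
  have "FT (-1) (foldr pd (replicate (Suc n) j) f) \<xi> = FT (-1) (pd j (foldr pd (replicate n j) f)) \<xi>" by simp
  also have "\<dots> = \<i> * complex_of_real (\<xi> $ j) * FT (-1) (foldr pd (replicate n j) f) \<xi>"
    by (rule FT_pd[OF schwartz_C1_L1[OF assms]])
  finally show ?case using Suc by simp
qed simp

text \<open>Repeated derivatives in one coordinate at a time suffice, since 1 + |\<xi>|^2 is at most
  3 times the largest of 1 and the two squared coordinates.\<close>

lemma schwartz_FT_decay: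
  fixes f :: "real^2 \<Rightarrow> complex" and N :: nat
  assumes "schwartz f"
  obtains K where "K \<ge> 0" "\<And>\<xi>. (1 + (norm \<xi>)\<^sup>2) ^ N * norm (FT (-1) f \<xi>) \<le> K"
proof -
  define B where "B n j = (LINT x|lborel. norm (foldr pd (replicate n j) f x))" for n j
  have B: "\<bar>\<xi> $ j\<bar> ^ n * norm (FT (-1) f \<xi>) \<le> B n j" for \<xi> j n
  proof -
    have "integrable lborel (foldr pd (replicate n j) f)"
      using schwartz_C1_L1[OF assms, of "replicate n j"] unfolding C1_L1_def by blast
    from norm_FT_le_LINT[OF this, of "-1" \<xi>] show ?thesis
      unfolding FT_pd_replicate[OF assms] B_def[symmetric] by (simp add: norm_mult norm_power)
  qed
  have B0: "B n j \<ge> 0" for n j by (simp add: B_def)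
  show ?thesis
  proof (rule that[of "3 ^ N * (B 0 1 + B (2 * N) 1 + B (2 * N) 2)"])
    show "3 ^ N * (B 0 1 + B (2 * N) 1 + B (2 * N) 2) \<ge> 0" using B0 by (simp add: add_nonneg_nonneg)
    fix \<xi> :: "real^2"
    define x y where "x = \<bar>\<xi> $ 1\<bar>" and "y = \<bar>\<xi> $ 2\<bar>"
    have "(1 + (norm \<xi>)\<^sup>2) ^ N \<le> 3 ^ N * (1 + x ^ (2 * N) + y ^ (2 * N))"
    proof -
      define m where "m = Max {1, x\<^sup>2, y\<^sup>2}"
      have m: "1 \<le> m" "x\<^sup>2 \<le> m" "y\<^sup>2 \<le> m" by (auto simp: m_def)
      have "m \<in> {1, x\<^sup>2, y\<^sup>2}" unfolding m_def by (rule Max_in) auto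
      hence "m ^ N \<in> {1, x ^ (2 * N), y ^ (2 * N)}" by (auto simp: power_mult)
      moreover have "x ^ (2 * N) \<ge> 0" "y ^ (2 * N) \<ge> 0" by (auto simp: x_def y_def)
      ultimately have mN: "m ^ N \<le> 1 + x ^ (2 * N) + y ^ (2 * N)" by auto
      have "1 + (norm \<xi>)\<^sup>2 \<le> 3 * m" unfolding norm_plane using m by (simp add: x_def y_def)
      hence "(1 + (norm \<xi>)\<^sup>2) ^ N \<le> (3 * m) ^ N" by (intro power_mono) auto
      also have "\<dots> = 3 ^ N * m ^ N" by (rule power_mult_distrib)
      also have "\<dots> \<le> 3 ^ N * (1 + x ^ (2 * N) + y ^ (2 * N))" using mN by (intro mult_left_mono) auto
      finally show ?thesis .
    qed
    hence "(1 + (norm \<xi>)\<^sup>2) ^ N * norm (FT (-1) f \<xi>) \<le> 3 ^ N * (1 + x ^ (2 * N) + y ^ (2 * N)) * norm (FT (-1) f \<xi>)"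
      by (rule mult_right_mono) simp
    also have "\<dots> = 3 ^ N * (\<bar>\<xi> $ 1\<bar> ^ 0 * norm (FT (-1) f \<xi>) + x ^ (2 * N) * norm (FT (-1) f \<xi>) + y ^ (2 * N) * norm (FT (-1) f \<xi>))"
      by (simp add: algebra_simps)
    also have "\<dots> \<le> 3 ^ N * (B 0 1 + B (2 * N) 1 + B (2 * N) 2)"
      unfolding x_def y_def by (intro mult_left_mono add_mono B) simp
    finally show "(1 + (norm \<xi>)\<^sup>2) ^ N * norm (FT (-1) f \<xi>) \<le> 3 ^ N * (B 0 1 + B (2 * N) 1 + B (2 * N) 2)" .
  qed
qed

lemma schwartz_FT_weight:
  fixes f :: "real^2 \<Rightarrow> complex" and a :: real
  assumes f: "schwartz f"
  shows "integrable lborel (\<lambda>\<xi>. complex_of_real ((1 + (norm \<xi>)\<^sup>2) powr a) * FT (-1) f \<xi>)"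
    and "continuous_on UNIV (\<lambda>\<xi>. complex_of_real ((1 + (norm \<xi>)\<^sup>2) powr a) * FT (-1) f \<xi>)"
proof -
  have pos: "1 + (norm \<xi>)\<^sup>2 > 0" for \<xi> :: "real^2" by (simp add: add_pos_nonneg)
  have nz: "1 + (norm \<xi>)\<^sup>2 \<noteq> 0" for \<xi> :: "real^2" using pos[of \<xi>] by linarith
  show c: "continuous_on UNIV (\<lambda>\<xi>. complex_of_real ((1 + (norm \<xi>)\<^sup>2) powr a) * FT (-1) f \<xi>)"
    by (intro continuous_intros continuous_FT schwartz_integrable[OF f]) (use nz in auto)
  \<comment> \<open>Leaves two powers of 1 + |\<xi>|^2 in reserve, which make the product
    integrable.\<close>
  define N where "N = nat \<lceil>a + 2\<rceil>"
  have N: "a + 2 \<le> real N" unfolding N_def by linarith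
  obtain K where K: "K \<ge> 0" "\<And>\<xi>. (1 + (norm \<xi>)\<^sup>2) ^ N * norm (FT (-1) f \<xi>) \<le> K"
    using schwartz_FT_decay[OF f] by blast
  show "integrable lborel (\<lambda>\<xi>. complex_of_real ((1 + (norm \<xi>)\<^sup>2) powr a) * FT (-1) f \<xi>)"
  proof (rule Bochner_Integration.integrable_bound)
    show "integrable lborel (\<lambda>\<xi>::real^2. K * (1 + (norm \<xi>)\<^sup>2) powr (- 2))"
      by (intro integrable_mult_right integrable_japanese_powr) simp
    show "AE \<xi> in lborel. norm (complex_of_real ((1 + (norm \<xi>)\<^sup>2) powr a) * FT (-1) f \<xi>) \<le> norm (K * (1 + (norm \<xi>)\<^sup>2) powr (- 2))"
    proof (rule AE_I2)
      fix \<xi> :: "real^2"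
      have "(1 + (norm \<xi>)\<^sup>2) powr a = (1 + (norm \<xi>)\<^sup>2) powr (a + 2) * (1 + (norm \<xi>)\<^sup>2) powr (- 2)"
        unfolding powr_add[symmetric] by simp
      also have "\<dots> \<le> (1 + (norm \<xi>)\<^sup>2) powr real N * (1 + (norm \<xi>)\<^sup>2) powr (- 2)"
        using N by (intro mult_right_mono powr_mono) auto
      also have "(1 + (norm \<xi>)\<^sup>2) powr real N = (1 + (norm \<xi>)\<^sup>2) ^ N" using pos by (rule powr_realpow)
      finally have "(1 + (norm \<xi>)\<^sup>2) powr a * norm (FT (-1) f \<xi>) \<le> (1 + (norm \<xi>)\<^sup>2) ^ N * (1 + (norm \<xi>)\<^sup>2) powr (- 2) * norm (FT (-1) f \<xi>)"
        by (rule mult_right_mono) simp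
      also have "\<dots> = ((1 + (norm \<xi>)\<^sup>2) ^ N * norm (FT (-1) f \<xi>)) * (1 + (norm \<xi>)\<^sup>2) powr (- 2)" by (simp only: mult_ac)
      also have "\<dots> \<le> K * (1 + (norm \<xi>)\<^sup>2) powr (- 2)" by (intro mult_right_mono K) simp
      finally show "norm (complex_of_real ((1 + (norm \<xi>)\<^sup>2) powr a) * FT (-1) f \<xi>) \<le> norm (K * (1 + (norm \<xi>)\<^sup>2) powr (- 2))"
        using K(1) by (simp add: norm_mult)
    qed
  qed (use c in \<open>simp add: borel_measurable_continuous_onI\<close>)
qed

lemma C1_L1_component:
  fixes F :: "real^2 \<Rightarrow> complex^2"
  assumes "C1_L1 F"
  shows "C1_L1 (\<lambda>x. F x $ k)"
proof -
  have b: "bounded_linear (\<lambda>v::complex^2. v $ k)" by (rule bounded_linear_vec_nth)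
  have F: "integrable lborel F" "\<And>x. F differentiable (at x)" "\<And>j. continuous_on UNIV (pd j F)" "\<And>j. integrable lborel (pd j F)"
    using assms by (auto simp: C1_L1_def)
  have "pd j (\<lambda>x. F x $ k) = (\<lambda>x. pd j F x $ k)" for j
    by (intro ext pd_bounded_linear(1)[OF b] F)
  thus ?thesis unfolding C1_L1_def
    using F by (auto intro!: integrable_bounded_linear[OF b] pd_bounded_linear(2)[OF b] continuous_on_component)
qed

section \<open>The homogeneous symbol\<close>

lemma hom_symbol_bound:
  assumes "continuous_on (sphere 0 1) A"
  obtains K where "K > 0" "\<And>\<xi>. norm (hom_symbol A \<xi>) \<le> K * (norm \<xi>)\<^sup>2"
proof -
  have "bounded (A ` sphere 0 1)" by (intro compact_imp_bounded compact_continuous_image assms) simp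
  then obtain K where K: "K > 0" "\<And>\<eta>. \<eta> \<in> sphere 0 1 \<Longrightarrow> norm (A \<eta>) \<le> K" unfolding bounded_pos by auto
  have "norm (hom_symbol A \<xi>) \<le> K * (norm \<xi>)\<^sup>2" for \<xi>
  proof (cases "\<xi> = 0")
    case False
    hence "norm (A (sgn \<xi>)) \<le> K" by (intro K) (simp add: norm_sgn)
    hence "(norm \<xi>)\<^sup>2 * norm (A (sgn \<xi>)) \<le> (norm \<xi>)\<^sup>2 * K" by (intro mult_left_mono) auto
    thus ?thesis by (simp add: hom_symbol_def mult.commute)
  qed (simp add: hom_symbol_def)
  thus ?thesis using K(1) that by blast
qed

lemma continuous_sgn_compose:
  fixes f :: "real^2 \<Rightarrow> 'b::topological_space"
  assumes "continuous_on (sphere 0 1) f"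
  shows "continuous_on (- {0}) (\<lambda>\<xi>. f (sgn \<xi>))"
proof (rule continuous_on_compose2[OF assms])
  show "continuous_on (- {0}) (sgn :: real^2 \<Rightarrow> real^2)"
    unfolding sgn_div_norm[abs_def] by (intro continuous_intros) auto
qed (auto simp: norm_sgn split: if_splits)

text \<open>At the origin there is no direction, but the symbol is bounded by a multiple of
  |\<xi>|^2 there.\<close>

lemma continuous_hom_symbol:
  assumes "continuous_on (sphere 0 1) A"
  shows "continuous_on UNIV (hom_symbol A)"
proof (rule continuous_at_imp_continuous_on, rule ballI)
  fix \<xi> :: "real^2"
  show "isCont (hom_symbol A) \<xi>"
  proof (cases "\<xi> = 0")
    case False
    have "continuous_on (- {0}) (hom_symbol A)"
      unfolding hom_symbol_def[abs_def] by (intro continuous_intros continuous_sgn_compose assms)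
    thus ?thesis using False by (simp add: continuous_on_eq_continuous_at open_Compl)
  next
    case True
    obtain K where K: "K > 0" "\<And>\<xi>. norm (hom_symbol A \<xi>) \<le> K * (norm \<xi>)\<^sup>2" using hom_symbol_bound[OF assms] by blast
    have "((\<lambda>\<xi>::real^2. K * (norm \<xi>)\<^sup>2) \<longlongrightarrow> K * (norm (0::real^2))\<^sup>2) (at 0)" by (intro tendsto_intros)
    hence "((\<lambda>\<xi>::real^2. K * (norm \<xi>)\<^sup>2) \<longlongrightarrow> 0) (at 0)" by simp
    hence "(hom_symbol A \<longlongrightarrow> 0) (at 0)" by (rule Lim_null_comparison[OF always_eventually[OF allI[OF K(2)]]])
    thus ?thesis unfolding True isCont_def by (simp add: hom_symbol_def)
  qed
qed

lemma mult_op_vec_FT: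
  "mult_op_vec M F x $ k = complex_of_real (1 / (2 * pi)) * FT 1 (\<lambda>\<xi>. \<Sum>l\<in>UNIV. M \<xi> $ k $ l * (complex_of_real (1 / (2 * pi)) * FT (-1) (\<lambda>x. F x $ l) \<xi>)) x"
  by (simp add: mult_op_vec_def inv_fourier_vec_def inv_fourier_FT fourier_vec_def fourier_FT matrix_vector_mult_def)

section \<open>The transformed Cauchy problem\<close>

text \<open>One solution of the Cauchy problem. The solution class asks for spatial regularity at
  positive times only; continuity of the data supplies measurability in space at time 0.\<close>

locale thermoelastic =
  fixes A :: "real^2 \<Rightarrow> complex^2^2" and \<kappa> \<gamma> :: real
    and U\<^sub>1 U\<^sub>2 :: "real^2 \<Rightarrow> complex^2" and \<theta>\<^sub>0 :: "real^2 \<Rightarrow> complex"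
    and U :: "real \<Rightarrow> real^2 \<Rightarrow> complex^2" and \<theta> :: "real \<Rightarrow> real^2 \<Rightarrow> complex"
  assumes A_cont: "continuous_on (sphere 0 1) A"
    and sol: "thermoelastic_solution A \<kappa> \<gamma> U\<^sub>1 U\<^sub>2 \<theta>\<^sub>0 U \<theta>"
    and data_cont: "continuous_on UNIV U\<^sub>1" "continuous_on UNIV U\<^sub>2" "continuous_on UNIV \<theta>\<^sub>0"
begin

text \<open>The hatted unknowns, componentwise and without normalisation. The factors 1 / (2 pi) of
  the Fourier multipliers reappear only where \<open>mult_op_vec\<close> does.\<close>

definition "uh k t = FT (-1) (\<lambda>x. U t x $ k)"
definition "vh k t = FT (-1) (\<lambda>x. dt U t x $ k)"
definition "th t = FT (-1) (\<theta> t)"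

lemma in_solution_class: "solution_class U \<theta>" using sol by (simp add: thermoelastic_solution_def)

lemma initial: "U 0 = U\<^sub>1" "dt U 0 = U\<^sub>2" "\<theta> 0 = \<theta>\<^sub>0"
  using sol by (auto simp: thermoelastic_solution_def)

lemma at_half_line: "t > 0 \<Longrightarrow> at t within {0..} = at (t::real)"
  by (rule at_within_open_subset[of t "{0<..}"]) auto

lemma U_deriv:
  assumes "t > 0" shows "((\<lambda>s. U s x) has_vector_derivative dt U t x) (at t)"
proof -
  have "(\<lambda>s. U s x) differentiable (at t within {0..})" using in_solution_class assms by (simp add: solution_class_def)
  hence "((\<lambda>s. U s x) has_vector_derivative dt U t x) (at t within {0..})"
    unfolding dt_def by (simp add: vector_derivative_works)
  thus ?thesis by (simp add: at_half_line assms)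
qed

lemma V_deriv:
  assumes "t > 0" shows "((\<lambda>s. dt U s x) has_vector_derivative dt (dt U) t x) (at t)"
proof -
  have "(\<lambda>s. dt U s x) differentiable (at t)" using in_solution_class assms by (simp add: solution_class_def)
  thus ?thesis unfolding dt_def[of "dt U"] at_half_line[OF assms] by (simp only: vector_derivative_works)
qed

lemma \<theta>_deriv:
  assumes "t > 0" shows "((\<lambda>s. \<theta> s x) has_vector_derivative dt \<theta> t x) (at t)"
proof -
  have "(\<lambda>s. \<theta> s x) differentiable (at t)" using in_solution_class assms by (simp add: solution_class_def)
  thus ?thesis unfolding dt_def at_half_line[OF assms] by (simp only: vector_derivative_works)
qed

lemma comp_deriv:
  assumes "((\<lambda>s. F s x) has_vector_derivative D) (at t)"
  shows "((\<lambda>s. (F s x :: complex^2) $ k) has_vector_derivative D $ k) (at t)"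
  by (rule bounded_linear.has_vector_derivative[OF bounded_linear_vec_nth assms])

lemma majorant:
  assumes "T > 0"
  obtains g where "integrable lborel g"
    "\<And>t x. 0 < t \<Longrightarrow> t \<le> T \<Longrightarrow> norm (U t x) \<le> g x"
    "\<And>t x. 0 < t \<Longrightarrow> t \<le> T \<Longrightarrow> norm (dt U t x) \<le> g x"
    "\<And>t x. 0 < t \<Longrightarrow> t \<le> T \<Longrightarrow> norm (dt (dt U) t x) \<le> g x"
    "\<And>t x. 0 < t \<Longrightarrow> t \<le> T \<Longrightarrow> norm (\<theta> t x) \<le> g x"
    "\<And>t x. 0 < t \<Longrightarrow> t \<le> T \<Longrightarrow> norm (dt \<theta> t x) \<le> g x"
proof -
  have "\<exists>g. integrable lborel g \<and> (\<forall>t x. 0 < t \<and> t \<le> T \<longrightarrow>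
        norm (U t x) \<le> g x \<and> norm (dt U t x) \<le> g x \<and> norm (dt (dt U) t x) \<le> g x \<and>
        norm (\<theta> t x) \<le> g x \<and> norm (dt \<theta> t x) \<le> g x)"
    using in_solution_class assms unfolding solution_class_def by blast
  thus ?thesis using that by blast
qed

lemma C1_L1_in_space: 
  assumes "t > 0" shows "C1_L1 (U t)" "C1_L1 (dt U t)" "C1_L1 (\<theta> t)" "C1_L1 (pd j (\<theta> t))"
  using in_solution_class assms by (auto simp: solution_class_def)

lemma C1_L1D:
  assumes "C1_L1 f" shows "integrable lborel f" "continuous_on UNIV f" "integrable lborel (pd j f)"
  using assms by (auto simp: C1_L1_def continuous_on_eq_continuous_at differentiable_imp_continuous_within)

lemma continuous_in_space:
  assumes "t \<ge> 0" shows "continuous_on UNIV (U t)" "continuous_on UNIV (dt U t)" "continuous_on UNIV (\<theta> t)"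
proof -
  have "continuous_on UNIV (U t) \<and> continuous_on UNIV (dt U t) \<and> continuous_on UNIV (\<theta> t)"
  proof (cases "t = 0")
    case True
    show ?thesis unfolding True initial by (intro conjI data_cont)
  next
    case False
    hence t: "t > 0" using assms by simp
    show ?thesis by (intro conjI C1_L1D(2)[OF C1_L1_in_space(1)[OF t]] C1_L1D(2)[OF C1_L1_in_space(2)[OF t]] C1_L1D(2)[OF C1_L1_in_space(3)[OF t]])
  qed
  thus "continuous_on UNIV (U t)" "continuous_on UNIV (dt U t)" "continuous_on UNIV (\<theta> t)" by blast+
qed

lemma time_cont_U: "continuous_on {0..} (\<lambda>t. U t x)"
  using in_solution_class unfolding solution_class_def continuous_on_eq_continuous_within
  by (auto intro: differentiable_imp_continuous_within)

lemma time_cont: "continuous_on {0..} (\<lambda>t. dt U t x)" "continuous_on {0..} (\<lambda>t. \<theta> t x)"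
  using in_solution_class unfolding solution_class_def by auto

lemma measurable_comp:
  fixes F :: "real^2 \<Rightarrow> complex^2"
  assumes "continuous_on UNIV F" shows "(\<lambda>x. F x $ k) \<in> borel_measurable borel"
  by (intro borel_measurable_continuous_onI continuous_on_component assms)

lemma uh_cont: "continuous_on {0..} (\<lambda>t. uh k t \<xi>)" and U_int0: "integrable lborel (\<lambda>x. U 0 x $ k)"
proof -
  have b: "\<exists>g. integrable lborel g \<and> (\<forall>s x. 0 < s \<longrightarrow> s \<le> T \<longrightarrow> norm (U s x $ k) \<le> g x)" if "T > 0" for T
    using majorant[OF that] order_trans[OF Finite_Cartesian_Product.norm_nth_le] by metis
  note * = FT_time_continuous[of "\<lambda>t x. U t x $ k", OF measurable_comp[OF continuous_in_space(1)] continuous_on_component[OF time_cont_U] b]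
  show "continuous_on {0..} (\<lambda>t. uh k t \<xi>)" unfolding uh_def by (rule *(1)) auto
  show "integrable lborel (\<lambda>x. U 0 x $ k)" by (rule *(2)) auto
qed

lemma vh_cont: "continuous_on {0..} (\<lambda>t. vh k t \<xi>)" and V_int0: "integrable lborel (\<lambda>x. dt U 0 x $ k)"
proof -
  have b: "\<exists>g. integrable lborel g \<and> (\<forall>s x. 0 < s \<longrightarrow> s \<le> T \<longrightarrow> norm (dt U s x $ k) \<le> g x)" if "T > 0" for T
    using majorant[OF that] order_trans[OF Finite_Cartesian_Product.norm_nth_le] by metis
  note * = FT_time_continuous[of "\<lambda>t x. dt U t x $ k", OF measurable_comp[OF continuous_in_space(2)] continuous_on_component[OF time_cont(1)] b]
  show "continuous_on {0..} (\<lambda>t. vh k t \<xi>)" unfolding vh_def by (rule *(1)) auto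
  show "integrable lborel (\<lambda>x. dt U 0 x $ k)" by (rule *(2)) auto
qed

lemma th_cont: "continuous_on {0..} (\<lambda>t. th t \<xi>)" and \<theta>_int0: "integrable lborel (\<theta> 0)"
proof -
  have b: "\<exists>g. integrable lborel g \<and> (\<forall>s x. 0 < s \<longrightarrow> s \<le> T \<longrightarrow> norm (\<theta> s x) \<le> g x)" if "T > 0" for T
    using majorant[OF that] by metis
  note * = FT_time_continuous[of "\<theta>", OF borel_measurable_continuous_onI[OF continuous_in_space(3)] time_cont(2) b]
  show "continuous_on {0..} (\<lambda>t. th t \<xi>)" unfolding th_def by (rule *(1)) auto
  show "integrable lborel (\<theta> 0)" by (rule *(2)) auto
qed

lemma integrable_in_space:
  assumes "t \<ge> 0"
  shows "integrable lborel (\<lambda>x. U t x $ k)" "integrable lborel (\<lambda>x. dt U t x $ k)" "integrable lborel (\<theta> t)"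
  using U_int0 V_int0 \<theta>_int0 C1_L1D(1)[OF C1_L1_component[OF C1_L1_in_space(1)]] C1_L1D(1)[OF C1_L1_component[OF C1_L1_in_space(2)]] C1_L1D(1)[OF C1_L1_in_space(3)] assms
  by (cases "t = 0"; simp)+

lemma uh_deriv:
  assumes "t > 0" shows "((\<lambda>s. uh k s \<xi>) has_vector_derivative vh k t \<xi>) (at t)"
proof -
  obtain g where g: "integrable lborel g" "\<And>s x. 0 < s \<Longrightarrow> s \<le> t + 1 \<Longrightarrow> norm (dt U s x) \<le> g x"
    using majorant[of "t + 1"] assms by (metis add_pos_pos zero_less_one)
  show ?thesis unfolding uh_def vh_def
  proof (rule FT_has_vector_derivative(1)[where T = "t + 1" and g = g])
    show "norm (dt U s x $ k) \<le> g x" if "0 < s" "s \<le> t + 1" for s x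
      using g(2)[OF that] Finite_Cartesian_Product.norm_nth_le[of "dt U s x" k] by (rule order_trans[rotated])
  qed (use assms g(1) in \<open>auto intro!: integrable_in_space comp_deriv U_deriv\<close>)
qed

text \<open>The differential equation is not inserted yet. The second claim is what later shows that
  the nonlocal term A(D) U is integrable in space.\<close>

lemma vh_deriv_raw:
  assumes "t > 0" shows "((\<lambda>s. vh k s \<xi>) has_vector_derivative FT (-1) (\<lambda>x. dt (dt U) t x $ k) \<xi>) (at t)"
    and "integrable lborel (\<lambda>x. dt (dt U) t x $ k)"
proof -
  obtain g where g: "integrable lborel g" "\<And>s x. 0 < s \<Longrightarrow> s \<le> t + 1 \<Longrightarrow> norm (dt (dt U) s x) \<le> g x"
    using majorant[of "t + 1"] assms by (metis add_pos_pos zero_less_one)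
  have b: "norm (dt (dt U) s x $ k) \<le> g x" if "0 < s" "s \<le> t + 1" for s x
    using g(2)[OF that] Finite_Cartesian_Product.norm_nth_le[of "dt (dt U) s x" k] by (rule order_trans[rotated])
  show "((\<lambda>s. vh k s \<xi>) has_vector_derivative FT (-1) (\<lambda>x. dt (dt U) t x $ k) \<xi>) (at t)"
    unfolding vh_def
    by (rule FT_has_vector_derivative(1)[where T = "t + 1" and g = g])
       (use assms g(1) b in \<open>auto intro!: integrable_in_space comp_deriv V_deriv\<close>)
  show "integrable lborel (\<lambda>x. dt (dt U) t x $ k)"
    by (rule FT_has_vector_derivative(2)[where T = "t + 1" and g = g and u = "\<lambda>t x. dt U t x $ k" and u' = "\<lambda>t x. dt (dt U) t x $ k"])
       (use assms g(1) b in \<open>auto intro!: integrable_in_space comp_deriv V_deriv\<close>)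
qed

lemma th_deriv_raw:
  assumes "t > 0" shows "((\<lambda>s. th s \<xi>) has_vector_derivative FT (-1) (dt \<theta> t) \<xi>) (at t)"
proof -
  obtain g where g: "integrable lborel g" "\<And>s x. 0 < s \<Longrightarrow> s \<le> t + 1 \<Longrightarrow> norm (dt \<theta> s x) \<le> g x"
    using majorant[of "t + 1"] assms by (metis add_pos_pos zero_less_one)
  show ?thesis unfolding th_def
    by (rule FT_has_vector_derivative(1)[where T = "t + 1" and g = g])
       (use assms g in \<open>auto intro!: integrable_in_space \<theta>_deriv\<close>)
qed

lemma FT_linear_combination:
  assumes "integrable lborel f" "integrable lborel g"
  shows "FT s (\<lambda>x. a * f x + b * g x) \<xi> = a * FT s f \<xi> + b * FT s g \<xi>"
  using FT_add[of "\<lambda>x. a * f x" "\<lambda>x. b * g x" s \<xi>] assms by (simp add: FT_cmult)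

lemma th_deriv:
  assumes t: "t > 0"
  shows "((\<lambda>s. th s \<xi>) has_vector_derivative
    - complex_of_real (\<kappa> * (norm \<xi>)\<^sup>2) * th t \<xi> - \<i> * complex_of_real \<gamma> * (\<Sum>l\<in>UNIV. complex_of_real (\<xi> $ l) * vh l t \<xi>)) (at t)"
proof -
  \<comment> \<open>The factors 1 bring the right-hand side into the nested shape a f + b g that
    \<open>FT_linear_combination\<close> expects.\<close>
  have pde: "dt \<theta> t x = complex_of_real \<kappa> * (1 * pd 1 (pd 1 (\<theta> t)) x + 1 * pd 2 (pd 2 (\<theta> t)) x)
     + (- complex_of_real \<gamma>) * (1 * pd 1 (\<lambda>y. dt U t y $ 1) x + 1 * pd 2 (\<lambda>y. dt U t y $ 2) x)" for x
  proof -
    have "dt \<theta> t x - \<kappa> *\<^sub>R laplacian (\<theta> t) x + \<gamma> *\<^sub>R divergence (dt U t) x = 0"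
      using sol t by (simp add: thermoelastic_solution_def)
    thus ?thesis by (simp add: laplacian_def divergence_def sum_2 scaleR_conv_of_real add_eq_0_iff algebra_simps)
  qed
  have c: "C1_L1 (\<theta> t)" "\<And>j. C1_L1 (pd j (\<theta> t))" "\<And>k. C1_L1 (\<lambda>y. dt U t y $ k)"
    using C1_L1_in_space[OF t] C1_L1_component by blast+
  have i: "integrable lborel (pd j (pd j (\<theta> t)))" "integrable lborel (pd j (\<lambda>y. dt U t y $ k))" for j k
    by (intro C1_L1D(3) c)+
  have "FT (-1) (dt \<theta> t) \<xi> = complex_of_real \<kappa> * (1 * FT (-1) (pd 1 (pd 1 (\<theta> t))) \<xi> + 1 * FT (-1) (pd 2 (pd 2 (\<theta> t))) \<xi>)
     + (- complex_of_real \<gamma>) * (1 * FT (-1) (pd 1 (\<lambda>y. dt U t y $ 1)) \<xi> + 1 * FT (-1) (pd 2 (\<lambda>y. dt U t y $ 2)) \<xi>)"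
    unfolding pde[abs_def]
    by (subst FT_linear_combination; (intro Bochner_Integration.integrable_add integrable_mult_right i)?; (subst (1 2) FT_linear_combination; (intro i)?)?)
       (rule refl)
  also have "\<dots> = - complex_of_real (\<kappa> * (norm \<xi>)\<^sup>2) * th t \<xi> - \<i> * complex_of_real \<gamma> * (\<Sum>l\<in>UNIV. complex_of_real (\<xi> $ l) * vh l t \<xi>)"
  proof -
    have "FT (-1) (pd j (pd j (\<theta> t))) \<xi> = - complex_of_real ((\<xi> $ j)\<^sup>2) * th t \<xi>" for j
    proof -
      have "\<i> * a * (\<i> * a * w) = (\<i> * \<i>) * (a * a * w)" for a w :: complex by (simp only: mult_ac)
      thus ?thesis unfolding FT_pd[OF c(2)] FT_pd[OF c(1)] th_def by (simp add: power2_eq_square)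
    qed
    moreover have "FT (-1) (pd j (\<lambda>y. dt U t y $ j)) \<xi> = \<i> * complex_of_real (\<xi> $ j) * vh j t \<xi>" for j
      unfolding FT_pd[OF c(3)] vh_def ..
    ultimately show ?thesis
      by (simp add: norm_plane sum_2 algebra_simps)
  qed
  finally show ?thesis using th_deriv_raw[OF t, of \<xi>] by simp
qed

text \<open>The nonlocal term is defined as an inverse Fourier integral, and its transform is the
  expected product only if that integral is integrable in space. This is read off from the equation
  itself: it equals minus the sum of U_tt and \<gamma> \<nabla> \<theta>, both of which are
  integrable.\<close>

lemma vh_deriv:
  assumes t: "t > 0"
  shows "((\<lambda>s. vh k s \<xi>) has_vector_derivative
    - (\<Sum>l\<in>UNIV. hom_symbol A \<xi> $ k $ l * uh l t \<xi>) - \<i> * complex_of_real (\<gamma> * \<xi> $ k) * th t \<xi>) (at t)"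
proof -
  define b where "b = complex_of_real (1 / (2 * pi))"
  define kk where "kk \<zeta> = (\<Sum>l\<in>UNIV. hom_symbol A \<zeta> $ k $ l * (b * uh l t \<zeta>))" for \<zeta>
  have b0: "b \<noteq> 0" by (simp add: b_def)
  have kc: "continuous_on UNIV kk"
    unfolding kk_def[abs_def] uh_def
    by (intro continuous_intros continuous_on_component continuous_hom_symbol A_cont continuous_FT integrable_in_space) (use t in auto)
  have fv: "fourier_vec (U t) \<zeta> $ l = b * uh l t \<zeta>" for \<zeta> l
    by (simp add: fourier_vec_def fourier_FT uh_def b_def)
  obtain K where K: "K > 0" "\<And>\<xi>. norm (hom_symbol A \<xi>) \<le> K * (norm \<xi>)\<^sup>2" using hom_symbol_bound[OF A_cont] by blast
  have ki: "integrable lborel kk"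
  proof (rule Bochner_Integration.integrable_bound)
    have "integrable lborel (\<lambda>\<zeta>. (norm \<zeta>)\<^sup>2 *\<^sub>R fourier_vec (U t) \<zeta>)" using in_solution_class t by (simp add: solution_class_def)
    thus "integrable lborel (\<lambda>\<zeta>. 2 * K * norm ((norm \<zeta>)\<^sup>2 *\<^sub>R fourier_vec (U t) \<zeta>))" by (intro integrable_mult_right integrable_norm)
    show "AE \<zeta> in lborel. norm (kk \<zeta>) \<le> norm (2 * K * norm ((norm \<zeta>)\<^sup>2 *\<^sub>R fourier_vec (U t) \<zeta>))"
    proof (rule AE_I2)
      fix \<zeta>
      have "norm (hom_symbol A \<zeta> $ k $ l * (b * uh l t \<zeta>)) \<le> K * norm ((norm \<zeta>)\<^sup>2 *\<^sub>R fourier_vec (U t) \<zeta>)" for l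
      proof -
        have "norm (hom_symbol A \<zeta> $ k $ l) \<le> norm (hom_symbol A \<zeta>)"
          by (rule order_trans[OF Finite_Cartesian_Product.norm_nth_le Finite_Cartesian_Product.norm_nth_le])
        hence "norm (hom_symbol A \<zeta> $ k $ l) \<le> K * (norm \<zeta>)\<^sup>2" using K(2) order_trans by blast
        moreover have "norm (b * uh l t \<zeta>) \<le> norm (fourier_vec (U t) \<zeta>)"
          unfolding fv[symmetric] by (rule Finite_Cartesian_Product.norm_nth_le)
        ultimately have "norm (hom_symbol A \<zeta> $ k $ l) * norm (b * uh l t \<zeta>) \<le> (K * (norm \<zeta>)\<^sup>2) * norm (fourier_vec (U t) \<zeta>)"
          using K(1) by (intro mult_mono) auto
        thus ?thesis by (simp add: norm_mult)
      qed
      hence "norm (kk \<zeta>) \<le> (\<Sum>l\<in>(UNIV::2 set). K * norm ((norm \<zeta>)\<^sup>2 *\<^sub>R fourier_vec (U t) \<zeta>))"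
        unfolding kk_def by (rule sum_norm_le)
      thus "norm (kk \<zeta>) \<le> norm (2 * K * norm ((norm \<zeta>)\<^sup>2 *\<^sub>R fourier_vec (U t) \<zeta>))" using K(1) by (simp add: sum_2)
    qed
  qed (use kc in \<open>simp add: borel_measurable_continuous_onI\<close>)
  have pde: "dt (dt U) t x $ k = (- b) * FT 1 kk x + (- complex_of_real \<gamma>) * pd k (\<theta> t) x" for x
  proof -
    have "dt (dt U) t x + mult_op_vec (hom_symbol A) (U t) x + \<gamma> *\<^sub>R gradient (\<theta> t) x = 0"
      using sol t by (simp add: thermoelastic_solution_def)
    hence "(dt (dt U) t x + mult_op_vec (hom_symbol A) (U t) x + \<gamma> *\<^sub>R gradient (\<theta> t) x) $ k = 0" by simp
    hence "dt (dt U) t x $ k + mult_op_vec (hom_symbol A) (U t) x $ k + \<gamma> *\<^sub>R pd k (\<theta> t) x = 0"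
      by (simp add: gradient_def)
    hence "dt (dt U) t x $ k + mult_op_vec (hom_symbol A) (U t) x $ k + complex_of_real \<gamma> * pd k (\<theta> t) x = 0"
      by (simp only: scaleR_conv_of_real)
    moreover have "mult_op_vec (hom_symbol A) (U t) x $ k = b * FT 1 kk x"
      unfolding mult_op_vec_FT kk_def[abs_def] b_def uh_def ..
    ultimately show ?thesis by (simp add: add_eq_0_iff algebra_simps)
  qed
  have pi: "integrable lborel (pd k (\<theta> t))" by (rule C1_L1D(3)[OF C1_L1_in_space(3)[OF t]])
  have wi: "integrable lborel (FT 1 kk)"
  proof -
    have "FT 1 kk x = (- 1 / b) * dt (dt U) t x $ k + (- complex_of_real \<gamma> / b) * pd k (\<theta> t) x" for x
      using b0 by (simp add: pde field_simps)
    hence fe: "FT 1 kk = (\<lambda>x. (- 1 / b) * dt (dt U) t x $ k + (- complex_of_real \<gamma> / b) * pd k (\<theta> t) x)"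
      by (rule ext)
    show ?thesis unfolding fe
      by (intro Bochner_Integration.integrable_add integrable_mult_right vh_deriv_raw(2)[OF t] pi)
  qed
  have "FT (-1) (FT 1 kk) \<xi> = (2 * pi)\<^sup>2 * kk \<xi>"
    using kc by (intro FT_inversion ki wi) (auto simp: continuous_on_eq_continuous_at)
  hence F: "FT (-1) (\<lambda>x. dt (dt U) t x $ k) \<xi> = (- b) * (complex_of_real ((2 * pi)\<^sup>2) * kk \<xi>) + (- complex_of_real \<gamma>) * (\<i> * complex_of_real (\<xi> $ k) * th t \<xi>)"
    unfolding pde FT_linear_combination[OF wi pi] FT_pd[OF C1_L1_in_space(3)[OF t]] th_def by simp
  \<comment> \<open>The two normalising factors 1 / (2 pi) cancel the (2 pi)^2 of the inversion
    formula.\<close>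
  have e: "b * (complex_of_real ((2 * pi)\<^sup>2) * kk \<xi>) = (\<Sum>l\<in>UNIV. hom_symbol A \<xi> $ k $ l * uh l t \<xi>)"
  proof -
    have "kk \<xi> = b * (\<Sum>l\<in>UNIV. hom_symbol A \<xi> $ k $ l * uh l t \<xi>)"
      unfolding kk_def sum_distrib_left by (simp add: mult_ac)
    moreover have "b * complex_of_real ((2 * pi)\<^sup>2) * b = 1" by (simp add: b_def power2_eq_square)
    moreover have "b * (c * (b * z)) = (b * c * b) * z" for c z by (simp only: mult_ac)
    ultimately show ?thesis by (simp only: mult_1)
  qed
  have "FT (-1) (\<lambda>x. dt (dt U) t x $ k) \<xi> = - (\<Sum>l\<in>UNIV. hom_symbol A \<xi> $ k $ l * uh l t \<xi>) - \<i> * complex_of_real (\<gamma> * \<xi> $ k) * th t \<xi>"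
    unfolding F minus_mult_left[symmetric] e by (simp add: mult_ac)
  thus ?thesis using vh_deriv_raw(1)[OF t, of k \<xi>] by simp
qed

end

section \<open>Spectral decomposition\<close>

text \<open>Orthonormal rows have orthonormal columns. The determinant D satisfies D^2 = 1, and the
  second vector is D times the first one rotated by a right angle.\<close>

lemma orthonormal_completeness:
  fixes r1 r2 :: "real^2"
  assumes "norm r1 = 1" "norm r2 = 1" "r1 \<bullet> r2 = 0"
  shows "r1 $ 1 * r1 $ 1 + r2 $ 1 * r2 $ 1 = 1" "r1 $ 2 * r1 $ 2 + r2 $ 2 * r2 $ 2 = 1"
    "r1 $ 1 * r1 $ 2 + r2 $ 1 * r2 $ 2 = 0"
proof -
  define a b c d where "a = r1 $ 1" and "b = r1 $ 2" and "c = r2 $ 1" and "d = r2 $ 2"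
  have e: "a * a + b * b = 1" "c * c + d * d = 1" "a * c + b * d = 0"
    using assms norm_plane[of r1] norm_plane[of r2] inner_plane[of r1 r2]
    by (simp_all add: a_def b_def c_def d_def power2_eq_square)
  define D where "D = a * d - b * c"
  have D2: "D * D = 1"
  proof -
    have "D * D = (a * a + b * b) * (c * c + d * d) - (a * c + b * d) * (a * c + b * d)"
      by (simp add: D_def algebra_simps)
    thus ?thesis by (simp add: e)
  qed
  have c: "c = - b * D"
  proof -
    have "- b * D = c * (a * a + b * b) - a * (a * c + b * d)" by (simp add: D_def algebra_simps)
    thus ?thesis by (simp add: e)
  qed
  have d: "d = a * D"
  proof -
    have "a * D = d * (a * a + b * b) - b * (a * c + b * d)" by (simp add: D_def algebra_simps)
    thus ?thesis by (simp add: e)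
  qed
  have "c * c = b * b * (D * D)" "d * d = a * a * (D * D)" "c * d = - (a * b) * (D * D)"
    unfolding c d by simp_all
  hence q: "c * c = b * b" "d * d = a * a" "c * d = - (a * b)" by (simp_all add: D2)
  show "r1 $ 1 * r1 $ 1 + r2 $ 1 * r2 $ 1 = 1" "r1 $ 2 * r1 $ 2 + r2 $ 2 * r2 $ 2 = 1"
    "r1 $ 1 * r1 $ 2 + r2 $ 1 * r2 $ 2 = 0"
    unfolding a_def[symmetric] b_def[symmetric] c_def[symmetric] d_def[symmetric] q using e by (simp_all add: add.commute)
qed

lemma orthonormal_resolution:
  fixes r :: "2 \<Rightarrow> real^2"
  assumes "norm (r 1) = 1" "norm (r 2) = 1" "r 1 \<bullet> r 2 = 0"
  shows "(\<Sum>j\<in>UNIV. r j $ k * r j $ l) = (if k = l then 1 else 0)"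
proof -
  note c = orthonormal_completeness[OF assms]
  have c': "r 1 $ 2 * r 1 $ 1 + r 2 $ 2 * r 2 $ 1 = 0" using c(3) by (simp only: mult.commute)
  from exhaust_2[of k] exhaust_2[of l] show ?thesis
    by (elim disjE) (simp_all add: sum_2 c c')
qed

lemma orthonormal_expansion:
  fixes r :: "2 \<Rightarrow> real^2" and x :: "2 \<Rightarrow> complex"
  assumes "norm (r 1) = 1" "norm (r 2) = 1" "r 1 \<bullet> r 2 = 0"
  shows "x k = (\<Sum>j\<in>UNIV. complex_of_real (r j $ k) * (\<Sum>l\<in>UNIV. complex_of_real (r j $ l) * x l))"
proof -
  have "(\<Sum>j\<in>UNIV. complex_of_real (r j $ k) * (\<Sum>l\<in>UNIV. complex_of_real (r j $ l) * x l))
     = (\<Sum>l\<in>UNIV. complex_of_real (\<Sum>j\<in>UNIV. r j $ k * r j $ l) * x l)"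
    by (simp add: sum_2 algebra_simps)
  also have "\<dots> = x k" unfolding orthonormal_resolution[OF assms] using exhaust_2[of k] by (auto simp: sum_2)
  finally show ?thesis ..
qed

text \<open>The matrix is multiplied by the resolution of the identity. Thus its action on the basis
  determines it, which also serves to identify square roots.\<close>

lemma spectral_entries:
  fixes r :: "2 \<Rightarrow> real^2" and S :: "complex^2^2"
  assumes o: "norm (r 1) = 1" "norm (r 2) = 1" "r 1 \<bullet> r 2 = 0"
    and S: "\<And>j. S *v complexify (r j) = complex_of_real (lam j) *s complexify (r j)"
  shows "S $ k $ l = (\<Sum>j\<in>UNIV. complex_of_real (lam j * r j $ k * r j $ l))"
proof -
  have "(\<Sum>m\<in>UNIV. S $ k $ m * complex_of_real (r j $ m)) = complex_of_real (lam j * r j $ k)" for j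
    using arg_cong[OF S[of j], of "\<lambda>v. v $ k"] by (simp add: matrix_vector_mult_def complexify_def)
  hence "(\<Sum>j\<in>UNIV. complex_of_real (lam j * r j $ k * r j $ l)) = (\<Sum>j\<in>UNIV. (\<Sum>m\<in>UNIV. S $ k $ m * complex_of_real (r j $ m)) * complex_of_real (r j $ l))"
    by (simp add: sum_2)
  also have "\<dots> = (\<Sum>m\<in>UNIV. S $ k $ m * complex_of_real (\<Sum>j\<in>UNIV. r j $ m * r j $ l))"
    by (simp add: sum_2 algebra_simps)
  also have "\<dots> = S $ k $ l" unfolding orthonormal_resolution[OF o] using exhaust_2[of l] by (auto simp: sum_2)
  finally show ?thesis ..
qed

lemma quad_form_real_combination:
  fixes r :: "2 \<Rightarrow> real^2"
  assumes S: "\<And>k l. S $ k $ l = (\<Sum>j\<in>UNIV. complex_of_real (lam j * r j $ k * r j $ l))" and l: "\<And>j. lam j \<ge> 0"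
  shows "self_adjoint S" "pos_semidefinite S"
proof -
  show "self_adjoint S" unfolding self_adjoint_def S by (simp add: mult_ac)
  have "Re (quad_form S v) \<ge> 0" for v
  proof -
    define y where "y j = (\<Sum>l\<in>UNIV. complex_of_real (r j $ l) * v $ l)" for j
    have "quad_form S v = (\<Sum>j\<in>UNIV. complex_of_real (lam j) * (cnj (y j) * y j))"
      by (simp add: quad_form_def matrix_vector_mult_def S y_def sum_2 algebra_simps)
    also have "\<dots> = complex_of_real (\<Sum>j\<in>UNIV. lam j * (norm (y j))\<^sup>2)"
      by (simp add: complex_norm_square[symmetric] mult.commute[of "cnj _"])
    finally show ?thesis using l by (simp add: sum_nonneg)
  qed
  thus "pos_semidefinite S" by (simp add: pos_semidefinite_def)
qed

text \<open>For uniqueness, let \<open>T\<close> be another root and y = T r_j - \<lambda>_j r_j. As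
  T^2 r_j = \<lambda>_j^2 r_j, one has T y = - \<lambda>_j y with \<lambda>_j > 0, and positivity of
  \<open>T\<close> forces y = 0. So \<open>T\<close> has the same eigenvectors and
  eigenvalues.\<close>

lemma matrix_sqrt_entries:
  fixes r :: "2 \<Rightarrow> real^2" and M :: "complex^2^2"
  assumes o: "norm (r 1) = 1" "norm (r 2) = 1" "r 1 \<bullet> r 2 = 0"
    and M: "\<And>j. M *v complexify (r j) = complex_of_real ((lam j)\<^sup>2) *s complexify (r j)" and l: "\<And>j. lam j > 0"
  shows "matrix_sqrt M $ k $ l = (\<Sum>j\<in>UNIV. complex_of_real (lam j * r j $ k * r j $ l))"
proof -
  define S :: "complex^2^2" where "S = (\<chi> k l. \<Sum>j\<in>UNIV. complex_of_real (lam j * r j $ k * r j $ l))"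
  have Se: "S $ k $ l = (\<Sum>j\<in>UNIV. complex_of_real (lam j * r j $ k * r j $ l))" for k l by (simp add: S_def)
  have rr: "(\<Sum>m\<in>UNIV. r i $ m * r j $ m) = (if i = j then 1 else 0)" for i j
  proof -
    have e: "r 1 $ 1 * r 1 $ 1 + r 1 $ 2 * r 1 $ 2 = 1" "r 2 $ 1 * r 2 $ 1 + r 2 $ 2 * r 2 $ 2 = 1"
      "r 1 $ 1 * r 2 $ 1 + r 1 $ 2 * r 2 $ 2 = 0"
      using norm_plane[of "r 1"] norm_plane[of "r 2"] inner_plane[of "r 1" "r 2"] o by (simp_all add: power2_eq_square)
    have e': "r 2 $ 1 * r 1 $ 1 + r 2 $ 2 * r 1 $ 2 = 0" using e(3) by (simp only: mult.commute)
    from exhaust_2[of i] exhaust_2[of j] show ?thesis by (elim disjE) (simp_all add: sum_2 e e')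
  qed
  have "S ** S = M"
  proof -
    have "(S ** S) $ k $ l = M $ k $ l" for k l
    proof -
      have alg: "(\<Sum>m\<in>UNIV. (\<Sum>i\<in>UNIV. a i * r i $ m) * (\<Sum>j\<in>UNIV. b j * r j $ m)) = (\<Sum>i\<in>UNIV. \<Sum>j\<in>UNIV. a i * b j * (\<Sum>m\<in>UNIV. r i $ m * r j $ m))" for a b :: "2 \<Rightarrow> real"
        by (simp add: sum_2 algebra_simps)
      have "(S ** S) $ k $ l = complex_of_real (\<Sum>m\<in>UNIV. (\<Sum>i\<in>UNIV. (lam i * r i $ k) * r i $ m) * (\<Sum>j\<in>UNIV. (lam j * r j $ l) * r j $ m))"
        unfolding of_real_sum of_real_mult by (simp add: matrix_matrix_mult_def Se sum_2 mult_ac)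
      also have "\<dots> = (\<Sum>j\<in>UNIV. complex_of_real ((lam j)\<^sup>2 * r j $ k * r j $ l))"
        unfolding alg rr by (simp add: sum_2 power2_eq_square mult_ac)
      also have "\<dots> = M $ k $ l" by (rule spectral_entries[OF o M, symmetric])
      finally show ?thesis .
    qed
    thus ?thesis by (simp add: vec_eq_iff)
  qed
  moreover have "self_adjoint S" "pos_semidefinite S"
    by (rule quad_form_real_combination[OF Se less_imp_le[OF l]])+
  moreover have "T = S" if T: "self_adjoint T \<and> pos_semidefinite T \<and> T ** T = M" for T
  proof -
    have "T *v complexify (r j) = complex_of_real (lam j) *s complexify (r j)" for j
    proof -
      define y where "y = T *v complexify (r j) - complex_of_real (lam j) *s complexify (r j)"
      have "T *v (T *v complexify (r j)) = complex_of_real ((lam j)\<^sup>2) *s complexify (r j)"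
        unfolding matrix_vector_mul_assoc using T M by simp
      hence "T *v y = complex_of_real ((lam j)\<^sup>2) *s complexify (r j) - complex_of_real (lam j) *s (T *v complexify (r j))"
        unfolding y_def matrix_vector_mult_diff_distrib vector_scalar_commute by (simp only:)
      hence Ty: "T *v y = - complex_of_real (lam j) *s y"
        by (simp add: y_def vec_eq_iff algebra_simps power2_eq_square)
      have "quad_form T y = (\<Sum>i\<in>UNIV. cnj (y $ i) * (- complex_of_real (lam j) * y $ i))"
        unfolding quad_form_def Ty by simp
      also have "\<dots> = complex_of_real (- lam j * (\<Sum>i\<in>UNIV. (norm (y $ i))\<^sup>2))"
      proof -
        have "complex_of_real ((norm z)\<^sup>2) = cnj z * z" for z by (simp only: complex_norm_square mult.commute)
        thus ?thesis unfolding of_real_mult of_real_sum by (simp add: sum_distrib_left mult_ac)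
      qed
      finally have q: "quad_form T y = complex_of_real (- lam j * (\<Sum>i\<in>UNIV. (norm (y $ i))\<^sup>2))" .
      have "0 \<le> Re (quad_form T y)" using T by (simp only: pos_semidefinite_def)
      hence "0 \<le> - lam j * (\<Sum>i\<in>UNIV. (norm (y $ i))\<^sup>2)" unfolding q Re_complex_of_real .
      hence "(\<Sum>i\<in>UNIV. (norm (y $ i))\<^sup>2) \<le> 0" using l[of j] by (simp add: mult_le_0_iff)
      hence "(\<Sum>i\<in>UNIV. (norm (y $ i))\<^sup>2) = 0" by (intro antisym sum_nonneg) auto
      hence "y = 0" by (simp add: sum_nonneg_eq_0_iff vec_eq_iff)
      thus ?thesis by (simp add: y_def)
    qed
    from spectral_entries[OF o this] show ?thesis by (simp add: vec_eq_iff Se)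
  qed
  ultimately have "matrix_sqrt M = S" unfolding matrix_sqrt_def by (intro the_equality conjI)
  thus ?thesis by (simp only: Se)
qed

lemma eigenvalue_pos:
  assumes "pos_definite M" and "norm (r::real^2) = 1" and "M *v complexify r = complex_of_real m *s complexify r"
  shows "m > 0"
proof -
  have "quad_form M (complexify r) = complex_of_real (m * (norm r)\<^sup>2)"
    unfolding quad_form_def assms(3) norm_plane by (simp add: complexify_def sum_2 power2_eq_square algebra_simps)
  moreover have "complexify r \<noteq> 0"
  proof
    assume "complexify r = 0"
    hence "r = 0" by (simp add: complexify_def vec_eq_iff)
    thus False using assms(2) by simp
  qed
  ultimately show ?thesis using assms(1,2) by (auto simp: pos_definite_def)
qed

text \<open>With equal eigenvalues on an orthonormal basis the matrix would be scalar and its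
  spectrum a single point.\<close>

lemma eigenvalues_distinct:
  fixes r :: "2 \<Rightarrow> real^2"
  assumes o: "norm (r 1) = 1" "norm (r 2) = 1" "r 1 \<bullet> r 2 = 0"
    and M: "\<And>j. M *v complexify (r j) = complex_of_real (m j) *s complexify (r j)" and c: "card (spec M) = 2"
  shows "m 1 \<noteq> m 2"
proof
  assume eq: "m 1 = m 2"
  have e: "M $ k $ l = (if k = l then complex_of_real (m 1) else 0)" for k l
  proof -
    have "M $ k $ l = (\<Sum>j\<in>UNIV. complex_of_real (m j * r j $ k * r j $ l))" by (rule spectral_entries[OF o M])
    also have "\<dots> = complex_of_real (m 1 * (\<Sum>j\<in>UNIV. r j $ k * r j $ l))"
      by (simp add: sum_2 eq[symmetric] algebra_simps)
    finally show ?thesis by (simp add: orthonormal_resolution[OF o])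
  qed
  have "M *v v = complex_of_real (m 1) *s v" for v
    using exhaust_2 by (simp add: vec_eq_iff forall_2 matrix_vector_mult_def sum_2 e)
  hence "spec M \<subseteq> {complex_of_real (m 1)}"
    unfolding spec_def by (auto simp: vec_eq_iff)
  hence "card (spec M) \<le> card {complex_of_real (m 1)}" by (intro card_mono) auto
  thus False using c by simp
qed

text \<open>The transformed problem at a single frequency, detached from the solution that it comes
  from. In this form the decay constants can be quantified before the frequency, the direction and
  the solution.\<close>

definition modal_system :: "real \<Rightarrow> real \<Rightarrow> real^2 \<Rightarrow> (2 \<Rightarrow> real^2) \<Rightarrow> (2 \<Rightarrow> real) \<Rightarrow> complex^2^2 \<Rightarrow>
    (2 \<Rightarrow> real \<Rightarrow> complex) \<Rightarrow> (2 \<Rightarrow> real \<Rightarrow> complex) \<Rightarrow> (real \<Rightarrow> complex) \<Rightarrow> bool" where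
  "modal_system \<kappa> \<gamma> \<xi> r om H u v th \<longleftrightarrow>
     norm (r 1) = 1 \<and> norm (r 2) = 1 \<and> r 1 \<bullet> r 2 = 0 \<and> \<xi> \<noteq> 0 \<and> self_adjoint H \<and>
     (\<forall>j. H *v complexify (r j) = complex_of_real ((norm \<xi> * om j)\<^sup>2) *s complexify (r j)) \<and>
     (\<forall>k. continuous_on {0..} (u k)) \<and> (\<forall>k. continuous_on {0..} (v k)) \<and> continuous_on {0..} th \<and>
     (\<forall>t>0. (\<forall>k. (u k has_vector_derivative v k t) (at t)) \<and>
       (\<forall>k. (v k has_vector_derivative - (\<Sum>l\<in>UNIV. H $ k $ l * u l t) - \<i> * complex_of_real (\<gamma> * \<xi> $ k) * th t) (at t)) \<and>
       (th has_vector_derivative - complex_of_real (\<kappa> * (norm \<xi>)\<^sup>2) * th t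
          - \<i> * complex_of_real \<gamma> * (\<Sum>l\<in>UNIV. complex_of_real (\<xi> $ l) * v l t)) (at t))"

definition modal :: "(2 \<Rightarrow> real^2) \<Rightarrow> (2 \<Rightarrow> real \<Rightarrow> complex) \<Rightarrow> 2 \<Rightarrow> real \<Rightarrow> complex" where
  "modal r u j t = (\<Sum>k\<in>UNIV. complex_of_real (r j $ k) * u k t)"

text \<open>Kinetic, elastic and thermal energy of one Fourier mode.\<close>

definition modal_energy :: "real^2 \<Rightarrow> (2 \<Rightarrow> real^2) \<Rightarrow> (2 \<Rightarrow> real) \<Rightarrow>
    (2 \<Rightarrow> real \<Rightarrow> complex) \<Rightarrow> (2 \<Rightarrow> real \<Rightarrow> complex) \<Rightarrow> (real \<Rightarrow> complex) \<Rightarrow> real \<Rightarrow> real" where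
  "modal_energy \<xi> r om u v th t =
     (\<Sum>j\<in>UNIV. (norm (modal r v j t))\<^sup>2) + (\<Sum>j\<in>UNIV. (norm \<xi> * om j * norm (modal r u j t))\<^sup>2) + (norm (th t))\<^sup>2"

lemma modal_sum_inner:
  fixes r :: "2 \<Rightarrow> real^2"
  assumes "norm (r 1) = 1" "norm (r 2) = 1" "r 1 \<bullet> r 2 = 0"
  shows "(\<Sum>l\<in>UNIV. complex_of_real (\<xi> $ l) * v l t) = (\<Sum>j\<in>UNIV. complex_of_real (r j \<bullet> \<xi>) * modal r v j t)"
proof -
  have "(\<Sum>l\<in>UNIV. complex_of_real (\<xi> $ l) * v l t) = (\<Sum>l\<in>UNIV. complex_of_real (\<xi> $ l) * (\<Sum>j\<in>UNIV. complex_of_real (r j $ l) * modal r v j t))"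
    unfolding modal_def
    by (intro sum.cong refl arg_cong2[where f = times] orthonormal_expansion[OF assms, of "\<lambda>l. v l t"])
  also have "\<dots> = (\<Sum>j\<in>UNIV. complex_of_real (r j \<bullet> \<xi>) * modal r v j t)"
    by (simp add: sum_2 inner_plane algebra_simps)
  finally show ?thesis .
qed

text \<open>\<open>H\<close> is Hermitian and need not be symmetric. But \<open>r j\<close> and its
  eigenvalue are real, so conjugating the eigenvalue equation turns the right eigenvector into a
  left one; projecting the system onto it therefore decouples the elastic part.\<close>

lemma modal_self_adjoint:
  assumes H: "self_adjoint H" and e: "H *v complexify (r j) = complex_of_real z *s complexify (r j)"
  shows "(\<Sum>k\<in>UNIV. complex_of_real (r j $ k) * (\<Sum>l\<in>UNIV. H $ k $ l * u l t)) = complex_of_real z * modal r u j t"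
proof -
  have c: "(\<Sum>k\<in>UNIV. complex_of_real (r j $ k) * H $ k $ l) = complex_of_real (z * r j $ l)" for l
  proof -
    have "(\<Sum>k\<in>UNIV. H $ l $ k * complex_of_real (r j $ k)) = complex_of_real (z * r j $ l)"
      using arg_cong[OF e, of "\<lambda>v. v $ l"] by (simp add: matrix_vector_mult_def complexify_def)
    from arg_cong[OF this, of cnj] have r: "(\<Sum>k\<in>UNIV. cnj (H $ l $ k) * complex_of_real (r j $ k)) = complex_of_real (z * r j $ l)"
      by (simp only: cnj_sum complex_cnj_mult complex_cnj_complex_of_real)
    have "(\<Sum>k\<in>UNIV. complex_of_real (r j $ k) * H $ k $ l) = (\<Sum>k\<in>UNIV. cnj (H $ l $ k) * complex_of_real (r j $ k))"
    proof (rule sum.cong[OF refl])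
      fix k
      have h: "H $ k $ l = cnj (H $ l $ k)" using H unfolding self_adjoint_def by blast
      show "complex_of_real (r j $ k) * H $ k $ l = cnj (H $ l $ k) * complex_of_real (r j $ k)"
        by (subst h) (rule mult.commute)
    qed
    thus ?thesis unfolding r .
  qed
  have "(\<Sum>k\<in>UNIV. complex_of_real (r j $ k) * (\<Sum>l\<in>UNIV. H $ k $ l * u l t)) = (\<Sum>l\<in>UNIV. (\<Sum>k\<in>UNIV. complex_of_real (r j $ k) * H $ k $ l) * u l t)"
    by (simp add: sum_2 algebra_simps)
  also have "\<dots> = complex_of_real z * modal r u j t"
    unfolding c modal_def by (simp add: sum_distrib_left mult.assoc)
  finally show ?thesis .
qed

lemma modal_has_vector_derivative:
  assumes "\<And>k. (u k has_vector_derivative u' k) (at t)"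
  shows "(modal r u j has_vector_derivative (\<Sum>k\<in>UNIV. complex_of_real (r j $ k) * u' k)) (at t)"
  unfolding modal_def[abs_def] sum_2
  by (intro has_vector_derivative_add has_vector_derivative_mult_right assms)

text \<open>After multiplication of the temperature by \<i> all coefficients of the modal system are
  real, so real and imaginary parts solve the same real system separately, and their energies add up
  to the modal energy.\<close>

lemma modal_energy_decay:
  fixes \<kappa> \<gamma> m M :: real
  assumes \<kappa>: "\<kappa> > 0" and g: "\<gamma> \<noteq> 0" and m: "m > 0" and M: "M \<ge> 1"
  shows "\<exists>C>0. \<exists>c>0. \<forall>\<xi> r om H u v th t. modal_system \<kappa> \<gamma> \<xi> r om H u v th \<longrightarrow>
    (\<forall>j. m \<le> om j \<and> om j \<le> M) \<longrightarrow> m \<le> \<bar>(om 1)\<^sup>2 - (om 2)\<^sup>2\<bar> \<longrightarrow> t \<ge> 0 \<longrightarrow>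
    modal_energy \<xi> r om u v th t \<le> C * exp (- c * t * ((norm \<xi>)\<^sup>2 / (1 + (norm \<xi>)\<^sup>2)) * min ((r 1 \<bullet> sgn \<xi>)\<^sup>2) ((r 2 \<bullet> sgn \<xi>)\<^sup>2))
      * modal_energy \<xi> r om u v th 0"
proof -
  obtain C c where C: "C > 0" and c: "c > 0" and decay:
    "\<forall>o1 o2 a1 a2 \<rho> :: real. m \<le> o1 \<longrightarrow> o1 \<le> M \<longrightarrow> m \<le> o2 \<longrightarrow> o2 \<le> M \<longrightarrow> m \<le> \<bar>o1\<^sup>2 - o2\<^sup>2\<bar> \<longrightarrow>
    a1\<^sup>2 + a2\<^sup>2 = 1 \<longrightarrow> \<rho> > 0 \<longrightarrow> (\<forall>v1 v2 w1 w2 f :: real \<Rightarrow> real.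
      continuous_on {0..} v1 \<longrightarrow> continuous_on {0..} v2 \<longrightarrow> continuous_on {0..} w1 \<longrightarrow> continuous_on {0..} w2 \<longrightarrow> continuous_on {0..} f \<longrightarrow>
      (\<forall>t>0. (v1 has_real_derivative \<rho> * (- o1 * w1 t - \<gamma> * a1 * f t)) (at t) \<and>
             (v2 has_real_derivative \<rho> * (- o2 * w2 t - \<gamma> * a2 * f t)) (at t) \<and>
             (w1 has_real_derivative \<rho> * (o1 * v1 t)) (at t) \<and>
             (w2 has_real_derivative \<rho> * (o2 * v2 t)) (at t) \<and>
             (f has_real_derivative \<rho> * (- (\<kappa> * \<rho>) * f t + \<gamma> * (a1 * v1 t + a2 * v2 t))) (at t)) \<longrightarrow>
      (\<forall>t\<ge>0. (v1 t)\<^sup>2 + (v2 t)\<^sup>2 + (w1 t)\<^sup>2 + (w2 t)\<^sup>2 + (f t)\<^sup>2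
        \<le> C * exp (- c * t * (\<rho>\<^sup>2 / (1 + \<rho>\<^sup>2)) * min (a1\<^sup>2) (a2\<^sup>2)) *
            ((v1 0)\<^sup>2 + (v2 0)\<^sup>2 + (w1 0)\<^sup>2 + (w2 0)\<^sup>2 + (f 0)\<^sup>2)))"
    using energy_decay_real[OF assms] by (elim exE conjE) (rule that)
  show ?thesis
  proof (rule exI[of _ C], rule conjI[OF C], rule exI[of _ c], rule conjI[OF c], intro allI impI)
    fix \<xi> :: "real^2" and r :: "2 \<Rightarrow> real^2" and om H u v th and t :: real
    assume S: "modal_system \<kappa> \<gamma> \<xi> r om H u v th" and om: "\<forall>j. m \<le> om j \<and> om j \<le> M"
      and gap: "m \<le> \<bar>(om 1)\<^sup>2 - (om 2)\<^sup>2\<bar>" and t: "t \<ge> 0"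
    have o: "norm (r 1) = 1" "norm (r 2) = 1" "r 1 \<bullet> r 2 = 0" and x0: "\<xi> \<noteq> 0" and H: "self_adjoint H"
      and e: "\<And>j. H *v complexify (r j) = complex_of_real ((norm \<xi> * om j)\<^sup>2) *s complexify (r j)"
      and cont: "\<And>k. continuous_on {0..} (u k)" "\<And>k. continuous_on {0..} (v k)" "continuous_on {0..} th"
      and du: "\<And>t k. t > 0 \<Longrightarrow> (u k has_vector_derivative v k t) (at t)"
      and dv: "\<And>t k. t > 0 \<Longrightarrow> (v k has_vector_derivative - (\<Sum>l\<in>UNIV. H $ k $ l * u l t) - \<i> * complex_of_real (\<gamma> * \<xi> $ k) * th t) (at t)"
      and dth: "\<And>t. t > 0 \<Longrightarrow> (th has_vector_derivative - complex_of_real (\<kappa> * (norm \<xi>)\<^sup>2) * th t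
          - \<i> * complex_of_real \<gamma> * (\<Sum>l\<in>UNIV. complex_of_real (\<xi> $ l) * v l t)) (at t)"
      using S unfolding modal_system_def by blast+
    define \<rho> where "\<rho> = norm \<xi>"
    have \<rho>: "\<rho> > 0" using x0 by (simp add: \<rho>_def)
    define a where "a j = r j \<bullet> sgn \<xi>" for j
    have ra: "r j \<bullet> \<xi> = \<rho> * a j" for j
      using \<rho> by (simp add: a_def sgn_div_norm \<rho>_def)
    have a1: "(a 1)\<^sup>2 + (a 2)\<^sup>2 = 1"
    proof -
      have "(a 1)\<^sup>2 + (a 2)\<^sup>2 = (\<Sum>k\<in>UNIV. \<Sum>l\<in>UNIV. sgn \<xi> $ k * sgn \<xi> $ l * (\<Sum>j\<in>UNIV. r j $ k * r j $ l))"
        by (simp add: a_def sum_2 inner_plane power2_eq_square algebra_simps)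
      also have "\<dots> = (norm (sgn \<xi>))\<^sup>2"
        unfolding orthonormal_resolution[OF o] norm_plane by (simp add: sum_2 power2_eq_square)
      finally show ?thesis using x0 by (simp add: norm_sgn)
    qed
    let ?vj = "modal r v" and ?uj = "modal r u"
    have Du: "(?uj j has_vector_derivative ?vj j t) (at t)" if "t > 0" for j t
      using modal_has_vector_derivative[where u = u and u' = "\<lambda>k. v k t" and t = t and r = r and j = j, OF du[OF that]] by (simp add: modal_def)
    have Dv: "(?vj j has_vector_derivative - complex_of_real ((\<rho> * om j)\<^sup>2) * ?uj j t - complex_of_real (\<gamma> * \<rho> * a j) * (\<i> * th t)) (at t)" if "t > 0" for j t
    proof -
      have q: "(\<Sum>k\<in>UNIV. complex_of_real (r j $ k) * (- q k - \<i> * complex_of_real (\<gamma> * \<xi> $ k) * z))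
        = - (\<Sum>k\<in>UNIV. complex_of_real (r j $ k) * q k) - complex_of_real (\<gamma> * (r j \<bullet> \<xi>)) * (\<i> * z)" for q :: "2 \<Rightarrow> complex" and z
        by (simp add: sum_2 inner_plane algebra_simps)
      have "(\<Sum>k\<in>UNIV. complex_of_real (r j $ k) * (- (\<Sum>l\<in>UNIV. H $ k $ l * u l t) - \<i> * complex_of_real (\<gamma> * \<xi> $ k) * th t))
        = - (\<Sum>k\<in>UNIV. complex_of_real (r j $ k) * (\<Sum>l\<in>UNIV. H $ k $ l * u l t)) - complex_of_real (\<gamma> * (r j \<bullet> \<xi>)) * (\<i> * th t)"
        by (rule q)
      also have "\<dots> = - complex_of_real ((\<rho> * om j)\<^sup>2) * ?uj j t - complex_of_real (\<gamma> * \<rho> * a j) * (\<i> * th t)"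
        unfolding modal_self_adjoint[where r = r and j = j and u = u and t = t, OF H e] ra \<rho>_def[symmetric] by (simp add: mult.assoc)
      finally have e: "(\<Sum>k\<in>UNIV. complex_of_real (r j $ k) * (- (\<Sum>l\<in>UNIV. H $ k $ l * u l t) - \<i> * complex_of_real (\<gamma> * \<xi> $ k) * th t))
        = - complex_of_real ((\<rho> * om j)\<^sup>2) * ?uj j t - complex_of_real (\<gamma> * \<rho> * a j) * (\<i> * th t)" .
      show ?thesis unfolding e[symmetric] by (rule modal_has_vector_derivative) (rule dv[OF that])
    qed
    have Dth: "((\<lambda>s. \<i> * th s) has_vector_derivative - complex_of_real (\<kappa> * \<rho>\<^sup>2) * (\<i> * th t) + complex_of_real (\<gamma> * \<rho>) * (complex_of_real (a 1) * ?vj 1 t + complex_of_real (a 2) * ?vj 2 t)) (at t)" if "t > 0" for t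
    proof -
      have s: "(\<Sum>l\<in>UNIV. complex_of_real (\<xi> $ l) * v l t) = complex_of_real \<rho> * (complex_of_real (a 1) * ?vj 1 t + complex_of_real (a 2) * ?vj 2 t)"
        unfolding modal_sum_inner[OF o] ra by (simp add: sum_2 algebra_simps)
      have ii: "\<i> * (- k * z - \<i> * g * w) = - k * (\<i> * z) + g * w" for k z g w :: complex
      proof -
        have "\<i> * (- k * z - \<i> * g * w) = - k * (\<i> * z) - (\<i> * \<i>) * (g * w)" by (simp only: right_diff_distrib mult_minus_left mult_minus_right mult_ac)
        thus ?thesis by simp
      qed
      have "((\<lambda>s. \<i> * th s) has_vector_derivative \<i> * (- complex_of_real (\<kappa> * \<rho>\<^sup>2) * th t - \<i> * complex_of_real \<gamma> * (complex_of_real \<rho> * (complex_of_real (a 1) * ?vj 1 t + complex_of_real (a 2) * ?vj 2 t)))) (at t)"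
        using has_vector_derivative_mult_right[OF dth[OF that], of \<i>] unfolding s \<rho>_def[symmetric] .
      thus ?thesis unfolding ii by (simp only: of_real_mult mult.assoc)
    qed
    have contj: "continuous_on {0..} (modal r w j)" if "\<And>k. continuous_on {0..} (w k)" for w j
      unfolding modal_def[abs_def] by (intro continuous_intros that)
    define F where "F P s = (P (?vj 1 s))\<^sup>2 + (P (?vj 2 s))\<^sup>2 + (\<rho> * om 1 * P (?uj 1 s))\<^sup>2 + (\<rho> * om 2 * P (?uj 2 s))\<^sup>2 + (P (\<i> * th s))\<^sup>2" for P :: "complex \<Rightarrow> real" and s
    define X where "X = C * exp (- c * t * (\<rho>\<^sup>2 / (1 + \<rho>\<^sup>2)) * min ((a 1)\<^sup>2) ((a 2)\<^sup>2))"
    \<comment> \<open>Here \<open>P\<close> stands for the real or the imaginary part; both commute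
      with multiplication by reals and with differentiation in time.\<close>
    have part: "F P t \<le> X * F P 0" if P: "bounded_linear P" for P
    proof -
      have Pa: "P (complex_of_real x * z) = x * P z" for x z
        using linear_cmul[OF bounded_linear.linear[OF P], of x z] by (simp add: scaleR_conv_of_real)
      note Pl = bounded_linear.linear[OF P]
      have PD: "((\<lambda>s. P (w s)) has_real_derivative P w') (at s)" if "(w has_vector_derivative w') (at s)" for w w' s
        using bounded_linear.has_vector_derivative[OF P that] by (simp add: has_real_derivative_iff_has_vector_derivative)
      have Pc: "continuous_on {0..} (\<lambda>s. P (w s))" if "continuous_on {0..} w" for w
        by (rule bounded_linear.continuous_on[OF P that])
      have D1: "((\<lambda>s. P (?vj j s)) has_real_derivative \<rho> * (- om j * (\<rho> * om j * P (?uj j s)) - \<gamma> * a j * P (\<i> * th s))) (at s)" if "s > 0" for j s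
      proof -
        have "P (- complex_of_real ((\<rho> * om j)\<^sup>2) * ?uj j s - complex_of_real (\<gamma> * \<rho> * a j) * (\<i> * th s)) = \<rho> * (- om j * (\<rho> * om j * P (?uj j s)) - \<gamma> * a j * P (\<i> * th s))"
          unfolding linear_diff[OF Pl] mult_minus_left linear_neg[OF Pl] Pa by (simp add: power2_eq_square algebra_simps)
        thus ?thesis using PD[OF Dv[OF that, of j]] by simp
      qed
      have D2: "((\<lambda>s. \<rho> * om j * P (?uj j s)) has_real_derivative \<rho> * (om j * P (?vj j s))) (at s)" if "s > 0" for j s
        using DERIV_cmult[OF PD[OF Du[OF that, of j]], of "\<rho> * om j"] by (simp add: mult.assoc)
      have D3: "((\<lambda>s. P (\<i> * th s)) has_real_derivative \<rho> * (- (\<kappa> * \<rho>) * P (\<i> * th s) + \<gamma> * (a 1 * P (?vj 1 s) + a 2 * P (?vj 2 s)))) (at s)" if "s > 0" for s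
      proof -
        have "P (- complex_of_real (\<kappa> * \<rho>\<^sup>2) * (\<i> * th s) + complex_of_real (\<gamma> * \<rho>) * (complex_of_real (a 1) * ?vj 1 s + complex_of_real (a 2) * ?vj 2 s))
          = \<rho> * (- (\<kappa> * \<rho>) * P (\<i> * th s) + \<gamma> * (a 1 * P (?vj 1 s) + a 2 * P (?vj 2 s)))"
          unfolding linear_add[OF Pl] mult_minus_left linear_neg[OF Pl] Pa by (simp add: linear_add[OF Pl] Pa power2_eq_square algebra_simps)
        thus ?thesis using PD[OF Dth[OF that]] by simp
      qed
      have om': "m \<le> om j" "om j \<le> M" for j using om by auto
      show ?thesis unfolding F_def X_def
        by (rule decay[rule_format, OF om' om' gap a1 \<rho> _ _ _ _ _ _ t])
           (intro Pc continuous_on_mult_left contj cont conjI D1 D2 D3 continuous_intros; assumption?)+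
    qed
    have EF: "modal_energy \<xi> r om u v th s = F Re s + F Im s" for s
    proof -
      have n: "(norm z)\<^sup>2 = (Re z)\<^sup>2 + (Im z)\<^sup>2" for z by (rule cmod_power2)
      have n1: "(norm z)\<^sup>2 = (Re (\<i> * z))\<^sup>2 + (Im (\<i> * z))\<^sup>2" for z by (simp add: cmod_power2)
      have n2: "(q * norm z)\<^sup>2 = (q * Re z)\<^sup>2 + (q * Im z)\<^sup>2" for q z
        unfolding power_mult_distrib n by (rule distrib_left)
      show ?thesis unfolding modal_energy_def F_def sum_2 \<rho>_def[symmetric] n2 n[of "modal r v _ s"] n1[of "th s"] by simp
    qed
    have "modal_energy \<xi> r om u v th t \<le> X * modal_energy \<xi> r om u v th 0"
      unfolding EF distrib_left by (intro add_mono part bounded_linear_Re bounded_linear_Im)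
    thus "modal_energy \<xi> r om u v th t \<le> C * exp (- c * t * ((norm \<xi>)\<^sup>2 / (1 + (norm \<xi>)\<^sup>2)) * min ((r 1 \<bullet> sgn \<xi>)\<^sup>2) ((r 2 \<bullet> sgn \<xi>)\<^sup>2))
      * modal_energy \<xi> r om u v th 0" unfolding X_def a_def \<rho>_def .
  qed
qed

section \<open>From pointwise decay to the dispersive estimate\<close>

lemma Lp_le_const_mono:
  assumes "Lp_le p f a" "0 \<le> a" "a \<le> b" "p \<ge> 0"
  shows "Lp_le p f b"
proof -
  have "ennreal (a powr p) \<le> ennreal (b powr p)" using assms by (intro ennreal_leI powr_mono2) auto
  thus ?thesis using assms(1) unfolding Lp_le_def by (meson order_trans)
qed

text \<open>Each further summand costs the factor 4 of the two-term estimate and a doubling of the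
  sum, which explains the base 8.\<close>

lemma Lp_le_sum:
  fixes f :: "'i \<Rightarrow> real^2 \<Rightarrow> 'b::real_normed_vector"
  assumes p: "p \<ge> 1" and I: "finite I" and f: "\<And>i. i \<in> I \<Longrightarrow> Lp_le p (f i) a" and a: "a \<ge> 0"
  shows "Lp_le p (\<lambda>x. \<Sum>i\<in>I. norm (f i x)) (8 ^ card I * a)"
  using I f
proof (induction I rule: finite_induct)
  case empty thus ?case by (simp add: Lp_le_def)
next
  case (insert i I)
  have i: "Lp_le p (f i) a" and I: "Lp_le p (\<lambda>x. \<Sum>i\<in>I. norm (f i x)) (8 ^ card I * a)"
    using insert by auto
  have [measurable]: "f i \<in> borel_measurable borel" "(\<lambda>x. \<Sum>i\<in>I. norm (f i x)) \<in> borel_measurable borel"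
    using i I by (simp_all add: Lp_le_def)
  have L: "Lp_le p (\<lambda>x. \<Sum>i\<in>insert i I. norm (f i x)) (4 * (a + 8 ^ card I * a))"
  proof (rule Lp_le_add[OF i I _ _ p a])
    show "AE x in lborel. norm (\<Sum>i\<in>insert i I. norm (f i x)) \<le> norm (f i x) + norm (\<Sum>i\<in>I. norm (f i x))"
      using insert(1,2) by (simp add: sum_nonneg)
    show "(\<lambda>x. \<Sum>i\<in>insert i I. norm (f i x)) \<in> borel_measurable borel" using insert(1,2) by simp
  qed (use a in simp)
  have le: "4 * (a + 8 ^ card I * a) \<le> 8 ^ card (insert i I) * a"
  proof -
    define E where "E = 8 ^ card I * a"
    have "1 * a \<le> E" unfolding E_def by (rule mult_right_mono) (use a in simp_all)
    hence "4 * (a + E) \<le> 8 * E" by simp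
    moreover have "8 ^ card (insert i I) * a = 8 * E" using insert(1,2) by (simp add: E_def)
    ultimately show ?thesis unfolding E_def[symmetric] by (simp only:)
  qed
  show ?case by (rule Lp_le_const_mono[OF L _ le]) (use a p in simp_all)
qed

text \<open>The constant is 8^2, for two components.\<close>

lemma Lp_norm_vec_le:
  fixes F :: "real^2 \<Rightarrow> complex^2"
  assumes q: "q \<ge> 1" and F: "continuous_on UNIV F" and a: "a \<ge> 0" and L: "\<And>k. Lp_le q (\<lambda>x. F x $ k) a"
  shows "Lp_norm q F \<le> ennreal (64 * a)"
proof (rule Lp_norm_le)
  have s: "Lp_le q (\<lambda>x. \<Sum>k\<in>UNIV. norm (F x $ k)) (8 ^ card (UNIV :: 2 set) * a)"
    by (rule Lp_le_sum[OF q _ _ a]) (auto intro: L)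
  have "norm (F x) \<le> norm (\<Sum>k\<in>UNIV. norm (F x $ k))" for x
    using L2_set_le_sum[of UNIV "\<lambda>k. norm (F x $ k)"] by (simp add: norm_vec_def sum_nonneg)
  with s show "Lp_le q F (64 * a)"
    using q F by (auto intro!: Lp_le_mono[of q "\<lambda>x. \<Sum>k\<in>UNIV. norm (F x $ k)"] borel_measurable_continuous_onI)
qed (use q a in auto)

text \<open>Summing over all pairs, instead of selecting the pair that fits the direction of \<xi>,
  makes the factor continuous in \<xi>; only constants are lost. Each summand is close to 1 near the
  line orthogonal to \<open>n\<close>.\<close>

definition low_pass :: "(real \<times> (real^2)) set \<Rightarrow> real \<Rightarrow> real^2 \<Rightarrow> real" where
  "low_pass F t \<xi> = (\<Sum>(c, n)\<in>F. exp (- c * t * (\<xi> \<bullet> n)\<^sup>2 / (1 + (norm \<xi>)\<^sup>2)))"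

lemma continuous_low_pass: "continuous_on UNIV (low_pass F t)"
proof -
  have "1 + (norm \<xi>)\<^sup>2 \<noteq> 0" for \<xi> :: "real^2" using zero_le_power2[of "norm \<xi>"] by linarith
  thus ?thesis unfolding low_pass_def[abs_def] case_prod_beta by (intro continuous_intros) auto
qed

lemma low_pass_nonneg: "low_pass F t \<xi> \<ge> 0"
  unfolding low_pass_def by (intro sum_nonneg) (auto simp: case_prod_beta)

lemma low_pass_le_card:
  assumes "\<And>c n. (c, n) \<in> F \<Longrightarrow> c > 0" "t \<ge> 0"
  shows "low_pass F t \<xi> \<le> card F"
proof -
  have "low_pass F t \<xi> \<le> (\<Sum>x\<in>F. 1)" unfolding low_pass_def
  proof (intro sum_mono)
    fix x assume "x \<in> F"
    hence "fst x > 0" using assms(1)[of "fst x" "snd x"] by simp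
    hence "0 \<le> fst x * t * (\<xi> \<bullet> snd x)\<^sup>2 / (1 + (norm \<xi>)\<^sup>2)" using assms(2) by simp
    thus "(case x of (c, n) \<Rightarrow> exp (- c * t * (\<xi> \<bullet> n)\<^sup>2 / (1 + (norm \<xi>)\<^sup>2))) \<le> 1" by (simp add: case_prod_beta)
  qed
  thus ?thesis by simp
qed

lemma continuous_japanese_powr: "continuous_on UNIV (\<lambda>\<xi>::real^2. (1 + (norm \<xi>)\<^sup>2) powr a)"
proof -
  have "1 + (norm \<xi>)\<^sup>2 \<noteq> 0" for \<xi> :: "real^2" using zero_le_power2[of "norm \<xi>"] by linarith
  thus ?thesis by (intro continuous_intros) auto
qed

text \<open>Raising to the power 1 / \<delta> divides the rate \<open>c\<close> by \<delta> and
  turns the weight exponent r / 2 into r / (2 \<delta>), which exceeds 1 exactly by the hypothesis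
  on \<open>r\<close>. The power \<delta> of the resulting integral then has the order (1 +
  t)^(-\<delta>/2).\<close>

lemma low_pass_Lp:
  assumes d: "\<delta> > 0" "\<delta> \<le> 1" and r: "r > 2 * \<delta>" and F: "finite F" "\<And>c n. (c, n) \<in> F \<Longrightarrow> c > 0 \<and> norm n = 1"
  shows "\<exists>K>0. \<forall>t\<ge>0. Lp_le (1 / \<delta>) (\<lambda>\<xi>. low_pass F t \<xi> * (1 + (norm \<xi>)\<^sup>2) powr (- r / 2)) (K * (1 + t) powr (- \<delta> / 2))"
proof -
  define g where "g x t \<xi> = exp (- fst x * t * (\<xi> \<bullet> snd x)\<^sup>2 / (1 + (norm \<xi>)\<^sup>2)) * (1 + (norm \<xi>)\<^sup>2) powr (- r / 2)"
    for x :: "real \<times> (real^2)" and t and \<xi> :: "real^2"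
  have gm: "g x t \<in> borel_measurable borel" for x t
  proof -
    have "1 + (norm \<xi>)\<^sup>2 \<noteq> 0" for \<xi> :: "real^2" using zero_le_power2[of "norm \<xi>"] by linarith
    thus ?thesis unfolding g_def[abs_def]
      by (intro borel_measurable_continuous_onI continuous_on_mult continuous_japanese_powr continuous_intros) auto
  qed
  have "\<exists>K>0. \<forall>t\<ge>0. Lp_le (1 / \<delta>) (g x t) (K * (1 + t) powr (- \<delta> / 2))" if x: "x \<in> F" for x
  proof -
    have c: "fst x / \<delta> > 0" "norm (snd x) = 1" using F(2)[of "fst x" "snd x"] x d by auto
    have b: "r / (2 * \<delta>) > 1" using r d by simp
    obtain C where C: "C > 0" and bd: "\<And>t. t \<ge> 0 \<Longrightarrow> (\<integral>\<^sup>+\<xi>. ennreal (exp (- (fst x / \<delta>) * t * (\<xi> \<bullet> snd x)\<^sup>2 / (1 + (norm \<xi>)\<^sup>2)) * (1 + (norm \<xi>)\<^sup>2) powr (- (r / (2 * \<delta>)))) \<partial>lborel)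
       \<le> ennreal (C * (1 + t) powr (- 1 / 2))"
      using degenerate_gauss_bound[OF c(1) b c(2)] by blast
    have "Lp_le (1 / \<delta>) (g x t) (C powr \<delta> * (1 + t) powr (- \<delta> / 2))" if t: "t \<ge> 0" for t
    proof -
      have "norm (g x t \<xi>) powr (1 / \<delta>) = exp (- (fst x / \<delta>) * t * (\<xi> \<bullet> snd x)\<^sup>2 / (1 + (norm \<xi>)\<^sup>2)) * (1 + (norm \<xi>)\<^sup>2) powr (- (r / (2 * \<delta>)))" for \<xi>
      proof -
        have e: "exp y powr (1 / \<delta>) = exp (y / \<delta>)" for y by (simp add: powr_def)
        have "norm (g x t \<xi>) powr (1 / \<delta>) = exp (- fst x * t * (\<xi> \<bullet> snd x)\<^sup>2 / (1 + (norm \<xi>)\<^sup>2)) powr (1 / \<delta>) * ((1 + (norm \<xi>)\<^sup>2) powr (- r / 2)) powr (1 / \<delta>)"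
          unfolding g_def by (simp add: powr_mult abs_mult)
        thus ?thesis unfolding e powr_powr using d by (simp add: field_simps)
      qed
      hence "(\<integral>\<^sup>+\<xi>. ennreal (norm (g x t \<xi>) powr (1 / \<delta>)) \<partial>lborel) \<le> ennreal (C * (1 + t) powr (- 1 / 2))"
        using bd[OF t] by simp
      also have "C * (1 + t) powr (- 1 / 2) = (C powr \<delta> * (1 + t) powr (- \<delta> / 2)) powr (1 / \<delta>)"
        using C d t by (simp add: powr_mult powr_powr)
      finally show ?thesis using gm by (simp add: Lp_le_def)
    qed
    thus ?thesis using C by (intro exI[of _ "C powr \<delta>"]) auto
  qed
  hence "\<forall>x\<in>F. \<exists>K>0. \<forall>t\<ge>0. Lp_le (1 / \<delta>) (g x t) (K * (1 + t) powr (- \<delta> / 2))" by blast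
  then obtain K where K: "\<And>x. x \<in> F \<Longrightarrow> K x > 0" "\<And>x t. x \<in> F \<Longrightarrow> t \<ge> 0 \<Longrightarrow> Lp_le (1 / \<delta>) (g x t) (K x * (1 + t) powr (- \<delta> / 2))"
    unfolding bchoice_iff by blast
  define K0 where "K0 = 1 + (\<Sum>x\<in>F. K x)"
  have K0: "K0 \<ge> 1" unfolding K0_def using K(1) by (simp add: sum_nonneg less_imp_le)
  have KK: "K x \<le> K0" if "x \<in> F" for x
  proof -
    have "K x \<le> (\<Sum>x\<in>F. K x)" using K(1) by (intro member_le_sum[OF that _ F(1)]) (simp add: less_imp_le)
    thus ?thesis by (simp add: K0_def)
  qed
  have "Lp_le (1 / \<delta>) (\<lambda>\<xi>. low_pass F t \<xi> * (1 + (norm \<xi>)\<^sup>2) powr (- r / 2)) (8 ^ card F * K0 * (1 + t) powr (- \<delta> / 2))" if t: "t \<ge> 0" for t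
  proof -
    have "Lp_le (1 / \<delta>) (g x t) (K0 * (1 + t) powr (- \<delta> / 2))" if x: "x \<in> F" for x
    proof (rule Lp_le_const_mono[OF K(2)[OF x t]])
      show "0 \<le> K x * (1 + t) powr (- \<delta> / 2)" using K(1)[OF x] by simp
      show "K x * (1 + t) powr (- \<delta> / 2) \<le> K0 * (1 + t) powr (- \<delta> / 2)" by (rule mult_right_mono[OF KK[OF x]]) simp
      show "0 \<le> 1 / \<delta>" using d by simp
    qed
    hence "Lp_le (1 / \<delta>) (\<lambda>\<xi>. \<Sum>x\<in>F. norm (g x t \<xi>)) (8 ^ card F * (K0 * (1 + t) powr (- \<delta> / 2)))"
      using d K0 by (intro Lp_le_sum[OF _ F(1)]) auto
    moreover have "(\<Sum>x\<in>F. norm (g x t \<xi>)) = low_pass F t \<xi> * (1 + (norm \<xi>)\<^sup>2) powr (- r / 2)" for \<xi>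
      unfolding low_pass_def g_def sum_distrib_right by (simp add: case_prod_beta abs_mult)
    ultimately show ?thesis by (simp add: mult.assoc)
  qed
  thus ?thesis using K0 by (intro exI[of _ "8 ^ card F * K0"]) auto
qed

text \<open>Hoelder's inequality with 1/p = \<delta> + 1/q turns the L^q bound on the transformed
  data into an L^p bound on \<open>g\<close>, and Hausdorff-Young leads back to L^q. The index type
  runs through the scalar components of the data.\<close>

lemma low_pass_dispersion:
  assumes p: "1 < p" "p \<le> 2" and q: "q = p / (p - 1)" and r: "r > 2 * (1 / p - 1 / q)"
    and F: "finite F" "\<And>c n. (c, n) \<in> F \<Longrightarrow> c > 0 \<and> norm n = 1" and B: "B > 0"
  shows "\<exists>K>0. \<forall>t\<ge>0. \<forall>a>0. \<forall>(G :: 'i::finite \<Rightarrow> real^2 \<Rightarrow> complex) g s. s\<^sup>2 = 1 \<longrightarrow> integrable lborel g \<longrightarrow>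
    (\<forall>i. Lp_le q (G i) a) \<longrightarrow>
    (AE \<xi> in lborel. norm (g \<xi>) \<le> B * low_pass F t \<xi> * (1 + (norm \<xi>)\<^sup>2) powr (- r / 2) * (\<Sum>i\<in>UNIV. norm (G i \<xi>))) \<longrightarrow>
    Lp_le q (FT s g) (K * (1 + t) powr (- (1 / 2) * (1 / p - 1 / q)) * a)"
proof -
  define \<delta> where "\<delta> = 1 / p - 1 / q"
  have p0: "p > 0" "p - 1 > 0" and q0: "q > 1" using p by (auto simp: q less_divide_eq)
  have iq: "1 / q = 1 - 1 / p" using p0 by (simp add: q field_simps)
  have d0: "\<delta> \<ge> 0" "\<delta> \<le> 1" using p by (auto simp: \<delta>_def iq field_simps)
  obtain C where C: "C > 0" and HY: "\<And>s f a. s\<^sup>2 = 1 \<Longrightarrow> integrable lborel f \<Longrightarrow> a > 0 \<Longrightarrow> Lp_le p f a \<Longrightarrow> Lp_le q (FT s f) (C * a)"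
    using hausdorff_young[OF p q] by blast
  define N where "N = (8::real) ^ card (UNIV :: 'i set)"
  have N: "N > 0" by (simp add: N_def)
  have "\<exists>K>0. \<forall>t\<ge>0. \<forall>a>0. \<forall>(D :: real^2 \<Rightarrow> real) (g :: real^2 \<Rightarrow> complex). Lp_le q D a \<longrightarrow> g \<in> borel_measurable borel \<longrightarrow>
    (AE \<xi> in lborel. norm (g \<xi>) \<le> B * low_pass F t \<xi> * (1 + (norm \<xi>)\<^sup>2) powr (- r / 2) * norm (D \<xi>)) \<longrightarrow> Lp_le p g (K * (1 + t) powr (- \<delta> / 2) * a)"
  proof (cases "\<delta> = 0")
    case True
    have pq: "p = q" using True by (simp add: \<delta>_def)
    have r0: "r > 0" using r True by (simp add: \<delta>_def)
    show ?thesis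
    proof (rule exI[of _ "B * (real (card F) + 1)"], intro conjI allI impI)
      fix t a :: real and D :: "real^2 \<Rightarrow> real" and g :: "real^2 \<Rightarrow> complex"
      assume t: "t \<ge> 0" and a: "a > 0" and D: "Lp_le q D a" and m: "g \<in> borel_measurable borel"
        and bd: "AE \<xi> in lborel. norm (g \<xi>) \<le> B * low_pass F t \<xi> * (1 + (norm \<xi>)\<^sup>2) powr (- r / 2) * norm (D \<xi>)"
      have c: "B * low_pass F t \<xi> * (1 + (norm \<xi>)\<^sup>2) powr (- r / 2) \<le> B * (real (card F) + 1)" for \<xi>
      proof -
        have "(1 + (norm \<xi>)\<^sup>2) powr (- r / 2) \<le> (1 + (norm \<xi>)\<^sup>2) powr 0" using r0 by (intro powr_mono) auto
        also have "\<dots> = 1" by (smt (verit) powr_zero_eq_one zero_le_power2)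
        finally have j: "(1 + (norm \<xi>)\<^sup>2) powr (- r / 2) \<le> 1" .
        have l: "low_pass F t \<xi> \<le> card F" using low_pass_le_card[of F t \<xi>] F(2) t by blast
        have "low_pass F t \<xi> * (1 + (norm \<xi>)\<^sup>2) powr (- r / 2) \<le> (real (card F) + 1) * 1"
          using l j by (intro mult_mono) auto
        thus ?thesis using B by (simp add: mult.assoc)
      qed
      have "AE \<xi> in lborel. norm (g \<xi>) \<le> B * (real (card F) + 1) * norm (D \<xi>)"
        using bd by (rule AE_mp) (intro AE_I2 impI, erule order_trans, rule mult_right_mono[OF c norm_ge_zero])
      hence "Lp_le q g (B * (real (card F) + 1) * a)" using B a q0 by (intro Lp_le_cmult[OF D m]) auto
      thus "Lp_le p g (B * (real (card F) + 1) * (1 + t) powr (- \<delta> / 2) * a)" using t by (simp add: True pq)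
    qed (use B in simp)
  next
    case False
    hence d: "\<delta> > 0" using d0 by simp
    obtain K where K: "K > 0" and LK: "\<And>t. t \<ge> 0 \<Longrightarrow> Lp_le (1 / \<delta>) (\<lambda>\<xi>. low_pass F t \<xi> * (1 + (norm \<xi>)\<^sup>2) powr (- r / 2)) (K * (1 + t) powr (- \<delta> / 2))"
      using low_pass_Lp[OF d d0(2) r[folded \<delta>_def] F] by blast
    show ?thesis
    proof (rule exI[of _ "2 * B * K"], intro conjI allI impI)
      fix t a :: real and D :: "real^2 \<Rightarrow> real" and g :: "real^2 \<Rightarrow> complex"
      assume t: "t \<ge> 0" and a: "a > 0" and D: "Lp_le q D a" and m: "g \<in> borel_measurable borel"
        and bd: "AE \<xi> in lborel. norm (g \<xi>) \<le> B * low_pass F t \<xi> * (1 + (norm \<xi>)\<^sup>2) powr (- r / 2) * norm (D \<xi>)"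
      let ?w = "\<lambda>\<xi>. B * (low_pass F t \<xi> * (1 + (norm \<xi>)\<^sup>2) powr (- r / 2))"
      have wm: "?w \<in> borel_measurable borel"
        by (intro borel_measurable_continuous_onI continuous_on_mult continuous_low_pass continuous_japanese_powr continuous_on_const)
      have w: "Lp_le (1 / \<delta>) ?w (B * (K * (1 + t) powr (- \<delta> / 2)))"
        using B K d by (intro Lp_le_cmult[OF LK[OF t] wm]) (auto simp: abs_mult)
      have wn: "norm (?w \<xi>) = B * low_pass F t \<xi> * (1 + (norm \<xi>)\<^sup>2) powr (- r / 2)" for \<xi>
        using B low_pass_nonneg[of F t \<xi>] by (simp add: abs_mult)
      have e: "1 / p = 1 / (1 / \<delta>) + 1 / q" by (simp add: \<delta>_def)
      have "Lp_le p g (2 * (B * (K * (1 + t) powr (- \<delta> / 2))) * a)"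
      proof (rule Lp_le_mult[OF _ _ _ e w D _ a m])
        show "AE x in lborel. norm (g x) \<le> norm (?w x) * norm (D x)" unfolding wn using bd .
        show "B * (K * (1 + t) powr (- \<delta> / 2)) > 0" using B K t by simp
      qed (use p q0 d in auto)
      thus "Lp_le p g (2 * B * K * (1 + t) powr (- \<delta> / 2) * a)" by (simp add: mult.assoc)
    qed (use B K in simp)
  qed
  then obtain K where K: "K > 0" and LK: "\<And>t a D g. t \<ge> 0 \<Longrightarrow> a > 0 \<Longrightarrow> Lp_le q (D :: real^2 \<Rightarrow> real) a \<Longrightarrow> (g :: real^2 \<Rightarrow> complex) \<in> borel_measurable borel \<Longrightarrow>
    (AE \<xi> in lborel. norm (g \<xi>) \<le> B * low_pass F t \<xi> * (1 + (norm \<xi>)\<^sup>2) powr (- r / 2) * norm (D \<xi>)) \<Longrightarrow> Lp_le p g (K * (1 + t) powr (- \<delta> / 2) * a)"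
    by blast
  show ?thesis
  proof (rule exI[of _ "C * K * N"], intro conjI allI impI)
    fix t a s :: real and G :: "'i \<Rightarrow> real^2 \<Rightarrow> complex" and g :: "real^2 \<Rightarrow> complex"
    assume t: "t \<ge> 0" and a: "a > 0" and s: "s\<^sup>2 = 1" and g: "integrable lborel g" and G: "\<forall>i. Lp_le q (G i) a"
      and bd: "AE \<xi> in lborel. norm (g \<xi>) \<le> B * low_pass F t \<xi> * (1 + (norm \<xi>)\<^sup>2) powr (- r / 2) * (\<Sum>i\<in>UNIV. norm (G i \<xi>))"
    have D: "Lp_le q (\<lambda>\<xi>. \<Sum>i\<in>UNIV. norm (G i \<xi>)) (N * a)"
      unfolding N_def using q0 a G by (intro Lp_le_sum) auto
    have m: "g \<in> borel_measurable borel" using borel_measurable_integrable[OF g] by simp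
    have bd': "AE \<xi> in lborel. norm (g \<xi>) \<le> B * low_pass F t \<xi> * (1 + (norm \<xi>)\<^sup>2) powr (- r / 2) * norm (\<Sum>i\<in>UNIV. norm (G i \<xi>))"
      using bd by (simp add: sum_nonneg)
    have Na: "N * a > 0" using N a by simp
    have "Lp_le q (FT s g) (C * (K * (1 + t) powr (- \<delta> / 2) * (N * a)))"
      using t K Na by (intro HY[OF s g _ LK[OF t Na D m bd']]) simp
    moreover have "- (1 / 2) * (1 / p - 1 / q) = - \<delta> / 2" unfolding \<delta>_def[symmetric] by simp
    ultimately show "Lp_le q (FT s g) (C * K * N * (1 + t) powr (- (1 / 2) * (1 / p - 1 / q)) * a)" by (simp only: mult_ac)
  qed (use C K N in simp)
qed

text \<open>Up to a constant, the function in the Sobolev norm is the inverse transform of the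
  weighted transform \<open>?h\<close>. Hence Hausdorff-Young is needed in its inverse direction,
  which applies because \<open>?h\<close> is integrable and continuous for a Schwartz
  function.\<close>

lemma sobolev_data:
  fixes f :: "real^2 \<Rightarrow> complex"
  assumes p: "1 < p" "p \<le> 2" and q: "q = p / (p - 1)"
  shows "\<exists>C>0. \<forall>s f a. schwartz f \<longrightarrow> a > 0 \<longrightarrow> Lp_le p (mult_op (japanese s) f) a \<longrightarrow>
    Lp_le q (\<lambda>\<xi>. complex_of_real ((1 + (norm \<xi>)\<^sup>2) powr (s / 2)) * FT (-1) f \<xi>) (C * a)"
proof -
  have p0: "p > 0" and q0: "q > 0" using p q by auto
  obtain C where C: "C > 0" and HY: "\<And>s f a. s\<^sup>2 = 1 \<Longrightarrow> integrable lborel f \<Longrightarrow> a > 0 \<Longrightarrow> Lp_le p f a \<Longrightarrow> Lp_le q (FT s f) (C * a)"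
    using hausdorff_young[OF p q] by blast
  show ?thesis
  proof (rule exI[of _ "C * (2 * pi)\<^sup>2"], intro conjI allI impI)
    fix s a :: real and f :: "real^2 \<Rightarrow> complex"
    assume f: "schwartz f" and a: "a > 0" and L: "Lp_le p (mult_op (japanese s) f) a"
    let ?h = "\<lambda>\<xi>. complex_of_real ((1 + (norm \<xi>)\<^sup>2) powr (s / 2)) * FT (-1) f \<xi>"
    note h = schwartz_FT_weight[OF f, of "s / 2"]
    have M: "mult_op (japanese s) f x = complex_of_real (1 / (2 * pi)) * (complex_of_real (1 / (2 * pi)) * FT 1 ?h x)" for x
    proof -
      have "(\<lambda>\<xi>. japanese s \<xi> * fourier f \<xi>) = (\<lambda>\<xi>. complex_of_real (1 / (2 * pi)) * ?h \<xi>)"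
        unfolding japanese_def fourier_FT by (intro ext) (simp only: mult_ac)
      thus ?thesis unfolding mult_op_def inv_fourier_FT by (simp only: FT_cmult)
    qed
    have n: "norm (FT 1 ?h x) = (2 * pi)\<^sup>2 * norm (mult_op (japanese s) f x)" for x
      unfolding M norm_mult norm_of_real by (simp add: power2_eq_square field_simps)
    have L1: "Lp_le p (FT 1 ?h) ((2 * pi)\<^sup>2 * a)"
    proof (rule Lp_le_cmult[OF L measurable_FT[OF h(1)]])
      show "AE x in lborel. norm (FT 1 ?h x) \<le> (2 * pi)\<^sup>2 * norm (mult_op (japanese s) f x)" unfolding n by simp
    qed (use p0 a in simp_all)
    have HY': "Lp_le q (FT (- 1) k) (C * b)" if "integrable lborel k" "b > 0" "Lp_le p k b" for k b
      by (rule HY[OF _ that]) simp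
    have a1: "(2 * pi)\<^sup>2 * a > 0" using a by simp
    have "Lp_le q ?h (C * ((2 * pi)\<^sup>2 * a))"
      by (rule hausdorff_young_inverse[where s = 1 and p = p, OF HY' power_one h a1 L1 p0 q0])
    thus "Lp_le q ?h (C * (2 * pi)\<^sup>2 * a)" by (simp only: mult.assoc)
  qed (use C in simp)
qed

lemma mult_op_vec_mat: "mult_op_vec (\<lambda>\<xi>. mat (m \<xi>)) F x $ k = mult_op m (\<lambda>x. F x $ k) x"
proof -
  have "(mat c *v v) $ k = c * v $ k" for c and v :: "complex^2"
    using exhaust_2[of k] by (auto simp: matrix_vector_mult_def mat_def sum_2)
  thus ?thesis unfolding mult_op_vec_def mult_op_def inv_fourier_vec_def fourier_vec_def by simp
qed

section \<open>Energy and Fourier amplitudes\<close>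

lemma modal_energy_nonneg: "modal_energy \<xi> r om u v th t \<ge> 0"
  unfolding modal_energy_def by (intro add_nonneg_nonneg sum_nonneg zero_le_power2)

lemma modal_energy_lower:
  shows "norm (modal r v j t) \<le> sqrt (modal_energy \<xi> r om u v th t)"
    and "norm \<xi> * om j * norm (modal r u j t) \<le> sqrt (modal_energy \<xi> r om u v th t)"
    and "norm (th t) \<le> sqrt (modal_energy \<xi> r om u v th t)"
proof -
  have s: "x j \<le> (\<Sum>j\<in>UNIV. x j)" if "\<And>j. x j \<ge> 0" for x :: "2 \<Rightarrow> real"
    using that by (intro member_le_sum) auto
  have n: "(\<Sum>j\<in>UNIV. (norm (modal r v j t))\<^sup>2) \<ge> 0" "(\<Sum>j\<in>UNIV. (norm \<xi> * om j * norm (modal r u j t))\<^sup>2) \<ge> 0"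
    by (intro sum_nonneg zero_le_power2)+
  show "norm (modal r v j t) \<le> sqrt (modal_energy \<xi> r om u v th t)"
    unfolding modal_energy_def using s[of "\<lambda>j. (norm (modal r v j t))\<^sup>2", OF zero_le_power2] n zero_le_power2[of "norm (th t)"] by (intro real_le_rsqrt) linarith
  show "norm \<xi> * om j * norm (modal r u j t) \<le> sqrt (modal_energy \<xi> r om u v th t)"
    unfolding modal_energy_def using s[of "\<lambda>j. (norm \<xi> * om j * norm (modal r u j t))\<^sup>2", OF zero_le_power2] n zero_le_power2[of "norm (th t)"] by (intro real_le_rsqrt) linarith
  show "norm (th t) \<le> sqrt (modal_energy \<xi> r om u v th t)"
    unfolding modal_energy_def using n zero_le_power2[of "norm (th t)"] by (intro real_le_rsqrt) linarith
qed

lemma orthonormal_component_le: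
  fixes r :: "2 \<Rightarrow> real^2"
  assumes "norm (r 1) = 1" "norm (r 2) = 1"
  shows "\<bar>r j $ k\<bar> \<le> 1"
  using component_le_norm_cart[of "r j" k] assms exhaust_2[of j] by auto

lemma norm_orthonormal_combination_le:
  fixes r :: "2 \<Rightarrow> real^2" and y :: "2 \<Rightarrow> complex"
  assumes o: "norm (r 1) = 1" "norm (r 2) = 1" and y: "\<And>j. norm (y j) \<le> e"
  shows "norm (\<Sum>j\<in>UNIV. complex_of_real (r j $ k) * y j) \<le> 2 * e"
proof -
  have "norm (\<Sum>j\<in>UNIV. complex_of_real (r j $ k) * y j) \<le> (\<Sum>j\<in>(UNIV::2 set). e)"
  proof (rule sum_norm_le)
    fix j
    show "norm (complex_of_real (r j $ k) * y j) \<le> e"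
      using mult_mono[OF orthonormal_component_le[OF o, of j k] y[of j]] by (simp add: norm_mult)
  qed
  thus ?thesis by simp
qed

text \<open>The factor 2 counts the two modes: each contributes at most the root of the energy, as
  the entries of the unit vectors are at most 1 in modulus.\<close>

lemma modal_energy_controls:
  fixes S :: "complex^2^2"
  assumes o: "norm (r 1) = 1" "norm (r 2) = 1" "r 1 \<bullet> r 2 = 0" and om: "\<And>j. om j \<ge> 0"
  shows "norm (v k t) \<le> 2 * sqrt (modal_energy \<xi> r om u v th t)"
    and "(\<And>l. S $ k $ l = (\<Sum>j\<in>UNIV. complex_of_real (norm \<xi> * om j * r j $ k * r j $ l))) \<Longrightarrow>
      norm (\<Sum>l\<in>UNIV. S $ k $ l * u l t) \<le> 2 * sqrt (modal_energy \<xi> r om u v th t)"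
proof -
  have "norm (\<Sum>j\<in>UNIV. complex_of_real (r j $ k) * modal r v j t) \<le> 2 * sqrt (modal_energy \<xi> r om u v th t)"
    by (rule norm_orthonormal_combination_le[OF o(1,2) modal_energy_lower(1)])
  also have "(\<Sum>j\<in>UNIV. complex_of_real (r j $ k) * modal r v j t) = v k t"
    unfolding modal_def by (rule orthonormal_expansion[OF o, of "\<lambda>l. v l t", symmetric])
  finally show "norm (v k t) \<le> 2 * sqrt (modal_energy \<xi> r om u v th t)" .
  assume S: "\<And>l. S $ k $ l = (\<Sum>j\<in>UNIV. complex_of_real (norm \<xi> * om j * r j $ k * r j $ l))"
  have "(\<Sum>l\<in>UNIV. S $ k $ l * u l t) = (\<Sum>j\<in>UNIV. complex_of_real (r j $ k) * (complex_of_real (norm \<xi> * om j) * modal r u j t))"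
    unfolding S modal_def by (simp add: sum_2 algebra_simps)
  also have "norm \<dots> \<le> 2 * sqrt (modal_energy \<xi> r om u v th t)"
  proof (rule norm_orthonormal_combination_le[OF o(1,2)])
    fix j show "norm (complex_of_real (norm \<xi> * om j) * modal r u j t) \<le> sqrt (modal_energy \<xi> r om u v th t)"
      using modal_energy_lower(2)[of \<xi> om j r u t v th] om[of j] by (simp add: norm_mult abs_mult)
  qed
  finally show "norm (\<Sum>l\<in>UNIV. S $ k $ l * u l t) \<le> 2 * sqrt (modal_energy \<xi> r om u v th t)" .
qed

lemma modal_energy_upper:
  assumes o: "norm (r 1) = 1" "norm (r 2) = 1" and om: "\<And>j. 0 \<le> om j" "\<And>j. om j \<le> M" and M: "M \<ge> 1"
  shows "sqrt (modal_energy \<xi> r om u v th t) \<le> 2 * M * ((\<Sum>k\<in>UNIV. norm (v k t)) + norm \<xi> * (\<Sum>k\<in>UNIV. norm (u k t)) + norm (th t))"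
proof -
  have b: "norm (modal r w j t) \<le> (\<Sum>k\<in>UNIV. norm (w k t))" for w j
    unfolding modal_def
    by (intro sum_norm_le) (simp add: norm_mult mult_left_le_one_le orthonormal_component_le[OF o])
  define V W Th where "V = (\<Sum>k\<in>UNIV. norm (v k t))" and "W = norm \<xi> * (\<Sum>k\<in>UNIV. norm (u k t))" and "Th = norm (th t)"
  have nn: "V \<ge> 0" "W \<ge> 0" "Th \<ge> 0" by (simp_all add: V_def W_def Th_def sum_nonneg)
  have v: "(norm (modal r v j t))\<^sup>2 \<le> (M * V)\<^sup>2" for j
  proof (rule power_mono[OF _ norm_ge_zero])
    have "1 * V \<le> M * V" using M nn by (intro mult_right_mono) auto
    thus "norm (modal r v j t) \<le> M * V" using b[of v j] by (simp add: V_def)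
  qed
  have u: "(norm \<xi> * om j * norm (modal r u j t))\<^sup>2 \<le> (M * W)\<^sup>2" for j
  proof (rule power_mono)
    have "(norm \<xi> * om j) * norm (modal r u j t) \<le> (norm \<xi> * M) * (\<Sum>k\<in>UNIV. norm (u k t))"
      using om[of j] M b by (intro mult_mono mult_left_mono) auto
    thus "norm \<xi> * om j * norm (modal r u j t) \<le> M * W" by (simp add: W_def mult_ac)
    show "0 \<le> norm \<xi> * om j * norm (modal r u j t)" using om[of j] by simp
  qed
  have "Th \<le> M * Th" using mult_right_mono[OF M nn(3)] by simp
  hence th: "Th\<^sup>2 \<le> (M * Th)\<^sup>2" using nn by (intro power_mono)
  have "modal_energy \<xi> r om u v th t \<le> 2 * (M * V)\<^sup>2 + 2 * (M * W)\<^sup>2 + (M * Th)\<^sup>2"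
    unfolding modal_energy_def sum_2 Th_def[symmetric] using v[of 1] v[of 2] u[of 1] u[of 2] th by linarith
  also have "\<dots> \<le> (2 * M * (V + W + Th))\<^sup>2"
  proof -
    have "2 * V\<^sup>2 + 2 * W\<^sup>2 + Th\<^sup>2 \<le> 4 * (V + W + Th)\<^sup>2"
    proof -
      have "0 \<le> V * W" "0 \<le> V * Th" "0 \<le> W * Th" "0 \<le> V\<^sup>2" "0 \<le> W\<^sup>2" "0 \<le> Th\<^sup>2" using nn by simp_all
      thus ?thesis unfolding power2_sum distrib_right by (simp add: algebra_simps power2_eq_square)
    qed
    have "2 * (M * V)\<^sup>2 + 2 * (M * W)\<^sup>2 + (M * Th)\<^sup>2 = M\<^sup>2 * (2 * V\<^sup>2 + 2 * W\<^sup>2 + Th\<^sup>2)"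
      by (simp add: power_mult_distrib algebra_simps)
    also have "\<dots> \<le> M\<^sup>2 * (4 * (V + W + Th)\<^sup>2)"
      by (rule mult_left_mono[OF \<open>2 * V\<^sup>2 + 2 * W\<^sup>2 + Th\<^sup>2 \<le> 4 * (V + W + Th)\<^sup>2\<close> zero_le_power2])
    also have "\<dots> = (2 * M * (V + W + Th))\<^sup>2" by (simp add: power_mult_distrib)
    finally show ?thesis .
  qed
  finally have "sqrt (modal_energy \<xi> r om u v th t) \<le> 2 * M * (V + W + Th)"
    using M nn by (intro real_le_lsqrt) auto
  thus ?thesis by (simp add: V_def W_def Th_def)
qed

section \<open>The symbol along rays and uniform bounds over the circle\<close>

lemma hom_symbol_eigen:
  fixes x :: "complex^2"
  assumes "A (sgn \<xi>) *v x = complex_of_real m *s x" "m > 0"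
  shows "hom_symbol A \<xi> *v x = complex_of_real ((norm \<xi> * sqrt m)\<^sup>2) *s x"
proof -
  have "hom_symbol A \<xi> *v x = (norm \<xi>)\<^sup>2 *\<^sub>R (A (sgn \<xi>) *v x)"
    unfolding hom_symbol_def by (simp add: matrix_vector_mult_def vec_eq_iff scaleR_sum_right)
  also have "\<dots> = complex_of_real ((norm \<xi> * sqrt m)\<^sup>2) *s x"
    unfolding assms(1) vec_eq_iff vector_scaleR_component vector_smult_component
    using assms(2) by (simp add: scaleR_conv_of_real power_mult_distrib)
  finally show ?thesis .
qed

lemma self_adjoint_hom_symbol:
  assumes "self_adjoint (A (sgn \<xi>))" shows "self_adjoint (hom_symbol A \<xi>)"
proof -
  have h: "A (sgn \<xi>) $ i $ j = cnj (A (sgn \<xi>) $ j $ i)" for i j using assms unfolding self_adjoint_def by blast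
  show ?thesis unfolding self_adjoint_def hom_symbol_def
  proof (intro allI)
    fix i j
    have "cnj (((norm \<xi>)\<^sup>2 *\<^sub>R A (sgn \<xi>)) $ j $ i) = (norm \<xi>)\<^sup>2 *\<^sub>R cnj (A (sgn \<xi>) $ j $ i)" by simp
    also have "cnj (A (sgn \<xi>) $ j $ i) = A (sgn \<xi>) $ i $ j" by (rule h[symmetric])
    finally show "((norm \<xi>)\<^sup>2 *\<^sub>R A (sgn \<xi>)) $ i $ j = cnj (((norm \<xi>)\<^sup>2 *\<^sub>R A (sgn \<xi>)) $ j $ i)"
      by (simp only: vector_scaleR_component)
  qed
qed

lemma positive_lower_bound_on_circle:
  fixes f :: "real^2 \<Rightarrow> real"
  assumes "continuous_on (sphere 0 1) f" "\<And>\<eta>. norm \<eta> = 1 \<Longrightarrow> f \<eta> > 0"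
  obtains m M where "m > 0" "\<And>\<eta>. norm \<eta> = 1 \<Longrightarrow> m \<le> f \<eta> \<and> f \<eta> \<le> M"
proof -
  have ne: "sphere (0 :: real^2) 1 \<noteq> {}" using norm_circ[of 0] by (metis dist_0_norm empty_iff mem_sphere)
  obtain x where x: "x \<in> sphere 0 1" "\<And>y. y \<in> sphere 0 1 \<Longrightarrow> f x \<le> f y"
    using continuous_attains_inf[OF compact_sphere ne assms(1)] by blast
  obtain z where z: "z \<in> sphere 0 1" "\<And>y. y \<in> sphere 0 1 \<Longrightarrow> f y \<le> f z"
    using continuous_attains_sup[OF compact_sphere ne assms(1)] by blast
  show ?thesis using assms(2)[of x] x z by (intro that[of "f x" "f z"]) auto
qed

text \<open>The assumptions on the symbol in the form in which the estimates use them: continuity on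
  the circle, positive and distinct eigenvalues, and simplicity of every zero of a coupling
  function.\<close>

locale spectral_symbol =
  fixes A :: "real^2 \<Rightarrow> complex^2^2" and \<mu> :: "2 \<Rightarrow> real^2 \<Rightarrow> real" and rv :: "2 \<Rightarrow> real^2 \<Rightarrow> real^2"
  assumes A_cont: "continuous_on (sphere 0 1) A" and A_sa: "\<And>\<eta>. norm \<eta> = 1 \<Longrightarrow> self_adjoint (A \<eta>)"
    and mu_cont: "\<And>j. continuous_on (sphere 0 1) (\<mu> j)" and rv_cont: "\<And>j. continuous_on (sphere 0 1) (rv j)"
    and mu_pos: "\<And>j \<eta>. norm \<eta> = 1 \<Longrightarrow> \<mu> j \<eta> > 0" and mu_distinct: "\<And>\<eta>. norm \<eta> = 1 \<Longrightarrow> \<mu> 1 \<eta> \<noteq> \<mu> 2 \<eta>"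
    and eigen: "\<And>\<eta> j. norm \<eta> = 1 \<Longrightarrow> A \<eta> *v complexify (rv j \<eta>) = complex_of_real (\<mu> j \<eta>) *s complexify (rv j \<eta>)"
    and orthonormal: "\<And>\<eta>. norm \<eta> = 1 \<Longrightarrow> norm (rv 1 \<eta>) = 1" "\<And>\<eta>. norm \<eta> = 1 \<Longrightarrow> norm (rv 2 \<eta>) = 1"
      "\<And>\<eta>. norm \<eta> = 1 \<Longrightarrow> rv 1 \<eta> \<bullet> rv 2 \<eta> = 0"
    and simple: "\<And>\<eta> j. norm \<eta> = 1 \<Longrightarrow> coupling rv j \<eta> = 0 \<Longrightarrow> simple_zero_on_circle (coupling rv j) \<eta>"
begin

lemma matrix_sqrt_hom_symbol:
  assumes "\<xi> \<noteq> 0"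
  shows "matrix_sqrt (hom_symbol A \<xi>) $ k $ l = (\<Sum>j\<in>UNIV. complex_of_real (norm \<xi> * sqrt (\<mu> j (sgn \<xi>)) * rv j (sgn \<xi>) $ k * rv j (sgn \<xi>) $ l))"
proof -
  have n: "norm (sgn \<xi>) = 1" using assms by (simp add: norm_sgn)
  have H: "hom_symbol A \<xi> *v complexify (rv j (sgn \<xi>)) = complex_of_real ((norm \<xi> * sqrt (\<mu> j (sgn \<xi>)))\<^sup>2) *s complexify (rv j (sgn \<xi>))" for j
    by (rule hom_symbol_eigen) (rule eigen[OF n], rule mu_pos[OF n])
  show ?thesis
    by (rule matrix_sqrt_entries[where r = "\<lambda>j. rv j (sgn \<xi>)" and lam = "\<lambda>j. norm \<xi> * sqrt (\<mu> j (sgn \<xi>))", OF orthonormal[OF n] H])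
       (use assms mu_pos[OF n] in simp)
qed

text \<open>The square root is given by a definite description, so measurability is taken from its
  spectral entries, which are continuous off the origin; the origin is split off as a single
  point.\<close>

lemma measurable_matrix_sqrt_hom_symbol:
  "(\<lambda>\<xi>. matrix_sqrt (hom_symbol A \<xi>) $ k $ l) \<in> borel_measurable borel"
proof -
  let ?f = "\<lambda>\<xi>. \<Sum>j\<in>UNIV. complex_of_real (norm \<xi> * sqrt (\<mu> j (sgn \<xi>)) * rv j (sgn \<xi>) $ k * rv j (sgn \<xi>) $ l)"
  have "continuous_on (- {0}) ?f"
    by (intro continuous_intros continuous_sgn_compose mu_cont rv_cont)
  hence "continuous_on (- {0}) (\<lambda>\<xi>. matrix_sqrt (hom_symbol A \<xi>) $ k $ l)"
    by (rule continuous_on_eq) (simp add: matrix_sqrt_hom_symbol)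
  hence "(\<lambda>\<xi>. if \<xi> \<in> - {0} then matrix_sqrt (hom_symbol A \<xi>) $ k $ l else matrix_sqrt (hom_symbol A 0) $ k $ l) \<in> borel_measurable borel"
    by (intro borel_measurable_continuous_on_if continuous_on_const) auto
  moreover have "(\<lambda>\<xi>. if \<xi> \<in> - {0} then matrix_sqrt (hom_symbol A \<xi>) $ k $ l else matrix_sqrt (hom_symbol A 0) $ k $ l) = (\<lambda>\<xi>. matrix_sqrt (hom_symbol A \<xi>) $ k $ l)"
    by auto
  ultimately show ?thesis by simp
qed

text \<open>By compactness of the circle the frequencies and their gap are bounded uniformly, which
  is what makes the decay constants independent of the direction.\<close>

lemma mode_bounds:
  obtains m M where "m > 0" "M \<ge> 1" "\<And>\<eta> j. norm \<eta> = 1 \<Longrightarrow> m \<le> sqrt (\<mu> j \<eta>) \<and> sqrt (\<mu> j \<eta>) \<le> M"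
    "\<And>\<eta>. norm \<eta> = 1 \<Longrightarrow> m \<le> \<bar>(sqrt (\<mu> 1 \<eta>))\<^sup>2 - (sqrt (\<mu> 2 \<eta>))\<^sup>2\<bar>"
proof -
  have "continuous_on (sphere 0 1) (\<lambda>\<eta>. sqrt (\<mu> j \<eta>))" for j by (intro continuous_intros mu_cont)
  note sb = positive_lower_bound_on_circle[OF this]
  obtain m1 M1 where 1: "m1 > 0" "\<And>\<eta>. norm \<eta> = 1 \<Longrightarrow> m1 \<le> sqrt (\<mu> 1 \<eta>) \<and> sqrt (\<mu> 1 \<eta>) \<le> M1"
    using sb[of 1] mu_pos real_sqrt_gt_zero by blast
  obtain m2 M2 where 2: "m2 > 0" "\<And>\<eta>. norm \<eta> = 1 \<Longrightarrow> m2 \<le> sqrt (\<mu> 2 \<eta>) \<and> sqrt (\<mu> 2 \<eta>) \<le> M2"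
    using sb[of 2] mu_pos real_sqrt_gt_zero by blast
  have d: "\<bar>(sqrt (\<mu> 1 \<eta>))\<^sup>2 - (sqrt (\<mu> 2 \<eta>))\<^sup>2\<bar> > 0" if "norm \<eta> = 1" for \<eta>
    using mu_pos[OF that, of 1] mu_pos[OF that, of 2] mu_distinct[OF that] by simp
  have "continuous_on (sphere 0 1) (\<lambda>\<eta>. \<bar>(sqrt (\<mu> 1 \<eta>))\<^sup>2 - (sqrt (\<mu> 2 \<eta>))\<^sup>2\<bar>)" by (intro continuous_intros mu_cont)
  from positive_lower_bound_on_circle[OF this d]
  obtain m3 M3 where 3: "m3 > 0" "\<And>\<eta>. norm \<eta> = 1 \<Longrightarrow> m3 \<le> \<bar>(sqrt (\<mu> 1 \<eta>))\<^sup>2 - (sqrt (\<mu> 2 \<eta>))\<^sup>2\<bar> \<and> \<bar>(sqrt (\<mu> 1 \<eta>))\<^sup>2 - (sqrt (\<mu> 2 \<eta>))\<^sup>2\<bar> \<le> M3"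
    by blast
  show ?thesis
  proof (rule that[of "min m1 (min m2 m3)" "max 1 (max M1 M2)"])
    fix \<eta> :: "real^2" and j :: 2 assume n: "norm \<eta> = 1"
    show "min m1 (min m2 m3) \<le> sqrt (\<mu> j \<eta>) \<and> sqrt (\<mu> j \<eta>) \<le> max 1 (max M1 M2)"
      using 1(2)[OF n] 2(2)[OF n] exhaust_2[of j] by auto
    show "min m1 (min m2 m3) \<le> \<bar>(sqrt (\<mu> 1 \<eta>))\<^sup>2 - (sqrt (\<mu> 2 \<eta>))\<^sup>2\<bar>" using 3(2)[OF n] by linarith
  qed (use 1 2 3 in auto)
qed

text \<open>The coupling functions are the coordinates of \<eta> in an orthonormal basis. Their
  squares add up to 1, so at a zero of one the other has modulus 1.\<close>

lemma coupling_lower_bound: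
  obtains F where "finite F" "\<And>c n. (c, n) \<in> F \<Longrightarrow> c > 0 \<and> norm n = 1"
    "\<And>\<eta>. norm \<eta> = 1 \<Longrightarrow> \<exists>(c, n)\<in>F. c * (\<eta> \<bullet> n)\<^sup>2 \<le> min ((rv 1 \<eta> \<bullet> \<eta>)\<^sup>2) ((rv 2 \<eta> \<bullet> \<eta>)\<^sup>2)"
proof -
  have s: "sgn \<eta> = \<eta>" if "norm \<eta> = 1" for \<eta> :: "real^2" using that by (simp add: sgn_div_norm)
  have cont: "continuous_on (sphere 0 1) (coupling rv j)" for j
  proof (rule continuous_on_eq)
    show "continuous_on (sphere 0 1) (\<lambda>\<eta>. rv j \<eta> \<bullet> \<eta>)" by (intro continuous_intros rv_cont)
    show "rv j \<eta> \<bullet> \<eta> = coupling rv j \<eta>" if "\<eta> \<in> sphere 0 1" for \<eta> using s[of \<eta>] that by (simp add: coupling_def)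
  qed
  have one: "(coupling rv 1 \<eta>)\<^sup>2 + (coupling rv 2 \<eta>)\<^sup>2 = 1" if n: "norm \<eta> = 1" for \<eta>
  proof -
    have "(rv 1 \<eta> \<bullet> \<eta>)\<^sup>2 + (rv 2 \<eta> \<bullet> \<eta>)\<^sup>2 = (\<Sum>k\<in>UNIV. \<Sum>l\<in>UNIV. \<eta> $ k * \<eta> $ l * (\<Sum>j\<in>UNIV. rv j \<eta> $ k * rv j \<eta> $ l))"
      by (simp add: sum_2 inner_plane power2_eq_square algebra_simps)
    also have "\<dots> = (norm \<eta>)\<^sup>2"
      unfolding orthonormal_resolution[where r = "\<lambda>j. rv j \<eta>", OF orthonormal[OF n]] norm_plane by (simp add: sum_2 power2_eq_square)
    finally show ?thesis using n by (simp add: coupling_def s)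
  qed
  obtain F :: "(real \<times> (real^2)) set" where F: "finite F" "\<forall>(c, n)\<in>F. c > 0 \<and> norm n = 1"
    "\<forall>\<eta>. norm \<eta> = 1 \<longrightarrow> (\<exists>(c, n)\<in>F. c * (\<eta> \<bullet> n)\<^sup>2 \<le> min ((coupling rv 1 \<eta>)\<^sup>2) ((coupling rv 2 \<eta>)\<^sup>2))"
    using quadratic_lower_bound_finite[OF cont[of 1] cont[of 2] one simple simple] by blast
  show ?thesis
  proof (rule that[OF F(1)])
    show "c > 0 \<and> norm n = 1" if "(c, n) \<in> F" for c n using F(2) that by auto
    show "\<exists>(c, n)\<in>F. c * (\<eta> \<bullet> n)\<^sup>2 \<le> min ((rv 1 \<eta> \<bullet> \<eta>)\<^sup>2) ((rv 2 \<eta> \<bullet> \<eta>)\<^sup>2)" if "norm \<eta> = 1" for \<eta>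
      using F(3)[rule_format, OF that] by (simp add: coupling_def s[OF that])
  qed
qed

text \<open>Since |\<xi>|^2 (sgn \<xi> \<bullet> n)^2 = (\<xi> \<bullet> n)^2, the angular
  degeneracy becomes a degeneracy in a linear coordinate. The exponential is then bounded by one
  summand, and hence by the sum.\<close>

lemma exp_coupling_le_low_pass:
  assumes F: "finite F" "\<And>\<eta>. norm \<eta> = 1 \<Longrightarrow> \<exists>(c, n)\<in>F. c * (\<eta> \<bullet> n)\<^sup>2 \<le> w \<eta>"
    and d: "d > 0" and t: "t \<ge> 0" and x: "\<xi> \<noteq> (0 :: real^2)"
  shows "exp (- d * t * ((norm \<xi>)\<^sup>2 / (1 + (norm \<xi>)\<^sup>2)) * w (sgn \<xi>)) \<le> low_pass ((\<lambda>(c, n). (d * c, n)) ` F) t \<xi>"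
proof -
  have n1: "norm (sgn \<xi>) = 1" using x by (simp add: norm_sgn)
  from F(2)[OF this] obtain c n where cn: "(c, n) \<in> F" "c * (sgn \<xi> \<bullet> n)\<^sup>2 \<le> w (sgn \<xi>)" by blast
  have F': "(d * c, n) \<in> (\<lambda>(c, n). (d * c, n)) ` F" using cn(1) by force
  have e: "(norm \<xi>)\<^sup>2 * (sgn \<xi> \<bullet> n)\<^sup>2 = (\<xi> \<bullet> n)\<^sup>2"
    using x by (simp add: sgn_div_norm power_mult_distrib[symmetric] mult.assoc[symmetric])
  have "d * t * ((norm \<xi>)\<^sup>2 / (1 + (norm \<xi>)\<^sup>2)) * (c * (sgn \<xi> \<bullet> n)\<^sup>2) \<le> d * t * ((norm \<xi>)\<^sup>2 / (1 + (norm \<xi>)\<^sup>2)) * w (sgn \<xi>)"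
    using cn(2) d t by (intro mult_left_mono) auto
  moreover have "d * t * ((norm \<xi>)\<^sup>2 / (1 + (norm \<xi>)\<^sup>2)) * (c * (sgn \<xi> \<bullet> n)\<^sup>2) = d * c * t * (\<xi> \<bullet> n)\<^sup>2 / (1 + (norm \<xi>)\<^sup>2)"
    unfolding e[symmetric] by simp
  ultimately have le: "d * c * t * (\<xi> \<bullet> n)\<^sup>2 / (1 + (norm \<xi>)\<^sup>2) \<le> d * t * ((norm \<xi>)\<^sup>2 / (1 + (norm \<xi>)\<^sup>2)) * w (sgn \<xi>)"
    by (simp only:)
  hence "exp (- d * t * ((norm \<xi>)\<^sup>2 / (1 + (norm \<xi>)\<^sup>2)) * w (sgn \<xi>)) \<le> exp (- (d * c) * t * (\<xi> \<bullet> n)\<^sup>2 / (1 + (norm \<xi>)\<^sup>2))"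
    by (simp only: mult_minus_left minus_divide_left[symmetric] neg_le_iff_le exp_le_cancel_iff)
  also have "\<dots> = (\<lambda>(c, n). exp (- c * t * (\<xi> \<bullet> n)\<^sup>2 / (1 + (norm \<xi>)\<^sup>2))) (d * c, n)" by simp
  also have "\<dots> \<le> (\<Sum>x\<in>(\<lambda>(c, n). (d * c, n)) ` F. (\<lambda>(c, n). exp (- c * t * (\<xi> \<bullet> n)\<^sup>2 / (1 + (norm \<xi>)\<^sup>2))) x)"
    using F(1) by (intro member_le_sum[OF F']) auto
  finally show ?thesis by (simp add: low_pass_def)
qed

text \<open>\<open>B\<close> and \<open>F\<close> are obtained before any solution is given, so they
  depend on the symbol, \<kappa> and \<gamma> alone. The displacement occurs only under the square
  root of the symbol, because the energy controls |\<xi>| times it.\<close>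

lemma pointwise_decay:
  assumes \<kappa>: "\<kappa> > 0" and g: "\<gamma> \<noteq> 0"
  obtains B F where "B > 0" "finite F" "\<And>c n. (c, n) \<in> F \<Longrightarrow> c > 0 \<and> norm n = 1"
    "\<And>U\<^sub>1 U\<^sub>2 \<theta>\<^sub>0 U \<theta> t \<xi> k. thermoelastic A \<kappa> \<gamma> U\<^sub>1 U\<^sub>2 \<theta>\<^sub>0 U \<theta> \<Longrightarrow> t \<ge> 0 \<Longrightarrow> \<xi> \<noteq> 0 \<Longrightarrow>
      max (norm (thermoelastic.vh U k t \<xi>)) (max (norm (thermoelastic.th \<theta> t \<xi>))
        (norm (\<Sum>l\<in>UNIV. matrix_sqrt (hom_symbol A \<xi>) $ k $ l * thermoelastic.uh U l t \<xi>)))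
      \<le> B * low_pass F t \<xi> * ((\<Sum>k\<in>UNIV. norm (thermoelastic.vh U k 0 \<xi>)) + norm \<xi> * (\<Sum>k\<in>UNIV. norm (thermoelastic.uh U k 0 \<xi>)) + norm (thermoelastic.th \<theta> 0 \<xi>))"
proof -
  obtain m M where m: "m > 0" and M: "M \<ge> 1" and mM: "\<And>\<eta> j. norm \<eta> = 1 \<Longrightarrow> m \<le> sqrt (\<mu> j \<eta>) \<and> sqrt (\<mu> j \<eta>) \<le> M"
    and gap: "\<And>\<eta>. norm \<eta> = 1 \<Longrightarrow> m \<le> \<bar>(sqrt (\<mu> 1 \<eta>))\<^sup>2 - (sqrt (\<mu> 2 \<eta>))\<^sup>2\<bar>"
    using mode_bounds by blast
  obtain C c where C: "C > 0" and c: "c > 0" and decay: "\<And>\<xi> r om H u v th t. modal_system \<kappa> \<gamma> \<xi> r om H u v th \<Longrightarrow>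
    (\<forall>j. m \<le> om j \<and> om j \<le> M) \<Longrightarrow> m \<le> \<bar>(om 1)\<^sup>2 - (om 2)\<^sup>2\<bar> \<Longrightarrow> t \<ge> 0 \<Longrightarrow>
    modal_energy \<xi> r om u v th t \<le> C * exp (- c * t * ((norm \<xi>)\<^sup>2 / (1 + (norm \<xi>)\<^sup>2)) * min ((r 1 \<bullet> sgn \<xi>)\<^sup>2) ((r 2 \<bullet> sgn \<xi>)\<^sup>2))
      * modal_energy \<xi> r om u v th 0"
    using modal_energy_decay[OF \<kappa> g m M] by meson
  obtain F where F: "finite F" "\<And>c n. (c, n) \<in> F \<Longrightarrow> c > 0 \<and> norm n = 1"
    "\<And>\<eta>. norm \<eta> = 1 \<Longrightarrow> \<exists>(c, n)\<in>F. c * (\<eta> \<bullet> n)\<^sup>2 \<le> min ((rv 1 \<eta> \<bullet> \<eta>)\<^sup>2) ((rv 2 \<eta> \<bullet> \<eta>)\<^sup>2)"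
    using coupling_lower_bound by blast
  \<comment> \<open>The rate is halved because amplitudes are square roots of energies.\<close>
  define F' where "F' = (\<lambda>(d, n). (c / 2 * d, n)) ` F"
  show ?thesis
  proof (rule that[of "4 * M * sqrt C" F'])
    show "4 * M * sqrt C > 0" using C M by simp
    show "finite F'" unfolding F'_def by (rule finite_imageI[OF F(1)])
    show "d > 0 \<and> norm n = 1" if "(d, n) \<in> F'" for d n using that F(2) c unfolding F'_def by auto
    fix U\<^sub>1 U\<^sub>2 \<theta>\<^sub>0 U \<theta> and t :: real and \<xi> :: "real^2" and k
    assume TE: "thermoelastic A \<kappa> \<gamma> U\<^sub>1 U\<^sub>2 \<theta>\<^sub>0 U \<theta>" and t: "t \<ge> 0" and x: "\<xi> \<noteq> 0"
    interpret thermoelastic A \<kappa> \<gamma> U\<^sub>1 U\<^sub>2 \<theta>\<^sub>0 U \<theta> by (rule TE)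
    have n: "norm (sgn \<xi>) = 1" using x by (simp add: norm_sgn)
    let ?r = "\<lambda>j. rv j (sgn \<xi>)" and ?om = "\<lambda>j. sqrt (\<mu> j (sgn \<xi>))"
    let ?E = "modal_energy \<xi> ?r ?om (\<lambda>k t. uh k t \<xi>) (\<lambda>k t. vh k t \<xi>) (\<lambda>t. th t \<xi>)"
    let ?D = "(\<Sum>k\<in>UNIV. norm (vh k 0 \<xi>)) + norm \<xi> * (\<Sum>k\<in>UNIV. norm (uh k 0 \<xi>)) + norm (th 0 \<xi>)"
    let ?x = "(norm \<xi>)\<^sup>2 / (1 + (norm \<xi>)\<^sup>2)" and ?w = "\<lambda>\<eta>. min ((rv 1 \<eta> \<bullet> \<eta>)\<^sup>2) ((rv 2 \<eta> \<bullet> \<eta>)\<^sup>2)"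
    have sys: "modal_system \<kappa> \<gamma> \<xi> ?r ?om (hom_symbol A \<xi>) (\<lambda>k t. uh k t \<xi>) (\<lambda>k t. vh k t \<xi>) (\<lambda>t. th t \<xi>)"
      unfolding modal_system_def
      by (intro conjI allI impI orthonormal[OF n] x self_adjoint_hom_symbol A_sa[OF n] hom_symbol_eigen eigen[OF n] mu_pos[OF n]
          uh_cont vh_cont th_cont uh_deriv vh_deriv th_deriv)
    have om0: "?om j \<ge> 0" for j using mu_pos[OF n, of j] by simp
    have "?E t \<le> C * exp (- c * t * ?x * ?w (sgn \<xi>)) * ?E 0"
      using decay[OF sys _ gap[OF n] t] mM[OF n] by blast
    hence "sqrt (?E t) \<le> sqrt (C * exp (- c * t * ?x * ?w (sgn \<xi>)) * ?E 0)" by (rule real_sqrt_le_mono)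
    also have "\<dots> = sqrt C * exp (- (c / 2) * t * ?x * ?w (sgn \<xi>)) * sqrt (?E 0)"
    proof -
      have "sqrt (exp z) = exp (z / 2)" for z by (rule real_sqrt_unique) (simp_all add: power2_eq_square exp_add[symmetric])
      thus ?thesis by (simp add: real_sqrt_mult)
    qed
    also have "\<dots> \<le> sqrt C * low_pass F' t \<xi> * (2 * M * ?D)"
    proof (rule mult_mono)
      show "sqrt C * exp (- (c / 2) * t * ?x * ?w (sgn \<xi>)) \<le> sqrt C * low_pass F' t \<xi>"
        unfolding F'_def using C c by (intro mult_left_mono exp_coupling_le_low_pass[OF F(1,3) _ t x]) auto
      show "sqrt (?E 0) \<le> 2 * M * ?D"
        using mM[OF n] by (intro modal_energy_upper orthonormal[OF n] om0 M) auto
      have "0 \<le> exp (- (c / 2) * t * ?x * ?w (sgn \<xi>))" by simp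
      also have "\<dots> \<le> low_pass F' t \<xi>" unfolding F'_def using c by (intro exp_coupling_le_low_pass[OF F(1,3) _ t x]) auto
      finally show "0 \<le> sqrt C * low_pass F' t \<xi>" using C by simp
    qed (simp add: modal_energy_nonneg)
    finally have b': "sqrt (?E t) \<le> sqrt C * low_pass F' t \<xi> * (2 * M * ?D)" .
    have "2 * e \<le> 4 * M * s * l * d" if "e \<le> s * l * (2 * M * d)" for e s l d :: real
      using that by (simp add: mult_ac)
    from this[OF b'] have b: "2 * sqrt (?E t) \<le> 4 * M * sqrt C * low_pass F' t \<xi> * ?D" .
    have sE: "sqrt (?E t) \<ge> 0" by (simp add: modal_energy_nonneg)
    have "norm (vh k t \<xi>) \<le> 2 * sqrt (?E t)"
      using modal_energy_controls(1)[where r = ?r and om = ?om and v = "\<lambda>k t. vh k t \<xi>" and k = k and t = t, OF orthonormal[OF n] om0] .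
    moreover have "norm (\<Sum>l\<in>UNIV. matrix_sqrt (hom_symbol A \<xi>) $ k $ l * uh l t \<xi>) \<le> 2 * sqrt (?E t)"
      using modal_energy_controls(2)[where r = ?r and om = ?om and u = "\<lambda>k t. uh k t \<xi>" and k = k and t = t and \<xi> = \<xi>, OF orthonormal[OF n] om0 matrix_sqrt_hom_symbol[OF x]] .
    moreover have "norm (th t \<xi>) \<le> 2 * sqrt (?E t)"
      using modal_energy_lower(3)[where th = "\<lambda>t. th t \<xi>" and t = t and r = ?r and om = ?om and u = "\<lambda>k t. uh k t \<xi>" and v = "\<lambda>k t. vh k t \<xi>" and \<xi> = \<xi>] sE by linarith
    ultimately show "max (norm (vh k t \<xi>)) (max (norm (th t \<xi>)) (norm (\<Sum>l\<in>UNIV. matrix_sqrt (hom_symbol A \<xi>) $ k $ l * uh l t \<xi>)))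
      \<le> 4 * M * sqrt C * low_pass F' t \<xi> * ?D"
      using b by (intro max.boundedI) linarith+
  qed
qed

end

section \<open>The five scalar components of the data\<close>

lemma sum_data_index:
  fixes f :: "2 + 2 option \<Rightarrow> real"
  shows "(\<Sum>i\<in>UNIV. f i) = (\<Sum>k\<in>UNIV. f (Inl k)) + (f (Inr None) + (\<Sum>k\<in>UNIV. f (Inr (Some k))))"
proof -
  have "(\<Sum>i\<in>UNIV. f i) = (\<Sum>k\<in>UNIV. f (Inl k)) + (\<Sum>k\<in>UNIV. f (Inr k))"
    unfolding UNIV_Plus_UNIV[symmetric] by (subst sum.Plus) (simp_all add: o_def)
  also have "(\<Sum>k\<in>UNIV. f (Inr k)) = f (Inr None) + (\<Sum>k\<in>UNIV. f (Inr (Some k)))"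
    unfolding UNIV_option_conv by (subst sum.insert) (auto simp: sum.reindex o_def)
  finally show ?thesis .
qed

lemma continuous_on_vec_componentwise:
  fixes F :: "'a::topological_space \<Rightarrow> complex^2"
  assumes "\<And>k. continuous_on S (\<lambda>x. F x $ k)"
  shows "continuous_on S F"
  using continuous_on_vec_lambda[of S "\<lambda>k x. F x $ k", OF assms] by simp

context thermoelastic
begin

text \<open>The index type \<open>2 + 2 option\<close> enumerates the two initial velocities, the
  temperature and the two displacements. The displacements carry one more derivative, which absorbs
  the factor |\<xi>| of the elastic energy.\<close>

definition "weighted_data r i \<xi> = (case i of
    Inl k \<Rightarrow> complex_of_real ((1 + (norm \<xi>)\<^sup>2) powr (r / 2)) * vh k 0 \<xi>
  | Inr None \<Rightarrow> complex_of_real ((1 + (norm \<xi>)\<^sup>2) powr (r / 2)) * th 0 \<xi>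
  | Inr (Some k) \<Rightarrow> complex_of_real ((1 + (norm \<xi>)\<^sup>2) powr ((r + 1) / 2)) * uh k 0 \<xi>)"

definition "data_size \<xi> = (\<Sum>k\<in>UNIV. norm (vh k 0 \<xi>)) + norm \<xi> * (\<Sum>k\<in>UNIV. norm (uh k 0 \<xi>)) + norm (th 0 \<xi>)"

lemma data_size_le_weighted_data:
  "data_size \<xi> \<le> (1 + (norm \<xi>)\<^sup>2) powr (- r / 2) * (\<Sum>i\<in>UNIV. norm (weighted_data r i \<xi>))"
proof -
  define j where "j = 1 + (norm \<xi>)\<^sup>2"
  have j: "j > 0" unfolding j_def using zero_le_power2[of "norm \<xi>"] by linarith
  have e1: "j powr (- r / 2) * j powr (r / 2) = 1" using j by (simp add: powr_add[symmetric])
  have e2: "j powr (- r / 2) * j powr ((r + 1) / 2) = j powr (1 / 2)"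
    using j by (simp add: powr_add[symmetric] field_simps)
  have n: "norm \<xi> \<le> j powr (1 / 2)"
    using j by (simp add: powr_half_sqrt) (simp add: j_def real_le_rsqrt)
  have "j powr (- r / 2) * (\<Sum>i\<in>UNIV. norm (weighted_data r i \<xi>))
     = (j powr (- r / 2) * j powr (r / 2)) * (\<Sum>k\<in>UNIV. norm (vh k 0 \<xi>)) + (j powr (- r / 2) * j powr (r / 2)) * norm (th 0 \<xi>)
       + (j powr (- r / 2) * j powr ((r + 1) / 2)) * (\<Sum>k\<in>UNIV. norm (uh k 0 \<xi>))"
    unfolding sum_data_index weighted_data_def j_def[symmetric]
    by (simp add: norm_mult sum_distrib_left[symmetric] distrib_left mult.assoc)
  also have "\<dots> = (\<Sum>k\<in>UNIV. norm (vh k 0 \<xi>)) + norm (th 0 \<xi>) + j powr (1 / 2) * (\<Sum>k\<in>UNIV. norm (uh k 0 \<xi>))"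
    unfolding e1 e2 by simp
  also have "\<dots> \<ge> data_size \<xi>"
    unfolding data_size_def using mult_right_mono[OF n, of "\<Sum>k\<in>UNIV. norm (uh k 0 \<xi>)"] by (simp add: sum_nonneg)
  finally show ?thesis unfolding j_def .
qed

text \<open>The case r = 0 of the weighted data, all of which are integrable for Schwartz functions.
  It is the source of integrability for the transforms at later times.\<close>

lemma data_size_integrable_majorant:
  assumes "\<And>k. schwartz (\<lambda>x. U\<^sub>1 x $ k)" "\<And>k. schwartz (\<lambda>x. U\<^sub>2 x $ k)" "schwartz \<theta>\<^sub>0"
  obtains J where "integrable lborel J" "\<And>\<xi>. data_size \<xi> \<le> J \<xi>"
proof
  have "integrable lborel (weighted_data 0 i)" for i
  proof (cases i)
    case (Inl k)
    thus ?thesis using schwartz_FT_weight(1)[OF assms(2), of "0 / 2" k]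
      by (simp only: weighted_data_def[abs_def] vh_def initial sum.case)
  next
    case (Inr b)
    show ?thesis
    proof (cases b)
      case None
      thus ?thesis using schwartz_FT_weight(1)[OF assms(3), of "0 / 2"] Inr
        by (simp only: weighted_data_def[abs_def] th_def initial sum.case option.case)
    next
      case (Some k)
      thus ?thesis using schwartz_FT_weight(1)[OF assms(1), of "(0 + 1) / 2" k] Inr
        by (simp only: weighted_data_def[abs_def] uh_def initial sum.case option.case)
    qed
  qed
  thus "integrable lborel (\<lambda>\<xi>. \<Sum>i\<in>UNIV. norm (weighted_data 0 i \<xi>))" by simp
  show "data_size \<xi> \<le> (\<Sum>i\<in>UNIV. norm (weighted_data 0 i \<xi>))" for \<xi>
  proof -
    have "1 + (norm \<xi>)\<^sup>2 \<noteq> 0" using zero_le_power2[of "norm \<xi>"] by linarith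
    thus ?thesis using data_size_le_weighted_data[of \<xi> 0] by simp
  qed
qed

text \<open>Continuity in space makes the inversion formula hold at every point. The integrability
  of the transform is supplied by the pointwise decay.\<close>

lemma velocity_inversion:
  assumes "t \<ge> 0" "integrable lborel (vh k t)"
  shows "dt U t x $ k = complex_of_real (1 / (2 * pi)\<^sup>2) * FT 1 (vh k t) x"
proof -
  have c: "isCont (\<lambda>x. dt U t x $ k) x"
    using continuous_on_component[OF continuous_in_space(2)[OF assms(1)]] by (simp add: continuous_on_eq_continuous_at)
  have "FT 1 (vh k t) x = (2 * pi)\<^sup>2 * dt U t x $ k"
    using FT_inversion[where s = "- 1", OF integrable_in_space(2)[OF assms(1)] assms(2)[unfolded vh_def] c] by (simp add: vh_def)
  thus ?thesis by simp
qed

lemma temperature_inversion: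
  assumes "t \<ge> 0" "integrable lborel (th t)"
  shows "\<theta> t x = complex_of_real (1 / (2 * pi)\<^sup>2) * FT 1 (th t) x"
proof -
  have c: "isCont (\<theta> t) x"
    using continuous_in_space(3)[OF assms(1)] by (simp add: continuous_on_eq_continuous_at)
  have "FT 1 (th t) x = (2 * pi)\<^sup>2 * \<theta> t x"
    using FT_inversion[where s = "- 1", OF integrable_in_space(3)[OF assms(1)] assms(2)[unfolded th_def] c] by (simp add: th_def)
  thus ?thesis by simp
qed

lemma mult_op_vec_uh:
  "mult_op_vec M (U t) x $ k = complex_of_real (1 / (2 * pi)\<^sup>2) * FT 1 (\<lambda>\<xi>. \<Sum>l\<in>UNIV. M \<xi> $ k $ l * uh l t \<xi>) x"
proof -
  have "(\<lambda>\<xi>. \<Sum>l\<in>UNIV. M \<xi> $ k $ l * (complex_of_real (1 / (2 * pi)) * uh l t \<xi>)) = (\<lambda>\<xi>. complex_of_real (1 / (2 * pi)) * (\<Sum>l\<in>UNIV. M \<xi> $ k $ l * uh l t \<xi>))"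
    unfolding sum_distrib_left by (intro ext sum.cong refl) (simp only: mult_ac)
  hence "mult_op_vec M (U t) x $ k = complex_of_real (1 / (2 * pi)) * (complex_of_real (1 / (2 * pi)) * FT 1 (\<lambda>\<xi>. \<Sum>l\<in>UNIV. M \<xi> $ k $ l * uh l t \<xi>) x)"
    unfolding mult_op_vec_FT uh_def[symmetric] by (simp only: FT_cmult)
  thus ?thesis by (simp add: power2_eq_square)
qed

lemma weighted_data_Lp:
  assumes SD: "\<And>s f a. schwartz f \<Longrightarrow> a > 0 \<Longrightarrow> Lp_le p (mult_op (japanese s) f) a \<Longrightarrow>
      Lp_le q (\<lambda>\<xi>. complex_of_real ((1 + (norm \<xi>)\<^sup>2) powr (s / 2)) * FT (-1) f \<xi>) (C * a)"
    and s: "\<And>k. schwartz (\<lambda>x. U\<^sub>1 x $ k)" "\<And>k. schwartz (\<lambda>x. U\<^sub>2 x $ k)" "schwartz \<theta>\<^sub>0" and a: "a > 0"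
    and L: "\<And>k. Lp_le p (mult_op (japanese (r + 1)) (\<lambda>x. U\<^sub>1 x $ k)) a" "\<And>k. Lp_le p (mult_op (japanese r) (\<lambda>x. U\<^sub>2 x $ k)) a"
      "Lp_le p (mult_op (japanese r) \<theta>\<^sub>0) a"
  shows "Lp_le q (weighted_data r i) (C * a)"
proof (cases i)
  case (Inl k)
  thus ?thesis using SD[OF s(2) a L(2), of k] by (simp only: weighted_data_def[abs_def] vh_def initial sum.case)
next
  case (Inr b)
  show ?thesis
  proof (cases b)
    case None
    thus ?thesis using SD[OF s(3) a L(3)] Inr by (simp only: weighted_data_def[abs_def] th_def initial sum.case option.case)
  next
    case (Some k)
    thus ?thesis using SD[OF s(1) a L(1), of k] Inr by (simp only: weighted_data_def[abs_def] uh_def initial sum.case option.case)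
  qed
qed

end

context spectral_symbol
begin

text \<open>A single number \<open>a\<close> bounds the norms of all scalar components of the data,
  since the dispersive estimate asks for a common bound of its inputs.\<close>

lemma Lp_decay:
  assumes \<kappa>: "\<kappa> > 0" and g: "\<gamma> \<noteq> 0" and p: "1 < p" "p \<le> 2" and q: "q = p / (p - 1)" and r: "r > 2 * (1 / p - 1 / q)"
  shows "\<exists>K>0. \<forall>U\<^sub>1 U\<^sub>2 \<theta>\<^sub>0 U \<theta> t a. thermoelastic A \<kappa> \<gamma> U\<^sub>1 U\<^sub>2 \<theta>\<^sub>0 U \<theta> \<longrightarrow>
    (\<forall>k. schwartz (\<lambda>x. U\<^sub>1 x $ k)) \<longrightarrow> (\<forall>k. schwartz (\<lambda>x. U\<^sub>2 x $ k)) \<longrightarrow> schwartz \<theta>\<^sub>0 \<longrightarrow> t \<ge> 0 \<longrightarrow> a > 0 \<longrightarrow>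
    (\<forall>k. Lp_le p (mult_op (japanese (r + 1)) (\<lambda>x. U\<^sub>1 x $ k)) a) \<longrightarrow> (\<forall>k. Lp_le p (mult_op (japanese r) (\<lambda>x. U\<^sub>2 x $ k)) a) \<longrightarrow>
    Lp_le p (mult_op (japanese r) \<theta>\<^sub>0) a \<longrightarrow>
    Lp_norm q (\<lambda>x. (- \<i>) *s dt U t x) + Lp_norm q (mult_op_vec (\<lambda>\<xi>. matrix_sqrt (hom_symbol A \<xi>)) (U t)) + Lp_norm q (\<theta> t)
      \<le> ennreal (K * (1 + t) powr (- (1 / 2) * (1 / p - 1 / q)) * a)"
proof -
  have q1: "q \<ge> 1" unfolding q using p by (simp add: le_divide_eq)
  obtain B F where B: "B > 0" and F: "finite F" "\<And>c n. (c, n) \<in> F \<Longrightarrow> c > 0 \<and> norm n = 1"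
    and PD: "\<And>U\<^sub>1 U\<^sub>2 \<theta>\<^sub>0 U \<theta> t \<xi> k. thermoelastic A \<kappa> \<gamma> U\<^sub>1 U\<^sub>2 \<theta>\<^sub>0 U \<theta> \<Longrightarrow> t \<ge> 0 \<Longrightarrow> \<xi> \<noteq> 0 \<Longrightarrow>
      max (norm (thermoelastic.vh U k t \<xi>)) (max (norm (thermoelastic.th \<theta> t \<xi>))
        (norm (\<Sum>l\<in>UNIV. matrix_sqrt (hom_symbol A \<xi>) $ k $ l * thermoelastic.uh U l t \<xi>)))
      \<le> B * low_pass F t \<xi> * ((\<Sum>k\<in>UNIV. norm (thermoelastic.vh U k 0 \<xi>)) + norm \<xi> * (\<Sum>k\<in>UNIV. norm (thermoelastic.uh U k 0 \<xi>)) + norm (thermoelastic.th \<theta> 0 \<xi>))"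
    by (rule pointwise_decay[OF \<kappa> g]) (rule that)
  obtain C where C: "C > 0" and SD: "\<And>s f a. schwartz f \<Longrightarrow> a > 0 \<Longrightarrow> Lp_le p (mult_op (japanese s) f) a \<Longrightarrow>
      Lp_le q (\<lambda>\<xi>. complex_of_real ((1 + (norm \<xi>)\<^sup>2) powr (s / 2)) * FT (-1) f \<xi>) (C * a)"
    using sobolev_data[OF p q] by blast
  obtain K where K: "K > 0" and LP: "\<And>t a (G :: 2 + 2 option \<Rightarrow> real^2 \<Rightarrow> complex) g s. t \<ge> 0 \<Longrightarrow> a > 0 \<Longrightarrow> s\<^sup>2 = 1 \<Longrightarrow> integrable lborel g \<Longrightarrow>
    (\<forall>i. Lp_le q (G i) a) \<Longrightarrow>
    (AE \<xi> in lborel. norm (g \<xi>) \<le> B * low_pass F t \<xi> * (1 + (norm \<xi>)\<^sup>2) powr (- r / 2) * (\<Sum>i\<in>UNIV. norm (G i \<xi>))) \<Longrightarrow>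
    Lp_le q (FT s g) (K * (1 + t) powr (- (1 / 2) * (1 / p - 1 / q)) * a)"
    using low_pass_dispersion[OF p q r F B, where 'i = "2 + 2 option"] by blast
  show ?thesis
  \<comment> \<open>Here 129 = 64 + 64 + 1: two vector-valued norms at the cost of 64 each, and the
    scalar temperature.\<close>
  proof (rule exI[of _ "129 * K * C"], intro conjI allI impI)
    show "129 * K * C > 0" using K C by simp
    fix U\<^sub>1 U\<^sub>2 \<theta>\<^sub>0 U \<theta> and t a :: real
    assume TE: "thermoelastic A \<kappa> \<gamma> U\<^sub>1 U\<^sub>2 \<theta>\<^sub>0 U \<theta>"
      and s': "\<forall>k. schwartz (\<lambda>x. U\<^sub>1 x $ k)" "\<forall>k. schwartz (\<lambda>x. U\<^sub>2 x $ k)" "schwartz \<theta>\<^sub>0" and t: "t \<ge> 0" and a: "a > 0"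
      and L': "\<forall>k. Lp_le p (mult_op (japanese (r + 1)) (\<lambda>x. U\<^sub>1 x $ k)) a" "\<forall>k. Lp_le p (mult_op (japanese r) (\<lambda>x. U\<^sub>2 x $ k)) a"
        "Lp_le p (mult_op (japanese r) \<theta>\<^sub>0) a"
    note s = s'(1,2)[rule_format] s'(3) and L = L'(1,2)[rule_format] L'(3)
    interpret thermoelastic A \<kappa> \<gamma> U\<^sub>1 U\<^sub>2 \<theta>\<^sub>0 U \<theta> by (rule TE)
    define sh where "sh k \<xi> = (\<Sum>l\<in>UNIV. matrix_sqrt (hom_symbol A \<xi>) $ k $ l * uh l t \<xi>)" for k \<xi>
    \<comment> \<open>The pointwise estimate needs a direction, and the origin is a null
      set.\<close>
    have nz: "AE \<xi> in lborel. \<xi> \<noteq> (0 :: real^2)" by (rule AE_lborel_singleton)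
    have pd: "AE \<xi> in lborel. max (norm (vh k t \<xi>)) (max (norm (th t \<xi>)) (norm (sh k \<xi>))) \<le> B * low_pass F t \<xi> * data_size \<xi>" for k
      using nz by eventually_elim (rule PD[OF TE t, folded data_size_def sh_def])
    have G: "\<forall>i. Lp_le q (weighted_data r i) (C * a)"
      by (intro allI weighted_data_Lp[OF SD s a L])
    obtain J where J: "integrable lborel J" "\<And>\<xi>. data_size \<xi> \<le> J \<xi>"
      using data_size_integrable_majorant[OF s] by blast
    have d0: "data_size \<xi> \<ge> 0" for \<xi> unfolding data_size_def by (intro add_nonneg_nonneg mult_nonneg_nonneg sum_nonneg norm_ge_zero)
    define b where "b = K * (1 + t) powr (- (1 / 2) * (1 / p - 1 / q)) * (C * a)"
    have b: "b \<ge> 0" using K C a by (simp add: b_def)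
    \<comment> \<open>Velocity, temperature and elastic part share nothing but this pointwise bound.
      It first yields integrability, as the decay factor is at most \<open>card F\<close> and the
      data have an integrable majorant; the dispersive estimate applies afterwards.\<close>
    have key: "integrable lborel h" "Lp_le q (FT 1 h) b"
      if h: "h \<in> borel_measurable borel" and le: "AE \<xi> in lborel. norm (h \<xi>) \<le> B * low_pass F t \<xi> * data_size \<xi>" for h :: "real^2 \<Rightarrow> complex"
    proof -
      show i: "integrable lborel h"
      proof (rule Bochner_Integration.integrable_bound)
        show "integrable lborel (\<lambda>\<xi>. B * card F * J \<xi>)" by (intro integrable_mult_right J)
        show "h \<in> borel_measurable lborel" using h by simp
        show "AE \<xi> in lborel. norm (h \<xi>) \<le> norm (B * card F * J \<xi>)"
          using le
        proof eventually_elim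
          case (elim \<xi>)
          have "low_pass F t \<xi> \<le> card F" using F(2) by (intro low_pass_le_card[OF _ t]) blast
          hence "B * low_pass F t \<xi> * data_size \<xi> \<le> B * card F * J \<xi>"
            using B by (intro mult_mono[OF _ J(2) _ d0] mult_left_mono) simp_all
          thus ?case using elim by simp
        qed
      qed
      have le': "AE \<xi> in lborel. norm (h \<xi>) \<le> B * low_pass F t \<xi> * (1 + (norm \<xi>)\<^sup>2) powr (- r / 2) * (\<Sum>i\<in>UNIV. norm (weighted_data r i \<xi>))"
        using le
      proof eventually_elim
        case (elim \<xi>)
        have "B * low_pass F t \<xi> * data_size \<xi> \<le> B * low_pass F t \<xi> * ((1 + (norm \<xi>)\<^sup>2) powr (- r / 2) * (\<Sum>i\<in>UNIV. norm (weighted_data r i \<xi>)))"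
          using B by (intro mult_left_mono data_size_le_weighted_data mult_nonneg_nonneg low_pass_nonneg) simp
        thus ?case using elim by (simp only: mult.assoc)
      qed
      show "Lp_le q (FT 1 h) b" unfolding b_def using C a by (intro LP[OF t _ _ i G le']) simp_all
    qed
    have scale: "Lp_le q (\<lambda>x. complex_of_real (1 / (2 * pi)\<^sup>2) * f x) b" if "Lp_le q f b" for f :: "real^2 \<Rightarrow> complex"
    proof (rule Lp_le_mono[OF that])
      have f: "f \<in> borel_measurable borel" using that by (simp add: Lp_le_def)
      show "(\<lambda>x. complex_of_real (1 / (2 * pi)\<^sup>2) * f x) \<in> borel_measurable borel" using f by (intro borel_measurable_times) simp_all
      have "1 \<le> (2 * pi)\<^sup>2" using pi_gt3 by (intro one_le_power) linarith
      hence "1 / (2 * pi)\<^sup>2 \<le> 1" by simp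
      hence "norm (complex_of_real (1 / (2 * pi)\<^sup>2) * f x) \<le> norm (f x)" for x
        unfolding norm_mult norm_of_real by (intro mult_left_le_one_le) auto
      thus "AE x in lborel. norm (complex_of_real (1 / (2 * pi)\<^sup>2) * f x) \<le> norm (f x)" by simp
    qed (use q1 in simp)
    have mv: "vh k t \<in> borel_measurable borel" for k unfolding vh_def by (rule measurable_FT[OF integrable_in_space(2)[OF t]])
    have mth: "th t \<in> borel_measurable borel" unfolding th_def by (rule measurable_FT[OF integrable_in_space(3)[OF t]])
    have mu: "uh l t \<in> borel_measurable borel" for l unfolding uh_def by (rule measurable_FT[OF integrable_in_space(1)[OF t]])
    have ms: "sh k \<in> borel_measurable borel" for k
      unfolding sh_def[abs_def] by (intro borel_measurable_sum borel_measurable_times measurable_matrix_sqrt_hom_symbol mu)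
    have av: "AE \<xi> in lborel. norm (vh k t \<xi>) \<le> B * low_pass F t \<xi> * data_size \<xi>" for k
      using pd[of k] by eventually_elim simp
    have ath: "AE \<xi> in lborel. norm (th t \<xi>) \<le> B * low_pass F t \<xi> * data_size \<xi>"
      using pd[of 1] by eventually_elim simp
    have as: "AE \<xi> in lborel. norm (sh k \<xi>) \<le> B * low_pass F t \<xi> * data_size \<xi>" for k
      using pd[of k] by eventually_elim simp
    note v = key[OF mv av] and T = key[OF mth ath] and S = key[OF ms as]
    have cFT: "continuous_on UNIV (\<lambda>x. complex_of_real (1 / (2 * pi)\<^sup>2) * FT 1 h x)" if "integrable lborel h" for h
      by (intro continuous_intros continuous_FT that)
    have 1: "Lp_norm q (\<lambda>x. (- \<i>) *s dt U t x) \<le> ennreal (64 * b)"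
    proof (rule Lp_norm_vec_le[OF q1 _ b])
      have e: "((- \<i>) *s dt U t x) $ k = (- \<i>) * (complex_of_real (1 / (2 * pi)\<^sup>2) * FT 1 (vh k t) x)" for x k
        by (simp only: vector_smult_component velocity_inversion[OF t v(1)])
      show "continuous_on UNIV (\<lambda>x. (- \<i>) *s dt U t x)"
        by (rule continuous_on_vec_componentwise, unfold e, intro continuous_on_mult_left cFT v(1))
      show "Lp_le q (\<lambda>x. ((- \<i>) *s dt U t x) $ k) b" for k
        unfolding e
      proof (rule Lp_le_mono[OF scale[OF v(2)[of k]]])
        show "(\<lambda>x. (- \<i>) * (complex_of_real (1 / (2 * pi)\<^sup>2) * FT 1 (vh k t) x)) \<in> borel_measurable borel"
          by (intro borel_measurable_continuous_onI continuous_on_mult_left cFT v(1))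
        show "AE x in lborel. norm ((- \<i>) * (complex_of_real (1 / (2 * pi)\<^sup>2) * FT 1 (vh k t) x)) \<le> norm (complex_of_real (1 / (2 * pi)\<^sup>2) * FT 1 (vh k t) x)"
          by (intro AE_I2) (simp only: norm_mult[of "- \<i>"] norm_minus_cancel norm_ii mult_1_left order_refl)
      qed (use q1 in simp)
    qed
    have 2: "Lp_norm q (mult_op_vec (\<lambda>\<xi>. matrix_sqrt (hom_symbol A \<xi>)) (U t)) \<le> ennreal (64 * b)"
    proof (rule Lp_norm_vec_le[OF q1 _ b])
      note e = mult_op_vec_uh[of "\<lambda>\<xi>. matrix_sqrt (hom_symbol A \<xi>)" t, folded sh_def]
      show "continuous_on UNIV (mult_op_vec (\<lambda>\<xi>. matrix_sqrt (hom_symbol A \<xi>)) (U t))"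
        by (rule continuous_on_vec_componentwise, unfold e, intro cFT S(1))
      show "Lp_le q (\<lambda>x. mult_op_vec (\<lambda>\<xi>. matrix_sqrt (hom_symbol A \<xi>)) (U t) x $ k) b" for k
        unfolding e by (rule scale[OF S(2)])
    qed
    have 3: "Lp_norm q (\<theta> t) \<le> ennreal b"
    proof (rule Lp_norm_le[OF _ _ b])
      have "\<theta> t = (\<lambda>x. complex_of_real (1 / (2 * pi)\<^sup>2) * FT 1 (th t) x)"
        by (intro ext temperature_inversion[OF t T(1)])
      thus "Lp_le q (\<theta> t) b" using scale[OF T(2)] by (simp only:)
    qed (use q1 in simp)
    have "Lp_norm q (\<lambda>x. (- \<i>) *s dt U t x) + Lp_norm q (mult_op_vec (\<lambda>\<xi>. matrix_sqrt (hom_symbol A \<xi>)) (U t)) + Lp_norm q (\<theta> t)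
      \<le> ennreal (64 * b) + ennreal (64 * b) + ennreal b" by (intro add_mono 1 2 3)
    also have "\<dots> = ennreal (129 * b)" using b by (simp add: ennreal_plus[symmetric] del: ennreal_plus)
    also have "129 * b = 129 * K * C * (1 + t) powr (- (1 / 2) * (1 / p - 1 / q)) * a" unfolding b_def by (simp only: mult_ac)
    finally show "Lp_norm q (\<lambda>x. (- \<i>) *s dt U t x) + Lp_norm q (mult_op_vec (\<lambda>\<xi>. matrix_sqrt (hom_symbol A \<xi>)) (U t)) + Lp_norm q (\<theta> t)
      \<le> ennreal (129 * K * C * (1 + t) powr (- (1 / 2) * (1 / p - 1 / q)) * a)" .
  qed
qed

end

section \<open>From scalar components to the norms of the data\<close>

lemma component_Lp_le:
  fixes F :: "real^2 \<Rightarrow> complex^2"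
  assumes L: "Lp_le p F a" and p: "p \<ge> 0" and a: "0 \<le> a" "a \<le> b"
  shows "Lp_le p (\<lambda>x. F x $ k) b"
proof (rule Lp_le_const_mono[OF Lp_le_mono[OF L _ _ p] a p])
  have F: "F \<in> borel_measurable borel" using L by (simp add: Lp_le_def)
  show "(\<lambda>x. F x $ k) \<in> borel_measurable borel"
    using measurable_compose[OF F borel_measurable_continuous_onI[OF continuous_on_component[OF continuous_on_id]]] by simp
  show "AE x in lborel. norm (F x $ k) \<le> norm (F x)" by (intro AE_I2 Finite_Cartesian_Product.norm_nth_le)
qed

lemma schwartz_complexify:
  fixes f :: "real^2 \<Rightarrow> real^2"
  assumes "schwartz f"
  shows "schwartz (\<lambda>x. complexify (f x) $ k)" and "continuous_on UNIV (\<lambda>x. complexify (f x))"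
proof -
  have "bounded_linear (\<lambda>v::real^2. complex_of_real (v $ k))" for k
    by (rule bounded_linear_compose[OF bounded_linear_of_real bounded_linear_vec_nth])
  from schwartz_bounded_linear[OF this assms] have s: "schwartz (\<lambda>x. complexify (f x) $ k)" for k
    by (simp add: complexify_def)
  thus "schwartz (\<lambda>x. complexify (f x) $ k)" .
  show "continuous_on UNIV (\<lambda>x. complexify (f x))"
    using continuous_on_vec_lambda[of UNIV "\<lambda>k x. complexify (f x) $ k", OF schwartz_integrable(2)[OF s]] by simp
qed

theorem corollary3p2:
  fixes A :: "real^2 \<Rightarrow> complex^2^2"
    and \<mu> :: "2 \<Rightarrow> real^2 \<Rightarrow> real"
    and rv :: "2 \<Rightarrow> real^2 \<Rightarrow> real^2"
    and \<kappa> \<gamma> :: real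
  assumes kappa: "\<kappa> > 0"
    and gamma: "\<gamma> \<noteq> 0"
    and A1: "real_analytic_on_circle A"
    and A2: "\<And>\<eta>. norm \<eta> = 1 \<Longrightarrow> self_adjoint (A \<eta>) \<and> pos_definite (A \<eta>)"
    and eigen: "\<And>\<eta> j. norm \<eta> = 1 \<Longrightarrow>
      A \<eta> *v complexify (rv j \<eta>) = complex_of_real (\<mu> j \<eta>) *s complexify (rv j \<eta>)"
    and orthonormal: "\<And>\<eta>. norm \<eta> = 1 \<Longrightarrow>
      norm (rv 1 \<eta>) = 1 \<and> norm (rv 2 \<eta>) = 1 \<and> rv 1 \<eta> \<bullet> rv 2 \<eta> = 0"
    and eigen_analytic: "\<And>j. real_analytic_on_circle (\<mu> j) \<and> real_analytic_on_circle (rv j)"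
    and A3: "\<And>\<eta>. norm \<eta> = 1 \<Longrightarrow> card (spec (A \<eta>)) = 2"
    and A4: "\<And>j \<eta>. hyperbolic_wrt \<kappa> \<gamma> \<mu> rv j \<eta> \<Longrightarrow>
      complex_of_real (\<gamma>\<^sup>2) \<noteq> 2 * complex_of_real (\<mu> j \<eta>) - trace (A \<eta>)"
    and first_order: "\<And>j \<eta>. hyperbolic_wrt \<kappa> \<gamma> \<mu> rv j \<eta> \<Longrightarrow>
      simple_zero_on_circle (coupling rv j) \<eta>"
  shows "\<forall>p q r :: real. 1 < p \<and> p \<le> 2 \<and> p * q = p + q \<and> r > 2 * (1 / p - 1 / q) \<longrightarrow>
    (\<exists>c>0. \<forall>(U\<^sub>1 :: real^2 \<Rightarrow> real^2) (U\<^sub>2 :: real^2 \<Rightarrow> real^2) (\<theta>\<^sub>0 :: real^2 \<Rightarrow> complex) U \<theta>.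
      schwartz U\<^sub>1 \<and> schwartz U\<^sub>2 \<and> schwartz \<theta>\<^sub>0 \<and>
      thermoelastic_solution A \<kappa> \<gamma> (\<lambda>x. complexify (U\<^sub>1 x)) (\<lambda>x. complexify (U\<^sub>2 x)) \<theta>\<^sub>0 U \<theta> \<longrightarrow>
      (\<forall>t\<ge>0.
        Lp_norm q (\<lambda>x. (- \<i>) *s dt U t x)
          + Lp_norm q (mult_op_vec (\<lambda>\<xi>. matrix_sqrt (hom_symbol A \<xi>)) (U t))
          + Lp_norm q (\<theta> t)
        \<le> ennreal (c * (1 + t) powr (- (1 / 2) * (1 / p - 1 / q))) *
           (sobolev_norm_vec p (r + 1) (\<lambda>x. complexify (U\<^sub>1 x))
             + sobolev_norm_vec p r (\<lambda>x. complexify (U\<^sub>2 x))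
             + sobolev_norm p r \<theta>\<^sub>0)))"
proof (intro allI impI)
  fix p q r :: real
  assume "1 < p \<and> p \<le> 2 \<and> p * q = p + q \<and> r > 2 * (1 / p - 1 / q)"
  hence p: "1 < p" "p \<le> 2" and pq: "p * q = p + q" and r: "r > 2 * (1 / p - 1 / q)" by blast+
  have q: "q = p / (p - 1)" using p pq by (simp add: field_simps)
  have p0: "p > 0" "p \<ge> 0" using p by simp_all
  interpret spectral_symbol A \<mu> rv
  proof
    show "continuous_on (sphere 0 1) A" by (rule real_analytic_on_circle_continuous[OF A1])
    show "continuous_on (sphere 0 1) (\<mu> j)" "continuous_on (sphere 0 1) (rv j)" for j
      using eigen_analytic by (auto intro: real_analytic_on_circle_continuous)
    fix \<eta> :: "real^2" assume n: "norm \<eta> = 1"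
    show "self_adjoint (A \<eta>)" using A2[OF n] by blast
    have o: "norm (rv 1 \<eta>) = 1" "norm (rv 2 \<eta>) = 1" "rv 1 \<eta> \<bullet> rv 2 \<eta> = 0" using orthonormal[OF n] by blast+
    show "norm (rv 1 \<eta>) = 1" "norm (rv 2 \<eta>) = 1" "rv 1 \<eta> \<bullet> rv 2 \<eta> = 0" by (rule o)+
    fix j
    show e: "A \<eta> *v complexify (rv j \<eta>) = complex_of_real (\<mu> j \<eta>) *s complexify (rv j \<eta>)" for j by (rule eigen[OF n])
    have nj: "norm (rv j \<eta>) = 1" using o exhaust_2[of j] by auto
    show "\<mu> j \<eta> > 0" by (rule eigenvalue_pos[OF _ nj e]) (use A2[OF n] in blast)
    show "\<mu> 1 \<eta> \<noteq> \<mu> 2 \<eta>"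
      by (rule eigenvalues_distinct[where r = "\<lambda>j. rv j \<eta>" and m = "\<lambda>j. \<mu> j \<eta>", OF o e A3[OF n]])
    show "simple_zero_on_circle (coupling rv j) \<eta>" if "coupling rv j \<eta> = 0"
      by (rule first_order[OF hyperbolic_wrt_of_coupling_eq_0[OF n that]])
  qed
  let ?w = "\<lambda>t. (1 + t) powr (- (1 / 2) * (1 / p - 1 / q))"
  obtain K where K: "K > 0" and decay: "\<forall>U\<^sub>1 U\<^sub>2 \<theta>\<^sub>0 U \<theta> t a. thermoelastic A \<kappa> \<gamma> U\<^sub>1 U\<^sub>2 \<theta>\<^sub>0 U \<theta> \<longrightarrow>
    (\<forall>k. schwartz (\<lambda>x. U\<^sub>1 x $ k)) \<longrightarrow> (\<forall>k. schwartz (\<lambda>x. U\<^sub>2 x $ k)) \<longrightarrow> schwartz \<theta>\<^sub>0 \<longrightarrow> t \<ge> 0 \<longrightarrow> a > 0 \<longrightarrow>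
    (\<forall>k. Lp_le p (mult_op (japanese (r + 1)) (\<lambda>x. U\<^sub>1 x $ k)) a) \<longrightarrow> (\<forall>k. Lp_le p (mult_op (japanese r) (\<lambda>x. U\<^sub>2 x $ k)) a) \<longrightarrow>
    Lp_le p (mult_op (japanese r) \<theta>\<^sub>0) a \<longrightarrow>
    Lp_norm q (\<lambda>x. (- \<i>) *s dt U t x) + Lp_norm q (mult_op_vec (\<lambda>\<xi>. matrix_sqrt (hom_symbol A \<xi>)) (U t)) + Lp_norm q (\<theta> t)
      \<le> ennreal (K * (1 + t) powr (- (1 / 2) * (1 / p - 1 / q)) * a)"
    using Lp_decay[OF kappa gamma p q r] by blast
  show "\<exists>c>0. \<forall>(U\<^sub>1 :: real^2 \<Rightarrow> real^2) (U\<^sub>2 :: real^2 \<Rightarrow> real^2) (\<theta>\<^sub>0 :: real^2 \<Rightarrow> complex) U \<theta>.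
      schwartz U\<^sub>1 \<and> schwartz U\<^sub>2 \<and> schwartz \<theta>\<^sub>0 \<and>
      thermoelastic_solution A \<kappa> \<gamma> (\<lambda>x. complexify (U\<^sub>1 x)) (\<lambda>x. complexify (U\<^sub>2 x)) \<theta>\<^sub>0 U \<theta> \<longrightarrow>
      (\<forall>t\<ge>0.
        Lp_norm q (\<lambda>x. (- \<i>) *s dt U t x)
          + Lp_norm q (mult_op_vec (\<lambda>\<xi>. matrix_sqrt (hom_symbol A \<xi>)) (U t))
          + Lp_norm q (\<theta> t)
        \<le> ennreal (c * ?w t) *
           (sobolev_norm_vec p (r + 1) (\<lambda>x. complexify (U\<^sub>1 x))
             + sobolev_norm_vec p r (\<lambda>x. complexify (U\<^sub>2 x))
             + sobolev_norm p r \<theta>\<^sub>0))"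
  proof (rule exI[of _ K], rule conjI[OF K], intro allI impI)
    fix U\<^sub>1 U\<^sub>2 :: "real^2 \<Rightarrow> real^2" and \<theta>\<^sub>0 :: "real^2 \<Rightarrow> complex" and U \<theta> and t :: real
    assume "schwartz U\<^sub>1 \<and> schwartz U\<^sub>2 \<and> schwartz \<theta>\<^sub>0 \<and>
      thermoelastic_solution A \<kappa> \<gamma> (\<lambda>x. complexify (U\<^sub>1 x)) (\<lambda>x. complexify (U\<^sub>2 x)) \<theta>\<^sub>0 U \<theta>"
    hence s: "schwartz U\<^sub>1" "schwartz U\<^sub>2" "schwartz \<theta>\<^sub>0"
      and sol: "thermoelastic_solution A \<kappa> \<gamma> (\<lambda>x. complexify (U\<^sub>1 x)) (\<lambda>x. complexify (U\<^sub>2 x)) \<theta>\<^sub>0 U \<theta>" by blast+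
    assume t: "0 \<le> t"
    have TE: "thermoelastic A \<kappa> \<gamma> (\<lambda>x. complexify (U\<^sub>1 x)) (\<lambda>x. complexify (U\<^sub>2 x)) \<theta>\<^sub>0 U \<theta>"
      unfolding thermoelastic_def
      by (intro conjI A_cont sol schwartz_complexify(2) s schwartz_integrable(2))
    let ?L = "Lp_norm q (\<lambda>x. (- \<i>) *s dt U t x)
          + Lp_norm q (mult_op_vec (\<lambda>\<xi>. matrix_sqrt (hom_symbol A \<xi>)) (U t))
          + Lp_norm q (\<theta> t)"
    let ?R = "sobolev_norm_vec p (r + 1) (\<lambda>x. complexify (U\<^sub>1 x))
             + sobolev_norm_vec p r (\<lambda>x. complexify (U\<^sub>2 x))
             + sobolev_norm p r \<theta>\<^sub>0"
    have w: "?w t > 0" using t by simp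
    show "?L \<le> ennreal (K * ?w t) * ?R"
    \<comment> \<open>If some norm of the data is infinite, then so is the right-hand side, because
      its coefficient is positive.\<close>
    proof (cases "?R = \<infinity>")
      case True
      have "ennreal (K * ?w t) \<noteq> 0" using K w by simp
      thus ?thesis unfolding True by (simp add: ennreal_mult_top)
    next
      case False
      hence fin: "sobolev_norm_vec p (r + 1) (\<lambda>x. complexify (U\<^sub>1 x)) \<noteq> \<infinity>"
        "sobolev_norm_vec p r (\<lambda>x. complexify (U\<^sub>2 x)) \<noteq> \<infinity>" "sobolev_norm p r \<theta>\<^sub>0 \<noteq> \<infinity>"
        by auto
      obtain a1 where a1: "a1 \<ge> 0" "sobolev_norm_vec p (r + 1) (\<lambda>x. complexify (U\<^sub>1 x)) = ennreal a1"
        "Lp_le p (mult_op_vec (\<lambda>\<xi>. mat (japanese (r + 1) \<xi>)) (\<lambda>x. complexify (U\<^sub>1 x))) a1"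
        using Lp_norm_finite[OF fin(1)[unfolded sobolev_norm_vec_def] p0(1)] unfolding sobolev_norm_vec_def by blast
      obtain a2 where a2: "a2 \<ge> 0" "sobolev_norm_vec p r (\<lambda>x. complexify (U\<^sub>2 x)) = ennreal a2"
        "Lp_le p (mult_op_vec (\<lambda>\<xi>. mat (japanese r \<xi>)) (\<lambda>x. complexify (U\<^sub>2 x))) a2"
        using Lp_norm_finite[OF fin(2)[unfolded sobolev_norm_vec_def] p0(1)] unfolding sobolev_norm_vec_def by blast
      obtain a3 where a3: "a3 \<ge> 0" "sobolev_norm p r \<theta>\<^sub>0 = ennreal a3" "Lp_le p (mult_op (japanese r) \<theta>\<^sub>0) a3"
        using Lp_norm_finite[OF fin(3)[unfolded sobolev_norm_def] p0(1)] unfolding sobolev_norm_def by blast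
      \<comment> \<open>The scalar estimate asks for a positive bound of the data, but the sum of
        the three norms may be 0. An arbitrary \<open>e > 0\<close> is added and removed again in
        the limit.\<close>
      have bd: "?L \<le> ennreal (K * ?w t * (a1 + a2 + a3 + e))" if e: "e > 0" for e
      proof (rule decay[rule_format, OF TE schwartz_complexify(1)[OF s(1)] schwartz_complexify(1)[OF s(2)] s(3) t])
        show "0 < a1 + a2 + a3 + e" using a1 a2 a3 e by simp
        show "Lp_le p (mult_op (japanese (r + 1)) (\<lambda>x. complexify (U\<^sub>1 x) $ k)) (a1 + a2 + a3 + e)" for k
          using component_Lp_le[OF a1(3) p0(2) a1(1), of "a1 + a2 + a3 + e" k] a2(1) a3(1) e by (simp add: mult_op_vec_mat)
        show "Lp_le p (mult_op (japanese r) (\<lambda>x. complexify (U\<^sub>2 x) $ k)) (a1 + a2 + a3 + e)" for k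
          using component_Lp_le[OF a2(3) p0(2) a2(1), of "a1 + a2 + a3 + e" k] a1(1) a3(1) e by (simp add: mult_op_vec_mat)
        show "Lp_le p (mult_op (japanese r) \<theta>\<^sub>0) (a1 + a2 + a3 + e)"
          by (rule Lp_le_const_mono[OF a3(3,1) _ p0(2)]) (use a1(1) a2(1) e in simp)
      qed
      have "?L \<le> ennreal (K * ?w t * (a1 + a2 + a3))"
      \<comment> \<open>The added quantity is taken as \<open>e\<close> divided by the coefficient,
        so that the error on the right-hand side is exactly \<open>e\<close>.\<close>
      proof (rule ennreal_le_epsilon)
        fix e :: real assume e: "0 < e"
        have Kw: "K * ?w t > 0" using K w by simp
        have gen: "k * (x + e / k) = k * x + e" if "k > 0" for k x :: real using that by (simp add: distrib_left)
        have "?L \<le> ennreal (K * ?w t * (a1 + a2 + a3 + e / (K * ?w t)))"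
          by (rule bd) (use e Kw in simp)
        also have "K * ?w t * (a1 + a2 + a3 + e / (K * ?w t)) = K * ?w t * (a1 + a2 + a3) + e"
          by (rule gen[OF Kw])
        also have "ennreal (K * ?w t * (a1 + a2 + a3) + e) = ennreal (K * ?w t * (a1 + a2 + a3)) + ennreal e"
          using K a1(1) a2(1) a3(1) e by (intro ennreal_plus mult_nonneg_nonneg) auto
        finally show "?L \<le> ennreal (K * ?w t * (a1 + a2 + a3)) + ennreal e" .
      qed
      also have "\<dots> = ennreal (K * ?w t) * ennreal (a1 + a2 + a3)" using K w by (intro ennreal_mult') simp
      also have "ennreal (a1 + a2 + a3) = ?R" unfolding a1(2) a2(2) a3(2) using a1(1) a2(1) a3(1) by simp
      finally show ?thesis .
    qed
  qed
qed

end
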